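(* Each representation $V_n(\rho,\lambda)$ is an irreducible $\mathcal Z_n$-representation over $\mathbb{C}$. Further, every irreducible complex $\mathcal Z_n$-representation is isomorphic to exactly one $V_n(\rho,\lambda)$.
   Context: $B_n$ is the braid group on $n$ strands, $PB_n$ the pure braid group. The level $4$ braid group $B_n[4]$ is the kernel of the composition $B_n\to GL_n(\mathbb{Z}[t,t^{-1}])\to GL_n(\mathbb{Z})\to GL_n(\mathbb{Z}/4)$ (unreduced Burau representation, evaluation at $t=-1$, reduction mod $4$). It is known that $B_n[4]$ equals the subgroup of $PB_n$ generated by all squares of elements of $PB_n$, i.e. the kernel of the mod $2$ abelianization of $PB_n$. Put $\mathcal Z_n=B_n/B_n[4]$ (a finite group) and let $\mathcal{PZ}_n\cong(\mathbb{Z}/2)^{\binom n2}$ be the image of $PB_n$ in $\mathcal Z_n$, with basis the images of the Artin generators $T_{ij}$, $1\le i<j\le n$. All representations are finite-dimensional over $\mathbb{C}$. Let $[n]=\{1,\dots,n\}$ and let $[n]^{\underline 2}$ be the set of unordered pairs of distinct elements of $[n]$. For $I\subseteq[n]^{\underline 2}$ let $V_I$ be the 1-dimensional representation of $\mathcal{PZ}_n$ in which $T_{ij}$ acts by $-1$ if $\{i,j\}\in I$ and by $+1$ otherwise. $B_n$ acts on $[n]$ and $[n]^{\underline 2}$ via $S_n$; $B_n^I$ is the stabilizer of the set $I$ in $B_n$ and $\mathcal Z_n^I$ its image in $\mathcal Z_n$. A representation of a subgroup of $\mathcal Z_n$ containing $\mathcal{PZ}_n$ is $I$-isotypic if its restriction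 to $\mathcal{PZ}_n$ is a direct sum of copies of $V_I$. A subset $I\subseteq[m]^{\underline 2}$ is full if the union of its elements is $[m]$ (for $m=0$, $I=\emptyset$ is full). For each $m\ge 0$ fix a set $\mathbb I_m$ of representatives of the $S_m$-orbits of full subsets of $[m]^{\underline 2}$. For $I\in\mathbb I_m$ and $n\ge m$, regard $I$ as a subset of $[n]^{\underline 2}$; there is a surjection $\mathcal Z_n^I\to\mathcal Z_m^I\times S_{n-m}$ whose first component is induced by forgetting the last $n-m$ strands and whose second component is the induced permutation of the last $n-m$ strands. For each $m\ge 0$ and $I\in\mathbb I_m$, fix one representative $\rho$ of each isomorphism class of irreducible $I$-isotypic representations of $\mathcal Z_m^I$, with underlying space $V_m(\rho)$. Irreducible representations $V_k(\lambda)$ of $S_k$ are labeled by padded partitions: for a partition $\lambda=(\lambda_1\ge\lambda_2\ge\cdots)$ with $k-|\lambda|\ge\lambda_1$, $V_k(\lambda)$ is the irreducible representation corresponding to the partition $(k-|\lambda|,\lambda_1,\lambda_2,\dots)$ of $k$. For $0\le m\le n$, $I\in\mathbb I_m$, $\rho$ one of the fixed irreducible $I$-isotypic representations of $\mathcal Z_m^I$, and $V_{n-m}(\lambda)$ an irreducible representation of $S_{n-m}$, define $$V_n(\rho,\lambda)=\mathrm{Ind}_{\mathcal Z_n^I}^{\mathcal Z_n}\bigl(V_m(\rho)\boxtimes V_{n-m}(\lambda)\bigr),$$ where $\mathcal Z_n^I$ acts via the surjection $\mathcal Z_n^I\to\mathcal Z_m^I\times S_{n-m}$. *)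

theory Defs
  imports
    "HOL-Algebra.Sym_Groups"
    "HOL-Algebra.Group_Action"
    "HOL-Library.Poly_Mapping"
    "HOL-Library.Numeral_Type"
    "Jordan_Normal_Form.Matrix"
    "Jordan_Normal_Form.VS_Connect"
begin

section \<open>Braid groups\<close>

text \<open>The letter \<open>(i, True)\<close> stands for the Artin generator \<open>\<sigma>\<^sub>i\<close> and \<open>(i, False)\<close> for its
  inverse. Strands are numbered \<open>1, \<dots>, n\<close>, so the generators are \<open>\<sigma>\<^sub>1, \<dots>, \<sigma>\<^sub>n\<^sub>-\<^sub>1\<close>.\<close>

type_synonym braid_word = "(nat \<times> bool) list"
type_synonym braid = "braid_word set"

definition braid_words :: "nat \<Rightarrow> braid_word set" where
  "braid_words n = lists ({1..<n} \<times> UNIV)"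

inductive braid_eq :: "nat \<Rightarrow> braid_word \<Rightarrow> braid_word \<Rightarrow> bool" for n where
  refl: "w \<in> braid_words n \<Longrightarrow> braid_eq n w w"
| sym: "braid_eq n u v \<Longrightarrow> braid_eq n v u"
| trans: "braid_eq n u v \<Longrightarrow> braid_eq n v w \<Longrightarrow> braid_eq n u w"
| cong: "x \<in> braid_words n \<Longrightarrow> y \<in> braid_words n \<Longrightarrow> braid_eq n u v \<Longrightarrow>
    braid_eq n (x @ u @ y) (x @ v @ y)"
| inverse: "1 \<le> i \<Longrightarrow> i < n \<Longrightarrow> braid_eq n [(i, e), (i, \<not> e)] []"
| far: "1 \<le> i \<Longrightarrow> i + 1 < j \<Longrightarrow> j < n \<Longrightarrow>
    braid_eq n [(i, True), (j, True)] [(j, True), (i, True)]"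
| braid: "1 \<le> i \<Longrightarrow> i + 1 < n \<Longrightarrow>
    braid_eq n [(i, True), (i + 1, True), (i, True)] [(i + 1, True), (i, True), (i + 1, True)]"

definition braid_class :: "nat \<Rightarrow> braid_word \<Rightarrow> braid" where
  "braid_class n w = {v. braid_eq n w v}"

definition braid_group :: "nat \<Rightarrow> braid monoid" where
  "braid_group n = \<lparr>carrier = braid_class n ` braid_words n,
     mult = (\<lambda>a b. \<Union>u\<in>a. \<Union>v\<in>b. braid_class n (u @ v)),
     one = braid_class n []\<rparr>"

text \<open>The functions on words below depend only on the braid represented by the word;
  \<open>the_elem (f ` b)\<close> is the common value of \<open>f\<close> on the class \<open>b\<close>.\<close>

definition word_perm :: "braid_word \<Rightarrow> nat \<Rightarrow> nat" where
  "word_perm w = foldr (\<lambda>(i, e) p. Transposition.transpose i (Suc i) \<circ> p) w id"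

definition braid_perm :: "braid \<Rightarrow> nat \<Rightarrow> nat" where
  "braid_perm b = the_elem (word_perm ` b)"

definition pure_braids :: "nat \<Rightarrow> braid set" where
  "pure_braids n = kernel (braid_group n) (sym_group n) braid_perm"

text \<open>\<open>T\<^sub>i\<^sub>j = (\<sigma>\<^sub>j\<^sub>-\<^sub>1 \<cdots> \<sigma>\<^sub>i\<^sub>+\<^sub>1) \<sigma>\<^sub>i\<^sup>2 (\<sigma>\<^sub>j\<^sub>-\<^sub>1 \<cdots> \<sigma>\<^sub>i\<^sub>+\<^sub>1)\<^sup>-\<^sup>1\<close> for \<open>i < j\<close>.\<close>

definition artin_gen :: "nat \<Rightarrow> nat \<Rightarrow> nat \<Rightarrow> braid" where
  "artin_gen n i j = braid_class n
     (map (\<lambda>l. (l, True)) (rev [i + 1..<j]) @ [(i, True), (i, True)] @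
      map (\<lambda>l. (l, False)) [i + 1..<j])"


section \<open>The Burau representation and the level 4 braid group\<close>

definition GL :: "'a::comm_ring_1 itself \<Rightarrow> nat \<Rightarrow> 'a mat monoid" where
  "GL ty n = units_of (ring_mat ty n ())"

text \<open>Laurent polynomials over \<open>\<int>\<close>: finitely supported functions from exponents to coefficients,
  with the convolution product.\<close>

type_synonym laurent = "int \<Rightarrow>\<^sub>0 int"

definition t_pow :: "int \<Rightarrow> laurent" where
  "t_pow k = Poly_Mapping.single k 1"

text \<open>\<open>\<sigma>\<^sub>i\<close> acts by the block with rows \<open>(1 - t, t)\<close> and \<open>(1, 0)\<close> in rows and columns \<open>i, i + 1\<close>,
  and by the identity elsewhere; \<open>\<sigma>\<^sub>i\<^sup>-\<^sup>1\<close> by the inverse block, with rows \<open>(0, 1)\<close> and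
  \<open>(t\<^sup>-\<^sup>1, 1 - t\<^sup>-\<^sup>1)\<close>. Matrix indices start at \<open>0\<close>, whence the \<open>Suc\<close>.\<close>

definition burau_gen :: "nat \<Rightarrow> nat \<times> bool \<Rightarrow> laurent mat" where
  "burau_gen n = (\<lambda>(i, e). mat n n (\<lambda>(r, c).
     if Suc r = i \<and> Suc c = i then (if e then 1 - t_pow 1 else 0)
     else if Suc r = i \<and> c = i then (if e then t_pow 1 else 1)
     else if r = i \<and> Suc c = i then (if e then 1 else t_pow (- 1))
     else if r = i \<and> c = i then (if e then 0 else 1 - t_pow (- 1))
     else if r = c then 1 else 0))"

definition burau_word :: "nat \<Rightarrow> braid_word \<Rightarrow> laurent mat" where
  "burau_word n w = foldr (\<lambda>l M. burau_gen n l * M) w (1\<^sub>m n)"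

definition burau :: "nat \<Rightarrow> braid \<Rightarrow> laurent mat" where
  "burau n b = the_elem (burau_word n ` b)"

text \<open>Evaluation at \<open>t = -1\<close>; note that \<open>(-1)\<^sup>k = (-1)\<^sup>|\<^sup>k\<^sup>|\<close> for negative \<open>k\<close> as well.\<close>

definition eval_minus_one :: "laurent \<Rightarrow> int" where
  "eval_minus_one p = (\<Sum>k\<in>Poly_Mapping.keys p. Poly_Mapping.lookup p k * (- 1) ^ nat \<bar>k\<bar>)"

definition level4 :: "nat \<Rightarrow> braid set" where
  "level4 n = kernel (braid_group n) (GL TYPE(4) n)
     (\<lambda>b. map_mat (of_int :: int \<Rightarrow> 4) (map_mat eval_minus_one (burau n b)))"


section \<open>The finite quotients\<close>

type_synonym zelem = "braid set"

definition Zgrp :: "nat \<Rightarrow> zelem monoid" where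
  "Zgrp n = braid_group n Mod level4 n"

definition to_Z :: "nat \<Rightarrow> braid \<Rightarrow> zelem" where
  "to_Z n b = level4 n #>\<^bsub>braid_group n\<^esub> b"

definition PZgrp :: "nat \<Rightarrow> zelem monoid" where
  "PZgrp n = (Zgrp n)\<lparr>carrier := to_Z n ` pure_braids n\<rparr>"

definition pairs :: "nat \<Rightarrow> nat set set" where
  "pairs n = {A. A \<subseteq> {1..n} \<and> card A = 2}"

definition braid_stab :: "nat \<Rightarrow> nat set set \<Rightarrow> braid set" where
  "braid_stab n I = stabilizer (braid_group n) (\<lambda>b. (`) ((`) (braid_perm b))) I"

definition Z_stab :: "nat \<Rightarrow> nat set set \<Rightarrow> zelem set" where
  "Z_stab n I = to_Z n ` braid_stab n I"

definition ZIgrp :: "nat \<Rightarrow> nat set set \<Rightarrow> zelem monoid" where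
  "ZIgrp n I = (Zgrp n)\<lparr>carrier := Z_stab n I\<rparr>"

definition full :: "nat \<Rightarrow> nat set set \<Rightarrow> bool" where
  "full m I \<longleftrightarrow> I \<subseteq> pairs m \<and> \<Union>I = {1..m}"

definition full_orbit_reps :: "nat \<Rightarrow> nat set set set \<Rightarrow> bool" where
  "full_orbit_reps m F \<longleftrightarrow> (\<forall>I\<in>F. full m I) \<and>
     (\<forall>J. full m J \<longrightarrow> (\<exists>!I. I \<in> F \<and> (\<exists>p. p permutes {1..m} \<and> J = (`) p ` I)))"

text \<open>Forgetting strands. Reading a word from left to right, \<open>K\<close> is the set of positions
  currently occupied by the strands that are kept. A crossing of two kept strands survives, and
  its position is renumbered among the kept strands; all other crossings disappear.\<close>

fun keep_word :: "nat set \<Rightarrow> braid_word \<Rightarrow> braid_word" where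
  "keep_word K [] = []"
| "keep_word K ((i, e) # w) =
     (let w' = keep_word (Transposition.transpose i (Suc i) ` K) w
      in if i \<in> K \<and> Suc i \<in> K then (card (K \<inter> {..i}), e) # w' else w')"

text \<open>Only meaningful for braids that preserve \<open>{1..m}\<close>, such as those in \<open>braid_stab n I\<close>
  for \<open>I\<close> full in \<open>{1..m}\<close>.\<close>

definition forget_strands :: "nat \<Rightarrow> braid \<Rightarrow> braid" where
  "forget_strands m b = the_elem ((\<lambda>w. braid_class m (keep_word {1..m} w)) ` b)"

definition last_perm :: "nat \<Rightarrow> nat \<Rightarrow> braid \<Rightarrow> nat \<Rightarrow> nat" where
  "last_perm n m b = (\<lambda>j. if j \<in> {1..n - m} then braid_perm b (j + m) - m else j)"

text \<open>The surjection from \<open>ZIgrp n I\<close> to \<open>ZIgrp m I \<times>\<times> sym_group (n - m)\<close>.\<close>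

definition Z_split :: "nat \<Rightarrow> nat \<Rightarrow> zelem \<Rightarrow> zelem \<times> (nat \<Rightarrow> nat)" where
  "Z_split n m z = the_elem ((\<lambda>b. (to_Z m (forget_strands m b), last_perm n m b)) ` z)"


section \<open>Finite-dimensional complex representations\<close>

text \<open>A representation is a pair of a dimension \<open>d\<close> and a homomorphism to \<open>GL\<^sub>d(\<complex>)\<close>, whose values
  outside the carrier of the group are irrelevant.\<close>

type_synonym 'g rep = "nat \<times> ('g \<Rightarrow> complex mat)"

definition is_rep :: "('g, 'x) monoid_scheme \<Rightarrow> 'g rep \<Rightarrow> bool" where
  "is_rep G \<pi> \<longleftrightarrow> snd \<pi> \<in> hom G (GL TYPE(complex) (fst \<pi>))"

definition is_irrep :: "('g, 'x) monoid_scheme \<Rightarrow> 'g rep \<Rightarrow> bool" where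
  "is_irrep G \<pi> \<longleftrightarrow> is_rep G \<pi> \<and> 0 < fst \<pi> \<and>
     (\<forall>W. subspace class_ring W (module_vec TYPE(complex) (fst \<pi>)) \<longrightarrow>
        (\<forall>g\<in>carrier G. \<forall>w\<in>W. snd \<pi> g *\<^sub>v w \<in> W) \<longrightarrow>
        W = {0\<^sub>v (fst \<pi>)} \<or> W = carrier_vec (fst \<pi>))"

definition rep_iso :: "('g, 'x) monoid_scheme \<Rightarrow> 'g rep \<Rightarrow> 'g rep \<Rightarrow> bool" where
  "rep_iso G \<pi> \<sigma> \<longleftrightarrow> fst \<pi> = fst \<sigma> \<and>
     (\<exists>P\<in>carrier (GL TYPE(complex) (fst \<pi>)). \<forall>g\<in>carrier G. P * snd \<pi> g = snd \<sigma> g * P)"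

definition copies :: "nat \<Rightarrow> 'g rep \<Rightarrow> 'g rep" where
  "copies k \<pi> = (k * fst \<pi>, \<lambda>g. diag_block_mat (replicate k (snd \<pi> g)))"

definition kronecker :: "complex mat \<Rightarrow> complex mat \<Rightarrow> complex mat" where
  "kronecker A B = mat (dim_row A * dim_row B) (dim_col A * dim_col B) (\<lambda>(i, j).
     A $$ (i div dim_row B, j div dim_col B) * B $$ (i mod dim_row B, j mod dim_col B))"

definition ext_tensor :: "'g rep \<Rightarrow> 'h rep \<Rightarrow> ('g \<times> 'h) rep" where
  "ext_tensor \<pi> \<sigma> = (fst \<pi> * fst \<sigma>, \<lambda>(g, h). kronecker (snd \<pi> g) (snd \<sigma> h))"

definition pullback :: "('g \<Rightarrow> 'h) \<Rightarrow> 'h rep \<Rightarrow> 'g rep" where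
  "pullback f \<pi> = (fst \<pi>, snd \<pi> \<circ> f)"

definition is_left_transversal :: "('g, 'x) monoid_scheme \<Rightarrow> 'g set \<Rightarrow> 'g list \<Rightarrow> bool" where
  "is_left_transversal G H ts \<longleftrightarrow> distinct ts \<and> set ts \<subseteq> carrier G \<and>
     (\<forall>g\<in>carrier G. \<exists>!t. t \<in> set ts \<and> g \<in> t <#\<^bsub>G\<^esub> H)"

text \<open>The matrix of \<open>g\<close> on \<open>\<Oplus>\<^sub>i t\<^sub>i V\<close>, where the \<open>t\<^sub>i\<close> represent the left cosets of \<open>H\<close>:
  its \<open>(i, j)\<close> block is \<open>\<pi>(t\<^sub>i\<^sup>-\<^sup>1 g t\<^sub>j)\<close> if \<open>t\<^sub>i\<^sup>-\<^sup>1 g t\<^sub>j \<in> H\<close>, and \<open>0\<close> otherwise. Other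
  transversals give isomorphic representations.\<close>

definition induced :: "('g, 'x) monoid_scheme \<Rightarrow> 'g set \<Rightarrow> 'g rep \<Rightarrow> 'g rep" where
  "induced G H \<pi> =
     (let ts = (SOME ts. is_left_transversal G H ts); d = fst \<pi>; N = length ts * d
      in (N, \<lambda>g. mat N N (\<lambda>(r, c).
            let h = inv\<^bsub>G\<^esub> (ts ! (r div d)) \<otimes>\<^bsub>G\<^esub> g \<otimes>\<^bsub>G\<^esub> (ts ! (c div d))
            in if h \<in> H then snd \<pi> h $$ (r mod d, c mod d) else 0)))"


section \<open>Irreducible representations of symmetric groups\<close>

text \<open>Cells of the Young diagram of \<open>\<mu>\<close> are numbered \<open>1, 2, \<dots>\<close> row by row. Rows and columns are
  counted from \<open>0\<close> and \<open>1\<close> respectively.\<close>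

definition tab_row :: "nat list \<Rightarrow> nat \<Rightarrow> nat" where
  "tab_row \<mu> x = (LEAST r. x \<le> sum_list (take (Suc r) \<mu>))"

definition tab_col :: "nat list \<Rightarrow> nat \<Rightarrow> nat" where
  "tab_col \<mu> x = x - sum_list (take (tab_row \<mu> x) \<mu>)"

definition row_group :: "nat list \<Rightarrow> (nat \<Rightarrow> nat) set" where
  "row_group \<mu> = {p. p permutes {1..sum_list \<mu>} \<and>
     (\<forall>x\<in>{1..sum_list \<mu>}. tab_row \<mu> (p x) = tab_row \<mu> x)}"

definition col_group :: "nat list \<Rightarrow> (nat \<Rightarrow> nat) set" where
  "col_group \<mu> = {p. p permutes {1..sum_list \<mu>} \<and>
     (\<forall>x\<in>{1..sum_list \<mu>}. tab_col \<mu> (p x) = tab_col \<mu> x)}"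

text \<open>The Young symmetrizer \<open>\<Sum>\<^sub>p \<Sum>\<^sub>q sgn(q) p q\<close> in \<open>\<complex>[S\<^sub>k]\<close>, as its coefficient function.\<close>

definition young_symmetrizer :: "nat list \<Rightarrow> (nat \<Rightarrow> nat) \<Rightarrow> complex" where
  "young_symmetrizer \<mu> x =
     (\<Sum>p\<in>row_group \<mu>. \<Sum>q\<in>col_group \<mu>. if p \<circ> q = x then of_int (sign q) else 0)"

text \<open>The left ideal \<open>\<complex>[S\<^sub>k] c\<close> generated by \<open>c\<close>; the coefficient of \<open>x\<close> in \<open>a c\<close> is
  \<open>\<Sum>\<^sub>g a(g) c(g\<^sup>-\<^sup>1 x)\<close>.\<close>

definition left_ideal :: "nat \<Rightarrow> ((nat \<Rightarrow> nat) \<Rightarrow> complex) \<Rightarrow> ((nat \<Rightarrow> nat) \<Rightarrow> complex) set" where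
  "left_ideal k c =
     {f. \<exists>a. f = (\<lambda>x. \<Sum>g\<in>carrier (sym_group k). a g * c (inv\<^bsub>sym_group k\<^esub> g \<circ> x))}"

text \<open>\<open>\<pi>\<close> is the matrix representation given by left multiplication of \<open>S\<^sub>k\<close> on the subspace
  \<open>W\<close> of \<open>\<complex>[S\<^sub>k]\<close>, with respect to some basis \<open>b\<^sub>0, b\<^sub>1, \<dots>\<close> of \<open>W\<close>.\<close>

definition affords :: "nat \<Rightarrow> ((nat \<Rightarrow> nat) \<Rightarrow> complex) set \<Rightarrow> (nat \<Rightarrow> nat) rep \<Rightarrow> bool" where
  "affords k W \<pi> \<longleftrightarrow> (\<exists>b :: nat \<Rightarrow> (nat \<Rightarrow> nat) \<Rightarrow> complex.
     W = {f. \<exists>a. f = (\<lambda>x. \<Sum>i<fst \<pi>. a i * b i x)} \<and>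
     (\<forall>a. (\<forall>x. (\<Sum>i<fst \<pi>. a i * b i x) = 0) \<longrightarrow> (\<forall>i<fst \<pi>. a i = 0)) \<and>
     (\<forall>g\<in>carrier (sym_group k). snd \<pi> g \<in> carrier_mat (fst \<pi>) (fst \<pi>) \<and>
        (\<forall>j<fst \<pi>. \<forall>x. b j (inv\<^bsub>sym_group k\<^esub> g \<circ> x) = (\<Sum>i<fst \<pi>. snd \<pi> g $$ (i, j) * b i x))))"

definition is_partition :: "nat list \<Rightarrow> bool" where
  "is_partition \<nu> \<longleftrightarrow> sorted_wrt (\<ge>) \<nu> \<and> (\<forall>x\<in>set \<nu>. 0 < x)"

text \<open>\<open>k - |\<nu>| \<ge> \<nu>\<^sub>1\<close>, where \<open>\<nu>\<^sub>1 = 0\<close> if \<open>\<nu>\<close> is empty.\<close>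

definition paddable :: "nat \<Rightarrow> nat list \<Rightarrow> bool" where
  "paddable k \<nu> \<longleftrightarrow> is_partition \<nu> \<and> sum_list \<nu> + (if \<nu> = [] then 0 else hd \<nu>) \<le> k"

definition Sym_irrep :: "nat \<Rightarrow> nat list \<Rightarrow> (nat \<Rightarrow> nat) rep" where
  "Sym_irrep k \<nu> =
     (SOME \<pi>. affords k (left_ideal k (young_symmetrizer ((k - sum_list \<nu>) # \<nu>))) \<pi>)"


section \<open>Isotypic representations and the representations of the quotients\<close>

definition is_V :: "nat \<Rightarrow> nat set set \<Rightarrow> zelem rep \<Rightarrow> bool" where
  "is_V n I \<chi> \<longleftrightarrow> fst \<chi> = 1 \<and> is_rep (PZgrp n) \<chi> \<and>
     (\<forall>i j. 1 \<le> i \<and> i < j \<and> j \<le> n \<longrightarrow>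
        snd \<chi> (to_Z n (artin_gen n i j)) = (if {i, j} \<in> I then - 1 else 1) \<cdot>\<^sub>m 1\<^sub>m 1)"

definition isotypic :: "nat \<Rightarrow> nat set set \<Rightarrow> zelem rep \<Rightarrow> bool" where
  "isotypic n I \<pi> \<longleftrightarrow> (\<exists>\<chi> k. is_V n I \<chi> \<and> rep_iso (PZgrp n) \<pi> (copies k \<chi>))"

definition isotypic_irrep_reps :: "nat \<Rightarrow> nat set set \<Rightarrow> zelem rep set \<Rightarrow> bool" where
  "isotypic_irrep_reps m I R \<longleftrightarrow>
     (\<forall>\<rho>\<in>R. is_irrep (ZIgrp m I) \<rho> \<and> isotypic m I \<rho>) \<and>
     (\<forall>\<sigma>. is_irrep (ZIgrp m I) \<sigma> \<and> isotypic m I \<sigma> \<longrightarrow>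
        (\<exists>!\<rho>. \<rho> \<in> R \<and> rep_iso (ZIgrp m I) \<sigma> \<rho>))"

text \<open>\<open>V_rep n m I \<rho> \<nu>\<close> is the representation \<open>V\<^sub>n(\<rho>, \<nu>)\<close>, where \<open>\<rho>\<close> is a representation of
  \<open>ZIgrp m I\<close>.\<close>

definition V_rep :: "nat \<Rightarrow> nat \<Rightarrow> nat set set \<Rightarrow> zelem rep \<Rightarrow> nat list \<Rightarrow> zelem rep" where
  "V_rep n m I \<rho> \<nu> = induced (Zgrp n) (Z_stab n I)
     (pullback (Z_split n m) (ext_tensor \<rho> (Sym_irrep (n - m) \<nu>)))"

end

theory Submission
  imports
    Defs
    "HOL-Combinatorics.Combinatorics"
    "HOL-Library.Function_Algebras"
    "Jordan_Normal_Form.Spectral_Radius"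
begin

text \<open>Irreducibility and isomorphism are decided by the Schur orthogonality relations between matrix
  coefficients. Modulo 4 the Burau matrix of a braid at \<open>t = -1\<close> is a permutation matrix times
  \<open>1 + 2Y\<close>, so the class of a braid in \<open>\<Z>\<^sub>n\<close> amounts to its permutation and the mod 2 crossing numbers
  \<open>Y\<close>; for pure braids \<open>Y\<close> is a set of pairs, and the characters of \<open>\<P>\<Z>\<^sub>n\<close> are the \<open>V\<^sub>I\<close>, permuted by \<open>S\<^sub>n\<close>
  with stabilizers \<open>\<Z>\<^sub>n\<^sup>I\<close>. By Clifford theory, inducing irreducible \<open>I\<close>-isotypic representations of \<open>\<Z>\<^sub>n\<^sup>I\<close>
  gives irreducible representations, which are orthogonal for different orbits. The kernel of
  \<open>\<Z>\<^sub>n\<^sup>I \<rightarrow> \<Z>\<^sub>m\<^sup>I \<times> S\<^sub>n\<^sub>-\<^sub>m\<close> consists of pure braids on which \<open>V\<^sub>I\<close> is trivial, so the \<open>I\<close>-isotypic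
  representations come from outer tensor products. A representation orthogonal to all of the
  \<open>V\<^sub>n(\<rho>, \<lambda>)\<close> contains no \<open>V\<^sub>I\<close> in its restriction to \<open>\<P>\<Z>\<^sub>n\<close> and is therefore zero. For the symmetric
  groups, Young symmetrizers give irreducible representations, pairwise distinguished by the
  dominance order and as numerous as the conjugacy classes.\<close>

section \<open>Matrix coefficients of irreducible representations\<close>

text \<open>The representations in question are only known up to choices: \<open>induced\<close>
  picks a transversal, \<open>Sym_irrep\<close> picks a basis. The vanishing of sums of products of
  matrix coefficients is insensitive to such choices, and under pullback, outer tensor product and
  induction these sums reduce to sums over smaller groups; this is why \<open>schur_rel\<close> and
  \<open>coef_orth\<close> carry the argument instead of invariant subspaces. Complete reducibility
  is replaced by \<open>irreps_separate\<close>: a function on a finite group annihilated by all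
  irreducible coefficients is zero. On the braid side the obstacle is that \<open>level4\<close> is
  the kernel of a matrix map on equivalence classes of words. The pair \<open>key\<close> of
  permutation and crossing parities makes equality in \<open>Zgrp\<close> computable on words. All
  characters of the pure part take the values 1 and -1, so a character never has to be distinguished
  from its inverse.\<close>

lemma mat_mult_entry:
  assumes "A \<in> carrier_mat n m" "B \<in> carrier_mat m k" "i < n" "j < k"
  shows "(A * B) $$ (i, j) = (\<Sum>l<m. A $$ (i, l) * B $$ (l, j))"
  using assms by (simp add: scalar_prod_def atLeast0LessThan)

lemma mat_vec_entry:
  assumes "A \<in> carrier_mat n m" "v \<in> carrier_vec m" "i < n"
  shows "(A *\<^sub>v v) $ i = (\<Sum>l<m. A $$ (i, l) * v $ l)"
  using assms by (simp add: scalar_prod_def atLeast0LessThan)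

lemma sum_single:
  fixes f :: "nat \<Rightarrow> 'a::semiring_1"
  assumes "j < n"
  shows "(\<Sum>l<n. f l * (if l = j then c else 0)) = f j * c"
    and "(\<Sum>l<n. (if l = j then c else 0) * f l) = c * f j"
    and "(\<Sum>l<n. (if j = l then c else 0) * f l) = c * f j"
    and "(\<Sum>l<n. f l * (if j = l then c else 0)) = f j * c"
  using assms by (simp_all add: if_distrib[of "\<lambda>x. _ * x"] if_distrib[of "\<lambda>x. x * _"] cong: if_cong)

lemma mat_eq_vecI:
  fixes A :: "'a::comm_ring_1 mat"
  assumes A: "A \<in> carrier_mat n m" and B: "B \<in> carrier_mat n m"
    and eq: "\<And>v. v \<in> carrier_vec m \<Longrightarrow> A *\<^sub>v v = B *\<^sub>v v"
  shows "A = B"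
proof (rule eq_matI)
  fix i j assume ij: "i < dim_row B" "j < dim_col B"
  hence "(A *\<^sub>v unit_vec m j) $ i = (B *\<^sub>v unit_vec m j) $ i"
    by (simp add: eq)
  moreover have "(C *\<^sub>v unit_vec m j) $ i = C $$ (i, j)" if "C \<in> carrier_mat n m" for C :: "'a mat"
    using that ij B by (subst mat_vec_entry[OF that]) (auto simp: unit_vec_def sum_single)
  ultimately show "A $$ (i, j) = B $$ (i, j)" using A B by simp
qed (use A B in auto)

lemma GL_carrier:
  "carrier (GL TYPE('a::comm_ring_1) d)
     = {P \<in> carrier_mat d d. \<exists>Q\<in>carrier_mat d d. Q * P = 1\<^sub>m d \<and> P * Q = 1\<^sub>m d}"
  by (auto simp: GL_def units_of_def Units_def ring_mat_simps)

lemma GL_simps: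
  "x \<otimes>\<^bsub>GL TYPE('a::comm_ring_1) d\<^esub> y = x * y" "\<one>\<^bsub>GL TYPE('a) d\<^esub> = 1\<^sub>m d"
  by (simp_all add: GL_def units_of_def ring_mat_simps)

lemma GL_group: "group (GL TYPE('a::comm_ring_1) d)"
proof -
  have "monoid (ring_mat TYPE('a) d ())"
    using ring_mat[of d "()", where ?'a = 'a] by (simp add: ring_def)
  thus ?thesis unfolding GL_def by (rule monoid.units_group)
qed

lemma subspace_vecI:
  assumes "W \<subseteq> carrier_vec d" "0\<^sub>v d \<in> W" "\<And>v w. v \<in> W \<Longrightarrow> w \<in> W \<Longrightarrow> v + w \<in> W"
    "\<And>c v. v \<in> W \<Longrightarrow> c \<cdot>\<^sub>v v \<in> W"
  shows "VectorSpace.subspace class_ring W (module_vec TYPE('a::field) d)"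
  using assms vec_vs[of d, where ?'a = 'a] vec_module[of d, where ?'a = 'a]
  by (auto simp: VectorSpace.subspace_def submodule_def module_vec_simps)

lemma subspace_vecD:
  assumes "VectorSpace.subspace class_ring W (module_vec TYPE('a::field) d)"
  shows "W \<subseteq> carrier_vec d" "0\<^sub>v d \<in> W" "\<And>v w. v \<in> W \<Longrightarrow> w \<in> W \<Longrightarrow> v + w \<in> W"
    "\<And>c v. v \<in> W \<Longrightarrow> c \<cdot>\<^sub>v v \<in> W"
  using assms
  by (auto simp: VectorSpace.subspace_def submodule_def module_vec_simps class_ring_simps)

section \<open>Matrix representations and Schur's lemma\<close>

context group
begin

lemma sum_lmult:
  assumes "a \<in> carrier G"
  shows "(\<Sum>g\<in>carrier G. f (a \<otimes> g)) = (\<Sum>g\<in>carrier G. f g)"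
  by (rule sum.reindex_bij_witness[where i = "\<lambda>g. inv a \<otimes> g" and j = "\<lambda>g. a \<otimes> g"])
    (use assms in \<open>auto simp: m_assoc[symmetric]\<close>)

lemma sum_rmult:
  assumes "a \<in> carrier G"
  shows "(\<Sum>g\<in>carrier G. f (g \<otimes> a)) = (\<Sum>g\<in>carrier G. f g)"
  by (rule sum.reindex_bij_witness[where i = "\<lambda>g. g \<otimes> inv a" and j = "\<lambda>g. g \<otimes> a"])
    (use assms in \<open>auto simp: m_assoc\<close>)

lemma sum_inv: "(\<Sum>g\<in>carrier G. f (inv g)) = (\<Sum>g\<in>carrier G. f g)"
  by (rule sum.reindex_bij_witness[where i = "\<lambda>g. inv g" and j = "\<lambda>g. inv g"]) auto

lemma is_repI:
  assumes "\<And>g. g \<in> carrier G \<Longrightarrow> M g \<in> carrier_mat d d" "M \<one> = 1\<^sub>m d"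
    "\<And>g h. g \<in> carrier G \<Longrightarrow> h \<in> carrier G \<Longrightarrow> M (g \<otimes> h) = M g * M h"
  shows "is_rep G (d, M)"
proof -
  have "\<exists>Q\<in>carrier_mat d d. Q * M g = 1\<^sub>m d \<and> M g * Q = 1\<^sub>m d" if "g \<in> carrier G" for g
    using that assms(1)[of "inv g"] assms(2) assms(3)[of g "inv g"] assms(3)[of "inv g" g]
    by (intro bexI[of _ "M (inv g)"]) auto
  thus ?thesis using assms by (auto simp: is_rep_def hom_def GL_carrier GL_simps)
qed

context
  fixes \<pi> :: "'a rep"
  assumes rep: "is_rep G \<pi>"
begin

lemma rep_carrier: "g \<in> carrier G \<Longrightarrow> snd \<pi> g \<in> carrier_mat (fst \<pi>) (fst \<pi>)"
  using rep by (auto simp: is_rep_def hom_def GL_carrier)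

lemma rep_mult:
  "g \<in> carrier G \<Longrightarrow> h \<in> carrier G \<Longrightarrow> snd \<pi> (g \<otimes> h) = snd \<pi> g * snd \<pi> h"
  using rep by (auto simp: is_rep_def hom_def GL_simps)

lemma rep_one: "snd \<pi> \<one> = 1\<^sub>m (fst \<pi>)"
  using rep hom_one[OF _ group_axioms GL_group] by (fastforce simp: is_rep_def GL_simps)

lemma rep_mult_entry:
  assumes "g \<in> carrier G" "h \<in> carrier G" "i < fst \<pi>" "j < fst \<pi>"
  shows "snd \<pi> (g \<otimes> h) $$ (i, j) = (\<Sum>l<fst \<pi>. snd \<pi> g $$ (i, l) * snd \<pi> h $$ (l, j))"
  using assms mat_mult_entry[OF rep_carrier rep_carrier] by (simp add: rep_mult)

end

text \<open>Schur's lemma. Kernel and image of an intertwiner are invariant, so a nonzero one is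
  injective and surjective. An explicit two-sided inverse is produced because \<open>rep_iso\<close>
  asks for an element of \<open>GL\<close>.\<close>

lemma intertwiner_cases:
  assumes p: "is_irrep G \<pi>" and s: "is_irrep G \<sigma>"
    and X: "X \<in> carrier_mat (fst \<sigma>) (fst \<pi>)"
    and comm: "\<And>g. g \<in> carrier G \<Longrightarrow> X * snd \<pi> g = snd \<sigma> g * X"
  shows "X = 0\<^sub>m (fst \<sigma>) (fst \<pi>) \<or>
    (fst \<sigma> = fst \<pi> \<and> (\<exists>Y\<in>carrier_mat (fst \<pi>) (fst \<sigma>). X * Y = 1\<^sub>m (fst \<sigma>) \<and> Y * X = 1\<^sub>m (fst \<pi>)))"
proof (cases "X = 0\<^sub>m (fst \<sigma>) (fst \<pi>)")
  case False
  let ?n = "fst \<pi>" and ?m = "fst \<sigma>"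
  have rp: "is_rep G \<pi>" and rs: "is_rep G \<sigma>" using p s by (auto simp: is_irrep_def)
  note cp = rep_carrier[OF rp] and cs = rep_carrier[OF rs]
  have equi: "X *\<^sub>v (snd \<pi> g *\<^sub>v v) = snd \<sigma> g *\<^sub>v (X *\<^sub>v v)"
    if "g \<in> carrier G" "v \<in> carrier_vec ?n" for g v
    using that comm[of g] cp[of g] cs[of g] X
    by (simp flip: assoc_mult_mat_vec)
  define K where "K = {v \<in> carrier_vec ?n. X *\<^sub>v v = 0\<^sub>v ?m}"
  define I where "I = (\<lambda>v. X *\<^sub>v v) ` carrier_vec ?n"
  have subK: "VectorSpace.subspace class_ring K (module_vec TYPE(complex) ?n)"
    unfolding K_def using X
    by (intro subspace_vecI)
      (auto simp: mult_add_distrib_mat_vec mult_mat_vec)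
  have subI: "VectorSpace.subspace class_ring I (module_vec TYPE(complex) ?m)"
  proof (intro subspace_vecI)
    show "I \<subseteq> carrier_vec ?m" using X by (auto simp: I_def)
    show "0\<^sub>v ?m \<in> I" unfolding I_def
      using X by (intro image_eqI[of _ _ "0\<^sub>v ?n"]) auto
    show "v + w \<in> I" if "v \<in> I" "w \<in> I" for v w
      using that X unfolding I_def
      by (auto simp flip: mult_add_distrib_mat_vec[OF X])
    show "c \<cdot>\<^sub>v v \<in> I" if "v \<in> I" for c v
      using that X unfolding I_def
      by (auto simp flip: mult_mat_vec[OF X])
  qed
  have "\<forall>g\<in>carrier G. \<forall>w\<in>K. snd \<pi> g *\<^sub>v w \<in> K"
  proof (intro ballI)
    fix g w assume "g \<in> carrier G" "w \<in> K"
    thus "snd \<pi> g *\<^sub>v w \<in> K"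
      using cp[of g] cs[of g] by (auto simp: K_def equi intro!: mult_mat_vec_carrier)
  qed
  hence K: "K = {0\<^sub>v ?n} \<or> K = carrier_vec ?n" using p subK by (auto simp: is_irrep_def)
  have "\<forall>g\<in>carrier G. \<forall>w\<in>I. snd \<sigma> g *\<^sub>v w \<in> I"
    using cp X by (auto simp: I_def simp flip: equi intro!: imageI mult_mat_vec_carrier)
  hence I: "I = {0\<^sub>v ?m} \<or> I = carrier_vec ?m" using s subI by (auto simp: is_irrep_def)
  have nz: "\<not> (\<forall>v\<in>carrier_vec ?n. X *\<^sub>v v = 0\<^sub>v ?m)"
  proof
    assume *: "\<forall>v\<in>carrier_vec ?n. X *\<^sub>v v = 0\<^sub>v ?m"
    have "X = 0\<^sub>m ?m ?n" by (rule mat_eq_vecI[OF X]) (use * in auto)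
    thus False using False by simp
  qed
  have K0: "K = {0\<^sub>v ?n}" using K nz by (auto simp: K_def)
  have I1: "I = carrier_vec ?m" using I nz by (auto simp: I_def)
  \<comment> \<open>Preimages of the unit vectors are the columns of a right inverse; injectivity of
    \<open>X\<close> makes it a left inverse as well.\<close>
  have "\<exists>y\<in>carrier_vec ?n. X *\<^sub>v y = unit_vec ?m c" for c
    using I1 unit_vec_carrier[of ?m c] unfolding I_def by (metis imageE)
  then obtain y where y: "\<And>c. y c \<in> carrier_vec ?n" "\<And>c. X *\<^sub>v y c = unit_vec ?m c" by metis
  define Y where "Y = mat ?n ?m (\<lambda>(r, c). y c $ r)"
  have Y: "Y \<in> carrier_mat ?n ?m" by (simp add: Y_def)
  have XY: "X * Y = 1\<^sub>m ?m"
  proof (rule eq_matI)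
    fix i j assume ij: "i < dim_row (1\<^sub>m ?m :: complex mat)" "j < dim_col (1\<^sub>m ?m :: complex mat)"
    hence "(X * Y) $$ (i, j) = (\<Sum>l<?n. X $$ (i, l) * y j $ l)"
      using X Y by (subst mat_mult_entry[OF X Y]) (auto simp: Y_def)
    also have "\<dots> = (X *\<^sub>v y j) $ i" using ij y(1)[of j] by (subst mat_vec_entry[OF X]) auto
    also have "\<dots> = 1\<^sub>m ?m $$ (i, j)" using ij by (simp add: y(2) unit_vec_def)
    finally show "(X * Y) $$ (i, j) = 1\<^sub>m ?m $$ (i, j)" .
  qed (use X Y in auto)
  have YX: "Y * X = 1\<^sub>m ?n"
  proof (rule mat_eq_vecI[of _ ?n ?n])
    fix v :: "complex vec" assume v: "v \<in> carrier_vec ?n"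
    let ?w = "Y * X *\<^sub>v v"
    have w: "?w \<in> carrier_vec ?n" using X Y v by auto
    have "X *\<^sub>v ?w = X *\<^sub>v (Y *\<^sub>v (X *\<^sub>v v))"
      using X Y v by (metis assoc_mult_mat_vec)
    also have "\<dots> = (X * Y) *\<^sub>v (X *\<^sub>v v)"
      using X Y v by (metis assoc_mult_mat_vec mult_mat_vec_carrier)
    also have "\<dots> = X *\<^sub>v v" using X v by (simp add: XY)
    finally have "X *\<^sub>v (?w - v) = 0\<^sub>v ?m"
      using X v w by (simp add: mult_minus_distrib_mat_vec[OF X])
    hence "?w - v \<in> K" using v w by (auto simp: K_def)
    hence d: "?w - v = 0\<^sub>v ?n" by (simp add: K0)
    show "?w = 1\<^sub>m ?n *\<^sub>v v"
    proof (rule eq_vecI)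
      fix i assume "i < dim_vec (1\<^sub>m ?n *\<^sub>v v)"
      thus "?w $ i = (1\<^sub>m ?n *\<^sub>v v) $ i"
        using arg_cong[OF d, of "\<lambda>u. u $ i"] v w by auto
    qed (use v w X Y in auto)
  qed (use X Y in \<open>auto intro: mult_carrier_mat\<close>)
  \<comment> \<open>The dimensions agree because \<open>X * Y\<close> and \<open>Y * X\<close> have
    the same trace and both are identity matrices.\<close>
  have "of_nat ?m = (\<Sum>i<?m. (X * Y) $$ (i, i))" by (simp add: XY)
  also have "\<dots> = (\<Sum>i<?m. \<Sum>l<?n. X $$ (i, l) * Y $$ (l, i))"
    by (intro sum.cong refl mat_mult_entry[OF X Y]) auto
  also have "\<dots> = (\<Sum>l<?n. \<Sum>i<?m. Y $$ (l, i) * X $$ (i, l))"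
    by (subst sum.swap) (simp add: mult.commute)
  also have "\<dots> = (\<Sum>l<?n. (Y * X) $$ (l, l))"
    by (intro sum.cong refl mat_mult_entry[OF Y X, symmetric]) auto
  also have "\<dots> = of_nat ?n" by (simp add: YX)
  finally have "?m = ?n" by (simp only: of_nat_eq_iff)
  thus ?thesis using XY YX Y by auto
qed simp

text \<open>Over the complex numbers \<open>X\<close> has an eigenvalue \<open>c\<close>. Then
  \<open>X\<close> minus \<open>c\<close> is an intertwiner that kills an eigenvector, hence is not
  invertible, hence is zero.\<close>

lemma irrep_scalar:
  assumes p: "is_irrep G \<pi>" and X: "X \<in> carrier_mat (fst \<pi>) (fst \<pi>)"
    and comm: "\<And>g. g \<in> carrier G \<Longrightarrow> X * snd \<pi> g = snd \<pi> g * X"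
  shows "\<exists>c. X = c \<cdot>\<^sub>m 1\<^sub>m (fst \<pi>)"
proof -
  let ?n = "fst \<pi>"
  have rp: "is_rep G \<pi>" and n: "0 < ?n" using p by (auto simp: is_irrep_def)
  obtain c where "c \<in> spectrum X" using spectrum_non_empty[OF X n] by auto
  then obtain v where v: "v \<in> carrier_vec ?n" "v \<noteq> 0\<^sub>v ?n" "X *\<^sub>v v = c \<cdot>\<^sub>v v"
    using X by (auto simp: spectrum_def eigenvalue_def eigenvector_def)
  define Z where "Z = X - c \<cdot>\<^sub>m 1\<^sub>m ?n"
  have Z: "Z \<in> carrier_mat ?n ?n" using X by (auto simp: Z_def)
  have "Z * snd \<pi> g = snd \<pi> g * Z" if "g \<in> carrier G" for g
    using comm[OF that] rep_carrier[OF rp that] X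
      mult_smult_distrib[OF rep_carrier[OF rp that] one_carrier_mat, of c]
    by (simp add: Z_def minus_mult_distrib_mat[OF X] mult_minus_distrib_mat[OF _ X]
        mult_smult_assoc_mat[of _ "fst \<pi>" "fst \<pi>"])
  from intertwiner_cases[OF p p Z this]
  have "Z = 0\<^sub>m ?n ?n \<or> (\<exists>Y\<in>carrier_mat ?n ?n. Y * Z = 1\<^sub>m ?n)" by auto
  moreover have False if Y: "Y \<in> carrier_mat ?n ?n" "Y * Z = 1\<^sub>m ?n" for Y
  proof -
    have "(c \<cdot>\<^sub>m 1\<^sub>m ?n) *\<^sub>v v = c \<cdot>\<^sub>v v"
    proof (rule eq_vecI)
      fix i assume "i < dim_vec (c \<cdot>\<^sub>v v)"
      hence i: "i < ?n" using v by simp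
      have "((c \<cdot>\<^sub>m 1\<^sub>m ?n) *\<^sub>v v) $ i = (\<Sum>l<?n. (c \<cdot>\<^sub>m 1\<^sub>m ?n) $$ (i, l) * v $ l)"
        using v i by (intro mat_vec_entry) auto
      also have "\<dots> = (\<Sum>l<?n. (if i = l then c else 0) * v $ l)"
        using i by (intro sum.cong) auto
      finally show "((c \<cdot>\<^sub>m 1\<^sub>m ?n) *\<^sub>v v) $ i = (c \<cdot>\<^sub>v v) $ i" using i v by (simp add: sum_single)
    qed (use v in auto)
    hence "Z *\<^sub>v v = 0\<^sub>v ?n"
      using v X by (simp add: Z_def minus_mult_distrib_mat_vec[OF X])
    hence "Y *\<^sub>v (Z *\<^sub>v v) = 0\<^sub>v ?n" using Y by (intro eq_vecI) auto
    hence "1\<^sub>m ?n *\<^sub>v v = 0\<^sub>v ?n" using assoc_mult_mat_vec[OF Y(1) Z v(1)] Y(2) by simp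
    thus False using v by simp
  qed
  ultimately have "Z = 0\<^sub>m ?n ?n" by auto
  hence "Z $$ (i, j) = 0" if "i < ?n" "j < ?n" for i j using that by simp
  hence "X $$ (i, j) = (c \<cdot>\<^sub>m 1\<^sub>m ?n) $$ (i, j)" if "i < ?n" "j < ?n" for i j
    using that X by (force simp: Z_def)
  hence "X = c \<cdot>\<^sub>m 1\<^sub>m ?n" using X by (intro eq_matI) auto
  thus ?thesis ..
qed

end

section \<open>Orthogonality relations between matrix coefficients\<close>

definition schur_rel :: "('g, 'x) monoid_scheme \<Rightarrow> 'g rep \<Rightarrow> bool" where
  "schur_rel G \<pi> \<longleftrightarrow> (\<forall>i<fst \<pi>. \<forall>j<fst \<pi>. \<forall>k<fst \<pi>. \<forall>l<fst \<pi>.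
     (\<Sum>g\<in>carrier G. snd \<pi> g $$ (i, j) * snd \<pi> (inv\<^bsub>G\<^esub> g) $$ (k, l)) =
     (if i = l \<and> j = k then of_nat (card (carrier G)) / of_nat (fst \<pi>) else 0))"

text \<open>As in \<open>schur_rel\<close>, an element is paired with its inverse rather than with a
  complex conjugate, so no unitary structure is required and the relation is bilinear in the
  coefficients.\<close>

definition coef_orth :: "('g, 'x) monoid_scheme \<Rightarrow> 'g rep \<Rightarrow> 'g rep \<Rightarrow> bool" where
  "coef_orth G \<pi> \<sigma> \<longleftrightarrow> (\<forall>i<fst \<pi>. \<forall>j<fst \<pi>. \<forall>k<fst \<sigma>. \<forall>l<fst \<sigma>.
     (\<Sum>g\<in>carrier G. snd \<pi> g $$ (i, j) * snd \<sigma> (inv\<^bsub>G\<^esub> g) $$ (k, l)) = 0)"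

lemma subspace_sum:
  assumes W: "VectorSpace.subspace class_ring W (module_vec TYPE('a::field) d)"
    and "finite S" "\<And>s. s \<in> S \<Longrightarrow> v s \<in> W"
  shows "vec d (\<lambda>i. \<Sum>s\<in>S. c s * v s $ i) \<in> W"
  using assms(2,3)
proof (induction S)
  case empty
  show ?case using subspace_vecD(2)[OF W] by (simp add: zero_vec_def)
next
  case (insert s S)
  have "v s \<in> carrier_vec d" using subspace_vecD(1)[OF W] insert by auto
  hence "vec d (\<lambda>i. \<Sum>s\<in>insert s S. c s * v s $ i) =
    c s \<cdot>\<^sub>v v s + vec d (\<lambda>i. \<Sum>s\<in>S. c s * v s $ i)"
    using insert by (intro eq_vecI) auto
  thus ?case using insert subspace_vecD(3,4)[OF W] by simp
qed

context group
begin

text \<open>\<open>X\<close> is the average, without normalisation, of the elementary matrix with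
  entry 1 at \<open>(j, k)\<close>. Translating the summation variable by \<open>h\<close> moves
  \<open>h\<close> from one side to the other.\<close>

lemma average_intertwiner:
  assumes rp: "is_rep G \<pi>" and rs: "is_rep G \<sigma>" and jk: "j < fst \<sigma>" "k < fst \<pi>"
    and h: "h \<in> carrier G"
  defines "X \<equiv> mat (fst \<sigma>) (fst \<pi>)
    (\<lambda>(i, l). \<Sum>g\<in>carrier G. snd \<sigma> g $$ (i, j) * snd \<pi> (inv g) $$ (k, l))"
  shows "X * snd \<pi> h = snd \<sigma> h * X"
proof (rule eq_matI)
  have X: "X \<in> carrier_mat (fst \<sigma>) (fst \<pi>)" by (simp add: X_def)
  note cp = rep_carrier[OF rp] and cs = rep_carrier[OF rs]
  fix i l assume "i < dim_row (snd \<sigma> h * X)" "l < dim_col (snd \<sigma> h * X)"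
  hence il: "i < fst \<sigma>" "l < fst \<pi>" using cs[OF h] X by auto
  have "(X * snd \<pi> h) $$ (i, l) =
    (\<Sum>p<fst \<pi>. \<Sum>g\<in>carrier G. snd \<sigma> g $$ (i, j) * (snd \<pi> (inv g) $$ (k, p) * snd \<pi> h $$ (p, l)))"
    by (subst mat_mult_entry[OF X cp[OF h] il])
      (intro sum.cong HOL.refl, auto simp: X_def sum_distrib_left mult_ac il)
  also have "\<dots> = (\<Sum>g\<in>carrier G. snd \<sigma> g $$ (i, j) * snd \<pi> (inv g \<otimes> h) $$ (k, l))"
    by (subst sum.swap) (auto intro!: sum.cong simp: rep_mult_entry[OF rp _ h jk(2) il(2)] sum_distrib_left)
  also have "\<dots> = (\<Sum>g\<in>carrier G. snd \<sigma> (h \<otimes> g) $$ (i, j) * snd \<pi> (inv (h \<otimes> g) \<otimes> h) $$ (k, l))"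
    by (rule sum_lmult[OF h, symmetric])
  also have "\<dots> = (\<Sum>g\<in>carrier G. \<Sum>p<fst \<sigma>. snd \<sigma> h $$ (i, p) * (snd \<sigma> g $$ (p, j) * snd \<pi> (inv g) $$ (k, l)))"
  proof (rule sum.cong[OF HOL.refl])
    fix g assume g: "g \<in> carrier G"
    have "inv (h \<otimes> g) \<otimes> h = inv g" using g h by (simp add: inv_mult_group m_assoc)
    thus "snd \<sigma> (h \<otimes> g) $$ (i, j) * snd \<pi> (inv (h \<otimes> g) \<otimes> h) $$ (k, l) =
      (\<Sum>p<fst \<sigma>. snd \<sigma> h $$ (i, p) * (snd \<sigma> g $$ (p, j) * snd \<pi> (inv g) $$ (k, l)))"
      by (simp add: rep_mult_entry[OF rs h g il(1) jk(1)] sum_distrib_right mult.assoc)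
  qed
  also have "\<dots> = (snd \<sigma> h * X) $$ (i, l)"
    by (subst mat_mult_entry[OF cs[OF h] X il], subst sum.swap)
      (intro sum.cong HOL.refl, auto simp: X_def sum_distrib_left il)
  finally show "(X * snd \<pi> h) $$ (i, l) = (snd \<sigma> h * X) $$ (i, l)" .
qed (use rep_carrier[OF rp h] rep_carrier[OF rs h] in \<open>auto simp: X_def\<close>)

text \<open>Each sum in question is an entry of an averaged elementary matrix. By Schur's lemma this
  average is zero or invertible, and an invertible one would be an isomorphism.\<close>

lemma irrep_iso_or_orth:
  assumes p: "is_irrep G \<pi>" and s: "is_irrep G \<sigma>" and ni: "\<not> rep_iso G \<pi> \<sigma>"
  shows "coef_orth G \<sigma> \<pi>"
  unfolding coef_orth_def
proof (intro allI impI)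
  fix i j k l assume ijkl: "i < fst \<sigma>" "j < fst \<sigma>" "k < fst \<pi>" "l < fst \<pi>"
  have rp: "is_rep G \<pi>" and rs: "is_rep G \<sigma>" using p s by (auto simp: is_irrep_def)
  define X where "X = mat (fst \<sigma>) (fst \<pi>)
    (\<lambda>(i, l). \<Sum>g\<in>carrier G. snd \<sigma> g $$ (i, j) * snd \<pi> (inv g) $$ (k, l))"
  have X: "X \<in> carrier_mat (fst \<sigma>) (fst \<pi>)" by (simp add: X_def)
  have comm: "X * snd \<pi> h = snd \<sigma> h * X" if "h \<in> carrier G" for h
    unfolding X_def by (rule average_intertwiner[OF rp rs ijkl(2,3) that])
  have "X = 0\<^sub>m (fst \<sigma>) (fst \<pi>)"
  proof (rule ccontr)
    assume "X \<noteq> 0\<^sub>m (fst \<sigma>) (fst \<pi>)"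
    then obtain Y where Y: "fst \<sigma> = fst \<pi>" "Y \<in> carrier_mat (fst \<pi>) (fst \<sigma>)"
      "X * Y = 1\<^sub>m (fst \<sigma>)" "Y * X = 1\<^sub>m (fst \<pi>)"
      using intertwiner_cases[OF p s X comm] by blast
    hence "X \<in> carrier (GL TYPE(complex) (fst \<pi>))" using X by (auto simp: GL_carrier)
    thus False using ni comm Y(1) unfolding rep_iso_def by metis
  qed
  hence "X $$ (i, l) = 0" using ijkl by simp
  thus "(\<Sum>g\<in>carrier G. snd \<sigma> g $$ (i, j) * snd \<pi> (inv g) $$ (k, l)) = 0"
    using ijkl by (simp add: X_def)
qed

text \<open>The averaged elementary matrix is a scalar \<open>c\<close>, and its trace determines
  \<open>c\<close>.\<close>

lemma irrep_schur_rel: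
  assumes p: "is_irrep G \<pi>"
  shows "schur_rel G \<pi>"
  unfolding schur_rel_def
proof (intro allI impI)
  let ?n = "fst \<pi>"
  fix i j k l assume ijkl: "i < ?n" "j < ?n" "k < ?n" "l < ?n"
  have rp: "is_rep G \<pi>" and n: "?n > 0" using p by (auto simp: is_irrep_def)
  define X where "X = mat ?n ?n
    (\<lambda>(i, l). \<Sum>g\<in>carrier G. snd \<pi> g $$ (i, j) * snd \<pi> (inv g) $$ (k, l))"
  have X: "X \<in> carrier_mat ?n ?n" by (simp add: X_def)
  have comm: "X * snd \<pi> h = snd \<pi> h * X" if "h \<in> carrier G" for h
    unfolding X_def by (rule average_intertwiner[OF rp rp ijkl(2,3) that])
  obtain c where c: "X = c \<cdot>\<^sub>m 1\<^sub>m ?n" using irrep_scalar[OF p X comm] by auto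
  have ent: "(\<Sum>g\<in>carrier G. snd \<pi> g $$ (i, j) * snd \<pi> (inv g) $$ (k, l)) = (if i = l then c else 0)"
    if "i < ?n" "l < ?n" for i l
    using arg_cong[OF c, of "\<lambda>Z. Z $$ (i, l)"] that by (simp add: X_def)
  \<comment> \<open>Under the trace the two factors recombine to the representation at
    \<open>inv g \<otimes> g\<close>, so every group element contributes an entry of the identity
    matrix.\<close>
  have "of_nat ?n * c = (\<Sum>q<?n. \<Sum>g\<in>carrier G. snd \<pi> g $$ (q, j) * snd \<pi> (inv g) $$ (k, q))"
    by (simp add: ent)
  also have "\<dots> = (\<Sum>g\<in>carrier G. snd \<pi> (inv g \<otimes> g) $$ (k, j))"
    by (subst sum.swap) (intro sum.cong HOL.refl, subst rep_mult_entry[OF rp _ _ ijkl(3,2)],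
        auto simp: mult.commute)
  also have "\<dots> = (if k = j then of_nat (card (carrier G)) else 0)"
    using ijkl by (simp add: rep_one[OF rp])
  finally have "c = (if j = k then of_nat (card (carrier G)) / of_nat ?n else 0)"
    using n by (auto simp: field_simps split: if_splits)
  thus "(\<Sum>g\<in>carrier G. snd \<pi> g $$ (i, j) * snd \<pi> (inv g) $$ (k, l)) =
     (if i = l \<and> j = k then of_nat (card (carrier G)) / of_nat ?n else 0)"
    using ent ijkl by auto
qed

text \<open>The converse of \<open>irrep_schur_rel\<close>. If an invariant subspace contains a
  vector \<open>w\<close> with \<open>w $ a\<close> nonzero, the combination of the vectors
  \<open>snd \<pi> g *\<^sub>v w\<close> with coefficients
  \<open>snd \<pi> (inv g) $$ (a, l)\<close> is a nonzero multiple of the unit vector with index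
  \<open>l\<close>. So all unit vectors lie in the subspace.\<close>

lemma schur_rel_irrep:
  assumes rp: "is_rep G \<pi>" and n: "0 < fst \<pi>" and sch: "schur_rel G \<pi>" and fin: "finite (carrier G)"
  shows "is_irrep G \<pi>"
  unfolding is_irrep_def
proof (intro conjI allI impI)
  let ?n = "fst \<pi>"
  fix W assume W: "VectorSpace.subspace class_ring W (module_vec TYPE(complex) ?n)"
    and inv: "\<forall>g\<in>carrier G. \<forall>w\<in>W. snd \<pi> g *\<^sub>v w \<in> W"
  note WD = subspace_vecD[OF W]
  have "carrier_vec ?n \<subseteq> W" if ne: "W \<noteq> {0\<^sub>v ?n}"
  proof
    obtain w where w: "w \<in> W" "w \<noteq> 0\<^sub>v ?n" using ne WD(2) by auto
    have wc: "w \<in> carrier_vec ?n" using w WD(1) by auto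
    have "\<exists>a<?n. w $ a \<noteq> 0"
    proof (rule ccontr)
      assume "\<not> (\<exists>a<?n. w $ a \<noteq> 0)"
      hence "w = 0\<^sub>v ?n" using wc by (intro eq_vecI) auto
      thus False using w by simp
    qed
    then obtain a where a: "a < ?n" "w $ a \<noteq> 0" by auto
    define q :: complex where "q = of_nat (card (carrier G)) / of_nat ?n"
    have "card (carrier G) > 0" using fin one_closed by (auto simp: card_gt_0_iff)
    hence q: "q * w $ a \<noteq> 0" using n a by (simp add: q_def)
    have unit: "(1 / (q * w $ a)) \<cdot>\<^sub>v ((q * w $ a) \<cdot>\<^sub>v unit_vec ?n l) \<in> W" if l: "l < ?n" for l
    proof (rule WD(4))
      have "(q * w $ a) \<cdot>\<^sub>v unit_vec ?n l =
        vec ?n (\<lambda>i. \<Sum>g\<in>carrier G. snd \<pi> (inv g) $$ (a, l) * (snd \<pi> g *\<^sub>v w) $ i)"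
      proof (rule eq_vecI)
        fix i assume "i < dim_vec (vec ?n (\<lambda>i. \<Sum>g\<in>carrier G. snd \<pi> (inv g) $$ (a, l) * (snd \<pi> g *\<^sub>v w) $ i))"
        hence i: "i < ?n" by simp
        have "(\<Sum>g\<in>carrier G. snd \<pi> (inv g) $$ (a, l) * (snd \<pi> g *\<^sub>v w) $ i)
          = (\<Sum>g\<in>carrier G. \<Sum>j<?n. w $ j * (snd \<pi> g $$ (i, j) * snd \<pi> (inv g) $$ (a, l)))"
        proof (rule sum.cong[OF HOL.refl])
          fix g assume g: "g \<in> carrier G"
          show "snd \<pi> (inv g) $$ (a, l) * (snd \<pi> g *\<^sub>v w) $ i =
            (\<Sum>j<?n. w $ j * (snd \<pi> g $$ (i, j) * snd \<pi> (inv g) $$ (a, l)))"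
            unfolding mat_vec_entry[OF rep_carrier[OF rp g] wc i] sum_distrib_left
            by (simp only: mult_ac)
        qed
        also have "\<dots> = (\<Sum>j<?n. w $ j * (\<Sum>g\<in>carrier G. snd \<pi> g $$ (i, j) * snd \<pi> (inv g) $$ (a, l)))"
          by (subst sum.swap) (simp add: sum_distrib_left)
        also have "\<dots> = (\<Sum>j<?n. w $ j * (if j = a then if i = l then q else 0 else 0))"
          using sch i a l by (intro sum.cong HOL.refl) (auto simp: schur_rel_def q_def)
        also have "\<dots> = w $ a * (if i = l then q else 0)" using a by (simp only: sum_single)
        finally have "(\<Sum>g\<in>carrier G. snd \<pi> (inv g) $$ (a, l) * (snd \<pi> g *\<^sub>v w) $ i)
          = w $ a * (if i = l then q else 0)" .
        moreover have "((q * w $ a) \<cdot>\<^sub>v unit_vec ?n l) $ i = w $ a * (if i = l then q else 0)"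
          using i l by simp
        ultimately show "((q * w $ a) \<cdot>\<^sub>v unit_vec ?n l) $ i =
          vec ?n (\<lambda>i. \<Sum>g\<in>carrier G. snd \<pi> (inv g) $$ (a, l) * (snd \<pi> g *\<^sub>v w) $ i) $ i"
          by (simp only: index_vec[OF i])
      qed auto
      thus "(q * w $ a) \<cdot>\<^sub>v unit_vec ?n l \<in> W"
        using subspace_sum[OF W fin, of "\<lambda>g. snd \<pi> g *\<^sub>v w"] inv w by simp
    qed
    fix v :: "complex vec" assume v: "v \<in> carrier_vec ?n"
    have "v = vec ?n (\<lambda>i. \<Sum>l<?n. v $ l * unit_vec ?n l $ i)"
    proof (rule eq_vecI)
      fix i assume "i < dim_vec (vec ?n (\<lambda>i. \<Sum>l<?n. v $ l * unit_vec ?n l $ i))"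
      hence i: "i < ?n" by simp
      have "(\<Sum>l<?n. v $ l * unit_vec ?n l $ i) = (\<Sum>l<?n. v $ l * (if i = l then 1 else 0))"
        using i by (intro sum.cong) auto
      thus "v $ i = vec ?n (\<lambda>i. \<Sum>l<?n. v $ l * unit_vec ?n l $ i) $ i"
        using i by (simp add: sum_single)
    qed (use v in auto)
    moreover have "vec ?n (\<lambda>i. \<Sum>l<?n. v $ l * unit_vec ?n l $ i) \<in> W"
      using subspace_sum[OF W, of "{..<?n}" "unit_vec ?n"] unit q by (simp add: smult_smult_assoc)
    ultimately show "v \<in> W" by simp
  qed
  thus "W = {0\<^sub>v ?n} \<or> W = carrier_vec ?n" using WD by auto
qed (use assms in auto)

lemma rep_iso_coefs:
  assumes rp: "is_rep G \<pi>" and rs: "is_rep G \<sigma>" and iso: "rep_iso G \<pi> \<sigma>"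
  shows "\<exists>P Q. \<forall>g\<in>carrier G. \<forall>i<fst \<pi>. \<forall>j<fst \<pi>.
    snd \<pi> g $$ (i, j) = (\<Sum>p<fst \<sigma>. \<Sum>q<fst \<sigma>. Q i p * P q j * snd \<sigma> g $$ (p, q))"
proof -
  let ?n = "fst \<sigma>"
  have n: "fst \<pi> = ?n" using iso by (simp add: rep_iso_def)
  obtain P Q where P: "P \<in> carrier_mat ?n ?n" "Q \<in> carrier_mat ?n ?n" "Q * P = 1\<^sub>m ?n"
    and c: "\<And>g. g \<in> carrier G \<Longrightarrow> P * snd \<pi> g = snd \<sigma> g * P"
    using iso n by (auto simp: rep_iso_def GL_carrier)
  have "snd \<pi> g $$ (i, j) = (\<Sum>p<?n. \<Sum>q<?n. Q $$ (i, p) * P $$ (q, j) * snd \<sigma> g $$ (p, q))"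
    if g: "g \<in> carrier G" and ij: "i < ?n" "j < ?n" for g i j
  proof -
    have cp: "snd \<pi> g \<in> carrier_mat ?n ?n" and cs: "snd \<sigma> g \<in> carrier_mat ?n ?n"
      using rep_carrier[OF rp g] rep_carrier[OF rs g] n by auto
    have "(Q * P) * snd \<pi> g = Q * (P * snd \<pi> g)" by (rule assoc_mult_mat[OF P(2,1) cp])
    hence "snd \<pi> g = Q * (snd \<sigma> g * P)" using cp unfolding P(3) c[OF g] by simp
    hence "snd \<pi> g $$ (i, j) = (Q * (snd \<sigma> g * P)) $$ (i, j)" by (rule arg_cong)
    also have "\<dots> = (\<Sum>p<?n. Q $$ (i, p) * (snd \<sigma> g * P) $$ (p, j))"
      using P cs ij by (intro mat_mult_entry) auto
    also have "\<dots> = (\<Sum>p<?n. \<Sum>q<?n. Q $$ (i, p) * P $$ (q, j) * snd \<sigma> g $$ (p, q))"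
      by (intro sum.cong HOL.refl, subst mat_mult_entry[OF cs P(1)])
        (auto simp: sum_distrib_left mult_ac ij)
    finally show ?thesis .
  qed
  thus ?thesis unfolding n
    by (intro exI[of _ "\<lambda>q j. P $$ (q, j)"] exI[of _ "\<lambda>i p. Q $$ (i, p)"]) simp
qed

text \<open>Coefficients of isomorphic representations span the same functions, so a linear
  condition on all coefficients of one passes to the other.\<close>

lemma rep_iso_sum_zero:
  assumes rp: "is_rep G \<pi>" and rs: "is_rep G \<sigma>" and iso: "rep_iso G \<pi> \<sigma>"
    and z: "\<And>p q. p < fst \<sigma> \<Longrightarrow> q < fst \<sigma> \<Longrightarrow> (\<Sum>g\<in>carrier G. f g * snd \<sigma> g $$ (p, q)) = 0"
    and ij: "i < fst \<pi>" "j < fst \<pi>"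
  shows "(\<Sum>g\<in>carrier G. f g * snd \<pi> g $$ (i, j)) = 0"
proof -
  obtain P Q where "\<forall>g\<in>carrier G. \<forall>i<fst \<pi>. \<forall>j<fst \<pi>.
    snd \<pi> g $$ (i, j) = (\<Sum>p<fst \<sigma>. \<Sum>q<fst \<sigma>. Q i p * P q j * snd \<sigma> g $$ (p, q))"
    using rep_iso_coefs[OF rp rs iso] by (elim exE)
  hence PQ: "snd \<pi> g $$ (i, j) = (\<Sum>p<fst \<sigma>. \<Sum>q<fst \<sigma>. Q i p * P q j * snd \<sigma> g $$ (p, q))"
    if "g \<in> carrier G" for g
    using that ij by simp
  have "(\<Sum>g\<in>carrier G. f g * snd \<pi> g $$ (i, j)) =
    (\<Sum>g\<in>carrier G. \<Sum>p<fst \<sigma>. \<Sum>q<fst \<sigma>. Q i p * P q j * (f g * snd \<sigma> g $$ (p, q)))"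
  proof (rule sum.cong[OF HOL.refl])
    fix g assume g: "g \<in> carrier G"
    show "f g * snd \<pi> g $$ (i, j) =
      (\<Sum>p<fst \<sigma>. \<Sum>q<fst \<sigma>. Q i p * P q j * (f g * snd \<sigma> g $$ (p, q)))"
      unfolding PQ[OF g] sum_distrib_left by (simp only: mult_ac)
  qed
  also have "\<dots> = (\<Sum>p<fst \<sigma>. \<Sum>g\<in>carrier G. \<Sum>q<fst \<sigma>. Q i p * P q j * (f g * snd \<sigma> g $$ (p, q)))"
    by (rule sum.swap)
  also have "\<dots> = (\<Sum>p<fst \<sigma>. \<Sum>q<fst \<sigma>. \<Sum>g\<in>carrier G. Q i p * P q j * (f g * snd \<sigma> g $$ (p, q)))"
    by (intro sum.cong HOL.refl sum.swap)
  also have "\<dots> = 0"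
    by (rule sum.neutral, rule ballI, rule sum.neutral, rule ballI) (simp add: z flip: sum_distrib_left)
  finally show ?thesis .
qed

text \<open>Orthogonality to \<sigma> would make \<pi> orthogonal to itself, while its own Schur
  relation contains a nonzero value.\<close>

lemma irrep_iso_not_orth:
  assumes p: "is_irrep G \<pi>" and s: "is_irrep G \<sigma>" and fin: "finite (carrier G)"
    and iso: "rep_iso G \<pi> \<sigma>" and orth: "coef_orth G \<sigma> \<pi>"
  shows False
proof -
  have rp: "is_rep G \<pi>" and rs: "is_rep G \<sigma>" and n: "0 < fst \<pi>" using p s by (auto simp: is_irrep_def)
  have "(\<Sum>g\<in>carrier G. snd \<pi> (inv g) $$ (0, 0) * snd \<pi> g $$ (0, 0)) = 0"
    using orth n by (intro rep_iso_sum_zero[OF rp rs iso]) (auto simp: coef_orth_def mult.commute)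
  hence "of_nat (card (carrier G)) / of_nat (fst \<pi>) = (0::complex)"
    using irrep_schur_rel[OF p] n by (simp add: schur_rel_def mult.commute)
  thus False using n fin one_closed by (auto simp: card_eq_0_iff)
qed

lemma rep_iso_sym:
  assumes rp: "is_rep G \<pi>" and rs: "is_rep G \<sigma>" and iso: "rep_iso G \<pi> \<sigma>"
  shows "rep_iso G \<sigma> \<pi>"
proof -
  let ?n = "fst \<sigma>"
  have n: "fst \<pi> = ?n" using iso by (simp add: rep_iso_def)
  obtain P Q where P: "P \<in> carrier_mat ?n ?n" "Q \<in> carrier_mat ?n ?n" "Q * P = 1\<^sub>m ?n" "P * Q = 1\<^sub>m ?n"
    and c: "\<And>g. g \<in> carrier G \<Longrightarrow> P * snd \<pi> g = snd \<sigma> g * P"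
    using iso n by (auto simp: rep_iso_def GL_carrier)
  have "Q * snd \<sigma> g = snd \<pi> g * Q" if g: "g \<in> carrier G" for g
  proof -
    have cp: "snd \<pi> g \<in> carrier_mat ?n ?n" and cs: "snd \<sigma> g \<in> carrier_mat ?n ?n"
      using rep_carrier[OF rp g] rep_carrier[OF rs g] n by auto
    note a = assoc_mult_mat[of _ ?n ?n _ ?n _ ?n]
    have "Q * snd \<sigma> g = Q * (snd \<sigma> g * (P * Q))" unfolding P(4) using P cs by simp
    also have "\<dots> = Q * ((snd \<sigma> g * P) * Q)" using P cs by (simp add: a)
    also have "\<dots> = (Q * P) * (snd \<pi> g * Q)" unfolding c[OF g, symmetric] using P(1,2) cp by (simp add: a)
    also have "\<dots> = snd \<pi> g * Q" unfolding P(3) using P cp by simp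
    finally show ?thesis .
  qed
  thus ?thesis using P n by (auto simp: rep_iso_def GL_carrier)
qed

lemma rep_iso_trans:
  assumes rp: "is_rep G \<pi>" and rs: "is_rep G \<sigma>" and rt: "is_rep G \<tau>"
    and iso: "rep_iso G \<pi> \<sigma>" "rep_iso G \<sigma> \<tau>"
  shows "rep_iso G \<pi> \<tau>"
proof -
  let ?n = "fst \<tau>"
  have n: "fst \<pi> = ?n" "fst \<sigma> = ?n" using iso by (auto simp: rep_iso_def)
  obtain P where P: "P \<in> carrier (GL TYPE(complex) ?n)"
    and c: "\<And>g. g \<in> carrier G \<Longrightarrow> P * snd \<pi> g = snd \<sigma> g * P"
    using iso(1) n by (auto simp: rep_iso_def)
  obtain Q where Q: "Q \<in> carrier (GL TYPE(complex) ?n)"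
    and d: "\<And>g. g \<in> carrier G \<Longrightarrow> Q * snd \<sigma> g = snd \<tau> g * Q"
    using iso(2) n by (auto simp: rep_iso_def)
  have "Q * P \<in> carrier (GL TYPE(complex) ?n)"
    using monoid.m_closed[OF group.is_monoid[OF GL_group] Q P] by (simp add: GL_simps)
  moreover have "Q * P * snd \<pi> g = snd \<tau> g * (Q * P)" if g: "g \<in> carrier G" for g
  proof -
    have PQ: "P \<in> carrier_mat ?n ?n" "Q \<in> carrier_mat ?n ?n" using P Q by (auto simp: GL_carrier)
    have cc: "snd \<pi> g \<in> carrier_mat ?n ?n" "snd \<sigma> g \<in> carrier_mat ?n ?n" "snd \<tau> g \<in> carrier_mat ?n ?n"
      using rep_carrier[OF rp g] rep_carrier[OF rs g] rep_carrier[OF rt g] n by auto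
    have "Q * P * snd \<pi> g = Q * (snd \<sigma> g * P)"
      unfolding c[OF g, symmetric] by (rule assoc_mult_mat[OF PQ(2,1) cc(1)])
    also have "\<dots> = (snd \<tau> g * Q) * P"
      unfolding d[OF g, symmetric] by (rule assoc_mult_mat[OF PQ(2) cc(2) PQ(1), symmetric])
    also have "\<dots> = snd \<tau> g * (Q * P)" by (rule assoc_mult_mat[OF cc(3) PQ(2,1)])
    finally show ?thesis .
  qed
  ultimately show ?thesis using n by (auto simp: rep_iso_def)
qed

end

section \<open>Spaces of complex functions and the representations they carry\<close>

interpretation funs: vector_space "\<lambda>(c::complex) (f::'b \<Rightarrow> complex) x. c * f x"
  by unfold_locales (auto simp: fun_eq_iff algebra_simps)

lemma sum_fun_apply: "(\<Sum>v\<in>S. F v) x = (\<Sum>v\<in>S. F v x :: complex)"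
  by (induction S rule: infinite_finite_induct) auto

text \<open>These are the first two clauses of \<open>affords\<close>, isolated so that they also
  serve for functions on an arbitrary finite group.\<close>

definition fun_basis :: "nat \<Rightarrow> (nat \<Rightarrow> 'b \<Rightarrow> complex) \<Rightarrow> ('b \<Rightarrow> complex) set \<Rightarrow> bool" where
  "fun_basis d b W \<longleftrightarrow> W = {f. \<exists>a. f = (\<lambda>x. \<Sum>i<d. a i * b i x)} \<and>
     (\<forall>a. (\<forall>x. (\<Sum>i<d. a i * b i x) = 0) \<longrightarrow> (\<forall>i<d. a i = 0))"

lemma fun_subspaceI:
  assumes "(\<lambda>x. 0) \<in> W" "\<And>f h. f \<in> W \<Longrightarrow> h \<in> W \<Longrightarrow> (\<lambda>x. f x + h x) \<in> W"
    "\<And>c f. f \<in> W \<Longrightarrow> (\<lambda>x. c * f x) \<in> W"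
  shows "funs.subspace W"
  using assms by (auto simp: funs.subspace_def zero_fun_def plus_fun_def)

lemma fun_subspaceD:
  assumes "funs.subspace W"
  shows "(\<lambda>x. 0) \<in> W" "\<And>f h. f \<in> W \<Longrightarrow> h \<in> W \<Longrightarrow> (\<lambda>x. f x + h x) \<in> W"
    "\<And>c f. f \<in> W \<Longrightarrow> (\<lambda>x. c * f x) \<in> W"
  using assms by (auto simp: funs.subspace_def zero_fun_def plus_fun_def)

lemma fun_subspace_sum:
  assumes W: "funs.subspace W" and "\<And>s. s \<in> S \<Longrightarrow> F s \<in> W"
  shows "(\<lambda>x. \<Sum>s\<in>S. c s * F s x) \<in> W"
  using assms(2)
proof (induction S rule: infinite_finite_induct)
  case (insert s S)
  have "(\<lambda>x. c s * F s x + (\<Sum>s\<in>S. c s * F s x)) \<in> W"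
    using insert by (intro fun_subspaceD[OF W]) auto
  thus ?case using insert by simp
qed (use fun_subspaceD[OF W] in auto)

text \<open>Functions supported in \<open>X\<close> lie in the span of the indicator functions of
  its points, which bounds the size of every independent set.\<close>

lemma fun_basis_set:
  assumes fin: "finite X" and W: "funs.subspace W" and supp: "\<forall>f\<in>W. \<forall>x. x \<notin> X \<longrightarrow> f x = 0"
  obtains B where "finite B" "B \<subseteq> W" "funs.independent B" "W = funs.span B" "card B = funs.dim W"
proof -
  obtain B where B: "B \<subseteq> W" "funs.independent B" "W \<subseteq> funs.span B" "card B = funs.dim W"
    using funs.basis_exists[of W] by auto
  define D where "D = (\<lambda>y x. if x = y then 1 else 0 :: complex) ` X"
  have "f \<in> funs.span D" if f: "f \<in> W" for f
  proof -
    have "f = (\<Sum>y\<in>X. (\<lambda>x. f y * (if x = y then 1 else 0)))"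
      using fin supp f by (auto simp: fun_eq_iff sum_fun_apply if_distrib cong: if_cong)
    also have "\<dots> \<in> funs.span D"
      by (intro funs.span_sum funs.span_scale funs.span_base) (auto simp: D_def)
    finally show ?thesis .
  qed
  hence "B \<subseteq> funs.span D" using B by auto
  moreover have "finite D" using fin by (simp add: D_def)
  ultimately have "finite B" using funs.independent_span_bound[of D B] B by auto
  moreover have "W = funs.span B" using B W by (auto dest: funs.span_minimal)
  ultimately show ?thesis using that B by auto
qed

lemma fun_basis_exists:
  assumes fin: "finite X" and W: "funs.subspace W" and supp: "\<forall>f\<in>W. \<forall>x. x \<notin> X \<longrightarrow> f x = 0"
  shows "\<exists>b. fun_basis (funs.dim W) b W"
proof -
  obtain B where B: "finite B" "B \<subseteq> W" "funs.independent B" "W = funs.span B" "card B = funs.dim W"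
    using fun_basis_set[OF fin W supp] by blast
  obtain b where b: "bij_betw b {..<funs.dim W} B"
    using ex_bij_betw_nat_finite[OF B(1)] B(5) by (auto simp: atLeast0LessThan)
  have eq: "(\<Sum>v\<in>B. (\<lambda>x. u v * v x)) = (\<lambda>x. \<Sum>i<funs.dim W. u (b i) * b i x)" for u
    unfolding fun_eq_iff sum_fun_apply
    by (auto intro!: sum.reindex_bij_betw[OF b, symmetric])
  have "W = range (\<lambda>u. \<Sum>v\<in>B. (\<lambda>x. u v * v x))" using B funs.span_finite by simp
  hence 1: "W = range (\<lambda>u x. \<Sum>i<funs.dim W. u (b i) * b i x)" unfolding eq .
  define c where "c = the_inv_into {..<funs.dim W} b"
  have c: "c (b i) = i" if "i < funs.dim W" for i
    using b that by (auto simp: c_def bij_betw_def the_inv_into_f_f)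
  have "W = {f. \<exists>a. f = (\<lambda>x. \<Sum>i<funs.dim W. a i * b i x)}"
  proof (intro equalityI subsetI; clarify)
    fix f assume "f \<in> W"
    then obtain u where "f = (\<lambda>x. \<Sum>i<funs.dim W. u (b i) * b i x)" using 1 by auto
    thus "\<exists>a. f = (\<lambda>x. \<Sum>i<funs.dim W. a i * b i x)" by (intro exI[of _ "u \<circ> b"]) simp
  next
    fix f a
    have "(\<lambda>x. \<Sum>i<funs.dim W. a i * b i x) = (\<lambda>x. \<Sum>i<funs.dim W. (a \<circ> c) (b i) * b i x)"
      using c by (auto intro!: sum.cong)
    thus "(\<lambda>x. \<Sum>i<funs.dim W. a i * b i x) \<in> W" using 1 by auto
  qed
  moreover have "a i = 0" if a: "\<forall>x. (\<Sum>i<funs.dim W. a i * b i x) = 0" and i: "i < funs.dim W" for a i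
  proof -
    have "(\<Sum>v\<in>B. (\<lambda>x. (a \<circ> c) v * v x)) = 0"
      unfolding eq using a c by (auto simp: zero_fun_def intro!: sum.cong)
    hence "(a \<circ> c) (b i) = 0"
      using funs.independentD[OF B(3,1) subset_refl, of "a \<circ> c" "b i"] b i
      by (auto simp: bij_betw_def)
    thus ?thesis using c i by simp
  qed
  ultimately show ?thesis unfolding fun_basis_def by blast
qed

lemma fun_basis_in:
  assumes "fun_basis d b W"
  shows "(\<lambda>x. \<Sum>i<d. a i * b i x) \<in> W" "i < d \<Longrightarrow> b i \<in> W"
proof -
  show 1: "(\<lambda>x. \<Sum>i<d. a i * b i x) \<in> W" for a using assms unfolding fun_basis_def by blast
  show "b i \<in> W" if "i < d"
    using 1[of "\<lambda>j. if j = i then 1 else 0"] by (simp add: sum_single(2)[OF that])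
qed

lemma fun_basis_unique:
  assumes b: "fun_basis d b W" and eq: "\<And>x. (\<Sum>i<d. a i * b i x) = (\<Sum>i<d. c i * b i x)" and i: "i < d"
  shows "a i = c i"
proof -
  have 1: "\<forall>x. (\<Sum>i<d. (a i - c i) * b i x) = 0"
    using eq by (simp add: left_diff_distrib sum_subtractf)
  have 2: "\<forall>i<d. u i = 0" if "\<forall>x. (\<Sum>i<d. u i * b i x) = 0" for u
    using b that by (simp add: fun_basis_def)
  have "\<forall>i<d. a i - c i = 0" by (rule 2[of "\<lambda>i. a i - c i", OF 1])
  thus ?thesis using i by simp
qed

lemma fun_basis_repr:
  assumes "fun_basis d b W" "f \<in> W"
  obtains a where "f = (\<lambda>x. \<Sum>i<d. a i * b i x)"
  using assms unfolding fun_basis_def by blast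

text \<open>The group acts through transformations \<open>s g\<close> of the points, so that left
  translation in a general group and in a symmetric group are both covered. The columns of the
  matrix are the coordinates of the moved basis functions.\<close>

lemma basis_matrix_exists:
  assumes b: "fun_basis d b W" and inv: "\<And>g f. g \<in> S \<Longrightarrow> f \<in> W \<Longrightarrow> (\<lambda>x. f (s g x)) \<in> W"
  shows "\<exists>M. \<forall>g\<in>S. M g \<in> carrier_mat d d \<and> (\<forall>j<d. \<forall>x. b j (s g x) = (\<Sum>i<d. M g $$ (i, j) * b i x))"
proof -
  have "\<forall>g\<in>S. \<forall>j\<in>{..<d}. \<exists>a. \<forall>x. b j (s g x) = (\<Sum>i<d. a i * b i x)"
  proof (intro ballI)
    fix g j assume "g \<in> S" "j \<in> {..<d}"
    hence "(\<lambda>x. b j (s g x)) \<in> W" using inv fun_basis_in(2)[OF b] by auto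
    then obtain a where "(\<lambda>x. b j (s g x)) = (\<lambda>x. \<Sum>i<d. a i * b i x)" by (rule fun_basis_repr[OF b])
    thus "\<exists>a. \<forall>x. b j (s g x) = (\<Sum>i<d. a i * b i x)" by metis
  qed
  then obtain a where a: "\<And>g j x. g \<in> S \<Longrightarrow> j < d \<Longrightarrow> b j (s g x) = (\<Sum>i<d. a g j i * b i x)"
    unfolding bchoice_iff by auto
  show ?thesis
  proof (intro exI[of _ "\<lambda>g. mat d d (\<lambda>(i, j). a g j i)"] ballI conjI allI impI)
    fix g j x assume "g \<in> S" "j < d"
    thus "b j (s g x) = (\<Sum>i<d. mat d d (\<lambda>(i, j). a g j i) $$ (i, j) * b i x)"
      using a by simp
  qed simp
qed

context
  fixes G :: "('a, 'x) monoid_scheme" (structure) and d :: nat and b :: "nat \<Rightarrow> 'b \<Rightarrow> complex" and W M and s :: "'a \<Rightarrow> 'b \<Rightarrow> 'b"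
  assumes G: "group G" and b: "fun_basis d b W"
    and M: "\<forall>g\<in>carrier G. M g \<in> carrier_mat d d \<and> (\<forall>j<d. \<forall>x. b j (s g x) = (\<Sum>i<d. M g $$ (i, j) * b i x))"
begin

interpretation group G by (rule G)

lemma basis_matrix_carrier: "g \<in> carrier G \<Longrightarrow> M g \<in> carrier_mat d d"
  using M by blast

lemma basis_matrix_entry:
  "g \<in> carrier G \<Longrightarrow> j < d \<Longrightarrow> b j (s g x) = (\<Sum>i<d. M g $$ (i, j) * b i x)"
  using M by blast

lemma basis_matrix_act:
  assumes "g \<in> carrier G" "v \<in> carrier_vec d"
  shows "(\<Sum>j<d. v $ j * b j (s g x)) = (\<Sum>i<d. (M g *\<^sub>v v) $ i * b i x)"
proof -
  have "(\<Sum>j<d. v $ j * b j (s g x)) = (\<Sum>j<d. \<Sum>i<d. M g $$ (i, j) * v $ j * b i x)"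
    using assms by (intro sum.cong) (auto simp: basis_matrix_entry sum_distrib_left mult_ac)
  also have "\<dots> = (\<Sum>i<d. (\<Sum>j<d. M g $$ (i, j) * v $ j) * b i x)"
    by (subst sum.swap) (simp add: sum_distrib_right)
  also have "\<dots> = (\<Sum>i<d. (M g *\<^sub>v v) $ i * b i x)"
    using assms mat_vec_entry[OF basis_matrix_carrier, of g v] by (intro sum.cong) auto
  finally show ?thesis .
qed

text \<open>Composition with \<open>s g\<close> reverses order, so \<open>s\<close> has to be a
  right action on points to give a left action on functions.\<close>

lemma basis_matrix_rep:
  assumes one: "\<And>f x. f \<in> W \<Longrightarrow> f (s \<one> x) = f x"
    and mult: "\<And>f g h x. f \<in> W \<Longrightarrow> g \<in> carrier G \<Longrightarrow> h \<in> carrier G \<Longrightarrow> f (s (g \<otimes> h) x) = f (s h (s g x))"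
  shows "is_rep G (d, M)"
proof (rule is_repI)
  note Mc = basis_matrix_carrier
  show "M g \<in> carrier_mat d d" if "g \<in> carrier G" for g using Mc that .
  show "M \<one> = 1\<^sub>m d"
  proof (rule eq_matI)
    fix i j assume ij: "i < dim_row (1\<^sub>m d :: complex mat)" "j < dim_col (1\<^sub>m d :: complex mat)"
    have "(\<Sum>i<d. M \<one> $$ (i, j) * b i x) = (\<Sum>i<d. (if i = j then 1 else 0) * b i x)" for x
      using basis_matrix_entry[of \<one> j x, symmetric] one[OF fun_basis_in(2)[OF b]] ij
      by (simp add: sum_single)
    from fun_basis_unique[OF b this, of i] show "M \<one> $$ (i, j) = 1\<^sub>m d $$ (i, j)" using ij by simp
  qed (use Mc[of \<one>] in auto)
  fix g h assume gh: "g \<in> carrier G" "h \<in> carrier G"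
  show "M (g \<otimes> h) = M g * M h"
  proof (rule eq_matI)
    fix i j assume "i < dim_row (M g * M h)" "j < dim_col (M g * M h)"
    hence ij: "i < d" "j < d" using Mc[OF gh(1)] Mc[OF gh(2)] by auto
    have "(\<Sum>i<d. M (g \<otimes> h) $$ (i, j) * b i x) = (\<Sum>i<d. (M g * M h) $$ (i, j) * b i x)" for x
    proof -
      have "(\<Sum>i<d. M (g \<otimes> h) $$ (i, j) * b i x) = b j (s h (s g x))"
        using basis_matrix_entry[of "g \<otimes> h" j x, symmetric] gh ij mult[OF fun_basis_in(2)[OF b], of j g h x]
        by simp
      also have "\<dots> = (\<Sum>p<d. col (M h) j $ p * b p (s g x))"
        using basis_matrix_entry[OF gh(2) ij(2)] ij Mc[OF gh(2)] by simp
      also have "\<dots> = (\<Sum>i<d. (M g *\<^sub>v col (M h) j) $ i * b i x)"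
        using Mc[OF gh(2)] by (intro basis_matrix_act gh) auto
      also have "\<dots> = (\<Sum>i<d. (M g * M h) $$ (i, j) * b i x)"
        using Mc[OF gh(1)] Mc[OF gh(2)] ij by (intro sum.cong) auto
      finally show ?thesis .
    qed
    from fun_basis_unique[OF b this ij(1)]
    show "M (g \<otimes> h) $$ (i, j) = (M g * M h) $$ (i, j)" .
  qed (use Mc[OF gh(1)] Mc[OF gh(2)] Mc[OF m_closed[OF gh]] in auto)
qed

text \<open>The coordinate map \<phi> is injective and equivariant, so invariant spaces of vectors
  correspond to invariant spaces of functions, where minimality is assumed.\<close>

lemma basis_matrix_irrep:
  assumes rep: "is_rep G (d, M)" and d: "0 < d"
    and min: "\<And>W'. funs.subspace W' \<Longrightarrow> W' \<subseteq> W \<Longrightarrow>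
      (\<And>g f. g \<in> carrier G \<Longrightarrow> f \<in> W' \<Longrightarrow> (\<lambda>x. f (s g x)) \<in> W') \<Longrightarrow> W' = {\<lambda>x. 0} \<or> W' = W"
  shows "is_irrep G (d, M)"
  unfolding is_irrep_def fst_conv snd_conv
proof (intro conjI allI impI rep d)
  fix U assume U: "VectorSpace.subspace class_ring U (module_vec TYPE(complex) d)"
    and inv: "\<forall>g\<in>carrier G. \<forall>w\<in>U. M g *\<^sub>v w \<in> U"
  note UD = subspace_vecD[OF U]
  define \<phi> where "\<phi> v x = (\<Sum>i<d. v $ i * b i x)" for v x
  have inj: "v = w" if "\<phi> v = \<phi> w" "v \<in> carrier_vec d" "w \<in> carrier_vec d" for v w
  proof (rule eq_vecI)
    fix i assume "i < dim_vec w"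
    hence i: "i < d" using that by simp
    show "v $ i = w $ i"
      by (rule fun_basis_unique[OF b _ i]) (use fun_cong[OF that(1)] in \<open>simp add: \<phi>_def\<close>)
  qed (use that in auto)
  have "\<phi> ` U = {\<lambda>x. 0} \<or> \<phi> ` U = W"
  proof (rule min)
    show "funs.subspace (\<phi> ` U)"
    proof (rule fun_subspaceI)
      have "\<phi> (0\<^sub>v d) = (\<lambda>x. 0)" by (rule ext) (simp add: \<phi>_def)
      thus "(\<lambda>x. 0) \<in> \<phi> ` U" using UD(2) by (metis imageI)
    next
      fix f h assume "f \<in> \<phi> ` U" "h \<in> \<phi> ` U"
      then obtain v w where vw: "v \<in> U" "w \<in> U" "f = \<phi> v" "h = \<phi> w" by auto
      have "(\<lambda>x. f x + h x) = \<phi> (v + w)"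
      proof (rule ext)
        fix x
        have "v \<in> carrier_vec d" "w \<in> carrier_vec d" using vw UD(1) by auto
        hence "\<phi> (v + w) x = (\<Sum>i<d. (v $ i + w $ i) * b i x)"
          unfolding \<phi>_def by (intro sum.cong) auto
        thus "f x + h x = \<phi> (v + w) x"
          by (simp add: vw(3,4) \<phi>_def distrib_right sum.distrib)
      qed
      thus "(\<lambda>x. f x + h x) \<in> \<phi> ` U" using UD(3)[OF vw(1,2)] by simp
    next
      fix c f assume "f \<in> \<phi> ` U"
      then obtain v where v: "v \<in> U" "f = \<phi> v" by auto
      have "(\<lambda>x. c * f x) = \<phi> (c \<cdot>\<^sub>v v)"
      proof (rule ext)
        fix x
        have "v \<in> carrier_vec d" using v UD(1) by auto
        hence "\<phi> (c \<cdot>\<^sub>v v) x = (\<Sum>i<d. (c * v $ i) * b i x)"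
          unfolding \<phi>_def by (intro sum.cong) auto
        thus "c * f x = \<phi> (c \<cdot>\<^sub>v v) x"
          by (simp add: v(2) \<phi>_def sum_distrib_left mult.assoc)
      qed
      thus "(\<lambda>x. c * f x) \<in> \<phi> ` U" using UD(4)[OF v(1)] by simp
    qed
    show "\<phi> ` U \<subseteq> W" using fun_basis_in(1)[OF b] by (auto simp: \<phi>_def[abs_def])
    fix g f assume g: "g \<in> carrier G" and "f \<in> \<phi> ` U"
    then obtain v where v: "v \<in> U" "f = \<phi> v" by auto
    have "(\<lambda>x. f (s g x)) = \<phi> (M g *\<^sub>v v)"
    proof (rule ext)
      fix x
      have "v \<in> carrier_vec d" using v UD(1) by auto
      thus "f (s g x) = \<phi> (M g *\<^sub>v v) x"
        unfolding v(2) \<phi>_def by (rule basis_matrix_act[OF g])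
    qed
    thus "(\<lambda>x. f (s g x)) \<in> \<phi> ` U" using inv g v by simp
  qed
  thus "U = {0\<^sub>v d} \<or> U = carrier_vec d"
  proof
    assume 0: "\<phi> ` U = {\<lambda>x. 0}"
    have "v = 0\<^sub>v d" if "v \<in> U" for v
    proof (rule inj)
      show "\<phi> v = \<phi> (0\<^sub>v d)" using 0 that UD(2) by (metis imageI singletonD)
    qed (use that UD in auto)
    hence "U \<subseteq> {0\<^sub>v d}" by blast
    thus ?thesis using UD(2) by blast
  next
    assume 1: "\<phi> ` U = W"
    have "v \<in> U" if v: "v \<in> carrier_vec d" for v
    proof -
      have "\<phi> v \<in> W" unfolding \<phi>_def[abs_def] by (rule fun_basis_in(1)[OF b])
      then obtain u where "u \<in> U" "\<phi> u = \<phi> v" using 1 by auto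
      thus ?thesis using inj[of u v] v UD(1) by auto
    qed
    thus ?thesis using UD(1) by auto
  qed
qed

end

section \<open>Separation of functions by irreducible representations\<close>

context group
begin

text \<open>The conjugate transpose at the inverse element; it equals \<pi> when \<pi> is unitary.
  Having it among the irreducible representations is what makes their common annihilator closed
  under the adjoint. Irreducibility is read off from the Schur relations.\<close>

lemma dual_irrep:
  assumes p: "is_irrep G \<pi>" and fin: "finite (carrier G)"
  shows "is_irrep G (fst \<pi>, \<lambda>g. mat (fst \<pi>) (fst \<pi>) (\<lambda>(i, j). cnj (snd \<pi> (inv g) $$ (j, i))))"
    (is "is_irrep G (?n, ?M)")
proof (rule schur_rel_irrep)
  have rp: "is_rep G \<pi>" and n: "0 < ?n" using p by (auto simp: is_irrep_def)
  show "0 < fst (?n, ?M)" using n by simp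
  show "is_rep G (?n, ?M)"
  proof (rule is_repI)
    show "?M \<one> = 1\<^sub>m ?n" by (rule eq_matI) (auto simp: rep_one[OF rp])
    fix g h assume gh: "g \<in> carrier G" "h \<in> carrier G"
    show "?M (g \<otimes> h) = ?M g * ?M h"
    proof (rule eq_matI)
      fix i j assume "i < dim_row (?M g * ?M h)" "j < dim_col (?M g * ?M h)"
      hence ij: "i < ?n" "j < ?n" by auto
      have "snd \<pi> (inv (g \<otimes> h)) $$ (j, i) = (\<Sum>l<?n. snd \<pi> (inv h) $$ (j, l) * snd \<pi> (inv g) $$ (l, i))"
        using gh ij by (simp add: inv_mult_group rep_mult_entry[OF rp])
      moreover have "(?M g * ?M h) $$ (i, j) = (\<Sum>l<?n. ?M g $$ (i, l) * ?M h $$ (l, j))"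
        using ij by (intro mat_mult_entry) auto
      ultimately show "?M (g \<otimes> h) $$ (i, j) = (?M g * ?M h) $$ (i, j)"
        using ij by (simp add: mult.commute)
    qed auto
  qed auto
  show "schur_rel G (?n, ?M)"
    unfolding schur_rel_def fst_conv snd_conv
  proof (intro allI impI)
    fix i j k l assume ijkl: "i < ?n" "j < ?n" "k < ?n" "l < ?n"
    have "(\<Sum>g\<in>carrier G. ?M g $$ (i, j) * ?M (inv g) $$ (k, l)) =
      cnj (\<Sum>g\<in>carrier G. snd \<pi> g $$ (l, k) * snd \<pi> (inv g) $$ (j, i))"
      using ijkl by (auto simp: mult.commute intro!: sum.cong)
    also have "\<dots> = (if i = l \<and> j = k then of_nat (card (carrier G)) / of_nat ?n else 0)"
      using irrep_schur_rel[OF p] ijkl unfolding schur_rel_def by auto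
    finally show "(\<Sum>g\<in>carrier G. ?M g $$ (i, j) * ?M (inv g) $$ (k, l)) =
      (if i = l \<and> j = k then of_nat (card (carrier G)) / of_nat ?n else 0)" .
  qed
qed (use fin in auto)

text \<open>The functions annihilated by all irreducible representations form a left ideal \<open>J\<close> closed
  under \<open>f\<^sup>*(g) = cnj f(g\<^sup>-\<^sup>1)\<close>. A minimal left ideal in \<open>J\<close> affords an irreducible representation, so
  \<open>w\<^sup>* \<in> J\<close> kills any \<open>w\<close> in it, but the value of \<open>w\<^sup>* w\<close> at \<open>1\<close> is \<open>\<Sum> |w|\<^sup>2\<close>.\<close>

lemma irreps_separate:
  assumes fin: "finite (carrier G)"
    and ann: "\<And>\<pi> i j. is_irrep G \<pi> \<Longrightarrow> i < fst \<pi> \<Longrightarrow> j < fst \<pi> \<Longrightarrow> (\<Sum>g\<in>carrier G. f g * snd \<pi> g $$ (i, j)) = 0"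
    and g0: "g0 \<in> carrier G"
  shows "f g0 = 0"
proof (rule ccontr)
  assume nz: "f g0 \<noteq> 0"
  define J where "J = {f :: 'a \<Rightarrow> complex. (\<forall>x. x \<notin> carrier G \<longrightarrow> f x = 0) \<and>
    (\<forall>\<pi> i j. is_irrep G \<pi> \<longrightarrow> i < fst \<pi> \<longrightarrow> j < fst \<pi> \<longrightarrow> (\<Sum>g\<in>carrier G. f g * snd \<pi> g $$ (i, j)) = 0)}"
  \<comment> \<open>Left translation, extended by the identity outside the carrier so that functions
    vanishing there keep doing so.\<close>
  define s where "s g x = (if x \<in> carrier G then inv g \<otimes> x else x)" for g x
  have Jsub: "funs.subspace J"
    by (rule fun_subspaceI)
      (auto simp: J_def distrib_right sum.distrib mult.assoc simp del: split_paired_All simp flip: sum_distrib_left)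
  have Jinv: "(\<lambda>x. f (s h x)) \<in> J" if h: "h \<in> carrier G" and f: "f \<in> J" for h f
  proof -
    have "(\<Sum>g\<in>carrier G. f (s h g) * snd \<pi> g $$ (i, j)) = 0"
      if p: "is_irrep G \<pi>" and ij: "i < fst \<pi>" "j < fst \<pi>" for \<pi> i j
    proof -
      have rp: "is_rep G \<pi>" using p by (simp add: is_irrep_def)
      have "(\<Sum>g\<in>carrier G. f (s h g) * snd \<pi> g $$ (i, j)) =
        (\<Sum>g\<in>carrier G. f (s h (h \<otimes> g)) * snd \<pi> (h \<otimes> g) $$ (i, j))"
        by (rule sum_lmult[OF h, symmetric])
      also have "\<dots> = (\<Sum>g\<in>carrier G. \<Sum>l<fst \<pi>. snd \<pi> h $$ (i, l) * (f g * snd \<pi> g $$ (l, j)))"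
      proof (rule sum.cong[OF HOL.refl])
        fix g assume g: "g \<in> carrier G"
        have "s h (h \<otimes> g) = g" using g h by (simp add: s_def m_assoc[symmetric])
        thus "f (s h (h \<otimes> g)) * snd \<pi> (h \<otimes> g) $$ (i, j) =
          (\<Sum>l<fst \<pi>. snd \<pi> h $$ (i, l) * (f g * snd \<pi> g $$ (l, j)))"
          by (simp add: rep_mult_entry[OF rp h g ij] sum_distrib_left mult_ac)
      qed
      also have "\<dots> = (\<Sum>l<fst \<pi>. snd \<pi> h $$ (i, l) * (\<Sum>g\<in>carrier G. f g * snd \<pi> g $$ (l, j)))"
        by (subst sum.swap) (simp add: sum_distrib_left)
      also have "\<dots> = 0"
      proof -
        have "(\<Sum>g\<in>carrier G. f g * snd \<pi> g $$ (l, j)) = 0" if "l < fst \<pi>" for l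
          using f p ij that unfolding J_def by blast
        thus ?thesis by simp
      qed
      finally show ?thesis .
    qed
    moreover have "f (s h x) = 0" if "x \<notin> carrier G" for x
      using that f by (simp add: s_def J_def)
    ultimately show ?thesis unfolding J_def by blast
  qed
  define good where "good W \<longleftrightarrow> funs.subspace W \<and> W \<subseteq> J \<and> W \<noteq> {\<lambda>x. 0} \<and>
    (\<forall>g\<in>carrier G. \<forall>f\<in>W. (\<lambda>x. f (s g x)) \<in> W)" for W
  define f' where "f' x = (if x \<in> carrier G then f x else 0)" for x
  have "f' \<in> J" using ann unfolding J_def f'_def by (simp del: split_paired_All)
  moreover have "f' \<noteq> (\<lambda>x. 0)" using nz g0 by (metis f'_def)
  ultimately have "good J" using Jsub Jinv by (auto simp: good_def)
  \<comment> \<open>A nonzero invariant subspace of \<open>J\<close> of least dimension. It is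
    minimal under inclusion: adding a vector outside a proper subspace to a basis of that subspace
    raises the dimension.\<close>
  then obtain W where W: "good W" and Wmin: "\<And>W'. good W' \<Longrightarrow> funs.dim W \<le> funs.dim W'"
    using ex_has_least_nat[of good J funs.dim] by auto
  have Wsub: "funs.subspace W" and WJ: "W \<subseteq> J" and W0: "W \<noteq> {\<lambda>x. 0}"
    and Winv: "\<And>g f. g \<in> carrier G \<Longrightarrow> f \<in> W \<Longrightarrow> (\<lambda>x. f (s g x)) \<in> W"
    using W by (auto simp: good_def)
  have supp: "\<forall>f\<in>W. \<forall>x. x \<notin> carrier G \<longrightarrow> f x = 0" using WJ by (auto simp: J_def)
  have min: "W' = {\<lambda>x. 0} \<or> W' = W" if sub: "funs.subspace W'" and le: "W' \<subseteq> W"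
    and inv: "\<And>g f. g \<in> carrier G \<Longrightarrow> f \<in> W' \<Longrightarrow> (\<lambda>x. f (s g x)) \<in> W'" for W'
  proof (rule ccontr)
    assume *: "\<not> (W' = {\<lambda>x. 0} \<or> W' = W)"
    hence "good W'" using sub le inv WJ by (auto simp: good_def)
    hence dim: "funs.dim W \<le> funs.dim W'" by (rule Wmin)
    obtain B where B: "finite B" "B \<subseteq> W" "funs.independent B" "W = funs.span B" "card B = funs.dim W"
      using fun_basis_set[OF fin Wsub supp] by blast
    obtain B' where B': "finite B'" "B' \<subseteq> W'" "funs.independent B'" "W' = funs.span B'" "card B' = funs.dim W'"
    proof -
      have "\<forall>f\<in>W'. \<forall>x. x \<notin> carrier G \<longrightarrow> f x = 0" using supp le by blast
      from fun_basis_set[OF fin sub this] that show thesis by blast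
    qed
    obtain w where w: "w \<in> W" "w \<notin> W'" using * le by auto
    have "w \<notin> funs.span B'" using w(2) B'(4) by blast
    hence "funs.independent (insert w B')" using B'(3) funs.independent_insert[of w B'] by presburger
    moreover have "insert w B' \<subseteq> funs.span B" using w(1) B(4) B'(2) le by blast
    ultimately have "card (insert w B') \<le> card B" using funs.independent_span_bound[OF B(1)] by blast
    moreover have "w \<notin> B'" using w(2) B'(2) by blast
    ultimately show False using B'(1,5) B(5) dim by simp
  qed
  define d where "d = funs.dim W"
  obtain b where b: "fun_basis d b W"
    using fun_basis_exists[OF fin Wsub supp] by (auto simp: d_def)
  obtain M where M: "\<forall>g\<in>carrier G. M g \<in> carrier_mat d d \<and>
    (\<forall>j<d. \<forall>x. b j (s g x) = (\<Sum>i<d. M g $$ (i, j) * b i x))"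
    using basis_matrix_exists[OF b, of "carrier G" s] Winv by auto
  have "is_rep G (d, M)"
  proof (rule basis_matrix_rep[where s = s and b = b, OF group_axioms b M])
    show "f (s \<one> x) = f x" if "f \<in> W" for f x by (simp add: s_def)
    show "f (s (g \<otimes> h) x) = f (s h (s g x))" if "g \<in> carrier G" "h \<in> carrier G" for f :: "'a \<Rightarrow> complex" and g h x
      using that by (simp add: s_def inv_mult_group m_assoc)
  qed
  moreover obtain w where w: "w \<in> W" "w \<noteq> (\<lambda>x. 0)" using W0 fun_subspaceD(1)[OF Wsub] by auto
  obtain a where a: "w = (\<lambda>x. \<Sum>i<d. a i * b i x)" by (rule fun_basis_repr[OF b w(1)])
  have d: "d > 0" using a w(2) by (cases d) auto
  ultimately have irr: "is_irrep G (d, M)" using basis_matrix_irrep[where s = s and b = b, OF group_axioms b M _ _ min] by blast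
  define w' where "w' g = cnj (w (inv g))" for g
  have zero: "(\<Sum>g\<in>carrier G. w' g * M g $$ (i, j)) = 0" if ij: "i < d" "j < d" for i j
  proof -
    \<comment> \<open>Since \<open>w\<close> lies in \<open>J\<close>, it annihilates the dual of
      \<open>M\<close>. At the transposed entry this is the claim for \<open>w'\<close>, up to
      conjugation and inversion of the summation variable.\<close>
    have "(\<Sum>g\<in>carrier G. w g * cnj (M (inv g) $$ (i, j))) = 0"
    proof -
      have "w \<in> J" using w(1) WJ by auto
      hence "(\<Sum>g\<in>carrier G. w g * snd \<pi> g $$ (k, l)) = 0"
        if "is_irrep G \<pi>" "k < fst \<pi>" "l < fst \<pi>" for \<pi> k l
        using that unfolding J_def by blast
      from this[OF dual_irrep[OF irr fin], of j i] ij show ?thesis by simp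
    qed
    hence "cnj (\<Sum>g\<in>carrier G. w g * cnj (M (inv g) $$ (i, j))) = 0" by simp
    hence "(\<Sum>g\<in>carrier G. cnj (w g) * M (inv g) $$ (i, j)) = 0" by simp
    thus ?thesis using sum_inv[of "\<lambda>g. w' g * M g $$ (i, j)"] by (simp add: w'_def cong: sum.cong)
  qed
  have "(\<Sum>g\<in>carrier G. w' g * w (s g \<one>)) = 0"
  proof -
    have "(\<Sum>g\<in>carrier G. w' g * w (s g \<one>)) =
      (\<Sum>g\<in>carrier G. \<Sum>j<d. \<Sum>i<d. a j * b i \<one> * (w' g * M g $$ (i, j)))"
    proof (rule sum.cong[OF HOL.refl])
      fix g assume g: "g \<in> carrier G"
      have "w' g * w (s g \<one>) = w' g * (\<Sum>j<d. a j * (\<Sum>i<d. M g $$ (i, j) * b i \<one>))"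
        using basis_matrix_entry[where s = s and b = b, OF group_axioms b M g] by (simp add: a)
      also have "\<dots> = (\<Sum>j<d. \<Sum>i<d. a j * b i \<one> * (w' g * M g $$ (i, j)))"
        by (simp add: sum_distrib_left mult_ac)
      finally show "w' g * w (s g \<one>) = (\<Sum>j<d. \<Sum>i<d. a j * b i \<one> * (w' g * M g $$ (i, j)))" .
    qed
    also have "\<dots> = (\<Sum>j<d. \<Sum>g\<in>carrier G. \<Sum>i<d. a j * b i \<one> * (w' g * M g $$ (i, j)))"
      by (rule sum.swap)
    also have "\<dots> = (\<Sum>j<d. \<Sum>i<d. \<Sum>g\<in>carrier G. a j * b i \<one> * (w' g * M g $$ (i, j)))"
      by (intro sum.cong HOL.refl sum.swap)
    also have "\<dots> = (\<Sum>j<d. \<Sum>i<d. a j * b i \<one> * (\<Sum>g\<in>carrier G. w' g * M g $$ (i, j)))"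
      by (simp add: sum_distrib_left)
    also have "\<dots> = 0" using zero by simp
    finally show ?thesis .
  qed
  also have "(\<Sum>g\<in>carrier G. w' g * w (s g \<one>)) = (\<Sum>g\<in>carrier G. w' g * w (inv g))"
    by (intro sum.cong) (auto simp: s_def)
  also have "\<dots> = (\<Sum>g\<in>carrier G. cnj (w g) * w g)"
    unfolding w'_def by (rule sum_inv[of "\<lambda>g. cnj (w g) * w g"])
  also have "\<dots> = of_real (\<Sum>g\<in>carrier G. (cmod (w g))\<^sup>2)"
    by (simp add: complex_norm_square mult.commute del: of_real_power)
  finally have "(\<Sum>g\<in>carrier G. (cmod (w g))\<^sup>2) = 0" by (simp only: of_real_eq_0_iff)
  hence "\<forall>g\<in>carrier G. w g = 0" using fin by (simp add: sum_nonneg_eq_0_iff)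
  hence "w = (\<lambda>x. 0)" using supp w(1) by (auto simp: fun_eq_iff)
  thus False using w by simp
qed

end

section \<open>Pullbacks, tensor products and induced representations\<close>

lemma schur_relD:
  assumes "schur_rel G \<pi>" "i < fst \<pi>" "j < fst \<pi>" "k < fst \<pi>" "l < fst \<pi>"
  shows "(\<Sum>g\<in>carrier G. snd \<pi> g $$ (i, j) * snd \<pi> (inv\<^bsub>G\<^esub> g) $$ (k, l)) =
     (if i = l \<and> j = k then of_nat (card (carrier G)) / of_nat (fst \<pi>) else 0)"
  using assms by (simp add: schur_rel_def)

lemma coef_orthD:
  assumes "coef_orth G \<pi> \<sigma>" "i < fst \<pi>" "j < fst \<pi>" "k < fst \<sigma>" "l < fst \<sigma>"
  shows "(\<Sum>g\<in>carrier G. snd \<pi> g $$ (i, j) * snd \<sigma> (inv\<^bsub>G\<^esub> g) $$ (k, l)) = 0"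
  using assms by (simp add: coef_orth_def)

lemma sum_div_mod:
  fixes F :: "nat \<Rightarrow> nat \<Rightarrow> 'a::comm_monoid_add"
  shows "(\<Sum>r<m * n. F (r div n) (r mod n)) = (\<Sum>a<m. \<Sum>b<n. F a b)"
proof (cases "n = 0")
  case False
  have "(\<Sum>a<m. \<Sum>b<n. F a b) = (\<Sum>(a, b)\<in>{..<m} \<times> {..<n}. F a b)"
    by (rule sum.cartesian_product)
  also have "\<dots> = (\<Sum>r<m * n. F (r div n) (r mod n))"
  proof (rule sum.reindex_bij_witness[where i = "\<lambda>r. (r div n, r mod n)" and j = "\<lambda>(a, b). a * n + b"])
    fix p assume p: "p \<in> {..<m} \<times> {..<n}"
    then obtain a b where ab: "p = (a, b)" "a < m" "b < n" by auto
    have "a * n + b < (a + 1) * n" using ab by simp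
    also have "\<dots> \<le> m * n" using ab by (intro mult_right_mono) auto
    finally show "(\<lambda>(a, b). a * n + b) p \<in> {..<m * n}" using ab by simp
  qed (use False in \<open>auto simp: less_mult_imp_div_less\<close>)
  finally show ?thesis by simp
qed simp

section \<open>Pullback along a surjective homomorphism\<close>

locale finite_group_surj = group_hom G Q f for G (structure) and Q (structure) and f +
  assumes fin: "finite (carrier G)" and surj: "f ` carrier G = carrier Q"
begin

lemma card_fibre:
  assumes q: "q \<in> carrier Q"
  shows "card {g \<in> carrier G. f g = q} = card {g \<in> carrier G. f g = \<one>\<^bsub>Q\<^esub>}"
proof -
  obtain a where a: "a \<in> carrier G" "f a = q" using q surj by (metis imageE)
  have "bij_betw (\<lambda>g. g \<otimes> a) {g \<in> carrier G. f g = \<one>\<^bsub>Q\<^esub>} {g \<in> carrier G. f g = q}"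
  proof (rule bij_betwI[where g = "\<lambda>g. g \<otimes> inv a"])
    show "(\<lambda>g. g \<otimes> a) \<in> {g \<in> carrier G. f g = \<one>\<^bsub>Q\<^esub>} \<rightarrow> {g \<in> carrier G. f g = q}"
    proof (rule Pi_I)
      fix g assume "g \<in> {g \<in> carrier G. f g = \<one>\<^bsub>Q\<^esub>}"
      hence "g \<in> carrier G" "f g = \<one>\<^bsub>Q\<^esub>" by auto
      thus "g \<otimes> a \<in> {g \<in> carrier G. f g = q}" using a(1) q by (simp add: a(2))
    qed
    show "(\<lambda>g. g \<otimes> inv a) \<in> {g \<in> carrier G. f g = q} \<rightarrow> {g \<in> carrier G. f g = \<one>\<^bsub>Q\<^esub>}"
    proof (rule Pi_I)
      fix g assume "g \<in> {g \<in> carrier G. f g = q}"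
      hence "g \<in> carrier G" "f g = q" by auto
      thus "g \<otimes> inv a \<in> {g \<in> carrier G. f g = \<one>\<^bsub>Q\<^esub>}" using a(1) q by (simp add: a(2))
    qed
  qed (use a(1) in \<open>simp_all add: G.m_assoc\<close>)
  from bij_betw_same_card[OF this] show ?thesis by (rule HOL.sym)
qed

text \<open>All fibres are cosets of the kernel and have its size, so orthogonality relations pull
  back up to a common factor.\<close>

lemma sum_over_hom:
  "(\<Sum>g\<in>carrier G. F (f g)) =
    of_nat (card {g \<in> carrier G. f g = \<one>\<^bsub>Q\<^esub>}) * (\<Sum>q\<in>carrier Q. F q :: complex)"
proof -
  have "(\<Sum>g\<in>carrier G. F (f g)) = (\<Sum>q\<in>f ` carrier G. \<Sum>g\<in>{g \<in> carrier G. f g = q}. F (f g))"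
    by (rule sum.image_gen[OF fin])
  also have "\<dots> = (\<Sum>q\<in>carrier Q. of_nat (card {g \<in> carrier G. f g = \<one>\<^bsub>Q\<^esub>}) * F q)"
    unfolding surj
  proof (rule sum.cong[OF HOL.refl])
    fix q assume q: "q \<in> carrier Q"
    have "(\<Sum>g\<in>{g \<in> carrier G. f g = q}. F (f g)) = (\<Sum>g\<in>{g \<in> carrier G. f g = q}. F q)"
      by (rule sum.cong) auto
    also have "\<dots> = of_nat (card {g \<in> carrier G. f g = q}) * F q" by simp
    finally show "(\<Sum>g\<in>{g \<in> carrier G. f g = q}. F (f g)) =
      of_nat (card {g \<in> carrier G. f g = \<one>\<^bsub>Q\<^esub>}) * F q"
      unfolding card_fibre[OF q] .
  qed
  finally show ?thesis by (simp add: sum_distrib_left)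
qed

lemma card_hom: "card (carrier G) = card {g \<in> carrier G. f g = \<one>\<^bsub>Q\<^esub>} * card (carrier Q)"
proof -
  have "complex_of_nat (card (carrier G)) =
    of_nat (card {g \<in> carrier G. f g = \<one>\<^bsub>Q\<^esub>} * card (carrier Q))"
    using sum_over_hom[of "\<lambda>_. 1"] by simp
  thus ?thesis by (simp only: of_nat_eq_iff)
qed

lemma pullback_rep: "is_rep Q \<tau> \<Longrightarrow> is_rep G (pullback f \<tau>)"
  using homh hom_closed by (auto simp: is_rep_def pullback_def hom_def)

lemma pullback_schur_rel:
  assumes "schur_rel Q \<tau>"
  shows "schur_rel G (pullback f \<tau>)"
  unfolding schur_rel_def
proof (intro allI impI)
  fix i j k l assume *: "i < fst (pullback f \<tau>)" "j < fst (pullback f \<tau>)" "k < fst (pullback f \<tau>)" "l < fst (pullback f \<tau>)"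
  have "(\<Sum>g\<in>carrier G. snd (pullback f \<tau>) g $$ (i, j) * snd (pullback f \<tau>) (inv g) $$ (k, l)) =
    (\<Sum>g\<in>carrier G. (\<lambda>q. snd \<tau> q $$ (i, j) * snd \<tau> (inv\<^bsub>Q\<^esub> q) $$ (k, l)) (f g))"
    by (intro sum.cong) (auto simp: pullback_def)
  also have "\<dots> = of_nat (card {g \<in> carrier G. f g = \<one>\<^bsub>Q\<^esub>}) *
      (if i = l \<and> j = k then of_nat (card (carrier Q)) / of_nat (fst \<tau>) else 0)"
    by (subst sum_over_hom, subst schur_relD[OF assms]) (use * in \<open>simp_all add: pullback_def\<close>)
  finally show "(\<Sum>g\<in>carrier G. snd (pullback f \<tau>) g $$ (i, j) * snd (pullback f \<tau>) (inv g) $$ (k, l)) =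
    (if i = l \<and> j = k then of_nat (card (carrier G)) / of_nat (fst (pullback f \<tau>)) else 0)"
    by (simp add: pullback_def card_hom)
qed

lemma pullback_coef_orth:
  assumes "coef_orth Q \<tau> \<sigma>"
  shows "coef_orth G (pullback f \<tau>) (pullback f \<sigma>)"
  unfolding coef_orth_def
proof (intro allI impI)
  fix i j k l assume *: "i < fst (pullback f \<tau>)" "j < fst (pullback f \<tau>)" "k < fst (pullback f \<sigma>)" "l < fst (pullback f \<sigma>)"
  have "(\<Sum>g\<in>carrier G. snd (pullback f \<tau>) g $$ (i, j) * snd (pullback f \<sigma>) (inv g) $$ (k, l)) =
    (\<Sum>g\<in>carrier G. (\<lambda>q. snd \<tau> q $$ (i, j) * snd \<sigma> (inv\<^bsub>Q\<^esub> q) $$ (k, l)) (f g))"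
    by (intro sum.cong) (auto simp: pullback_def)
  also have "\<dots> = 0"
    by (subst sum_over_hom, subst coef_orthD[OF assms]) (use * in \<open>simp_all add: pullback_def\<close>)
  finally show "(\<Sum>g\<in>carrier G. snd (pullback f \<tau>) g $$ (i, j) * snd (pullback f \<sigma>) (inv g) $$ (k, l)) = 0" .
qed

end

section \<open>Outer tensor products\<close>

lemma kronecker_entry:
  assumes "A \<in> carrier_mat m m" "B \<in> carrier_mat n n" "i < m * n" "j < m * n"
  shows "kronecker A B $$ (i, j) = A $$ (i div n, j div n) * B $$ (i mod n, j mod n)"
  using assms by (simp add: kronecker_def)

lemma kronecker_carrier:
  assumes "A \<in> carrier_mat m m" "B \<in> carrier_mat n n"
  shows "kronecker A B \<in> carrier_mat (m * n) (m * n)"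
  using assms by (simp add: kronecker_def)

lemma div_mod_less: "(i::nat) < m * n \<Longrightarrow> i div n < m \<and> i mod n < n"
  by (cases "n = 0") (auto simp: less_mult_imp_div_less)

lemma div_mod_eq_iff: "(i::nat) = l \<longleftrightarrow> i div n = l div n \<and> i mod n = l mod n"
  by (metis div_mult_mod_eq)

lemma kronecker_mult:
  assumes A: "A \<in> carrier_mat m m" "A' \<in> carrier_mat m m" and B: "B \<in> carrier_mat n n" "B' \<in> carrier_mat n n"
  shows "kronecker (A * A') (B * B') = kronecker A B * kronecker A' B'"
proof (rule eq_matI)
  note K = kronecker_carrier
  fix i j assume "i < dim_row (kronecker A B * kronecker A' B')" "j < dim_col (kronecker A B * kronecker A' B')"
  hence ij: "i < m * n" "j < m * n" using K[OF A(1) B(1)] K[OF A(2) B(2)] by auto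
  have d: "i div n < m" "i mod n < n" "j div n < m" "j mod n < n" using div_mod_less ij by auto
  have "(kronecker A B * kronecker A' B') $$ (i, j) =
    (\<Sum>l<m * n. kronecker A B $$ (i, l) * kronecker A' B' $$ (l, j))"
    by (rule mat_mult_entry[OF K[OF A(1) B(1)] K[OF A(2) B(2)] ij])
  also have "\<dots> = (\<Sum>l<m * n. (\<lambda>a b. A $$ (i div n, a) * B $$ (i mod n, b) * (A' $$ (a, j div n) * B' $$ (b, j mod n)))
      (l div n) (l mod n))"
    using ij by (intro sum.cong) (auto simp: kronecker_entry[OF A(1) B(1)] kronecker_entry[OF A(2) B(2)])
  also have "\<dots> = (\<Sum>a<m. \<Sum>b<n. (A $$ (i div n, a) * A' $$ (a, j div n)) * (B $$ (i mod n, b) * B' $$ (b, j mod n)))"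
    by (subst sum_div_mod) (simp only: mult_ac)
  also have "\<dots> = (A * A') $$ (i div n, j div n) * (B * B') $$ (i mod n, j mod n)"
    unfolding mat_mult_entry[OF A d(1,3)] mat_mult_entry[OF B d(2,4)] by (simp add: sum_product)
  also have "\<dots> = kronecker (A * A') (B * B') $$ (i, j)"
    using A B ij by (intro kronecker_entry[symmetric]) auto
  finally show "kronecker (A * A') (B * B') $$ (i, j) = (kronecker A B * kronecker A' B') $$ (i, j)" ..
qed (use assms in \<open>auto simp: kronecker_def\<close>)

locale group_pair = A: group G + B: group H for G (structure) and H (structure)
begin

lemma group_prod: "group (G \<times>\<times> H)"
  using A.group_axioms B.group_axioms by (rule DirProd_group)

lemma tensor_rep:
  assumes p: "is_rep G \<pi>" and s: "is_rep H \<sigma>"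
  shows "is_rep (G \<times>\<times> H) (ext_tensor \<pi> \<sigma>)"
  unfolding ext_tensor_def
proof (rule group.is_repI[OF group_prod])
  note cp = A.rep_carrier[OF p] and cs = B.rep_carrier[OF s]
  show "(case g of (g, h) \<Rightarrow> kronecker (snd \<pi> g) (snd \<sigma> h)) \<in> carrier_mat (fst \<pi> * fst \<sigma>) (fst \<pi> * fst \<sigma>)"
    if "g \<in> carrier (G \<times>\<times> H)" for g
    using that by (auto simp: DirProd_def intro!: kronecker_carrier cp cs)
  have "kronecker (1\<^sub>m (fst \<pi>)) (1\<^sub>m (fst \<sigma>)) = (1\<^sub>m (fst \<pi> * fst \<sigma>) :: complex mat)"
  proof (rule eq_matI)
    fix i j assume "i < dim_row (1\<^sub>m (fst \<pi> * fst \<sigma>) :: complex mat)" "j < dim_col (1\<^sub>m (fst \<pi> * fst \<sigma>) :: complex mat)"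
    hence ij: "i < fst \<pi> * fst \<sigma>" "j < fst \<pi> * fst \<sigma>" by auto
    show "kronecker (1\<^sub>m (fst \<pi>)) (1\<^sub>m (fst \<sigma>)) $$ (i, j) = (1\<^sub>m (fst \<pi> * fst \<sigma>) :: complex mat) $$ (i, j)"
      unfolding kronecker_entry[OF one_carrier_mat one_carrier_mat ij]
      using ij div_mod_less[OF ij(1)] div_mod_less[OF ij(2)] div_mod_eq_iff[of i j "fst \<sigma>"] by auto
  qed (auto simp: kronecker_def)
  thus "(case \<one>\<^bsub>G \<times>\<times> H\<^esub> of (g, h) \<Rightarrow> kronecker (snd \<pi> g) (snd \<sigma> h)) = 1\<^sub>m (fst \<pi> * fst \<sigma>)"
    by (simp add: DirProd_def A.rep_one[OF p] B.rep_one[OF s])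
  show "(case g \<otimes>\<^bsub>G \<times>\<times> H\<^esub> h of (g, h) \<Rightarrow> kronecker (snd \<pi> g) (snd \<sigma> h)) =
      (case g of (g, h) \<Rightarrow> kronecker (snd \<pi> g) (snd \<sigma> h)) * (case h of (g, h) \<Rightarrow> kronecker (snd \<pi> g) (snd \<sigma> h))"
    if "g \<in> carrier (G \<times>\<times> H)" "h \<in> carrier (G \<times>\<times> H)" for g h
    using that by (auto simp: DirProd_def A.rep_mult[OF p] B.rep_mult[OF s] intro!: kronecker_mult cp cs)
qed

text \<open>Division with remainder by \<open>fst \<sigma>\<close> splits a Kronecker index into its
  two components, and the sum over the product group factors accordingly.\<close>

lemma tensor_sum:
  assumes p: "is_rep G \<pi>" and s: "is_rep H \<sigma>" and p': "is_rep G \<pi>'" and s': "is_rep H \<sigma>'"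
    and ij: "i < fst \<pi> * fst \<sigma>" "j < fst \<pi> * fst \<sigma>" and kl: "k < fst \<pi>' * fst \<sigma>'" "l < fst \<pi>' * fst \<sigma>'"
  shows "(\<Sum>g\<in>carrier (G \<times>\<times> H). snd (ext_tensor \<pi> \<sigma>) g $$ (i, j) * snd (ext_tensor \<pi>' \<sigma>') (inv\<^bsub>G \<times>\<times> H\<^esub> g) $$ (k, l)) =
    (\<Sum>g\<in>carrier G. snd \<pi> g $$ (i div fst \<sigma>, j div fst \<sigma>) * snd \<pi>' (inv g) $$ (k div fst \<sigma>', l div fst \<sigma>')) *
    (\<Sum>h\<in>carrier H. snd \<sigma> h $$ (i mod fst \<sigma>, j mod fst \<sigma>) * snd \<sigma>' (inv\<^bsub>H\<^esub> h) $$ (k mod fst \<sigma>', l mod fst \<sigma>'))"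
proof -
  note c = A.rep_carrier[OF p] B.rep_carrier[OF s] A.rep_carrier[OF p'] B.rep_carrier[OF s']
  have carr: "carrier (G \<times>\<times> H) = carrier G \<times> carrier H" by (simp add: DirProd_def)
  have "(\<Sum>g\<in>carrier (G \<times>\<times> H). snd (ext_tensor \<pi> \<sigma>) g $$ (i, j) * snd (ext_tensor \<pi>' \<sigma>') (inv\<^bsub>G \<times>\<times> H\<^esub> g) $$ (k, l)) =
    (\<Sum>(g, h)\<in>carrier G \<times> carrier H.
      (snd \<pi> g $$ (i div fst \<sigma>, j div fst \<sigma>) * snd \<pi>' (inv g) $$ (k div fst \<sigma>', l div fst \<sigma>')) *
      (snd \<sigma> h $$ (i mod fst \<sigma>, j mod fst \<sigma>) * snd \<sigma>' (inv\<^bsub>H\<^esub> h) $$ (k mod fst \<sigma>', l mod fst \<sigma>')))"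
    unfolding carr
  proof (rule sum.cong[OF HOL.refl], elim SigmaE, simp only: prod.case)
    fix g h assume gh: "g \<in> carrier G" "h \<in> carrier H"
    have inv: "inv\<^bsub>G \<times>\<times> H\<^esub> (g, h) = (inv g, inv\<^bsub>H\<^esub> h)"
      using gh by (intro inv_DirProd A.group_axioms B.group_axioms)
    show "snd (ext_tensor \<pi> \<sigma>) (g, h) $$ (i, j) * snd (ext_tensor \<pi>' \<sigma>') (inv\<^bsub>G \<times>\<times> H\<^esub> (g, h)) $$ (k, l) =
      (snd \<pi> g $$ (i div fst \<sigma>, j div fst \<sigma>) * snd \<pi>' (inv g) $$ (k div fst \<sigma>', l div fst \<sigma>')) *
      (snd \<sigma> h $$ (i mod fst \<sigma>, j mod fst \<sigma>) * snd \<sigma>' (inv\<^bsub>H\<^esub> h) $$ (k mod fst \<sigma>', l mod fst \<sigma>'))"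
      using gh by (simp add: inv ext_tensor_def kronecker_entry[OF c(1,2) ij] kronecker_entry[OF c(3,4) kl])
  qed
  thus ?thesis by (simp add: sum_product sum.cartesian_product)
qed

lemma tensor_schur_rel:
  assumes p: "is_rep G \<pi>" and s: "is_rep H \<sigma>" and sch: "schur_rel G \<pi>" "schur_rel H \<sigma>"
  shows "schur_rel (G \<times>\<times> H) (ext_tensor \<pi> \<sigma>)"
  unfolding schur_rel_def
proof (intro allI impI)
  fix i j k l assume "i < fst (ext_tensor \<pi> \<sigma>)" "j < fst (ext_tensor \<pi> \<sigma>)" "k < fst (ext_tensor \<pi> \<sigma>)" "l < fst (ext_tensor \<pi> \<sigma>)"
  hence *: "i < fst \<pi> * fst \<sigma>" "j < fst \<pi> * fst \<sigma>" "k < fst \<pi> * fst \<sigma>" "l < fst \<pi> * fst \<sigma>"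
    by (auto simp: ext_tensor_def)
  note dm = *[THEN div_mod_less]
  have card: "card (carrier (G \<times>\<times> H)) = card (carrier G) * card (carrier H)"
    by (simp add: DirProd_def card_cartesian_product)
  show "(\<Sum>g\<in>carrier (G \<times>\<times> H). snd (ext_tensor \<pi> \<sigma>) g $$ (i, j) * snd (ext_tensor \<pi> \<sigma>) (inv\<^bsub>G \<times>\<times> H\<^esub> g) $$ (k, l)) =
    (if i = l \<and> j = k then of_nat (card (carrier (G \<times>\<times> H))) / of_nat (fst (ext_tensor \<pi> \<sigma>)) else 0)"
    unfolding tensor_sum[OF p s p s *] card
    using dm schur_relD[OF sch(1)] schur_relD[OF sch(2)] div_mod_eq_iff[of i l "fst \<sigma>"] div_mod_eq_iff[of j k "fst \<sigma>"]
    by (auto simp: ext_tensor_def)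
qed

lemma tensor_coef_orth:
  assumes p: "is_rep G \<pi>" and s: "is_rep H \<sigma>" and p': "is_rep G \<pi>'" and s': "is_rep H \<sigma>'"
    and orth: "coef_orth G \<pi> \<pi>' \<or> coef_orth H \<sigma> \<sigma>'"
  shows "coef_orth (G \<times>\<times> H) (ext_tensor \<pi> \<sigma>) (ext_tensor \<pi>' \<sigma>')"
  unfolding coef_orth_def
proof (intro allI impI)
  fix i j k l assume "i < fst (ext_tensor \<pi> \<sigma>)" "j < fst (ext_tensor \<pi> \<sigma>)" "k < fst (ext_tensor \<pi>' \<sigma>')" "l < fst (ext_tensor \<pi>' \<sigma>')"
  hence *: "i < fst \<pi> * fst \<sigma>" "j < fst \<pi> * fst \<sigma>" "k < fst \<pi>' * fst \<sigma>'" "l < fst \<pi>' * fst \<sigma>'"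
    by (auto simp: ext_tensor_def)
  note dm = *[THEN div_mod_less]
  show "(\<Sum>g\<in>carrier (G \<times>\<times> H). snd (ext_tensor \<pi> \<sigma>) g $$ (i, j) * snd (ext_tensor \<pi>' \<sigma>') (inv\<^bsub>G \<times>\<times> H\<^esub> g) $$ (k, l)) = 0"
    unfolding tensor_sum[OF p s p' s' *]
    using orth dm coef_orthD[of G \<pi> \<pi>' "i div fst \<sigma>" "j div fst \<sigma>" "k div fst \<sigma>'" "l div fst \<sigma>'"]
      coef_orthD[of H \<sigma> \<sigma>' "i mod fst \<sigma>" "j mod fst \<sigma>" "k mod fst \<sigma>'" "l mod fst \<sigma>'"]
    by auto
qed

end

text \<open>Writing the matrix coefficients of two inner factors as \<open>f (g\<^sub>1, g\<^sub>2)\<close>, fix one variable and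
  apply \<open>irreps_separate\<close> in the other one.\<close>

lemma (in group_pair) tensors_separate:
  assumes fin: "finite (carrier G)" "finite (carrier H)"
    and ann: "\<And>\<pi> \<sigma> i j k l. is_irrep G \<pi> \<Longrightarrow> is_irrep H \<sigma> \<Longrightarrow> i < fst \<pi> \<Longrightarrow> j < fst \<pi> \<Longrightarrow> k < fst \<sigma> \<Longrightarrow> l < fst \<sigma> \<Longrightarrow>
      (\<Sum>g\<in>carrier G. \<Sum>h\<in>carrier H. F g h * (snd \<pi> g $$ (i, j) * snd \<sigma> h $$ (k, l))) = 0"
    and g: "g \<in> carrier G" and h: "h \<in> carrier H"
  shows "F g h = 0"
proof (rule B.irreps_separate[OF fin(2) _ h, of "F g"])
  fix \<sigma> :: "'c rep" and k l assume s: "is_irrep H \<sigma>" "k < fst \<sigma>" "l < fst \<sigma>"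
  show "(\<Sum>h\<in>carrier H. F g h * snd \<sigma> h $$ (k, l)) = 0"
  proof (rule A.irreps_separate[OF fin(1) _ g, of "\<lambda>g. \<Sum>h\<in>carrier H. F g h * snd \<sigma> h $$ (k, l)"])
    fix \<pi> :: "'a rep" and i j assume p: "is_irrep G \<pi>" "i < fst \<pi>" "j < fst \<pi>"
    show "(\<Sum>g\<in>carrier G. (\<Sum>h\<in>carrier H. F g h * snd \<sigma> h $$ (k, l)) * snd \<pi> g $$ (i, j)) = 0"
      using ann[OF p(1) s(1) p(2,3) s(2,3)] unfolding sum_distrib_right
        by (simp only: mult_ac)
  qed
qed

section \<open>Induced representations in block form\<close>

definition transv :: "('g, 'x) monoid_scheme \<Rightarrow> 'g set \<Rightarrow> 'g list" where
  "transv G H = (SOME ts. is_left_transversal G H ts)"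

text \<open>A row \<open>r\<close> of the induced matrix is stored as block
  \<open>r div fst \<pi>\<close> and position \<open>r mod fst \<pi>\<close>. Separating the four
  indices lets whole blocks be compared.\<close>

definition ind_block :: "('g, 'x) monoid_scheme \<Rightarrow> 'g set \<Rightarrow> 'g rep \<Rightarrow> nat \<Rightarrow> nat \<Rightarrow> 'g \<Rightarrow> nat \<Rightarrow> nat \<Rightarrow> complex" where
  "ind_block G H \<pi> i j g a b =
     (let h = inv\<^bsub>G\<^esub> (transv G H ! i) \<otimes>\<^bsub>G\<^esub> g \<otimes>\<^bsub>G\<^esub> (transv G H ! j)
      in if h \<in> H then snd \<pi> h $$ (a, b) else 0)"

lemma fst_induced: "fst (induced G H \<pi>) = length (transv G H) * fst \<pi>"
  by (simp add: induced_def transv_def Let_def)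

lemma induced_entry:
  assumes "r < length (transv G H) * fst \<pi>" "c < length (transv G H) * fst \<pi>"
  shows "snd (induced G H \<pi>) g $$ (r, c) =
    ind_block G H \<pi> (r div fst \<pi>) (c div fst \<pi>) g (r mod fst \<pi>) (c mod fst \<pi>)"
  using assms by (simp add: induced_def ind_block_def Let_def flip: transv_def)

lemma induced_carrier:
  "snd (induced G H \<pi>) g \<in> carrier_mat (length (transv G H) * fst \<pi>) (length (transv G H) * fst \<pi>)"
  by (simp add: induced_def Let_def flip: transv_def)

lemma (in group) inv_cancel:
  assumes "x \<in> carrier G" "y \<in> carrier G"
  shows "x \<otimes> (inv x \<otimes> y) = y" "inv x \<otimes> (x \<otimes> y) = y"
  using assms by (simp_all add: m_assoc[symmetric])

locale finite_subgroup = group G for G (structure) +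
  fixes H
  assumes fin: "finite (carrier G)" and sub: "subgroup H G"
begin

lemma H_closed: "h \<in> H \<Longrightarrow> h \<in> carrier G"
  using subgroup.subset[OF sub] by auto

lemma H_mult: "h \<in> H \<Longrightarrow> h' \<in> H \<Longrightarrow> h \<otimes> h' \<in> H"
  using subgroup.m_closed[OF sub] .

lemma H_inv: "h \<in> H \<Longrightarrow> inv h \<in> H"
  using subgroup.m_inv_closed[OF sub] .

lemma H_one: "\<one> \<in> H"
  using subgroup.one_closed[OF sub] .

lemma finH: "finite H"
  using fin H_closed by (metis finite_subset subsetI)

lemma H_group: "group (G\<lparr>carrier := H\<rparr>)"
  using sub by (rule subgroup_imp_group)

lemma H_m_inv: "h \<in> H \<Longrightarrow> inv\<^bsub>G\<lparr>carrier := H\<rparr>\<^esub> h = inv h"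
  using m_inv_consistent[OF sub] by simp

lemma H_cancel:
  assumes "g \<in> carrier G" "h \<in> H"
  shows "g \<otimes> h \<in> H \<longleftrightarrow> g \<in> H" "h \<otimes> g \<in> H \<longleftrightarrow> g \<in> H"
proof -
  have "g = (g \<otimes> h) \<otimes> inv h" "g = inv h \<otimes> (h \<otimes> g)"
    using assms H_closed by (simp_all add: m_assoc) (simp add: m_assoc[symmetric])
  thus "g \<otimes> h \<in> H \<longleftrightarrow> g \<in> H" "h \<otimes> g \<in> H \<longleftrightarrow> g \<in> H"
    using assms H_mult H_inv by metis+
qed

lemma l_coset_iff:
  assumes "t \<in> carrier G" "g \<in> carrier G"
  shows "g \<in> t <# H \<longleftrightarrow> inv t \<otimes> g \<in> H"
proof
  assume "g \<in> t <# H"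
  then obtain h where "h \<in> H" "g = t \<otimes> h" by (auto simp: l_coset_def)
  thus "inv t \<otimes> g \<in> H" using assms H_closed by (simp add: m_assoc[symmetric])
next
  assume "inv t \<otimes> g \<in> H"
  moreover have "g = t \<otimes> (inv t \<otimes> g)" using assms by (simp add: m_assoc[symmetric])
  ultimately show "g \<in> t <# H" unfolding l_coset_def by blast
qed

lemma transversal_exists: "\<exists>ts. is_left_transversal G H ts"
proof -
  \<comment> \<open>\<open>E g\<close> is the left coset of \<open>g\<close>. The representative
    \<open>r g\<close> depends on \<open>g\<close> only through this set, which gives
    uniqueness.\<close>
  define E where "E g = {x \<in> carrier G. inv x \<otimes> g \<in> H}" for g
  define r where "r g = (SOME x. x \<in> E g)" for g
  have r: "r g \<in> E g" if "g \<in> carrier G" for g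
    unfolding r_def by (rule someI[of _ g]) (use that H_one in \<open>simp add: E_def\<close>)
  have E: "E t = E g" if t: "t \<in> carrier G" and g: "g \<in> carrier G" and tg: "inv t \<otimes> g \<in> H" for t g
  proof -
    have "inv x \<otimes> t \<in> H \<longleftrightarrow> inv x \<otimes> g \<in> H" if x: "x \<in> carrier G" for x
    proof -
      have "inv x \<otimes> g = (inv x \<otimes> t) \<otimes> (inv t \<otimes> g)"
        using t g x by (simp add: m_assoc) (simp add: m_assoc[symmetric])
      thus ?thesis using H_cancel(1)[of "inv x \<otimes> t", OF _ tg] t x by simp
    qed
    thus ?thesis by (auto simp: E_def)
  qed
  obtain ts where ts: "set ts = r ` carrier G" "distinct ts"
    using finite_distinct_list[of "r ` carrier G"] fin by auto
  have rc: "r g \<in> carrier G" "inv (r g) \<otimes> g \<in> H" if "g \<in> carrier G" for g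
    using r[OF that] by (auto simp: E_def)
  have "is_left_transversal G H ts"
    unfolding is_left_transversal_def
  proof (intro conjI ballI ts(2))
    show "set ts \<subseteq> carrier G" using ts(1) rc by auto
    fix g assume g: "g \<in> carrier G"
    show "\<exists>!t. t \<in> set ts \<and> g \<in> t <# H"
    proof (rule ex1I[of _ "r g"])
      show "r g \<in> set ts \<and> g \<in> r g <# H" using ts rc[OF g] g by (simp add: l_coset_iff)
      fix t assume t: "t \<in> set ts \<and> g \<in> t <# H"
      then obtain a where a: "a \<in> carrier G" "t = r a" using ts by auto
      have tc: "t \<in> carrier G" using a rc by simp
      have "E t = E g" using t g tc E l_coset_iff by blast
      moreover have "E t = E a" using E[OF tc a(1)] rc[OF a(1)] a(2) by simp
      ultimately show "t = r g" unfolding a(2) r_def by simp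
    qed
  qed
  thus ?thesis ..
qed

abbreviation "ts \<equiv> transv G H"
abbreviation "N \<equiv> length (transv G H)"

lemma ts_transversal: "is_left_transversal G H ts"
  unfolding transv_def by (rule someI_ex[OF transversal_exists])

lemma ts_carrier: "i < N \<Longrightarrow> ts ! i \<in> carrier G"
  using ts_transversal nth_mem[of i ts] by (auto simp: is_left_transversal_def)

lemma ts_ex:
  assumes "g \<in> carrier G"
  obtains i where "i < N" "inv (ts ! i) \<otimes> g \<in> H"
proof -
  obtain t where "t \<in> set ts" "g \<in> t <# H"
    using ts_transversal assms unfolding is_left_transversal_def by blast
  then obtain i where "i < N" "ts ! i = t" by (auto simp: in_set_conv_nth)
  thus ?thesis using that[of i] \<open>g \<in> t <# H\<close> assms ts_carrier[of i] l_coset_iff[of t g] by simp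
qed

lemma ts_unique:
  assumes "g \<in> carrier G" "i < N" "j < N" "inv (ts ! i) \<otimes> g \<in> H" "inv (ts ! j) \<otimes> g \<in> H"
  shows "i = j"
proof -
  have "\<exists>!t. t \<in> set ts \<and> g \<in> t <# H" and d: "distinct ts"
    using ts_transversal assms(1) unfolding is_left_transversal_def by auto
  moreover have "ts ! i \<in> set ts \<and> g \<in> ts ! i <# H" "ts ! j \<in> set ts \<and> g \<in> ts ! j <# H"
    using assms ts_carrier l_coset_iff by auto
  ultimately have "ts ! i = ts ! j" by blast
  thus ?thesis using d assms by (simp add: nth_eq_iff_index_eq)
qed

lemma N_pos: "0 < N"
  using ts_ex[of \<one>] by (metis gr_zeroI not_less_zero one_closed)

text \<open>Translation on both sides permutes the group, so a sum over one block of an induced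
  matrix is a sum over the subgroup.\<close>

lemma sum_translate:
  assumes "t \<in> carrier G" "t' \<in> carrier G"
  shows "(\<Sum>g\<in>carrier G. if inv t \<otimes> g \<otimes> t' \<in> H then F (inv t \<otimes> g \<otimes> t') else 0) = (\<Sum>h\<in>H. F h)"
proof -
  have "(\<Sum>g\<in>carrier G. if inv t \<otimes> g \<otimes> t' \<in> H then F (inv t \<otimes> g \<otimes> t') else 0) =
    (\<Sum>g\<in>carrier G. if g \<otimes> t' \<in> H then F (g \<otimes> t') else 0)"
    using sum_lmult[of "inv t" "\<lambda>x. if x \<otimes> t' \<in> H then F (x \<otimes> t') else 0"] assms by simp
  also have "\<dots> = (\<Sum>g\<in>carrier G. if g \<in> H then F g else 0)"
    using sum_rmult[of t' "\<lambda>x. if x \<in> H then F x else 0"] assms by simp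
  also have "\<dots> = (\<Sum>h\<in>H. F h)"
    using fin H_closed by (intro sum.mono_neutral_cong_right) auto
  finally show ?thesis .
qed

lemma card_index: "card (carrier G) = N * card H"
proof -
  have "(\<Sum>i<N. if inv (ts ! i) \<otimes> g \<in> H then 1 else 0 :: nat) = 1" if g: "g \<in> carrier G" for g
  proof -
    obtain k where k: "k < N" "inv (ts ! k) \<otimes> g \<in> H" using ts_ex[OF g] .
    have "(\<Sum>i<N. if inv (ts ! i) \<otimes> g \<in> H then 1 else 0 :: nat) = (\<Sum>i<N. if i = k then 1 else 0)"
      using k ts_unique[OF g] by (intro sum.cong) auto
    thus ?thesis using k by simp
  qed
  hence "card (carrier G) = (\<Sum>g\<in>carrier G. \<Sum>i<N. if inv (ts ! i) \<otimes> g \<in> H then 1 else 0)"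
    by simp
  also have "\<dots> = (\<Sum>i<N. \<Sum>g\<in>carrier G. if inv (ts ! i) \<otimes> g \<otimes> \<one> \<in> H then 1 else 0)"
    by (subst sum.swap) (use ts_carrier in \<open>auto intro!: sum.cong\<close>)
  also have "\<dots> = (\<Sum>i<N. card H)"
    by (intro sum.cong HOL.refl, subst sum_translate) (use ts_carrier in auto)
  finally show ?thesis by simp
qed

text \<open>For given \<open>j\<close> and \<open>g'\<close> exactly one coset representative
  \<open>ts ! k\<close> satisfies
  \<open>inv (ts ! k) \<otimes> (g' \<otimes> ts ! j) \<in> H\<close>, so the sum over the middle
  block index has a single term.\<close>

lemma ind_block_mult:
  assumes rep: "is_rep (G\<lparr>carrier := H\<rparr>) \<pi>" and g: "g \<in> carrier G" "g' \<in> carrier G"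
    and ij: "i < N" "j < N" and ab: "a < fst \<pi>" "b < fst \<pi>"
  shows "ind_block G H \<pi> i j (g \<otimes> g') a b =
    (\<Sum>k<N. \<Sum>c<fst \<pi>. ind_block G H \<pi> i k g a c * ind_block G H \<pi> k j g' c b)"
proof -
  interpret HG: group "G\<lparr>carrier := H\<rparr>" by (rule H_group)
  have t: "ts ! i \<in> carrier G" "ts ! j \<in> carrier G" using ij ts_carrier by auto
  obtain k where k: "k < N" "inv (ts ! k) \<otimes> (g' \<otimes> ts ! j) \<in> H"
    using ts_ex[of "g' \<otimes> ts ! j"] g t by auto
  have tk: "ts ! k \<in> carrier G" using k ts_carrier by auto
  define h1 where "h1 = inv (ts ! i) \<otimes> g \<otimes> ts ! k"
  define h2 where "h2 = inv (ts ! k) \<otimes> g' \<otimes> ts ! j"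
  have h2: "h2 \<in> H" using k g t tk by (simp add: h2_def m_assoc)
  have h1: "h1 \<in> carrier G" using g t tk by (simp add: h1_def)
  have "h1 \<otimes> h2 = inv (ts ! i) \<otimes> g \<otimes> (ts ! k \<otimes> inv (ts ! k)) \<otimes> g' \<otimes> ts ! j"
    using g t tk by (simp add: h1_def h2_def m_assoc inv_cancel)
  hence h12: "h1 \<otimes> h2 = inv (ts ! i) \<otimes> (g \<otimes> g') \<otimes> ts ! j"
    using g t tk by (simp add: m_assoc)
  have z: "ind_block G H \<pi> l j g' c b = 0" if "l < N" "l \<noteq> k" for l c
  proof -
    have "inv (ts ! l) \<otimes> (g' \<otimes> ts ! j) \<notin> H" using ts_unique[OF _ that(1) k(1) _ k(2)] g t that(2) by auto
    thus ?thesis using ts_carrier[OF that(1)] g t by (simp add: ind_block_def m_assoc)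
  qed
  have "(\<Sum>l<N. \<Sum>c<fst \<pi>. ind_block G H \<pi> i l g a c * ind_block G H \<pi> l j g' c b) =
    (\<Sum>l\<in>{k}. \<Sum>c<fst \<pi>. ind_block G H \<pi> i l g a c * ind_block G H \<pi> l j g' c b)"
    by (rule sum.mono_neutral_right) (use k z in auto)
  also have "\<dots> = (\<Sum>c<fst \<pi>. ind_block G H \<pi> i k g a c * snd \<pi> h2 $$ (c, b))"
    using h2 by (simp add: ind_block_def flip: h2_def)
  also have "\<dots> = ind_block G H \<pi> i j (g \<otimes> g') a b"
  proof (cases "h1 \<in> H")
    case True
    hence "h1 \<otimes> h2 \<in> H" using h2 H_mult by simp
    thus ?thesis using True h2 HG.rep_mult_entry[OF rep, of h1 h2 a b] ab
      by (simp add: ind_block_def flip: h1_def h12)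
  next
    case False
    hence "h1 \<otimes> h2 \<notin> H" using H_cancel(1)[OF h1 h2] by simp
    thus ?thesis using False by (simp add: ind_block_def flip: h1_def h12)
  qed
  finally show ?thesis ..
qed

lemma induced_rep:
  assumes rep: "is_rep (G\<lparr>carrier := H\<rparr>) \<pi>"
  shows "is_rep G (induced G H \<pi>)"
proof -
  interpret HG: group "G\<lparr>carrier := H\<rparr>" by (rule H_group)
  let ?d = "fst \<pi>"
  have "is_rep G (N * ?d, snd (induced G H \<pi>))"
  proof (rule is_repI)
    show "snd (induced G H \<pi>) \<one> = 1\<^sub>m (N * ?d)"
    proof (rule eq_matI)
      fix r c assume "r < dim_row (1\<^sub>m (N * ?d) :: complex mat)" "c < dim_col (1\<^sub>m (N * ?d) :: complex mat)"
      hence rc: "r < N * ?d" "c < N * ?d" by auto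
      note dm = rc[THEN div_mod_less]
      have t: "ts ! (r div ?d) \<in> carrier G" "ts ! (c div ?d) \<in> carrier G" using dm ts_carrier by auto
      show "snd (induced G H \<pi>) \<one> $$ (r, c) = 1\<^sub>m (N * ?d) $$ (r, c)"
      proof (cases "r div ?d = c div ?d")
        case True
        thus ?thesis unfolding induced_entry[OF rc]
          using t dm rc H_one HG.rep_one[OF rep] div_mod_eq_iff[of r c ?d] by (simp add: ind_block_def)
      next
        case False
        have "inv (ts ! (r div ?d)) \<otimes> ts ! (c div ?d) \<notin> H"
          using ts_unique[of "ts ! (c div ?d)" "r div ?d" "c div ?d"] t dm False H_one by auto
        thus ?thesis unfolding induced_entry[OF rc]
          using False rc t by (auto simp: ind_block_def)
      qed
    qed (use induced_carrier[of G H \<pi> \<one>] in auto)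
    fix g g' assume g: "g \<in> carrier G" "g' \<in> carrier G"
    show "snd (induced G H \<pi>) (g \<otimes> g') = snd (induced G H \<pi>) g * snd (induced G H \<pi>) g'"
    proof (rule eq_matI)
      fix r c assume "r < dim_row (snd (induced G H \<pi>) g * snd (induced G H \<pi>) g')"
        "c < dim_col (snd (induced G H \<pi>) g * snd (induced G H \<pi>) g')"
      hence rc: "r < N * ?d" "c < N * ?d"
        using induced_carrier[of G H \<pi> g] induced_carrier[of G H \<pi> g'] by auto
      note dm = rc[THEN div_mod_less]
      have "(snd (induced G H \<pi>) g * snd (induced G H \<pi>) g') $$ (r, c) =
        (\<Sum>l<N * ?d. snd (induced G H \<pi>) g $$ (r, l) * snd (induced G H \<pi>) g' $$ (l, c))"
        by (rule mat_mult_entry[OF induced_carrier induced_carrier rc])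
      also have "\<dots> = (\<Sum>l<N * ?d. (\<lambda>k e. ind_block G H \<pi> (r div ?d) k g (r mod ?d) e *
          ind_block G H \<pi> k (c div ?d) g' e (c mod ?d)) (l div ?d) (l mod ?d))"
        by (rule sum.cong[OF HOL.refl]) (use rc in \<open>simp add: induced_entry\<close>)
      also have "\<dots> = (\<Sum>k<N. \<Sum>e<?d. ind_block G H \<pi> (r div ?d) k g (r mod ?d) e *
          ind_block G H \<pi> k (c div ?d) g' e (c mod ?d))"
        by (rule sum_div_mod)
      also have "\<dots> = snd (induced G H \<pi>) (g \<otimes> g') $$ (r, c)"
        unfolding induced_entry[OF rc] by (rule ind_block_mult[symmetric]) (use rep g dm in auto)
      finally show "snd (induced G H \<pi>) (g \<otimes> g') $$ (r, c) =
        (snd (induced G H \<pi>) g * snd (induced G H \<pi>) g') $$ (r, c)" ..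
    qed (use induced_carrier[of G H \<pi> g] induced_carrier[of G H \<pi> g'] induced_carrier[of G H \<pi> "g \<otimes> g'"] in auto)
  qed (rule induced_carrier)
  thus ?thesis by (simp add: fst_induced[symmetric])
qed

text \<open>The part of Frobenius reciprocity that completeness uses: orthogonality to an induced
  representation is orthogonality of the restriction to the inducing one. A single diagonal block
  suffices.\<close>

lemma induced_orth_restrict:
  assumes rep: "is_rep G \<pi>" and orth: "coef_orth G (induced G H \<tau>) \<pi>"
    and ab: "a < fst \<tau>" "b < fst \<tau>" and kl: "k < fst \<pi>" "l < fst \<pi>"
  shows "(\<Sum>h\<in>H. snd \<tau> h $$ (a, b) * snd \<pi> (inv h) $$ (k, l)) = 0"
proof -
  let ?t = "ts ! 0" and ?d = "fst \<pi>"
  have t: "?t \<in> carrier G" using ts_carrier N_pos by simp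
  \<comment> \<open>The block with index 0 belongs to the first coset representative, which need not
    be the identity. It therefore gives the relation only after conjugation by \<open>?t\<close>,
    undone below by expanding the representation at \<open>inv h\<close> as a triple
    product.\<close>
  have Y: "(\<Sum>h\<in>H. snd \<tau> h $$ (a, b) * snd \<pi> (?t \<otimes> inv h \<otimes> inv ?t) $$ (p, q)) = 0"
    if pq: "p < ?d" "q < ?d" for p q
  proof -
    have le: "x < N * fst \<tau>" if "x < fst \<tau>" for x
      using that N_pos by (metis less_le_trans mult_le_mono1 nat_mult_1 Suc_leI One_nat_def)
    have "0 = (\<Sum>g\<in>carrier G. snd (induced G H \<tau>) g $$ (a, b) * snd \<pi> (inv g) $$ (p, q))"
      using coef_orthD[OF orth _ _ pq] ab le by (simp add: fst_induced)
    also have "\<dots> = (\<Sum>g\<in>carrier G. if inv ?t \<otimes> g \<otimes> ?t \<in> H then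
      (\<lambda>h. snd \<tau> h $$ (a, b) * snd \<pi> (?t \<otimes> inv h \<otimes> inv ?t) $$ (p, q)) (inv ?t \<otimes> g \<otimes> ?t) else 0)"
    proof (rule sum.cong[OF HOL.refl])
      fix g assume g: "g \<in> carrier G"
      have "?t \<otimes> inv (inv ?t \<otimes> g \<otimes> ?t) \<otimes> inv ?t = (?t \<otimes> inv ?t) \<otimes> inv g \<otimes> (?t \<otimes> inv ?t)"
        using g t by (simp add: inv_mult_group m_assoc inv_cancel)
      also have "\<dots> = inv g" using g t by simp
      finally show "snd (induced G H \<tau>) g $$ (a, b) * snd \<pi> (inv g) $$ (p, q) =
        (if inv ?t \<otimes> g \<otimes> ?t \<in> H then
          (\<lambda>h. snd \<tau> h $$ (a, b) * snd \<pi> (?t \<otimes> inv h \<otimes> inv ?t) $$ (p, q)) (inv ?t \<otimes> g \<otimes> ?t) else 0)"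
        using ab le by (simp add: induced_entry ind_block_def)
    qed
    also have "\<dots> = (\<Sum>h\<in>H. snd \<tau> h $$ (a, b) * snd \<pi> (?t \<otimes> inv h \<otimes> inv ?t) $$ (p, q))"
      by (rule sum_translate[OF t t])
    finally show ?thesis by simp
  qed
  have "(\<Sum>h\<in>H. snd \<tau> h $$ (a, b) * snd \<pi> (inv h) $$ (k, l)) =
    (\<Sum>h\<in>H. \<Sum>p<?d. \<Sum>q<?d. snd \<pi> (inv ?t) $$ (k, p) * snd \<pi> ?t $$ (q, l) *
      (snd \<tau> h $$ (a, b) * snd \<pi> (?t \<otimes> inv h \<otimes> inv ?t) $$ (p, q)))"
  proof (rule sum.cong[OF HOL.refl])
    fix h assume "h \<in> H"
    hence h: "h \<in> carrier G" by (rule H_closed)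
    let ?x = "?t \<otimes> inv h \<otimes> inv ?t"
    have x: "?x \<in> carrier G" using h t by simp
    have "inv ?t \<otimes> (?x \<otimes> ?t) = (inv ?t \<otimes> ?t) \<otimes> inv h \<otimes> (inv ?t \<otimes> ?t)"
      using h t by (simp add: m_assoc inv_cancel)
    hence e: "inv ?t \<otimes> (?x \<otimes> ?t) = inv h" using h t by simp
    have "snd \<pi> (inv ?t \<otimes> (?x \<otimes> ?t)) $$ (k, l) =
      (\<Sum>p<?d. snd \<pi> (inv ?t) $$ (k, p) * (\<Sum>q<?d. snd \<pi> ?x $$ (p, q) * snd \<pi> ?t $$ (q, l)))"
      by (subst rep_mult_entry[OF rep]) (use t x kl in \<open>auto simp: rep_mult_entry[OF rep]\<close>)
    thus "snd \<tau> h $$ (a, b) * snd \<pi> (inv h) $$ (k, l) =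
      (\<Sum>p<?d. \<Sum>q<?d. snd \<pi> (inv ?t) $$ (k, p) * snd \<pi> ?t $$ (q, l) *
      (snd \<tau> h $$ (a, b) * snd \<pi> ?x $$ (p, q)))"
      unfolding e by (simp add: sum_distrib_left mult_ac)
  qed
  also have "\<dots> = (\<Sum>p<?d. \<Sum>h\<in>H. \<Sum>q<?d. snd \<pi> (inv ?t) $$ (k, p) * snd \<pi> ?t $$ (q, l) *
      (snd \<tau> h $$ (a, b) * snd \<pi> (?t \<otimes> inv h \<otimes> inv ?t) $$ (p, q)))"
    by (rule sum.swap)
  also have "\<dots> = (\<Sum>p<?d. \<Sum>q<?d. \<Sum>h\<in>H. snd \<pi> (inv ?t) $$ (k, p) * snd \<pi> ?t $$ (q, l) *
      (snd \<tau> h $$ (a, b) * snd \<pi> (?t \<otimes> inv h \<otimes> inv ?t) $$ (p, q)))"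
    by (intro sum.cong HOL.refl sum.swap)
  also have "\<dots> = (\<Sum>p<?d. \<Sum>q<?d. snd \<pi> (inv ?t) $$ (k, p) * snd \<pi> ?t $$ (q, l) *
      (\<Sum>h\<in>H. snd \<tau> h $$ (a, b) * snd \<pi> (?t \<otimes> inv h \<otimes> inv ?t) $$ (p, q)))"
    by (simp only: sum_distrib_left)
  also have "\<dots> = 0" using Y by simp
  finally show ?thesis .
qed

end

section \<open>Clifford theory for characters with values 1 and -1\<close>

locale clifford = finite_subgroup G H for G (structure) and H +
  fixes A and \<chi> :: "'a \<Rightarrow> complex"
  assumes A_sub: "subgroup A G" and AH: "A \<subseteq> H"
    and A_norm: "\<And>g a. g \<in> carrier G \<Longrightarrow> a \<in> A \<Longrightarrow> inv g \<otimes> a \<otimes> g \<in> A"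
    and \<chi>_mult: "\<And>a b. a \<in> A \<Longrightarrow> b \<in> A \<Longrightarrow> \<chi> (a \<otimes> b) = \<chi> a * \<chi> b"
    and \<chi>_sq: "\<And>a. a \<in> A \<Longrightarrow> \<chi> a * \<chi> a = 1"
    and \<chi>_H: "\<And>h a. h \<in> H \<Longrightarrow> a \<in> A \<Longrightarrow> \<chi> (inv h \<otimes> a \<otimes> h) = \<chi> a"
    and stab: "\<And>g. g \<in> carrier G \<Longrightarrow> (\<And>a. a \<in> A \<Longrightarrow> \<chi> (inv g \<otimes> a \<otimes> g) = \<chi> a) \<Longrightarrow> g \<in> H"
begin

definition iso_rep :: "'a rep \<Rightarrow> bool" where
  "iso_rep \<pi> \<longleftrightarrow> is_rep (G\<lparr>carrier := H\<rparr>) \<pi> \<and> (\<forall>a\<in>A. snd \<pi> a = \<chi> a \<cdot>\<^sub>m 1\<^sub>m (fst \<pi>))"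

lemma A_closed: "a \<in> A \<Longrightarrow> a \<in> carrier G"
  using subgroup.subset[OF A_sub] by auto

lemma A_inv: "a \<in> A \<Longrightarrow> inv a \<in> A"
  using subgroup.m_inv_closed[OF A_sub] .

lemma A_one: "\<one> \<in> A"
  using subgroup.one_closed[OF A_sub] .

lemma \<chi>_one: "\<chi> \<one> = 1"
proof -
  have "\<chi> (\<one> \<otimes> \<one>) = \<chi> \<one> * \<chi> \<one>" by (rule \<chi>_mult[OF A_one A_one])
  thus ?thesis using \<chi>_sq[OF A_one] by simp
qed

lemma \<chi>_inv: "a \<in> A \<Longrightarrow> \<chi> (inv a) = \<chi> a"
proof -
  assume a: "a \<in> A"
  have "\<chi> (inv a) = \<chi> (inv a) * (\<chi> a * \<chi> a)" using \<chi>_sq[OF a] by simp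
  also have "\<dots> = \<chi> (inv a \<otimes> a) * \<chi> a" using \<chi>_mult[OF A_inv[OF a] a] by simp
  finally show ?thesis using A_closed[OF a] by (simp add: \<chi>_one)
qed

lemma A_norm': "g \<in> carrier G \<Longrightarrow> a \<in> A \<Longrightarrow> g \<otimes> a \<otimes> inv g \<in> A"
  using A_norm[of "inv g" a] by simp

lemma iso_rep_left:
  assumes p: "iso_rep \<pi>" and a: "a \<in> A" and h: "h \<in> H" and ij: "i < fst \<pi>" "j < fst \<pi>"
  shows "snd \<pi> (a \<otimes> h) $$ (i, j) = \<chi> a * snd \<pi> h $$ (i, j)"
    and "snd \<pi> (h \<otimes> a) $$ (i, j) = \<chi> a * snd \<pi> h $$ (i, j)"
proof -
  interpret HG: group "G\<lparr>carrier := H\<rparr>" by (rule H_group)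
  have rep: "is_rep (G\<lparr>carrier := H\<rparr>) \<pi>" using p by (simp add: iso_rep_def)
  have aH: "a \<in> H" using a AH by auto
  have pa: "snd \<pi> a $$ (k, l) = (if k = l then \<chi> a else 0)" if "k < fst \<pi>" "l < fst \<pi>" for k l
    using p a that by (simp add: iso_rep_def)
  have "snd \<pi> (a \<otimes> h) $$ (i, j) = (\<Sum>l<fst \<pi>. (if i = l then \<chi> a else 0) * snd \<pi> h $$ (l, j))"
    using HG.rep_mult_entry[OF rep, of a h i j] aH h ij pa by simp
  thus "snd \<pi> (a \<otimes> h) $$ (i, j) = \<chi> a * snd \<pi> h $$ (i, j)" using ij by (simp add: sum_single)
  have "snd \<pi> (h \<otimes> a) $$ (i, j) = (\<Sum>l<fst \<pi>. snd \<pi> h $$ (i, l) * (if l = j then \<chi> a else 0))"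
    using HG.rep_mult_entry[OF rep, of h a i j] aH h ij pa by simp
  thus "snd \<pi> (h \<otimes> a) $$ (i, j) = \<chi> a * snd \<pi> h $$ (i, j)" using ij by (simp add: sum_single)
qed

text \<open>Moving \<alpha> past the coset representative turns it into a conjugate in
  \<open>A\<close>, where \<pi> acts by a scalar. Thus \<open>A\<close> acts on each block row by a
  conjugate of \<chi>.\<close>

lemma ind_block_left:
  assumes p: "iso_rep \<pi>" and al: "\<alpha> \<in> A" and g: "g \<in> carrier G" and ij: "i < N" "j < N"
    and ab: "a < fst \<pi>" "b < fst \<pi>"
  shows "ind_block G H \<pi> i j (\<alpha> \<otimes> g) a b = \<chi> (inv (ts ! i) \<otimes> \<alpha> \<otimes> ts ! i) * ind_block G H \<pi> i j g a b"
proof -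
  have t: "ts ! i \<in> carrier G" "ts ! j \<in> carrier G" "\<alpha> \<in> carrier G" using ij ts_carrier A_closed al by auto
  define \<beta> where "\<beta> = inv (ts ! i) \<otimes> \<alpha> \<otimes> ts ! i"
  have b: "\<beta> \<in> A" using A_norm[OF t(1) al] by (simp add: \<beta>_def)
  have e: "inv (ts ! i) \<otimes> (\<alpha> \<otimes> g) \<otimes> ts ! j = \<beta> \<otimes> (inv (ts ! i) \<otimes> g \<otimes> ts ! j)"
    using t g by (simp add: \<beta>_def m_assoc inv_cancel)
  show ?thesis
    unfolding ind_block_def e \<beta>_def[symmetric] Let_def
    using H_cancel(2)[of "inv (ts ! i) \<otimes> g \<otimes> ts ! j" \<beta>] b AH t g iso_rep_left(1)[OF p b _ ab] by auto
qed

lemma ind_block_right: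
  assumes p: "iso_rep \<pi>" and al: "\<alpha> \<in> A" and g: "g \<in> carrier G" and ij: "i < N" "j < N"
    and ab: "a < fst \<pi>" "b < fst \<pi>"
  shows "ind_block G H \<pi> i j (g \<otimes> \<alpha>) a b = \<chi> (inv (ts ! j) \<otimes> \<alpha> \<otimes> ts ! j) * ind_block G H \<pi> i j g a b"
proof -
  have t: "ts ! i \<in> carrier G" "ts ! j \<in> carrier G" "\<alpha> \<in> carrier G" using ij ts_carrier A_closed al by auto
  define \<beta> where "\<beta> = inv (ts ! j) \<otimes> \<alpha> \<otimes> ts ! j"
  have b: "\<beta> \<in> A" using A_norm[OF t(2) al] by (simp add: \<beta>_def)
  have e: "inv (ts ! i) \<otimes> (g \<otimes> \<alpha>) \<otimes> ts ! j = (inv (ts ! i) \<otimes> g \<otimes> ts ! j) \<otimes> \<beta>"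
    using t g by (simp add: \<beta>_def m_assoc inv_cancel)
  show ?thesis
    unfolding ind_block_def e \<beta>_def[symmetric] Let_def
    using H_cancel(1)[of "inv (ts ! i) \<otimes> g \<otimes> ts ! j" \<beta>] b AH t g iso_rep_left(2)[OF p b _ ab] by auto
qed

text \<open>If the conjugates of \<chi> by two coset representatives agreed on \<open>A\<close>,
  their quotient would stabilise \<chi> and lie in \<open>H\<close>, so both would represent the
  same coset.\<close>

lemma separating_element:
  assumes ij: "i < N" "j < N" "i \<noteq> j"
  obtains \<alpha> where "\<alpha> \<in> A" "\<chi> (inv (ts ! i) \<otimes> \<alpha> \<otimes> ts ! i) \<noteq> \<chi> (inv (ts ! j) \<otimes> \<alpha> \<otimes> ts ! j)"
proof (rule ccontr)
  assume "\<not> thesis"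
  hence eq: "\<And>\<alpha>. \<alpha> \<in> A \<Longrightarrow> \<chi> (inv (ts ! i) \<otimes> \<alpha> \<otimes> ts ! i) = \<chi> (inv (ts ! j) \<otimes> \<alpha> \<otimes> ts ! j)"
    using that by blast
  have t: "ts ! i \<in> carrier G" "ts ! j \<in> carrier G" using ij ts_carrier by auto
  have "inv (ts ! i) \<otimes> ts ! j \<in> H"
  proof (rule stab)
    fix a assume a: "a \<in> A"
    have ac: "a \<in> carrier G" using a A_closed by auto
    \<comment> \<open>Comparing the two conjugates of \<chi> at this element gives the stabiliser
      condition at \<open>a\<close>.\<close>
    let ?b = "ts ! i \<otimes> a \<otimes> inv (ts ! i)"
    have "\<chi> (inv (ts ! i) \<otimes> ?b \<otimes> ts ! i) = \<chi> (inv (ts ! j) \<otimes> ?b \<otimes> ts ! j)"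
      by (rule eq[OF A_norm'[OF t(1) a]])
    moreover have "inv (ts ! i) \<otimes> ?b \<otimes> ts ! i = a" using t ac by (simp add: m_assoc inv_cancel)
    moreover have "inv (ts ! j) \<otimes> ?b \<otimes> ts ! j = inv (inv (ts ! i) \<otimes> ts ! j) \<otimes> a \<otimes> (inv (ts ! i) \<otimes> ts ! j)"
      using t ac by (simp add: m_assoc inv_mult_group)
    ultimately show "\<chi> (inv (inv (ts ! i) \<otimes> ts ! j) \<otimes> a \<otimes> (inv (ts ! i) \<otimes> ts ! j)) = \<chi> a" by simp
  qed (use t in simp)
  hence "i = j" using ts_unique[of "ts ! j" i j] t ij H_one by auto
  thus False using ij by simp
qed

end

lemma (in group) ind_block_orth:
  assumes c: "clifford G H A \<chi>" and c': "clifford G H' A \<chi>'"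
    and p: "clifford.iso_rep G H A \<chi> \<pi>" and s: "clifford.iso_rep G H' A \<chi>' \<sigma>"
    and ij: "i < length (transv G H)" "j < length (transv G H)" and kl: "k < length (transv G H')" "l < length (transv G H')"
    and ab: "a < fst \<pi>" "b < fst \<pi>" and ef: "e < fst \<sigma>" "f < fst \<sigma>"
    and \<alpha>: "\<alpha> \<in> A"
    and ne: "\<chi> (inv (transv G H ! i) \<otimes> \<alpha> \<otimes> transv G H ! i) \<noteq> \<chi>' (inv (transv G H' ! l) \<otimes> \<alpha> \<otimes> transv G H' ! l)
      \<or> \<chi> (inv (transv G H ! j) \<otimes> \<alpha> \<otimes> transv G H ! j) \<noteq> \<chi>' (inv (transv G H' ! k) \<otimes> \<alpha> \<otimes> transv G H' ! k)"
  shows "(\<Sum>g\<in>carrier G. ind_block G H \<pi> i j g a b * ind_block G H' \<sigma> k l (inv g) e f) = 0"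
    (is "?S = 0")
proof -
  interpret C: clifford G H A \<chi> by (rule c)
  interpret C': clifford G H' A \<chi>' by (rule c')
  have ac: "\<alpha> \<in> carrier G" using \<alpha> C.A_closed by auto
  have tt: "transv G H ! i \<in> carrier G" "transv G H ! j \<in> carrier G"
    "transv G H' ! k \<in> carrier G" "transv G H' ! l \<in> carrier G"
    using C.ts_carrier C'.ts_carrier ij kl by auto
  have inv_conj: "\<chi>' (inv t \<otimes> inv \<alpha> \<otimes> t) = \<chi>' (inv t \<otimes> \<alpha> \<otimes> t)" if t: "t \<in> carrier G" for t
  proof -
    have "inv (inv t \<otimes> \<alpha> \<otimes> t) = inv t \<otimes> inv \<alpha> \<otimes> t" using t ac by (simp add: inv_mult_group m_assoc)
    thus ?thesis using C'.\<chi>_inv[OF C'.A_norm[OF t \<alpha>]] by simp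
  qed
  have zero: "S = 0" if "S = x * y * S" "x * x = 1" "y * y = 1" "x \<noteq> y" for S x y :: complex
  proof (rule ccontr)
    assume "S \<noteq> 0"
    hence "x * y = 1" using that(1) by simp
    have "x = x * (y * y)" using that(3) by simp
    also have "\<dots> = x * y * y" by simp
    also have "\<dots> = y" using \<open>x * y = 1\<close> by simp
    finally have "x = y" .
    thus False using that(4) by simp
  qed
  from ne show ?thesis
  proof
    let ?x = "\<chi> (inv (transv G H ! i) \<otimes> \<alpha> \<otimes> transv G H ! i)"
    let ?y = "\<chi>' (inv (transv G H' ! l) \<otimes> \<alpha> \<otimes> transv G H' ! l)"
    assume n: "?x \<noteq> ?y"
    have "?S = (\<Sum>g\<in>carrier G. ind_block G H \<pi> i j (\<alpha> \<otimes> g) a b * ind_block G H' \<sigma> k l (inv (\<alpha> \<otimes> g)) e f)"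
      using sum_lmult[OF ac, of "\<lambda>g. ind_block G H \<pi> i j g a b * ind_block G H' \<sigma> k l (inv g) e f"] by simp
    also have "\<dots> = (\<Sum>g\<in>carrier G. ?x * ?y * (ind_block G H \<pi> i j g a b * ind_block G H' \<sigma> k l (inv g) e f))"
    proof (rule sum.cong[OF HOL.refl])
      fix g assume g: "g \<in> carrier G"
      have "inv (\<alpha> \<otimes> g) = inv g \<otimes> inv \<alpha>" using g ac by (simp add: inv_mult_group)
      hence "ind_block G H' \<sigma> k l (inv (\<alpha> \<otimes> g)) e f = ?y * ind_block G H' \<sigma> k l (inv g) e f"
        using C'.ind_block_right[OF s C'.A_inv[OF \<alpha>] _ kl ef, of "inv g"] g inv_conj[OF tt(4)] by simp
      moreover have "ind_block G H \<pi> i j (\<alpha> \<otimes> g) a b = ?x * ind_block G H \<pi> i j g a b"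
        by (rule C.ind_block_left[OF p \<alpha> g ij ab])
      ultimately show "ind_block G H \<pi> i j (\<alpha> \<otimes> g) a b * ind_block G H' \<sigma> k l (inv (\<alpha> \<otimes> g)) e f =
        ?x * ?y * (ind_block G H \<pi> i j g a b * ind_block G H' \<sigma> k l (inv g) e f)" by simp
    qed
    also have "\<dots> = ?x * ?y * ?S" by (rule sum_distrib_left[symmetric])
    finally have "?S = ?x * ?y * ?S" .
    thus ?thesis
      by (rule zero[OF _ _ _ n]) (use C.\<chi>_sq C'.\<chi>_sq C.A_norm tt \<alpha> in auto)
  next
    let ?x = "\<chi> (inv (transv G H ! j) \<otimes> \<alpha> \<otimes> transv G H ! j)"
    let ?y = "\<chi>' (inv (transv G H' ! k) \<otimes> \<alpha> \<otimes> transv G H' ! k)"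
    assume n: "?x \<noteq> ?y"
    have "?S = (\<Sum>g\<in>carrier G. ind_block G H \<pi> i j (g \<otimes> \<alpha>) a b * ind_block G H' \<sigma> k l (inv (g \<otimes> \<alpha>)) e f)"
      using sum_rmult[OF ac, of "\<lambda>g. ind_block G H \<pi> i j g a b * ind_block G H' \<sigma> k l (inv g) e f"] by simp
    also have "\<dots> = (\<Sum>g\<in>carrier G. ?x * ?y * (ind_block G H \<pi> i j g a b * ind_block G H' \<sigma> k l (inv g) e f))"
    proof (rule sum.cong[OF HOL.refl])
      fix g assume g: "g \<in> carrier G"
      have "inv (g \<otimes> \<alpha>) = inv \<alpha> \<otimes> inv g" using g ac by (simp add: inv_mult_group)
      hence "ind_block G H' \<sigma> k l (inv (g \<otimes> \<alpha>)) e f = ?y * ind_block G H' \<sigma> k l (inv g) e f"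
        using C'.ind_block_left[OF s C'.A_inv[OF \<alpha>] _ kl ef, of "inv g"] g inv_conj[OF tt(3)] by simp
      moreover have "ind_block G H \<pi> i j (g \<otimes> \<alpha>) a b = ?x * ind_block G H \<pi> i j g a b"
        by (rule C.ind_block_right[OF p \<alpha> g ij ab])
      ultimately show "ind_block G H \<pi> i j (g \<otimes> \<alpha>) a b * ind_block G H' \<sigma> k l (inv (g \<otimes> \<alpha>)) e f =
        ?x * ?y * (ind_block G H \<pi> i j g a b * ind_block G H' \<sigma> k l (inv g) e f)" by simp
    qed
    also have "\<dots> = ?x * ?y * ?S" by (rule sum_distrib_left[symmetric])
    finally have "?S = ?x * ?y * ?S" .
    thus ?thesis
      by (rule zero[OF _ _ _ n]) (use C.\<chi>_sq C'.\<chi>_sq C.A_norm tt \<alpha> in auto)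
  qed
qed

text \<open>The hypothesis \<open>diff\<close> says that \<chi> and \<chi>' lie in different orbits
  of \<open>G\<close>, so every pair of blocks is separated by an element of
  \<open>A\<close>.\<close>

lemma (in group) induced_coef_orth_diff:
  assumes c: "clifford G H A \<chi>" and c': "clifford G H' A \<chi>'"
    and p: "clifford.iso_rep G H A \<chi> \<pi>" and s: "clifford.iso_rep G H' A \<chi>' \<sigma>"
    and diff: "\<And>t t'. t \<in> carrier G \<Longrightarrow> t' \<in> carrier G \<Longrightarrow>
      \<exists>\<alpha>\<in>A. \<chi> (inv t \<otimes> \<alpha> \<otimes> t) \<noteq> \<chi>' (inv t' \<otimes> \<alpha> \<otimes> t')"
  shows "coef_orth G (induced G H \<pi>) (induced G H' \<sigma>)"
  unfolding coef_orth_def fst_induced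
proof (intro allI impI)
  interpret C: clifford G H A \<chi> by (rule c)
  interpret C': clifford G H' A \<chi>' by (rule c')
  fix r c r' c' assume rc: "r < length (transv G H) * fst \<pi>" "c < length (transv G H) * fst \<pi>"
    and rc': "r' < length (transv G H') * fst \<sigma>" "c' < length (transv G H') * fst \<sigma>"
  note dm = rc[THEN div_mod_less] rc'[THEN div_mod_less]
  obtain \<alpha> where \<alpha>: "\<alpha> \<in> A" "\<chi> (inv (transv G H ! (r div fst \<pi>)) \<otimes> \<alpha> \<otimes> transv G H ! (r div fst \<pi>)) \<noteq>
    \<chi>' (inv (transv G H' ! (c' div fst \<sigma>)) \<otimes> \<alpha> \<otimes> transv G H' ! (c' div fst \<sigma>))"
    using diff[of "transv G H ! (r div fst \<pi>)" "transv G H' ! (c' div fst \<sigma>)"] C.ts_carrier C'.ts_carrier dm by auto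
  show "(\<Sum>g\<in>carrier G. snd (induced G H \<pi>) g $$ (r, c) * snd (induced G H' \<sigma>) (inv g) $$ (r', c')) = 0"
    unfolding induced_entry[OF rc] induced_entry[OF rc']
    by (rule ind_block_orth[OF c c' p s]) (use dm \<alpha> in auto)
qed

context clifford
begin

text \<open>Blocks that do not match are separated by an element of \<open>A\<close> and contribute
  zero; in matching blocks the conditions for the two entries to be nonzero coincide, and the sum
  moves to \<open>H\<close>.\<close>

lemma induced_sum:
  assumes p: "iso_rep \<pi>" and s: "iso_rep \<sigma>"
    and rc: "r < N * fst \<pi>" "c < N * fst \<pi>" and rc': "r' < N * fst \<sigma>" "c' < N * fst \<sigma>"
  shows "(\<Sum>g\<in>carrier G. snd (induced G H \<pi>) g $$ (r, c) * snd (induced G H \<sigma>) (inv g) $$ (r', c')) =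
    (if r div fst \<pi> = c' div fst \<sigma> \<and> c div fst \<pi> = r' div fst \<sigma>
     then \<Sum>h\<in>H. snd \<pi> h $$ (r mod fst \<pi>, c mod fst \<pi>) * snd \<sigma> (inv h) $$ (r' mod fst \<sigma>, c' mod fst \<sigma>)
     else 0)"
proof -
  note dm = rc[THEN div_mod_less] rc'[THEN div_mod_less]
  let ?i = "r div fst \<pi>" and ?j = "c div fst \<pi>" and ?k = "r' div fst \<sigma>" and ?l = "c' div fst \<sigma>"
  have ax: "clifford G H A \<chi>" by (rule clifford_axioms)
  show ?thesis
  proof (cases "?i = ?l \<and> ?j = ?k")
    case True
    have t: "ts ! ?i \<in> carrier G" "ts ! ?j \<in> carrier G" using dm ts_carrier by auto
    have "(\<Sum>g\<in>carrier G. snd (induced G H \<pi>) g $$ (r, c) * snd (induced G H \<sigma>) (inv g) $$ (r', c')) =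
      (\<Sum>g\<in>carrier G. if inv (ts ! ?i) \<otimes> g \<otimes> ts ! ?j \<in> H then
        (\<lambda>h. snd \<pi> h $$ (r mod fst \<pi>, c mod fst \<pi>) * snd \<sigma> (inv h) $$ (r' mod fst \<sigma>, c' mod fst \<sigma>))
          (inv (ts ! ?i) \<otimes> g \<otimes> ts ! ?j) else 0)"
      unfolding induced_entry[OF rc] induced_entry[OF rc']
    proof (rule sum.cong[OF HOL.refl])
      fix g assume g: "g \<in> carrier G"
      have kl: "?k = ?j" "?l = ?i" using True by auto
      have e: "inv (ts ! ?j) \<otimes> inv g \<otimes> ts ! ?i = inv (inv (ts ! ?i) \<otimes> g \<otimes> ts ! ?j)"
        using g t by (simp add: inv_mult_group m_assoc)
      show "ind_block G H \<pi> ?i ?j g (r mod fst \<pi>) (c mod fst \<pi>) *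
          ind_block G H \<sigma> ?k ?l (inv g) (r' mod fst \<sigma>) (c' mod fst \<sigma>) =
        (if inv (ts ! ?i) \<otimes> g \<otimes> ts ! ?j \<in> H then
        (\<lambda>h. snd \<pi> h $$ (r mod fst \<pi>, c mod fst \<pi>) * snd \<sigma> (inv h) $$ (r' mod fst \<sigma>, c' mod fst \<sigma>))
          (inv (ts ! ?i) \<otimes> g \<otimes> ts ! ?j) else 0)"
        unfolding kl ind_block_def Let_def e using H_inv by auto
    qed
    also have "\<dots> = (\<Sum>h\<in>H. snd \<pi> h $$ (r mod fst \<pi>, c mod fst \<pi>) * snd \<sigma> (inv h) $$ (r' mod fst \<sigma>, c' mod fst \<sigma>))"
      by (rule sum_translate[OF t])
    finally show ?thesis using True by simp
  next
    case False
    have "\<exists>\<alpha>\<in>A. \<chi> (inv (ts ! ?i) \<otimes> \<alpha> \<otimes> ts ! ?i) \<noteq> \<chi> (inv (ts ! ?l) \<otimes> \<alpha> \<otimes> ts ! ?l)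
      \<or> \<chi> (inv (ts ! ?j) \<otimes> \<alpha> \<otimes> ts ! ?j) \<noteq> \<chi> (inv (ts ! ?k) \<otimes> \<alpha> \<otimes> ts ! ?k)"
      using False separating_element[of ?i ?l] separating_element[of ?j ?k] dm by metis
    then obtain \<alpha> where \<alpha>: "\<alpha> \<in> A" "\<chi> (inv (ts ! ?i) \<otimes> \<alpha> \<otimes> ts ! ?i) \<noteq> \<chi> (inv (ts ! ?l) \<otimes> \<alpha> \<otimes> ts ! ?l)
      \<or> \<chi> (inv (ts ! ?j) \<otimes> \<alpha> \<otimes> ts ! ?j) \<noteq> \<chi> (inv (ts ! ?k) \<otimes> \<alpha> \<otimes> ts ! ?k)" by blast
    show ?thesis
      unfolding induced_entry[OF rc] induced_entry[OF rc'] if_not_P[OF False]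
      by (rule ind_block_orth[OF ax ax p s]) (use dm \<alpha> in simp_all)
  qed
qed

text \<open>Irreducibility of the induced representation in coefficient form. The index
  \<open>N\<close> enlarges the group order and the dimension by the same factor.\<close>

lemma induced_schur_rel:
  assumes p: "iso_rep \<pi>" and sch: "schur_rel (G\<lparr>carrier := H\<rparr>) \<pi>"
  shows "schur_rel G (induced G H \<pi>)"
  unfolding schur_rel_def fst_induced
proof (intro allI impI)
  fix i j k l assume *: "i < N * fst \<pi>" "j < N * fst \<pi>" "k < N * fst \<pi>" "l < N * fst \<pi>"
  note dm = *[THEN div_mod_less]
  have "(\<Sum>h\<in>H. snd \<pi> h $$ (i mod fst \<pi>, j mod fst \<pi>) * snd \<pi> (inv h) $$ (k mod fst \<pi>, l mod fst \<pi>)) =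
    (if i mod fst \<pi> = l mod fst \<pi> \<and> j mod fst \<pi> = k mod fst \<pi> then of_nat (card H) / of_nat (fst \<pi>) else 0)"
    using schur_relD[OF sch, of "i mod fst \<pi>" "j mod fst \<pi>" "k mod fst \<pi>" "l mod fst \<pi>"] dm
    by (simp add: H_m_inv cong: sum.cong)
  thus "(\<Sum>g\<in>carrier G. snd (induced G H \<pi>) g $$ (i, j) * snd (induced G H \<pi>) (inv g) $$ (k, l)) =
    (if i = l \<and> j = k then of_nat (card (carrier G)) / of_nat (N * fst \<pi>) else 0)"
    unfolding induced_sum[OF p p *] card_index
    using N_pos div_mod_eq_iff[of i l "fst \<pi>"] div_mod_eq_iff[of j k "fst \<pi>"] by auto
qed

lemma induced_coef_orth_same:
  assumes p: "iso_rep \<pi>" and s: "iso_rep \<sigma>" and orth: "coef_orth (G\<lparr>carrier := H\<rparr>) \<pi> \<sigma>"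
  shows "coef_orth G (induced G H \<pi>) (induced G H \<sigma>)"
  unfolding coef_orth_def fst_induced
proof (intro allI impI)
  fix i j k l assume *: "i < N * fst \<pi>" "j < N * fst \<pi>" "k < N * fst \<sigma>" "l < N * fst \<sigma>"
  note dm = *[THEN div_mod_less]
  have "(\<Sum>h\<in>H. snd \<pi> h $$ (i mod fst \<pi>, j mod fst \<pi>) * snd \<sigma> (inv h) $$ (k mod fst \<sigma>, l mod fst \<sigma>)) = 0"
    using coef_orthD[OF orth, of "i mod fst \<pi>" "j mod fst \<pi>" "k mod fst \<sigma>" "l mod fst \<sigma>"] dm
    by (simp add: H_m_inv cong: sum.cong)
  thus "(\<Sum>g\<in>carrier G. snd (induced G H \<pi>) g $$ (i, j) * snd (induced G H \<sigma>) (inv g) $$ (k, l)) = 0"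
    unfolding induced_sum[OF p s *] by simp
qed

end

text \<open>Models \<open>Z_split\<close>. By \<open>kernel_A\<close>, a representation on which
  \<open>A\<close> acts through \<chi> is trivial on the kernel of \<open>f\<close>; by
  \<open>A_snd\<close>, being isotypic is a condition on the first tensor factor alone.\<close>

locale clifford_product = clifford G H A \<chi> + Q: group_pair Q\<^sub>1 Q\<^sub>2 +
    f: finite_group_surj "G\<lparr>carrier := H\<rparr>" "Q\<^sub>1 \<times>\<times> Q\<^sub>2" f
  for G :: "('a, 'm) monoid_scheme" (structure) and H A \<chi>
    and Q\<^sub>1 :: "('b, 'n) monoid_scheme" and Q\<^sub>2 :: "('c, 'o) monoid_scheme" and f +
  assumes kernel_A: "\<And>h. h \<in> H \<Longrightarrow> f h = (\<one>\<^bsub>Q\<^sub>1\<^esub>, \<one>\<^bsub>Q\<^sub>2\<^esub>) \<Longrightarrow> h \<in> A \<and> \<chi> h = 1"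
    and A_snd: "\<And>a. a \<in> A \<Longrightarrow> snd (f a) = \<one>\<^bsub>Q\<^sub>2\<^esub>"
begin

lemma f_carrier: "h \<in> H \<Longrightarrow> fst (f h) \<in> carrier Q\<^sub>1" "h \<in> H \<Longrightarrow> snd (f h) \<in> carrier Q\<^sub>2"
  using f.hom_closed[of h] by (auto simp: DirProd_def)

lemma f_mult:
  assumes "h \<in> H" "h' \<in> H"
  shows "fst (f (h \<otimes> h')) = fst (f h) \<otimes>\<^bsub>Q\<^sub>1\<^esub> fst (f h')" "snd (f (h \<otimes> h')) = snd (f h) \<otimes>\<^bsub>Q\<^sub>2\<^esub> snd (f h')"
  using f.hom_mult[of h h'] assms by (simp_all add: DirProd_def split: prod.splits)

lemma f_one: "f \<one> = (\<one>\<^bsub>Q\<^sub>1\<^esub>, \<one>\<^bsub>Q\<^sub>2\<^esub>)"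
  using f.hom_one by (simp add: DirProd_def)

lemma Q_finite: "finite (carrier Q\<^sub>1)" "finite (carrier Q\<^sub>2)"
proof -
  have "finite (f ` carrier (G\<lparr>carrier := H\<rparr>))" using finH by simp
  hence "finite (carrier Q\<^sub>1 \<times> carrier Q\<^sub>2)" unfolding f.surj by (simp add: DirProd_def)
  thus "finite (carrier Q\<^sub>1)" "finite (carrier Q\<^sub>2)"
    using Q.A.one_closed Q.B.one_closed by (auto dest: finite_cartesian_productD1 finite_cartesian_productD2)
qed

lemma A_H: "a \<in> A \<Longrightarrow> a \<in> H"
  using AH by auto

lemma sum_A_lmult: "a \<in> A \<Longrightarrow> (\<Sum>x\<in>A. F (a \<otimes> x)) = (\<Sum>x\<in>A. F x)"
  using group.sum_lmult[OF subgroup_imp_group[OF A_sub], of a F] by simp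

lemma sum_A_rmult: "a \<in> A \<Longrightarrow> (\<Sum>x\<in>A. F (x \<otimes> a)) = (\<Sum>x\<in>A. F x)"
  using group.sum_rmult[OF subgroup_imp_group[OF A_sub], of a F] by simp

lemma sum_H_lmult: "a \<in> H \<Longrightarrow> (\<Sum>x\<in>H. F (a \<otimes> x)) = (\<Sum>x\<in>H. F x)"
  using group.sum_lmult[OF H_group, of a F] by simp

lemma sum_A_inv: "(\<Sum>x\<in>A. F (inv x)) = (\<Sum>x\<in>A. F x)"
  by (rule sum.reindex_bij_witness[where i = "\<lambda>x. inv x" and j = "\<lambda>x. inv x"])
    (auto simp: A_inv A_closed)

text \<open>\<open>P\<close> is the projector to the \<chi>-part, up to a factor. It commutes with
  the whole image because \<chi> is invariant under \<open>H\<close>, so it is a scalar; the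
  alternatives are that the scalar is nonzero or zero.\<close>

lemma isotypic_dichotomy:
  assumes p: "is_irrep Q\<^sub>1 \<rho>"
  shows "(\<forall>a\<in>A. snd \<rho> (fst (f a)) = \<chi> a \<cdot>\<^sub>m 1\<^sub>m (fst \<rho>)) \<or>
    (\<forall>i<fst \<rho>. \<forall>j<fst \<rho>. (\<Sum>a\<in>A. \<chi> a * snd \<rho> (fst (f a)) $$ (i, j)) = 0)"
proof -
  let ?n = "fst \<rho>" and ?\<phi> = "\<lambda>h. snd \<rho> (fst (f h))"
  have rp: "is_rep Q\<^sub>1 \<rho>" using p by (simp add: is_irrep_def)
  have carr: "?\<phi> h \<in> carrier_mat ?n ?n" if "h \<in> H" for h
    by (rule Q.A.rep_carrier[OF rp f_carrier(1)[OF that]])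
  have mult: "?\<phi> (h \<otimes> h') $$ (i, j) = (\<Sum>l<?n. ?\<phi> h $$ (i, l) * ?\<phi> h' $$ (l, j))"
    if "h \<in> H" "h' \<in> H" "i < ?n" "j < ?n" for h h' i j
    using that by (simp add: f_mult Q.A.rep_mult_entry[OF rp] f_carrier)
  define P where "P = mat ?n ?n (\<lambda>(i, j). \<Sum>a\<in>A. \<chi> a * ?\<phi> a $$ (i, j))"
  have P: "P \<in> carrier_mat ?n ?n" by (simp add: P_def)
  have left: "(?\<phi> h * P) $$ (i, j) = (\<Sum>a\<in>A. \<chi> a * ?\<phi> (h \<otimes> a) $$ (i, j))"
    if h: "h \<in> H" and ij: "i < ?n" "j < ?n" for h i j
  proof -
    have "(?\<phi> h * P) $$ (i, j) = (\<Sum>l<?n. \<Sum>a\<in>A. \<chi> a * (?\<phi> h $$ (i, l) * ?\<phi> a $$ (l, j)))"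
      unfolding mat_mult_entry[OF carr[OF h] P ij]
      using ij by (intro sum.cong HOL.refl) (simp add: P_def sum_distrib_left mult_ac)
    also have "\<dots> = (\<Sum>a\<in>A. \<Sum>l<?n. \<chi> a * (?\<phi> h $$ (i, l) * ?\<phi> a $$ (l, j)))"
      by (rule sum.swap)
    also have "\<dots> = (\<Sum>a\<in>A. \<chi> a * ?\<phi> (h \<otimes> a) $$ (i, j))"
      by (rule sum.cong[OF HOL.refl]) (simp add: mult[OF h A_H ij] sum_distrib_left)
    finally show ?thesis .
  qed
  have right: "(P * ?\<phi> h) $$ (i, j) = (\<Sum>a\<in>A. \<chi> a * ?\<phi> (a \<otimes> h) $$ (i, j))"
    if h: "h \<in> H" and ij: "i < ?n" "j < ?n" for h i j
  proof -
    have "(P * ?\<phi> h) $$ (i, j) = (\<Sum>l<?n. \<Sum>a\<in>A. \<chi> a * (?\<phi> a $$ (i, l) * ?\<phi> h $$ (l, j)))"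
      unfolding mat_mult_entry[OF P carr[OF h] ij]
      using ij by (intro sum.cong HOL.refl) (simp add: P_def sum_distrib_right mult.assoc)
    also have "\<dots> = (\<Sum>a\<in>A. \<Sum>l<?n. \<chi> a * (?\<phi> a $$ (i, l) * ?\<phi> h $$ (l, j)))"
      by (rule sum.swap)
    also have "\<dots> = (\<Sum>a\<in>A. \<chi> a * ?\<phi> (a \<otimes> h) $$ (i, j))"
      by (rule sum.cong[OF HOL.refl]) (simp add: mult[OF A_H h ij] sum_distrib_left)
    finally show ?thesis .
  qed
  have "P * snd \<rho> q = snd \<rho> q * P" if q: "q \<in> carrier Q\<^sub>1" for q
  proof -
    have "(q, \<one>\<^bsub>Q\<^sub>2\<^esub>) \<in> f ` H" using q f.surj by (auto simp: DirProd_def)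
    then obtain h where h: "h \<in> H" "fst (f h) = q" by (metis fst_conv imageE)
    have hc: "h \<in> carrier G" using h H_closed by auto
    have "P * ?\<phi> h = ?\<phi> h * P"
    proof (rule eq_matI)
      fix i j assume "i < dim_row (?\<phi> h * P)" "j < dim_col (?\<phi> h * P)"
      hence ij: "i < ?n" "j < ?n" using carr[OF h(1)] P by auto
      have "(\<Sum>a\<in>A. \<chi> a * ?\<phi> (a \<otimes> h) $$ (i, j)) = (\<Sum>a\<in>A. \<chi> a * ?\<phi> (h \<otimes> a) $$ (i, j))"
      proof (rule sum.reindex_bij_witness[where j = "\<lambda>a. inv h \<otimes> a \<otimes> h" and i = "\<lambda>a. h \<otimes> a \<otimes> inv h"])
        fix a assume a: "a \<in> A"
        have ac: "a \<in> carrier G" using a A_closed by auto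
        show "h \<otimes> (inv h \<otimes> a \<otimes> h) \<otimes> inv h = a" using ac hc by (simp add: m_assoc inv_cancel)
        show "inv h \<otimes> (h \<otimes> a \<otimes> inv h) \<otimes> h = a" using ac hc by (simp add: m_assoc inv_cancel)
        show "inv h \<otimes> a \<otimes> h \<in> A" "h \<otimes> a \<otimes> inv h \<in> A" using A_norm A_norm' hc a by auto
        have "h \<otimes> (inv h \<otimes> a \<otimes> h) = a \<otimes> h" using ac hc by (simp add: m_assoc inv_cancel)
        thus "\<chi> (inv h \<otimes> a \<otimes> h) * ?\<phi> (h \<otimes> (inv h \<otimes> a \<otimes> h)) $$ (i, j) = \<chi> a * ?\<phi> (a \<otimes> h) $$ (i, j)"
          using \<chi>_H[OF h(1) a] by simp
      qed
      thus "(P * ?\<phi> h) $$ (i, j) = (?\<phi> h * P) $$ (i, j)"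
        unfolding left[OF h(1) ij] right[OF h(1) ij] .
    qed (use carr[OF h(1)] P in auto)
    thus ?thesis using h(2) by simp
  qed
  then obtain c where c: "P = c \<cdot>\<^sub>m 1\<^sub>m ?n" using Q.A.irrep_scalar[OF p P] by blast
  show ?thesis
  proof (cases "c = 0")
    case True
    have "(\<Sum>a\<in>A. \<chi> a * ?\<phi> a $$ (i, j)) = 0" if "i < ?n" "j < ?n" for i j
    proof -
      have "P $$ (i, j) = 0" using c True that by simp
      thus ?thesis using that by (simp add: P_def)
    qed
    thus ?thesis by blast
  next
    case False
    \<comment> \<open>Translating the sum that defines \<open>P\<close> gives
      \<open>?\<phi> x * P = \<chi> x \<cdot>\<^sub>m P\<close>; then the nonzero scalar
      \<open>c\<close> is cancelled.\<close>
    have "?\<phi> x = \<chi> x \<cdot>\<^sub>m 1\<^sub>m ?n" if x: "x \<in> A" for x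
    proof (rule eq_matI)
      fix i j assume "i < dim_row (\<chi> x \<cdot>\<^sub>m 1\<^sub>m ?n)" "j < dim_col (\<chi> x \<cdot>\<^sub>m 1\<^sub>m ?n)"
      hence ij: "i < ?n" "j < ?n" by auto
      have "(?\<phi> x * P) $$ (i, j) = (\<Sum>l<?n. ?\<phi> x $$ (i, l) * (if l = j then c else 0))"
        unfolding mat_mult_entry[OF carr[OF A_H[OF x]] P ij] using ij c by (intro sum.cong) auto
      hence 1: "(?\<phi> x * P) $$ (i, j) = ?\<phi> x $$ (i, j) * c" using ij by (simp add: sum_single)
      have "(?\<phi> x * P) $$ (i, j) = (\<Sum>a\<in>A. \<chi> x * ((\<lambda>y. \<chi> y * ?\<phi> y $$ (i, j)) (x \<otimes> a)))"
        unfolding left[OF A_H[OF x] ij]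
      proof (rule sum.cong[OF HOL.refl])
        fix a assume a: "a \<in> A"
        have "\<chi> x * \<chi> (x \<otimes> a) = (\<chi> x * \<chi> x) * \<chi> a" using \<chi>_mult[OF x a] by simp
        hence "\<chi> x * \<chi> (x \<otimes> a) = \<chi> a" using \<chi>_sq[OF x] by simp
        thus "\<chi> a * ?\<phi> (x \<otimes> a) $$ (i, j) = \<chi> x * ((\<lambda>y. \<chi> y * ?\<phi> y $$ (i, j)) (x \<otimes> a))"
          by (simp add: mult.assoc[symmetric])
      qed
      also have "\<dots> = \<chi> x * P $$ (i, j)"
        unfolding sum_distrib_left[symmetric] sum_A_lmult[OF x, of "\<lambda>y. \<chi> y * ?\<phi> y $$ (i, j)"]
        using ij by (simp add: P_def)
      finally have "?\<phi> x $$ (i, j) * c = \<chi> x * P $$ (i, j)" using 1 by simp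
      thus "?\<phi> x $$ (i, j) = (\<chi> x \<cdot>\<^sub>m 1\<^sub>m ?n) $$ (i, j)"
        using False ij c by (auto split: if_splits)
    qed (use carr[OF A_H[OF x]] in auto)
    thus ?thesis by blast
  qed
qed

text \<open>Averaging \<open>u\<close> over \<open>A\<close> against \<chi> and summing over the
  fibres of \<open>f\<close> gives a function \<open>F\<close> on the product. Tensors with a
  non-isotypic first factor annihilate it because of the averaging, the others by assumption. So
  \<open>F\<close> vanishes, in particular at the identity.\<close>

lemma isotypic_part_zero:
  fixes u :: "'a \<Rightarrow> complex"
  assumes orth: "\<And>\<rho> \<sigma> i j k l. is_irrep Q\<^sub>1 \<rho> \<Longrightarrow> (\<forall>a\<in>A. snd \<rho> (fst (f a)) = \<chi> a \<cdot>\<^sub>m 1\<^sub>m (fst \<rho>)) \<Longrightarrow>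
      is_irrep Q\<^sub>2 \<sigma> \<Longrightarrow> i < fst \<rho> \<Longrightarrow> j < fst \<rho> \<Longrightarrow> k < fst \<sigma> \<Longrightarrow> l < fst \<sigma> \<Longrightarrow>
      (\<Sum>h\<in>H. u h * (snd \<rho> (fst (f h)) $$ (i, j) * snd \<sigma> (snd (f h)) $$ (k, l))) = 0"
  shows "(\<Sum>a\<in>A. \<chi> a * u a) = 0"
proof -
  define U where "U h = (\<Sum>a\<in>A. \<chi> a * u (a \<otimes> h))" for h
  define F where "F q r = (\<Sum>h\<in>{h \<in> H. f h = (q, r)}. U h)" for q r
  have "F \<one>\<^bsub>Q\<^sub>1\<^esub> \<one>\<^bsub>Q\<^sub>2\<^esub> = 0"
  proof (rule Q.tensors_separate[OF Q_finite])
    fix \<rho> :: "'b rep" and \<sigma> :: "'c rep" and i j k l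
    assume p: "is_irrep Q\<^sub>1 \<rho>" and s: "is_irrep Q\<^sub>2 \<sigma>"
      and ij: "i < fst \<rho>" "j < fst \<rho>" and kl: "k < fst \<sigma>" "l < fst \<sigma>"
    have rp: "is_rep Q\<^sub>1 \<rho>" and rs: "is_rep Q\<^sub>2 \<sigma>" using p s by (auto simp: is_irrep_def)
    let ?\<phi> = "\<lambda>h i. snd \<rho> (fst (f h)) $$ (i, j)" and ?\<psi> = "\<lambda>h. snd \<sigma> (snd (f h)) $$ (k, l)"
    let ?W = "\<lambda>q r. snd \<rho> q $$ (i, j) * snd \<sigma> r $$ (k, l)"
    have "(\<Sum>q\<in>carrier Q\<^sub>1. \<Sum>r\<in>carrier Q\<^sub>2. F q r * ?W q r) =
      (\<Sum>(q, r)\<in>carrier Q\<^sub>1 \<times> carrier Q\<^sub>2. F q r * ?W q r)"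
      by (rule sum.cartesian_product)
    also have "\<dots> = (\<Sum>p\<in>carrier Q\<^sub>1 \<times> carrier Q\<^sub>2. \<Sum>h\<in>{h \<in> H. f h = p}. U h * (?\<phi> h i * ?\<psi> h))"
    proof (rule sum.cong[OF HOL.refl], elim SigmaE, simp only: prod.case)
      fix q r
      show "F q r * ?W q r = (\<Sum>h\<in>{h \<in> H. f h = (q, r)}. U h * (?\<phi> h i * ?\<psi> h))"
        unfolding F_def sum_distrib_right by (rule sum.cong) auto
    qed
    also have "\<dots> = (\<Sum>h\<in>H. U h * (?\<phi> h i * ?\<psi> h))"
      by (rule sum.group) (use finH Q_finite f.surj in \<open>auto simp: DirProd_def\<close>)
    also have "\<dots> = (\<Sum>a\<in>A. \<Sum>h\<in>H. \<chi> a * (u (a \<otimes> h) * (?\<phi> h i * ?\<psi> h)))"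
      unfolding U_def sum_distrib_right by (subst sum.swap) (simp only: mult.assoc)
    also have "\<dots> = (\<Sum>a\<in>A. \<Sum>h\<in>H. \<chi> a * (u h * (?\<phi> (inv a \<otimes> h) i * ?\<psi> h)))"
    proof (rule sum.cong[OF HOL.refl])
      fix a assume a: "a \<in> A"
      have "(\<Sum>h\<in>H. \<chi> a * (u (a \<otimes> h) * (?\<phi> h i * ?\<psi> h))) =
        (\<Sum>h\<in>H. (\<lambda>h. \<chi> a * (u h * (?\<phi> (inv a \<otimes> h) i * ?\<psi> h))) (a \<otimes> h))"
      proof (rule sum.cong[OF HOL.refl])
        fix h assume h: "h \<in> H"
        have "inv a \<otimes> (a \<otimes> h) = h" using a h A_closed H_closed by (simp add: inv_cancel)
        moreover have "snd (f (a \<otimes> h)) = snd (f h)"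
          using f_mult(2)[OF A_H[OF a] h] A_snd[OF a] f_carrier(2)[OF h] by simp
        ultimately show "\<chi> a * (u (a \<otimes> h) * (?\<phi> h i * ?\<psi> h)) =
          (\<lambda>h. \<chi> a * (u h * (?\<phi> (inv a \<otimes> h) i * ?\<psi> h))) (a \<otimes> h)" by simp
      qed
      thus "(\<Sum>h\<in>H. \<chi> a * (u (a \<otimes> h) * (?\<phi> h i * ?\<psi> h))) =
        (\<Sum>h\<in>H. \<chi> a * (u h * (?\<phi> (inv a \<otimes> h) i * ?\<psi> h)))"
        using sum_H_lmult[OF A_H[OF a], of "\<lambda>h. \<chi> a * (u h * (?\<phi> (inv a \<otimes> h) i * ?\<psi> h))"] by simp
    qed
    also have "\<dots> = 0"
      using isotypic_dichotomy[OF p]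
    proof
      assume iso: "\<forall>a\<in>A. snd \<rho> (fst (f a)) = \<chi> a \<cdot>\<^sub>m 1\<^sub>m (fst \<rho>)"
      show ?thesis
      proof (rule sum.neutral, rule ballI)
        fix a assume a: "a \<in> A"
        have "?\<phi> (inv a \<otimes> h) i = \<chi> a * ?\<phi> h i" if h: "h \<in> H" for h
        proof -
          have ia: "inv a \<in> H" using a A_inv A_H by auto
          have "?\<phi> (inv a \<otimes> h) i = (\<Sum>p<fst \<rho>. snd \<rho> (fst (f (inv a))) $$ (i, p) * ?\<phi> h p)"
            using f_mult(1)[OF ia h] Q.A.rep_mult_entry[OF rp f_carrier(1)[OF ia] f_carrier(1)[OF h] ij] by simp
          also have "\<dots> = (\<Sum>p<fst \<rho>. (if i = p then \<chi> a else 0) * ?\<phi> h p)"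
            using iso A_inv[OF a] ij \<chi>_inv[OF a] by (intro sum.cong) auto
          finally show ?thesis using ij by (simp add: sum_single)
        qed
        hence "(\<Sum>h\<in>H. \<chi> a * (u h * (?\<phi> (inv a \<otimes> h) i * ?\<psi> h))) =
          (\<Sum>h\<in>H. \<chi> a * \<chi> a * (u h * (?\<phi> h i * ?\<psi> h)))"
          by (intro sum.cong) auto
        also have "\<dots> = 0" using orth[OF p iso s ij kl] by (simp only: sum_distrib_left[symmetric] mult_zero_right)
        finally show "(\<Sum>h\<in>H. \<chi> a * (u h * (?\<phi> (inv a \<otimes> h) i * ?\<psi> h))) = 0" .
      qed
    next
      assume z: "\<forall>i<fst \<rho>. \<forall>j<fst \<rho>. (\<Sum>a\<in>A. \<chi> a * snd \<rho> (fst (f a)) $$ (i, j)) = 0"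
      have "(\<Sum>a\<in>A. \<Sum>h\<in>H. \<chi> a * (u h * (?\<phi> (inv a \<otimes> h) i * ?\<psi> h))) =
        (\<Sum>h\<in>H. \<Sum>a\<in>A. \<chi> a * (u h * (?\<phi> (inv a \<otimes> h) i * ?\<psi> h)))" by (rule sum.swap)
      also have "\<dots> = 0"
      proof (rule sum.neutral, rule ballI)
        fix h assume h: "h \<in> H"
        have "(\<Sum>a\<in>A. \<chi> a * (u h * (?\<phi> (inv a \<otimes> h) i * ?\<psi> h))) =
          (\<Sum>a\<in>A. (\<lambda>a. \<chi> a * (u h * (?\<phi> (a \<otimes> h) i * ?\<psi> h))) (inv a))"
          by (intro sum.cong) (auto simp: \<chi>_inv)
        also have "\<dots> = (\<Sum>a\<in>A. \<chi> a * (u h * (?\<phi> (a \<otimes> h) i * ?\<psi> h)))"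
          by (rule sum_A_inv)
        also have "\<dots> = (\<Sum>a\<in>A. \<Sum>p<fst \<rho>. u h * ?\<psi> h * ?\<phi> h p * (\<chi> a * snd \<rho> (fst (f a)) $$ (i, p)))"
        proof (rule sum.cong[OF HOL.refl])
          fix a assume a: "a \<in> A"
          have "?\<phi> (a \<otimes> h) i = (\<Sum>p<fst \<rho>. snd \<rho> (fst (f a)) $$ (i, p) * ?\<phi> h p)"
            using f_mult(1)[OF A_H[OF a] h] Q.A.rep_mult_entry[OF rp f_carrier(1)[OF A_H[OF a]] f_carrier(1)[OF h] ij] by simp
          thus "\<chi> a * (u h * (?\<phi> (a \<otimes> h) i * ?\<psi> h)) =
            (\<Sum>p<fst \<rho>. u h * ?\<psi> h * ?\<phi> h p * (\<chi> a * snd \<rho> (fst (f a)) $$ (i, p)))"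
            by (simp add: sum_distrib_left sum_distrib_right mult_ac)
        qed
        also have "\<dots> = (\<Sum>p<fst \<rho>. u h * ?\<psi> h * ?\<phi> h p * (\<Sum>a\<in>A. \<chi> a * snd \<rho> (fst (f a)) $$ (i, p)))"
          by (subst sum.swap) (simp only: sum_distrib_left)
        also have "\<dots> = 0" using z ij by simp
        finally show "(\<Sum>a\<in>A. \<chi> a * (u h * (?\<phi> (inv a \<otimes> h) i * ?\<psi> h))) = 0" .
      qed
      finally show ?thesis .
    qed
    finally show "(\<Sum>q\<in>carrier Q\<^sub>1. \<Sum>r\<in>carrier Q\<^sub>2. F q r * (snd \<rho> q $$ (i, j) * snd \<sigma> r $$ (k, l))) = 0" .
  qed simp_all
  moreover have "F \<one>\<^bsub>Q\<^sub>1\<^esub> \<one>\<^bsub>Q\<^sub>2\<^esub> = of_nat (card {h \<in> H. f h = (\<one>\<^bsub>Q\<^sub>1\<^esub>, \<one>\<^bsub>Q\<^sub>2\<^esub>)}) * (\<Sum>a\<in>A. \<chi> a * u a)"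
  proof -
    \<comment> \<open>Elements of the kernel of \<open>f\<close> lie in \<open>A\<close> and have
      \<chi> equal to 1, so the average is constant on the kernel and \<open>F\<close> at the
      identity is a positive multiple of the desired sum.\<close>
    have "U h = (\<Sum>a\<in>A. \<chi> a * u a)" if h: "h \<in> H" "f h = (\<one>\<^bsub>Q\<^sub>1\<^esub>, \<one>\<^bsub>Q\<^sub>2\<^esub>)" for h
    proof -
      have hA: "h \<in> A" and h1: "\<chi> h = 1" using kernel_A[OF h] by auto
      have "U h = (\<Sum>a\<in>A. (\<lambda>x. \<chi> x * u x) (a \<otimes> h))"
        unfolding U_def by (intro sum.cong) (simp_all add: \<chi>_mult hA h1)
      also have "\<dots> = (\<Sum>a\<in>A. \<chi> a * u a)" by (rule sum_A_rmult[OF hA])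
      finally show ?thesis .
    qed
    thus ?thesis unfolding F_def by simp
  qed
  moreover have "card {h \<in> H. f h = (\<one>\<^bsub>Q\<^sub>1\<^esub>, \<one>\<^bsub>Q\<^sub>2\<^esub>)} > 0"
    using H_one f_one finH by (auto simp: card_gt_0_iff)
  ultimately show ?thesis by simp
qed

end

section \<open>Tableaux and Young symmetrizers\<close>

lemma sum_list_take_mono: "r \<le> s \<Longrightarrow> sum_list (take r \<mu>) \<le> sum_list (take s (\<mu> :: nat list))"
proof -
  assume "r \<le> s"
  then obtain k where "s = r + k" using le_Suc_ex by blast
  thus ?thesis by (simp add: take_add)
qed

lemma tab_row_less:
  assumes x: "x \<in> {1..sum_list \<mu>}"
  shows "tab_row \<mu> x < r \<longleftrightarrow> x \<le> sum_list (take r \<mu>)"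
proof
  have "x \<le> sum_list (take (Suc (length \<mu>)) \<mu>)" using x by simp
  hence L: "x \<le> sum_list (take (Suc (tab_row \<mu> x)) \<mu>)"
    unfolding tab_row_def by (rule LeastI)
  assume "tab_row \<mu> x < r"
  thus "x \<le> sum_list (take r \<mu>)"
    using L sum_list_take_mono[of "Suc (tab_row \<mu> x)" r \<mu>] by linarith
next
  assume a: "x \<le> sum_list (take r \<mu>)"
  then obtain s where s: "r = Suc s" using x by (cases r) auto
  have "tab_row \<mu> x \<le> s" unfolding tab_row_def by (rule Least_le) (use a s in simp)
  thus "tab_row \<mu> x < r" using s by simp
qed

lemma card_tab_row_less: "card {x \<in> {1..sum_list \<mu>}. tab_row \<mu> x < r} = sum_list (take r \<mu>)"
proof -
  have "sum_list (take r \<mu>) \<le> sum_list \<mu>"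
    using sum_list_take_mono[of r "r + length \<mu>" \<mu>] by simp
  hence "{x \<in> {1..sum_list \<mu>}. tab_row \<mu> x < r} = {1..sum_list (take r \<mu>)}"
    using tab_row_less[of _ \<mu> r] by auto
  thus ?thesis by simp
qed

text \<open>A filling is described by the row and column of each entry. The second clause says that
  columns have no gaps above an entry; row lengths and the order of columns do not enter the
  dominance argument.\<close>

definition is_tab :: "'a set \<Rightarrow> ('a \<Rightarrow> nat) \<Rightarrow> ('a \<Rightarrow> nat) \<Rightarrow> bool" where
  "is_tab X rw cl \<longleftrightarrow> inj_on (\<lambda>x. (rw x, cl x)) X \<and>
     (\<forall>x\<in>X. \<forall>r<rw x. \<exists>y\<in>X. rw y = r \<and> cl y = cl x)"

lemma tab_row_bounds:
  assumes x: "x \<in> {1..sum_list \<mu>}"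
  shows "sum_list (take (tab_row \<mu> x) \<mu>) < x" "x \<le> sum_list (take (Suc (tab_row \<mu> x)) \<mu>)"
    "tab_row \<mu> x < length \<mu>"
  using tab_row_less[OF x, of "tab_row \<mu> x"] tab_row_less[OF x, of "Suc (tab_row \<mu> x)"]
    tab_row_less[OF x, of "length \<mu>"] x by auto

lemma is_tab_young:
  assumes s: "sorted_wrt (\<ge>) \<mu>"
  shows "is_tab {1..sum_list \<mu>} (tab_row \<mu>) (tab_col \<mu>)"
  unfolding is_tab_def
proof (intro conjI ballI allI impI)
  show "inj_on (\<lambda>x. (tab_row \<mu> x, tab_col \<mu> x)) {1..sum_list \<mu>}"
  proof (rule inj_onI)
    fix x y assume x: "x \<in> {1..sum_list \<mu>}" and y: "y \<in> {1..sum_list \<mu>}"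
      and eq: "(tab_row \<mu> x, tab_col \<mu> x) = (tab_row \<mu> y, tab_col \<mu> y)"
    show "x = y" using tab_row_bounds(1)[OF x] tab_row_bounds(1)[OF y] eq by (auto simp: tab_col_def)
  qed
  fix x r assume x: "x \<in> {1..sum_list \<mu>}" and r: "r < tab_row \<mu> x"
  note b = tab_row_bounds[OF x]
  have "\<mu> ! r \<ge> \<mu> ! tab_row \<mu> x" using s r b(3) by (simp add: sorted_wrt_iff_nth_less)
  moreover have "x \<le> sum_list (take (tab_row \<mu> x) \<mu>) + \<mu> ! tab_row \<mu> x"
    using b by (simp add: take_Suc_conv_app_nth)
  ultimately have c: "tab_col \<mu> x \<le> \<mu> ! r" "tab_col \<mu> x > 0" using b(1) by (auto simp: tab_col_def)
  \<comment> \<open>The entry of row \<open>r\<close> in the column of \<open>x\<close>; it exists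
    because rows higher up are at least as long.\<close>
  define y where "y = sum_list (take r \<mu>) + tab_col \<mu> x"
  have y2: "y \<le> sum_list (take (Suc r) \<mu>)" using c r b(3) by (simp add: y_def take_Suc_conv_app_nth)
  hence yX: "y \<in> {1..sum_list \<mu>}"
    using c sum_list_take_mono[of "Suc r" "Suc r + length \<mu>" \<mu>] by (simp add: y_def)
  have "tab_row \<mu> y < Suc r" "\<not> tab_row \<mu> y < r"
    using tab_row_less[OF yX] y2 c by (auto simp: y_def)
  hence "tab_row \<mu> y = r" by simp
  moreover from this have "tab_col \<mu> y = tab_col \<mu> x" by (simp add: tab_col_def y_def)
  ultimately show "\<exists>y\<in>{1..sum_list \<mu>}. tab_row \<mu> y = r \<and> tab_col \<mu> y = tab_col \<mu> x" using yX by blast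
qed

context
  fixes X :: "'a set" and rw rw' cl :: "'a \<Rightarrow> nat"
  assumes fin: "finite X" and tab: "is_tab X rw' cl" and inj: "inj_on (\<lambda>x. (rw x, cl x)) X"
begin

text \<open>If column \<open>c\<close> reaches row \<open>r\<close> for \<open>rw'\<close>, it has
  an entry in each of the \<open>r\<close> rows above, while \<open>rw\<close> is injective on the
  column and so has at most \<open>r\<close> values below \<open>r\<close>. Otherwise all entries of
  the column are counted on the right.\<close>

lemma column_card_le:
  "card {x \<in> X. cl x = c \<and> rw x < r} \<le> card {x \<in> X. cl x = c \<and> rw' x < r}"
proof (cases "\<exists>y\<in>X. cl y = c \<and> rw' y \<ge> r")
  case False
  hence "{x \<in> X. cl x = c \<and> rw x < r} \<subseteq> {x \<in> X. cl x = c \<and> rw' x < r}" by force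
  thus ?thesis using fin by (intro card_mono) auto
next
  case True
  then obtain y where y: "y \<in> X" "cl y = c" "rw' y \<ge> r" by blast
  have "inj_on rw {x \<in> X. cl x = c \<and> rw x < r}"
    using inj by (auto simp: inj_on_def)
  hence "card {x \<in> X. cl x = c \<and> rw x < r} = card (rw ` {x \<in> X. cl x = c \<and> rw x < r})"
    by (simp add: card_image)
  also have "\<dots> \<le> card {..<r}" by (intro card_mono) auto
  also have "{..<r} \<subseteq> rw' ` {x \<in> X. cl x = c \<and> rw' x < r}"
  proof
    fix s assume s: "s \<in> {..<r}"
    hence "s < rw' y" using y by simp
    then obtain z where "z \<in> X" "rw' z = s" "cl z = c" using tab y unfolding is_tab_def by metis
    thus "s \<in> rw' ` {x \<in> X. cl x = c \<and> rw' x < r}" using s by auto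
  qed
  hence "card {..<r} \<le> card {x \<in> X. cl x = c \<and> rw' x < r}"
    using fin surj_card_le[of "{x \<in> X. cl x = c \<and> rw' x < r}" "{..<r}" rw'] by simp
  finally show ?thesis .
qed

lemma card_columns: "card {x \<in> X. P x} = (\<Sum>c\<in>cl ` X. card {x \<in> X. cl x = c \<and> P x})"
proof -
  have "card {x \<in> X. P x} = (\<Sum>x\<in>{x \<in> X. P x}. 1)" by simp
  also have "\<dots> = (\<Sum>c\<in>cl ` X. \<Sum>x\<in>{x \<in> {x \<in> X. P x}. cl x = c}. 1)"
    by (rule sum.group[symmetric]) (use fin in auto)
  also have "\<dots> = (\<Sum>c\<in>cl ` X. card {x \<in> X. cl x = c \<and> P x})"
    by (intro sum.cong) (auto intro!: arg_cong[where f = card])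
  finally show ?thesis .
qed

lemma tab_dominance: "card {x \<in> X. rw x < r} \<le> card {x \<in> X. rw' x < r}"
  unfolding card_columns[of "\<lambda>x. rw x < r"] card_columns[of "\<lambda>x. rw' x < r"]
  by (intro sum_mono column_card_le)

text \<open>Equality of the totals forces equality in every column of \<open>column_card_le\<close>.
  Then \<open>rw\<close> and \<open>rw'\<close> take the same values on each column, and matching
  equal values permutes the columns.\<close>

lemma tab_rearrange:
  assumes eq: "\<And>r. card {x \<in> X. rw x < r} = card {x \<in> X. rw' x < r}"
  shows "\<exists>q. q permutes X \<and> (\<forall>x\<in>X. cl (q x) = cl x \<and> rw' (q x) = rw x)"
proof -
  have eqc: "card {x \<in> X. cl x = c \<and> rw x < r} = card {x \<in> X. cl x = c \<and> rw' x < r}" if c: "c \<in> cl ` X" for c r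
  proof (rule sum_mono_inv[OF _ column_card_le c])
    show "(\<Sum>c\<in>cl ` X. card {x \<in> X. cl x = c \<and> rw x < r}) = (\<Sum>c\<in>cl ` X. card {x \<in> X. cl x = c \<and> rw' x < r})"
      unfolding card_columns[of "\<lambda>x. rw x < r", symmetric] card_columns[of "\<lambda>x. rw' x < r", symmetric]
      by (rule eq)
  qed (use fin in auto)
  have "\<exists>y\<in>X. cl y = cl x \<and> rw' y = rw x" if x: "x \<in> X" for x
  proof -
    have split: "card {y \<in> X. cl y = cl x \<and> f y < Suc (rw x)} =
      card {y \<in> X. cl y = cl x \<and> f y < rw x} + card {y \<in> X. cl y = cl x \<and> f y = rw x}" for f :: "'a \<Rightarrow> nat"
      by (subst card_Un_disjoint[symmetric]) (use fin in \<open>auto intro!: arg_cong[where f = card]\<close>)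
    have "card {y \<in> X. cl y = cl x \<and> rw' y = rw x} = card {y \<in> X. cl y = cl x \<and> rw y = rw x}"
      using split[of rw] split[of rw'] eqc[of "cl x"] x by simp
    also have "\<dots> > 0" using x fin by (auto simp: card_gt_0_iff)
    finally show ?thesis using fin by (auto simp: card_gt_0_iff)
  qed
  then obtain f where f: "\<And>x. x \<in> X \<Longrightarrow> f x \<in> X \<and> cl (f x) = cl x \<and> rw' (f x) = rw x" by metis
  have inj_f: "inj_on f X"
  proof (rule inj_onI)
    fix x y assume xy: "x \<in> X" "y \<in> X" "f x = f y"
    hence "(rw x, cl x) = (rw y, cl y)" using f[of x] f[of y] by auto
    thus "x = y" using inj xy by (simp add: inj_on_def)
  qed
  have "f ` X = X" using endo_inj_surj[OF fin _ inj_f] f by auto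
  define q where "q x = (if x \<in> X then f x else x)" for x
  have "bij_betw q X X" using inj_f \<open>f ` X = X\<close> by (simp add: bij_betw_def q_def inj_on_def)
  hence "q permutes X" by (rule bij_imp_permutes) (simp add: q_def)
  thus ?thesis using f by (intro exI[of _ q]) (simp add: q_def)
qed

end

lemma row_groupD:
  assumes "p \<in> row_group \<mu>"
  shows "p permutes {1..sum_list \<mu>}" "x \<in> {1..sum_list \<mu>} \<Longrightarrow> tab_row \<mu> (p x) = tab_row \<mu> x"
  using assms by (auto simp: row_group_def)

lemma col_groupD:
  assumes "p \<in> col_group \<mu>"
  shows "p permutes {1..sum_list \<mu>}" "x \<in> {1..sum_list \<mu>} \<Longrightarrow> tab_col \<mu> (p x) = tab_col \<mu> x"
  using assms by (auto simp: col_group_def)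

lemma row_group_closed:
  assumes "p \<in> row_group \<mu>" "p' \<in> row_group \<mu>"
  shows "p \<circ> p' \<in> row_group \<mu>" "inv' p \<in> row_group \<mu>"
proof -
  let ?X = "{1..sum_list \<mu>}"
  note P = row_groupD[OF assms(1)] and P' = row_groupD[OF assms(2)]
  show "p \<circ> p' \<in> row_group \<mu>"
    using permutes_compose[OF P'(1) P(1)] P P' permutes_in_image[OF P'(1)] by (auto simp: row_group_def)
  have "tab_row \<mu> (inv' p x) = tab_row \<mu> x" if x: "x \<in> ?X" for x
  proof -
    have "inv' p x \<in> ?X" using permutes_in_image[OF permutes_inv[OF P(1)]] x by blast
    from P(2)[OF this] show ?thesis using permutes_inverses(1)[OF P(1)] by simp
  qed
  thus "inv' p \<in> row_group \<mu>" using permutes_inv[OF P(1)] by (simp add: row_group_def)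
qed

lemma col_group_closed:
  assumes "p \<in> col_group \<mu>" "p' \<in> col_group \<mu>"
  shows "p \<circ> p' \<in> col_group \<mu>" "inv' p \<in> col_group \<mu>"
proof -
  let ?X = "{1..sum_list \<mu>}"
  note P = col_groupD[OF assms(1)] and P' = col_groupD[OF assms(2)]
  show "p \<circ> p' \<in> col_group \<mu>"
    using permutes_compose[OF P'(1) P(1)] P P' permutes_in_image[OF P'(1)] by (auto simp: col_group_def)
  have "tab_col \<mu> (inv' p x) = tab_col \<mu> x" if x: "x \<in> ?X" for x
  proof -
    have "inv' p x \<in> ?X" using permutes_in_image[OF permutes_inv[OF P(1)]] x by blast
    from P(2)[OF this] show ?thesis using permutes_inverses(1)[OF P(1)] by simp
  qed
  thus "inv' p \<in> col_group \<mu>" using permutes_inv[OF P(1)] by (simp add: col_group_def)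
qed

text \<open>If no two entries share a row of the first tableau and a column of the second, shifted one,
  then sorting the columns of the second tableau by the rows of the first produces \<open>p\<close> and \<open>q\<close>.\<close>

lemma tab_pair:
  assumes s: "sorted_wrt (\<ge>) \<mu>" and k: "sum_list \<kappa> = k" "sum_list \<mu> = k" and g: "g permutes {1..k}"
    and np: "\<And>x y. x \<in> {1..k} \<Longrightarrow> y \<in> {1..k} \<Longrightarrow> x \<noteq> y \<Longrightarrow> tab_row \<kappa> x = tab_row \<kappa> y \<Longrightarrow>
      tab_col \<mu> (inv' g x) = tab_col \<mu> (inv' g y) \<Longrightarrow> False"
  shows "sum_list (take r \<kappa>) \<le> sum_list (take r \<mu>)"
    and "\<kappa> = \<mu> \<Longrightarrow> \<exists>p\<in>row_group \<mu>. \<exists>q\<in>col_group \<mu>. g = p \<circ> q"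
proof -
  let ?X = "{1..k}"
  define cl where "cl = tab_col \<mu> \<circ> inv' g"
  define rw' where "rw' = tab_row \<mu> \<circ> inv' g"
  have ig: "inv' g permutes ?X" by (rule permutes_inv[OF g])
  have igX: "inv' g x \<in> ?X \<longleftrightarrow> x \<in> ?X" for x by (rule permutes_in_image[OF ig])
  have T: "is_tab ?X (tab_row \<mu>) (tab_col \<mu>)" using is_tab_young[OF s] k by simp
  have tab: "is_tab ?X rw' cl"
    unfolding is_tab_def
  proof (intro conjI ballI allI impI)
    show "inj_on (\<lambda>x. (rw' x, cl x)) ?X"
    proof (rule inj_onI)
      fix x y assume xy: "x \<in> ?X" "y \<in> ?X" "(rw' x, cl x) = (rw' y, cl y)"
      have "(tab_row \<mu> (inv' g x), tab_col \<mu> (inv' g x)) = (tab_row \<mu> (inv' g y), tab_col \<mu> (inv' g y))"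
        using xy(3) by (simp add: rw'_def cl_def)
      moreover have "inv' g x \<in> ?X" "inv' g y \<in> ?X" using igX xy(1,2) by blast+
      ultimately have "inv' g x = inv' g y"
        by (rule inj_onD[OF T[unfolded is_tab_def, THEN conjunct1]])
      thus "x = y" using permutes_inj[OF ig] by (simp add: inj_eq)
    qed
    fix x r assume x: "x \<in> ?X" and r: "r < rw' x"
    have "\<exists>y\<in>?X. tab_row \<mu> y = r \<and> tab_col \<mu> y = tab_col \<mu> (inv' g x)"
    proof -
      have "inv' g x \<in> ?X" using igX x by blast
      moreover have "r < tab_row \<mu> (inv' g x)" using r by (simp add: rw'_def)
      ultimately show ?thesis using T unfolding is_tab_def by blast
    qed
    then obtain y where y: "y \<in> ?X" "tab_row \<mu> y = r" "tab_col \<mu> y = tab_col \<mu> (inv' g x)" by blast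
    have "g y \<in> ?X" using y permutes_in_image[OF g] by blast
    moreover have "rw' (g y) = r" "cl (g y) = cl x"
      using y permutes_inverses(2)[OF g] by (simp_all add: rw'_def cl_def)
    ultimately show "\<exists>y\<in>?X. rw' y = r \<and> cl y = cl x" by blast
  qed
  have inj: "inj_on (\<lambda>x. (tab_row \<kappa> x, cl x)) ?X"
    by (rule inj_onI) (use np in \<open>auto simp: cl_def\<close>)
  have cnt: "card {x \<in> ?X. rw' x < r} = sum_list (take r \<mu>)" for r
  proof -
    have "bij_betw g {x \<in> ?X. tab_row \<mu> x < r} {x \<in> ?X. rw' x < r}"
    proof (rule bij_betwI[where g = "inv' g"])
      show "g \<in> {x \<in> ?X. tab_row \<mu> x < r} \<rightarrow> {x \<in> ?X. rw' x < r}"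
      proof (rule Pi_I)
        fix x assume x: "x \<in> {x \<in> ?X. tab_row \<mu> x < r}"
        have "g x \<in> ?X" using permutes_in_image[OF g] x by blast
        thus "g x \<in> {x \<in> ?X. rw' x < r}" using x permutes_inverses(2)[OF g] by (simp add: rw'_def)
      qed
      show "inv' g \<in> {x \<in> ?X. rw' x < r} \<rightarrow> {x \<in> ?X. tab_row \<mu> x < r}"
      proof (rule Pi_I)
        fix x assume x: "x \<in> {x \<in> ?X. rw' x < r}"
        have "inv' g x \<in> ?X" using igX x by blast
        thus "inv' g x \<in> {x \<in> ?X. tab_row \<mu> x < r}" using x by (simp add: rw'_def)
      qed
    qed (simp_all add: permutes_inverses[OF g])
    hence "card {x \<in> ?X. rw' x < r} = card {x \<in> ?X. tab_row \<mu> x < r}"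
      by (rule bij_betw_same_card[symmetric])
    thus ?thesis using card_tab_row_less[of \<mu> r] k by simp
  qed
  show "sum_list (take r \<kappa>) \<le> sum_list (take r \<mu>)"
    using tab_dominance[OF _ tab inj, of r] card_tab_row_less[of \<kappa> r] cnt[of r] k by simp
  show "\<exists>p\<in>row_group \<mu>. \<exists>q\<in>col_group \<mu>. g = p \<circ> q" if "\<kappa> = \<mu>"
  proof -
    have "card {x \<in> ?X. tab_row \<kappa> x < r} = card {x \<in> ?X. rw' x < r}" for r
      using cnt[of r] card_tab_row_less[of \<kappa> r] k that by simp
    from tab_rearrange[OF _ tab inj this] obtain q where q': "q permutes ?X"
      "\<forall>x\<in>?X. cl (q x) = cl x \<and> rw' (q x) = tab_row \<kappa> x" by blast
    have q: "q permutes ?X" "\<And>x. x \<in> ?X \<Longrightarrow> cl (q x) = cl x" "\<And>x. x \<in> ?X \<Longrightarrow> rw' (q x) = tab_row \<mu> x"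
      using q' that by blast+
    define p where "p = inv' g \<circ> q"
    have p: "p permutes ?X" unfolding p_def by (rule permutes_compose[OF q(1) ig])
    have "tab_row \<mu> (p x) = tab_row \<mu> x" if "x \<in> ?X" for x
      using q(3)[OF that] by (simp add: p_def rw'_def)
    hence pR: "p \<in> row_group \<mu>" using p unfolding row_group_def k by blast
    have pg: "p \<circ> g permutes ?X" by (rule permutes_compose[OF g p])
    have "tab_col \<mu> ((p \<circ> g) x) = tab_col \<mu> x" if "x \<in> ?X" for x
    proof -
      have "g x \<in> ?X" using that permutes_in_image[OF g] by blast
      from q(2)[OF this] show ?thesis using permutes_inverses(2)[OF g, of x] by (simp add: p_def cl_def)
    qed
    hence pC: "p \<circ> g \<in> col_group \<mu>" using pg unfolding col_group_def k by blast
    have "g = inv' p \<circ> (p \<circ> g)" using permutes_inverses(2)[OF p] by (simp add: fun_eq_iff)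
    thus ?thesis using row_group_closed(2)[OF pR pR] pC by blast
  qed
qed

section \<open>The group algebra of a symmetric group\<close>

declare sym_group_inv_equality [simp del]

text \<open>The product of the group algebra. The first factor is read only on the group, the second
  also outside of it, which is why supports are tracked separately.\<close>

definition conv :: "nat \<Rightarrow> ((nat \<Rightarrow> nat) \<Rightarrow> complex) \<Rightarrow> ((nat \<Rightarrow> nat) \<Rightarrow> complex) \<Rightarrow> (nat \<Rightarrow> nat) \<Rightarrow> complex" where
  "conv k f h x = (\<Sum>g\<in>carrier (sym_group k). f g * h (inv\<^bsub>sym_group k\<^esub> g \<circ> x))"

lemma left_ideal_conv: "left_ideal k c = range (\<lambda>a. conv k a c)"
  unfolding left_ideal_def conv_def[abs_def] by auto

lemma finite_sym_group: "finite (carrier (sym_group k))"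
  unfolding sym_group_def by (simp add: finite_permutations)

lemma sym_simps:
  "x \<otimes>\<^bsub>sym_group k\<^esub> y = x \<circ> y" "\<one>\<^bsub>sym_group k\<^esub> = id"
  by (simp_all add: sym_group_mult sym_group_one)

context
  fixes k :: nat
begin

interpretation S: group "sym_group k" by (rule sym_group_is_group)

abbreviation (input) "SC \<equiv> carrier (sym_group k)"
abbreviation (input) "iv \<equiv> m_inv (sym_group k)"

lemma SC_comp: "x \<in> SC \<Longrightarrow> y \<in> SC \<Longrightarrow> x \<circ> y \<in> SC"
  using S.m_closed by (simp add: sym_simps)

lemma SC_id: "id \<in> SC"
  using S.one_closed by (simp add: sym_simps)

lemma iv_comp: "g \<in> SC \<Longrightarrow> iv g \<circ> g = id" "g \<in> SC \<Longrightarrow> g \<circ> iv g = id"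
  using S.l_inv S.r_inv by (simp_all add: sym_simps)

lemma iv_cancel: "g \<in> SC \<Longrightarrow> iv g \<circ> (g \<circ> x) = x" "g \<in> SC \<Longrightarrow> g \<circ> (iv g \<circ> x) = x"
  by (simp_all add: iv_comp comp_assoc[symmetric])

lemma iv_mult: "g \<in> SC \<Longrightarrow> h \<in> SC \<Longrightarrow> iv (g \<circ> h) = iv h \<circ> iv g"
  using S.inv_mult_group by (simp add: sym_simps)

lemma iv_id: "iv id = id"
  using S.inv_one by (simp add: sym_simps)

lemma SC_sum: "a \<in> SC \<Longrightarrow> (\<Sum>g\<in>SC. F (a \<circ> g)) = (\<Sum>g\<in>SC. F g)"
  "a \<in> SC \<Longrightarrow> (\<Sum>g\<in>SC. F (g \<circ> a)) = (\<Sum>g\<in>SC. F g)"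
  using S.sum_lmult[of a F] S.sum_rmult[of a F] by (simp_all add: sym_simps)

lemma SC_out: "g \<in> SC \<Longrightarrow> x \<notin> SC \<Longrightarrow> iv g \<circ> x \<notin> SC"
  using SC_comp[of g "iv g \<circ> x"] by (auto simp: iv_cancel)

lemma conv_assoc: "conv k (conv k f h) u = conv k f (conv k h u)"
proof (rule ext)
  fix x
  have "conv k (conv k f h) u x = (\<Sum>g\<in>SC. \<Sum>v\<in>SC. f v * (h (iv v \<circ> g) * u (iv g \<circ> x)))"
    by (simp add: conv_def sum_distrib_right mult.assoc)
  also have "\<dots> = (\<Sum>v\<in>SC. \<Sum>g\<in>SC. f v * (h (iv v \<circ> g) * u (iv g \<circ> x)))"
    by (rule sum.swap)
  also have "\<dots> = (\<Sum>v\<in>SC. f v * (\<Sum>w\<in>SC. h w * u (iv w \<circ> (iv v \<circ> x))))"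
  proof (rule sum.cong[OF HOL.refl])
    fix v assume v: "v \<in> SC"
    have "(\<Sum>g\<in>SC. f v * (h (iv v \<circ> g) * u (iv g \<circ> x))) =
      (\<Sum>w\<in>SC. f v * (h (iv v \<circ> (v \<circ> w)) * u (iv (v \<circ> w) \<circ> x)))"
      by (rule SC_sum(1)[OF v, symmetric])
    also have "\<dots> = (\<Sum>w\<in>SC. f v * (h w * u (iv w \<circ> (iv v \<circ> x))))"
      by (rule sum.cong[OF HOL.refl]) (simp add: iv_cancel v iv_mult comp_assoc)
    finally show "(\<Sum>g\<in>SC. f v * (h (iv v \<circ> g) * u (iv g \<circ> x))) =
      f v * (\<Sum>w\<in>SC. h w * u (iv w \<circ> (iv v \<circ> x)))" by (simp only: sum_distrib_left)
  qed
  finally show "conv k (conv k f h) u x = conv k f (conv k h u) x" by (simp add: conv_def)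
qed

lemma conv_left:
  assumes p: "p \<in> SC" and f: "\<And>g. g \<in> SC \<Longrightarrow> f (p \<circ> g) = f g"
  shows "conv k f h (p \<circ> x) = conv k f h x"
proof -
  have "conv k f h (p \<circ> x) = (\<Sum>g\<in>SC. f (p \<circ> g) * h (iv (p \<circ> g) \<circ> (p \<circ> x)))"
    unfolding conv_def by (rule SC_sum(1)[OF p, symmetric])
  also have "\<dots> = conv k f h x"
    unfolding conv_def by (rule sum.cong[OF HOL.refl]) (simp add: p f iv_mult comp_assoc iv_cancel)
  finally show ?thesis .
qed

lemma conv_right:
  assumes "\<And>x. h (x \<circ> q) = s * h x"
  shows "conv k f h (x \<circ> q) = s * conv k f h x"
  using assms by (simp add: conv_def sum_distrib_left comp_assoc[symmetric] mult_ac)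

lemma conv_support:
  assumes "\<And>x. x \<notin> SC \<Longrightarrow> h x = 0" "x \<notin> SC"
  shows "conv k f h x = 0"
  using assms by (simp add: conv_def SC_out)

lemma conv_unit: "conv k (\<lambda>g. if g = id then 1 else 0) h = h"
proof (rule ext)
  fix x
  have "conv k (\<lambda>g. if g = id then 1 else 0) h x = (\<Sum>g\<in>SC. if g = id then h x else 0)"
    unfolding conv_def by (rule sum.cong) (auto simp: iv_id)
  thus "conv k (\<lambda>g. if g = id then 1 else 0) h x = h x" using finite_sym_group SC_id by simp
qed

lemma left_ideal_subspace: "funs.subspace (left_ideal k c)"
proof (rule fun_subspaceI)
  show "(\<lambda>x. 0) \<in> left_ideal k c"
    unfolding left_ideal_conv by (rule range_eqI[of _ _ "\<lambda>_. 0"]) (simp add: conv_def fun_eq_iff)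
next
  fix f h assume "f \<in> left_ideal k c" "h \<in> left_ideal k c"
  then obtain a b where "f = conv k a c" "h = conv k b c" unfolding left_ideal_conv by auto
  thus "(\<lambda>x. f x + h x) \<in> left_ideal k c"
    unfolding left_ideal_conv
    by (intro range_eqI[of _ _ "\<lambda>g. a g + b g"]) (simp add: conv_def fun_eq_iff distrib_right sum.distrib)
next
  fix s f assume "f \<in> left_ideal k c"
  then obtain a where "f = conv k a c" unfolding left_ideal_conv by auto
  thus "(\<lambda>x. s * f x) \<in> left_ideal k c"
    unfolding left_ideal_conv
    by (intro range_eqI[of _ _ "\<lambda>g. s * a g"]) (simp add: conv_def fun_eq_iff sum_distrib_left mult.assoc)
qed

lemma left_ideal_inv:
  assumes g: "g \<in> SC" and f: "f \<in> left_ideal k c"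
  shows "(\<lambda>x. f (iv g \<circ> x)) \<in> left_ideal k c"
proof -
  obtain a where a: "f = conv k a c" using f unfolding left_ideal_conv by auto
  have "f (iv g \<circ> x) = conv k (\<lambda>u. a (iv g \<circ> u)) c x" for x
  proof -
    have "conv k (\<lambda>u. a (iv g \<circ> u)) c x = (\<Sum>h\<in>SC. a (iv g \<circ> (g \<circ> h)) * c (iv (g \<circ> h) \<circ> x))"
      unfolding conv_def by (rule SC_sum(1)[OF g, symmetric])
    also have "\<dots> = f (iv g \<circ> x)"
      unfolding a conv_def by (rule sum.cong[OF HOL.refl]) (simp add: g iv_cancel iv_mult comp_assoc)
    finally show ?thesis ..
  qed
  thus ?thesis unfolding left_ideal_conv by (intro range_eqI[of _ _ "\<lambda>u. a (iv g \<circ> u)"]) auto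
qed

text \<open>A convolution is a linear combination of left translates of its second factor.\<close>

lemma conv_in_invariant:
  assumes W: "funs.subspace W" and inv: "\<And>g f. g \<in> SC \<Longrightarrow> f \<in> W \<Longrightarrow> (\<lambda>x. f (iv g \<circ> x)) \<in> W" and w: "w \<in> W"
  shows "conv k a w \<in> W"
  unfolding conv_def[abs_def] by (rule fun_subspace_sum[OF W, where F = "\<lambda>g x. w (iv g \<circ> x)"]) (rule inv[OF _ w])

end

lemma finite_row_group: "finite (row_group \<mu>)"
  by (rule finite_subset[OF _ finite_permutations[of "{1..sum_list \<mu>}"]]) (auto simp: row_group_def)

lemma finite_col_group: "finite (col_group \<mu>)"
  by (rule finite_subset[OF _ finite_permutations[of "{1..sum_list \<mu>}"]]) (auto simp: col_group_def)

lemma young_symmetrizer_left: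
  assumes p: "p \<in> row_group \<mu>"
  shows "young_symmetrizer \<mu> (p \<circ> x) = young_symmetrizer \<mu> x"
  unfolding young_symmetrizer_def
proof (rule sum.reindex_bij_witness[where i = "\<lambda>u. p \<circ> u" and j = "\<lambda>u. inv' p \<circ> u"])
  note P = row_groupD(1)[OF p]
  have i: "inv' p \<circ> (p \<circ> u) = u" "p \<circ> (inv' p \<circ> u) = u" for u
    using permutes_inv_o[OF P] by (simp_all add: comp_assoc[symmetric])
  fix u assume u: "u \<in> row_group \<mu>"
  show "inv' p \<circ> (p \<circ> u) = u" "p \<circ> (inv' p \<circ> u) = u" by (rule i)+
  show "p \<circ> u \<in> row_group \<mu>" "inv' p \<circ> u \<in> row_group \<mu>"
    using row_group_closed p u by blast+
  have "inv' p \<circ> u \<circ> q = x \<longleftrightarrow> u \<circ> q = p \<circ> x" for q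
    using i by (metis comp_assoc)
  thus "(\<Sum>q\<in>col_group \<mu>. if inv' p \<circ> u \<circ> q = x then of_int (sign q) else 0) =
    (\<Sum>q\<in>col_group \<mu>. if u \<circ> q = p \<circ> x then of_int (sign q) else 0)" by simp
qed

lemma col_group_permutation: "q \<in> col_group \<mu> \<Longrightarrow> permutation q"
  using col_groupD(1) permutation_permutes by (metis finite_atLeastAtMost)

lemma young_symmetrizer_right:
  assumes q: "q \<in> col_group \<mu>"
  shows "young_symmetrizer \<mu> (x \<circ> q) = of_int (sign q) * young_symmetrizer \<mu> x"
  unfolding young_symmetrizer_def sum_distrib_left
proof (rule sum.cong[OF HOL.refl])
  note Q = col_groupD(1)[OF q]
  have i: "u \<circ> q \<circ> inv' q = u" "u \<circ> inv' q \<circ> q = u" for u :: "nat \<Rightarrow> nat"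
    using permutes_inv_o[OF Q] by (simp_all add: comp_assoc)
  fix p
  show "(\<Sum>u\<in>col_group \<mu>. if p \<circ> u = x \<circ> q then of_int (sign u) else 0) =
    (\<Sum>u\<in>col_group \<mu>. of_int (sign q) * (if p \<circ> u = x then of_int (sign u) else (0::complex)))"
  proof (rule sum.reindex_bij_witness[where i = "\<lambda>u. u \<circ> q" and j = "\<lambda>u. u \<circ> inv' q"])
    fix u assume u: "u \<in> col_group \<mu>"
    show "u \<circ> inv' q \<circ> q = u" "u \<circ> q \<circ> inv' q = u" by (rule i)+
    show uq: "u \<circ> inv' q \<in> col_group \<mu>" "u \<circ> q \<in> col_group \<mu>" using col_group_closed q u by blast+
    have "p \<circ> (u \<circ> inv' q) = x \<longleftrightarrow> p \<circ> u = x \<circ> q"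
      using i by (metis comp_assoc)
    moreover have "sign u = sign (u \<circ> inv' q) * sign q"
      using sign_compose[OF col_group_permutation[OF uq(1)] col_group_permutation[OF q]] i(2)[of u] by simp
    ultimately show "of_int (sign q) * (if p \<circ> (u \<circ> inv' q) = x then of_int (sign (u \<circ> inv' q)) else 0) =
      (if p \<circ> u = x \<circ> q then of_int (sign u) else (0::complex))" by simp
  qed
qed

lemma young_symmetrizer_support:
  assumes "\<not> x permutes {1..sum_list \<mu>}"
  shows "young_symmetrizer \<mu> x = 0"
  unfolding young_symmetrizer_def
proof (rule sum.neutral, rule ballI, rule sum.neutral, rule ballI)
  fix p q assume "p \<in> row_group \<mu>" "q \<in> col_group \<mu>"
  hence "p \<circ> q permutes {1..sum_list \<mu>}"
    using permutes_compose[OF col_groupD(1) row_groupD(1)] by blast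
  thus "(if p \<circ> q = x then of_int (sign q) else (0::complex)) = 0" using assms by auto
qed

lemma row_col_trivial:
  assumes s: "sorted_wrt (\<ge>) \<mu>" and "q \<in> row_group \<mu>" "q \<in> col_group \<mu>"
  shows "q = id"
proof (rule ext)
  fix x
  show "q x = id x"
  proof (cases "x \<in> {1..sum_list \<mu>}")
    case True
    have "q x \<in> {1..sum_list \<mu>}" using permutes_in_image[OF row_groupD(1)[OF assms(2)]] True by blast
    moreover have "(tab_row \<mu> (q x), tab_col \<mu> (q x)) = (tab_row \<mu> x, tab_col \<mu> x)"
      using row_groupD(2)[OF assms(2) True] col_groupD(2)[OF assms(3) True] by simp
    ultimately have "q x = x"
      using is_tab_young[OF s] True unfolding is_tab_def inj_on_def by blast
    thus ?thesis by simp
  next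
    case False
    thus ?thesis using row_groupD(1)[OF assms(2)] by (simp add: permutes_not_in)
  qed
qed

lemma id_row_col: "id \<in> row_group \<mu>" "id \<in> col_group \<mu>"
  by (simp_all add: row_group_def col_group_def permutes_id)

text \<open>Row and column group intersect trivially, so the identity arises from one pair
  \<open>(p, q)\<close> only. This normalises the symmetrizer and shows that it is nonzero.\<close>

lemma young_symmetrizer_id:
  assumes s: "sorted_wrt (\<ge>) \<mu>"
  shows "young_symmetrizer \<mu> id = 1"
proof -
  have "young_symmetrizer \<mu> id = (\<Sum>p\<in>row_group \<mu>. if p = id then 1 else 0)"
    unfolding young_symmetrizer_def
  proof (rule sum.cong[OF HOL.refl])
    fix p assume p: "p \<in> row_group \<mu>"
    have "(\<Sum>q\<in>col_group \<mu>. if p \<circ> q = id then of_int (sign q) else (0::complex)) =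
      (\<Sum>q\<in>col_group \<mu>. if q = id then (if p = id then 1 else 0) else 0)"
    proof (rule sum.cong[OF HOL.refl])
      fix q assume q: "q \<in> col_group \<mu>"
      have "p = id \<and> q = id" if pq: "p \<circ> q = id"
      proof -
        have "q = inv' p \<circ> (p \<circ> q)"
          using permutes_inv_o(2)[OF row_groupD(1)[OF p]] by (simp add: comp_assoc[symmetric])
        hence "q = inv' p" using pq by simp
        hence "q \<in> row_group \<mu>" using row_group_closed(2)[OF p p] by simp
        from row_col_trivial[OF s this q] have "q = id" .
        thus ?thesis using pq by simp
      qed
      thus "(if p \<circ> q = id then of_int (sign q) else (0::complex)) =
        (if q = id then (if p = id then 1 else 0) else 0)" by (auto simp: sign_id)
    qed
    thus "(\<Sum>q\<in>col_group \<mu>. if p \<circ> q = id then of_int (sign q) else (0::complex)) = (if p = id then 1 else 0)"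
      using finite_col_group id_row_col by simp
  qed
  thus ?thesis using finite_row_group id_row_col by simp
qed

lemma transpose_conj:
  assumes "bij g"
  shows "Transposition.transpose x y \<circ> g = g \<circ> Transposition.transpose (inv' g x) (inv' g y)"
proof (rule ext)
  fix z
  have "g z = x \<longleftrightarrow> z = inv' g x" "g z = y \<longleftrightarrow> z = inv' g y" "g (inv' g x) = x" "g (inv' g y) = y"
    using assms by (metis bij_inv_eq_iff)+
  thus "(Transposition.transpose x y \<circ> g) z = (g \<circ> Transposition.transpose (inv' g x) (inv' g y)) z"
    by (auto simp: Transposition.transpose_def)
qed

context
  fixes \<kappa> \<mu> :: "nat list" and k :: nat and f :: "(nat \<Rightarrow> nat) \<Rightarrow> complex"
  assumes s: "sorted_wrt (\<ge>) \<mu>" and k: "sum_list \<kappa> = k" "sum_list \<mu> = k"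
    and left: "\<And>p x. p \<in> row_group \<kappa> \<Longrightarrow> f (p \<circ> x) = f x"
    and right: "\<And>q x. q \<in> col_group \<mu> \<Longrightarrow> f (x \<circ> q) = of_int (sign q) * f x"
begin

text \<open>The transposition of \<open>x\<close> and \<open>y\<close> can be absorbed on the left
  without a sign and, conjugated by \<open>g\<close>, on the right with the sign -1.\<close>

lemma biinvariant_vanishes:
  assumes g: "g permutes {1..k}" and xy: "x \<in> {1..k}" "y \<in> {1..k}" "x \<noteq> y"
    and r: "tab_row \<kappa> x = tab_row \<kappa> y" and c: "tab_col \<mu> (inv' g x) = tab_col \<mu> (inv' g y)"
  shows "f g = 0"
proof -
  let ?t = "Transposition.transpose x y" and ?u = "Transposition.transpose (inv' g x) (inv' g y)"
  have "inv' g x \<in> {1..k}" "inv' g y \<in> {1..k}"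
    using permutes_in_image[OF permutes_inv[OF g]] xy by blast+
  hence "?u permutes {1..k}" by (rule permutes_swap_id)
  moreover have "tab_col \<mu> (?u z) = tab_col \<mu> z" for z
    using c by (simp add: Transposition.transpose_def)
  ultimately have u: "?u \<in> col_group \<mu>" unfolding col_group_def k by blast
  have "?t permutes {1..k}" using xy by (intro permutes_swap_id)
  moreover have "tab_row \<kappa> (?t z) = tab_row \<kappa> z" for z
    using r by (simp add: Transposition.transpose_def)
  ultimately have t: "?t \<in> row_group \<kappa>" unfolding row_group_def k by blast
  have ne: "inv' g x \<noteq> inv' g y" using permutes_inj[OF permutes_inv[OF g]] xy(3) by (simp add: inj_eq)
  have "f g = f (?t \<circ> g)" by (rule left[OF t, symmetric])
  also have "\<dots> = f (g \<circ> ?u)" using transpose_conj[OF permutes_bij[OF g]] by simp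
  also have "\<dots> = - f g" unfolding right[OF u] using ne by (simp add: sign_swap_id)
  finally show ?thesis by simp
qed

text \<open>Without dominance, \<open>tab_pair\<close> yields for every \<open>g\<close> two entries
  in a common row and a common shifted column.\<close>

lemma biinvariant_zero:
  assumes g: "g permutes {1..k}" and "\<not> (\<forall>r. sum_list (take r \<kappa>) \<le> sum_list (take r \<mu>))"
  shows "f g = 0"
  using tab_pair(1)[OF s k g] biinvariant_vanishes[OF g] assms(2) by blast

end

text \<open>Von Neumann's characterisation of the symmetrizer. Either two entries collide and both
  sides vanish, or \<open>g\<close> is a product of a row and a column permutation and both sides
  are determined by their value at \<open>id\<close>.\<close>

lemma biinvariant_multiple:
  fixes f :: "(nat \<Rightarrow> nat) \<Rightarrow> complex"
  assumes s: "sorted_wrt (\<ge>) \<mu>" and k: "sum_list \<mu> = k"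
    and left: "\<And>p x. p \<in> row_group \<mu> \<Longrightarrow> f (p \<circ> x) = f x"
    and right: "\<And>q x. q \<in> col_group \<mu> \<Longrightarrow> f (x \<circ> q) = of_int (sign q) * f x"
    and g: "g permutes {1..k}"
  shows "f g = f id * young_symmetrizer \<mu> g"
proof (cases "\<exists>x\<in>{1..k}. \<exists>y\<in>{1..k}. x \<noteq> y \<and> tab_row \<mu> x = tab_row \<mu> y \<and> tab_col \<mu> (inv' g x) = tab_col \<mu> (inv' g y)")
  case True
  then obtain x y where xy: "x \<in> {1..k}" "y \<in> {1..k}" "x \<noteq> y" "tab_row \<mu> x = tab_row \<mu> y"
    "tab_col \<mu> (inv' g x) = tab_col \<mu> (inv' g y)" by blast
  have "f g = 0" by (rule biinvariant_vanishes[OF s k k left right g xy])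
  moreover have "young_symmetrizer \<mu> g = 0"
    by (rule biinvariant_vanishes[OF s k k young_symmetrizer_left young_symmetrizer_right g xy])
  ultimately show ?thesis by simp
next
  case False
  obtain p q where pq: "p \<in> row_group \<mu>" "q \<in> col_group \<mu>" "g = p \<circ> q"
    using tab_pair(2)[OF s k k g _ HOL.refl] False by blast
  have "f g = of_int (sign q) * f id" using left[OF pq(1), of q] right[OF pq(2), of id] pq(3) by simp
  moreover have "young_symmetrizer \<mu> g = of_int (sign q)"
    using young_symmetrizer_left[OF pq(1), of q] young_symmetrizer_right[OF pq(2), of id]
      young_symmetrizer_id[OF s] pq(3) by simp
  ultimately show ?thesis by simp
qed

text \<open>For a self-adjoint element \<open>y\<close>, i.e. \<open>y(g\<^sup>-\<^sup>1) = cnj y(g)\<close>, the value of \<open>y * y\<close> at \<open>1\<close> is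
  \<open>\<Sum> |y|\<^sup>2\<close>; this is applied to \<open>y = w\<^sup>* w\<close>.\<close>

lemma annihilated_left_ideal_zero:
  assumes sub: "funs.subspace W" and WL: "W \<subseteq> left_ideal k c" and supp: "\<And>x. x \<notin> carrier (sym_group k) \<Longrightarrow> c x = 0"
    and inv: "\<And>g f. g \<in> carrier (sym_group k) \<Longrightarrow> f \<in> W \<Longrightarrow> (\<lambda>x. f (inv\<^bsub>sym_group k\<^esub> g \<circ> x)) \<in> W"
    and null: "\<And>w. w \<in> W \<Longrightarrow> conv k c w = (\<lambda>x. 0)"
    and w: "w \<in> W"
  shows "w = (\<lambda>x. 0)"
proof -
  interpret S: group "sym_group k" by (rule sym_group_is_group)
  let ?S = "carrier (sym_group k)" and ?i = "m_inv (sym_group k)"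
  define y where "y = conv k (\<lambda>g. cnj (w (?i g))) w"
  have yW: "y \<in> W" unfolding y_def by (rule conv_in_invariant[OF sub inv w])
  then obtain a where a: "y = conv k a c" using WL unfolding left_ideal_conv by blast
  \<comment> \<open>As \<open>y\<close> is a left multiple of \<open>c\<close>, the product of
    \<open>y\<close> with itself is a left multiple of the product of \<open>c\<close> and
    \<open>y\<close>, which is zero by \<open>null\<close>.\<close>
  have yy: "conv k y y = (\<lambda>x. 0)"
  proof -
    have "conv k y y = conv k a (conv k c y)" unfolding conv_assoc[symmetric] a[symmetric] ..
    thus ?thesis unfolding null[OF yW] by (simp add: conv_def[abs_def])
  qed
  have y: "y g = (\<Sum>h\<in>?S. cnj (w h) * w (h \<circ> g))" for g
    using S.sum_inv[of "\<lambda>h. cnj (w h) * w (h \<circ> g)"] by (simp add: y_def conv_def)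
  have adj: "y (?i g) = cnj (y g)" if g: "g \<in> ?S" for g
  proof -
    have "y (?i g) = (\<Sum>h\<in>?S. cnj (w (h \<circ> g)) * w (h \<circ> g \<circ> ?i g))"
      unfolding y by (rule SC_sum(2)[OF g, symmetric])
    also have "\<dots> = (\<Sum>h\<in>?S. cnj (w (h \<circ> g)) * w h)"
      by (simp add: comp_assoc iv_comp[OF g])
    also have "\<dots> = cnj (y g)" by (simp add: y mult.commute)
    finally show ?thesis .
  qed
  have pos: "\<forall>g\<in>?S. u g = 0" if "(\<Sum>g\<in>?S. u g * cnj (u g)) = 0" for u :: "(nat \<Rightarrow> nat) \<Rightarrow> complex"
  proof -
    have "complex_of_real (\<Sum>g\<in>?S. (cmod (u g))\<^sup>2) = (\<Sum>g\<in>?S. u g * cnj (u g))"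
      by (simp add: complex_norm_square del: of_real_power)
    hence "(\<Sum>g\<in>?S. (cmod (u g))\<^sup>2) = 0" using that by (simp only: of_real_eq_0_iff)
    thus ?thesis using finite_sym_group by (simp add: sum_nonneg_eq_0_iff)
  qed
  have "conv k y y id = (\<Sum>g\<in>?S. y g * cnj (y g))"
    unfolding conv_def by (rule sum.cong) (simp_all add: adj)
  hence "\<forall>g\<in>?S. y g = 0" using yy by (intro pos) simp
  \<comment> \<open>The value of \<open>y\<close> at \<open>id\<close> is the sum of the squared
    absolute values of \<open>w\<close>, so positivity is applied a second time.\<close>
  hence "y id = 0" using SC_id by simp
  hence "(\<Sum>g\<in>?S. w g * cnj (w g)) = 0" unfolding y by (simp add: mult.commute)
  hence wS: "\<forall>g\<in>?S. w g = 0" by (rule pos)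
  obtain b where "w = conv k b c" using w WL unfolding left_ideal_conv by blast
  hence "w x = 0" if "x \<notin> ?S" for x using conv_support[OF supp that] by simp
  thus ?thesis using wS by (intro ext) blast
qed

section \<open>Minimality of the left ideal of a Young symmetrizer\<close>

context
  fixes k :: nat and \<mu> :: "nat list"
  assumes s: "sorted_wrt (\<ge>) \<mu>" and k: "sum_list \<mu> = k"
begin

lemma ys_support: "x \<notin> carrier (sym_group k) \<Longrightarrow> young_symmetrizer \<mu> x = 0"
  using young_symmetrizer_support k by (simp add: sym_group_carrier)

lemma row_SC: "p \<in> row_group \<mu> \<Longrightarrow> p \<in> carrier (sym_group k)"
  using row_groupD(1) k by (auto simp: sym_group_carrier)

text \<open>The product inherits left invariance from its first factor and right sign-invariance
  from its last, so \<open>biinvariant_multiple\<close> applies.\<close>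

lemma ys_sandwich:
  "\<exists>t. conv k (young_symmetrizer \<mu>) (conv k a (young_symmetrizer \<mu>)) = (\<lambda>x. t * young_symmetrizer \<mu> x)"
proof -
  let ?c = "young_symmetrizer \<mu>"
  let ?f = "conv k ?c (conv k a ?c)"
  have "?f x = ?f id * ?c x" for x
  proof (cases "x permutes {1..k}")
    case True
    show ?thesis
    proof (rule biinvariant_multiple[OF s k _ _ True])
      show "?f (p \<circ> x) = ?f x" if "p \<in> row_group \<mu>" for p x
        by (rule conv_left[OF row_SC[OF that]]) (rule young_symmetrizer_left[OF that])
      show "?f (x \<circ> q) = of_int (sign q) * ?f x" if "q \<in> col_group \<mu>" for q x
        by (intro conv_right young_symmetrizer_right that)
    qed
  next
    case False
    hence x: "x \<notin> carrier (sym_group k)" by (simp add: sym_group_carrier)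
    have "?f x = 0" by (rule conv_support[OF conv_support[OF ys_support] x])
    thus ?thesis using ys_support[OF x] by simp
  qed
  thus ?thesis by (intro exI[of _ "?f id"] ext)
qed

lemma ys_in_left_ideal: "young_symmetrizer \<mu> \<in> left_ideal k (young_symmetrizer \<mu>)"
  unfolding left_ideal_conv by (metis conv_unit rangeI)

lemma ys_nonzero: "young_symmetrizer \<mu> \<noteq> (\<lambda>x. 0)"
  using young_symmetrizer_id[OF s] by (metis zero_neq_one)

lemma left_ideal_support: "f \<in> left_ideal k (young_symmetrizer \<mu>) \<Longrightarrow> x \<notin> carrier (sym_group k) \<Longrightarrow> f x = 0"
proof -
  assume "f \<in> left_ideal k (young_symmetrizer \<mu>)" and x: "x \<notin> carrier (sym_group k)"
  then obtain a where "f = conv k a (young_symmetrizer \<mu>)" unfolding left_ideal_conv by blast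
  moreover have "conv k a (young_symmetrizer \<mu>) x = 0" by (rule conv_support[OF ys_support x])
  ultimately show "f x = 0" by simp
qed

text \<open>If the symmetrizer \<open>c\<close> annihilates \<open>W\<close>, then \<open>W\<close>
  is zero. Otherwise some product of \<open>c\<close> with an element of \<open>W\<close> is a
  nonzero multiple of \<open>c\<close> by \<open>ys_sandwich\<close>, so \<open>W\<close> contains
  the generator.\<close>

lemma left_ideal_minimal:
  assumes sub: "funs.subspace W" and WL: "W \<subseteq> left_ideal k (young_symmetrizer \<mu>)"
    and inv: "\<And>g f. g \<in> carrier (sym_group k) \<Longrightarrow> f \<in> W \<Longrightarrow> (\<lambda>x. f (inv\<^bsub>sym_group k\<^esub> g \<circ> x)) \<in> W"
  shows "W = {\<lambda>x. 0} \<or> W = left_ideal k (young_symmetrizer \<mu>)"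
proof (cases "\<forall>w\<in>W. conv k (young_symmetrizer \<mu>) w = (\<lambda>x. 0)")
  case True
  hence "W \<subseteq> {\<lambda>x. 0}"
    using annihilated_left_ideal_zero[OF sub WL ys_support inv] by blast
  thus ?thesis using fun_subspaceD(1)[OF sub] by blast
next
  case False
  then obtain w where w: "w \<in> W" "conv k (young_symmetrizer \<mu>) w \<noteq> (\<lambda>x. 0)" by blast
  obtain a where a: "w = conv k a (young_symmetrizer \<mu>)" using w WL unfolding left_ideal_conv by blast
  obtain t where t: "conv k (young_symmetrizer \<mu>) w = (\<lambda>x. t * young_symmetrizer \<mu> x)"
    using ys_sandwich a by blast
  have t0: "t \<noteq> 0" using w(2) t by auto
  have "(\<lambda>x. t * young_symmetrizer \<mu> x) \<in> W"
    unfolding t[symmetric] by (rule conv_in_invariant[OF sub inv w(1)])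
  from fun_subspaceD(3)[OF sub this, of "1 / t"] have c: "young_symmetrizer \<mu> \<in> W" using t0 by simp
  have "conv k b (young_symmetrizer \<mu>) \<in> W" for b by (rule conv_in_invariant[OF sub inv c])
  hence "left_ideal k (young_symmetrizer \<mu>) \<subseteq> W" unfolding left_ideal_conv by blast
  thus ?thesis using WL by blast
qed

lemma affords_exists: "\<exists>\<pi>. affords k (left_ideal k (young_symmetrizer \<mu>)) \<pi>"
proof -
  let ?L = "left_ideal k (young_symmetrizer \<mu>)"
  obtain b where b: "fun_basis (funs.dim ?L) b ?L"
    using fun_basis_exists[OF finite_sym_group[of k] left_ideal_subspace] left_ideal_support by blast
  obtain M where "\<forall>g\<in>carrier (sym_group k). M g \<in> carrier_mat (funs.dim ?L) (funs.dim ?L) \<and>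
    (\<forall>j<funs.dim ?L. \<forall>x. b j (inv\<^bsub>sym_group k\<^esub> g \<circ> x) = (\<Sum>i<funs.dim ?L. M g $$ (i, j) * b i x))"
    using basis_matrix_exists[OF b, of "carrier (sym_group k)" "\<lambda>g x. inv\<^bsub>sym_group k\<^esub> g \<circ> x"] left_ideal_inv by blast
  thus ?thesis using b unfolding affords_def fun_basis_def
    by (intro exI[of _ "(funs.dim ?L, M)"] exI[of _ b]) simp
qed

lemma affordsD:
  assumes "affords k (left_ideal k (young_symmetrizer \<mu>)) \<pi>"
  obtains b where "fun_basis (fst \<pi>) b (left_ideal k (young_symmetrizer \<mu>))"
    "\<forall>g\<in>carrier (sym_group k). snd \<pi> g \<in> carrier_mat (fst \<pi>) (fst \<pi>) \<and>
      (\<forall>j<fst \<pi>. \<forall>x. b j (inv\<^bsub>sym_group k\<^esub> g \<circ> x) = (\<Sum>i<fst \<pi>. snd \<pi> g $$ (i, j) * b i x))"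
  using assms unfolding affords_def fun_basis_def by blast

lemma affords_irrep:
  assumes "affords k (left_ideal k (young_symmetrizer \<mu>)) \<pi>"
  shows "is_irrep (sym_group k) \<pi>"
proof -
  let ?L = "left_ideal k (young_symmetrizer \<mu>)"
  let ?s = "\<lambda>g x. inv\<^bsub>sym_group k\<^esub> g \<circ> x"
  obtain b where b: "fun_basis (fst \<pi>) b ?L"
    and M: "\<forall>g\<in>carrier (sym_group k). snd \<pi> g \<in> carrier_mat (fst \<pi>) (fst \<pi>) \<and>
      (\<forall>j<fst \<pi>. \<forall>x. b j (?s g x) = (\<Sum>i<fst \<pi>. snd \<pi> g $$ (i, j) * b i x))"
    using assms by (rule affordsD)
  have "is_rep (sym_group k) (fst \<pi>, snd \<pi>)"
  proof (rule basis_matrix_rep[where s = ?s and b = b, OF sym_group_is_group b M])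
    show "f (?s \<one>\<^bsub>sym_group k\<^esub> x) = f x" for f :: "(nat \<Rightarrow> nat) \<Rightarrow> complex" and x
      by (simp add: sym_simps iv_id)
    show "f (?s (g \<otimes>\<^bsub>sym_group k\<^esub> h) x) = f (?s h (?s g x))"
      if "g \<in> carrier (sym_group k)" "h \<in> carrier (sym_group k)" for f :: "(nat \<Rightarrow> nat) \<Rightarrow> complex" and g h x
      using that by (simp add: sym_simps iv_mult comp_assoc)
  qed
  moreover have "fst \<pi> > 0"
  proof (rule ccontr)
    assume "\<not> fst \<pi> > 0"
    obtain a where "young_symmetrizer \<mu> = (\<lambda>x. \<Sum>i<fst \<pi>. a i * b i x)"
      by (rule fun_basis_repr[OF b ys_in_left_ideal])
    thus False using \<open>\<not> fst \<pi> > 0\<close> ys_nonzero by simp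
  qed
  ultimately have "is_irrep (sym_group k) (fst \<pi>, snd \<pi>)"
    using basis_matrix_irrep[where s = ?s and b = b, OF sym_group_is_group b M _ _ left_ideal_minimal] by blast
  thus ?thesis by simp
qed

end

text \<open>Without dominance the symmetrizer of \<kappa> annihilates the ideal of \<mu> by
  \<open>biinvariant_zero\<close>. An isomorphism would make it annihilate its own ideal, which
  \<open>annihilated_left_ideal_zero\<close> excludes.\<close>

lemma not_dominated_not_iso:
  assumes s: "sorted_wrt (\<ge>) \<kappa>" "sorted_wrt (\<ge>) \<mu>" and k: "sum_list \<kappa> = k" "sum_list \<mu> = k"
    and aff: "affords k (left_ideal k (young_symmetrizer \<kappa>)) \<pi>" "affords k (left_ideal k (young_symmetrizer \<mu>)) \<sigma>"
    and nd: "\<not> (\<forall>r. sum_list (take r \<kappa>) \<le> sum_list (take r \<mu>))"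
  shows "\<not> rep_iso (sym_group k) \<pi> \<sigma>"
proof
  interpret S: group "sym_group k" by (rule sym_group_is_group)
  let ?S = "carrier (sym_group k)"
  assume iso: "rep_iso (sym_group k) \<pi> \<sigma>"
  let ?s = "\<lambda>g x. inv\<^bsub>sym_group k\<^esub> g \<circ> x" and ?c = "young_symmetrizer \<kappa>" and ?e = "young_symmetrizer \<mu>"
  have rp: "is_rep (sym_group k) \<pi>" and rs: "is_rep (sym_group k) \<sigma>"
    using affords_irrep[OF s(1) k(1) aff(1)] affords_irrep[OF s(2) k(2) aff(2)] by (simp_all add: is_irrep_def)
  obtain b where b: "fun_basis (fst \<pi>) b (left_ideal k ?c)"
    and M: "\<forall>g\<in>?S. snd \<pi> g \<in> carrier_mat (fst \<pi>) (fst \<pi>) \<and>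
      (\<forall>j<fst \<pi>. \<forall>x. b j (?s g x) = (\<Sum>i<fst \<pi>. snd \<pi> g $$ (i, j) * b i x))"
    using aff(1) by (rule affordsD[OF s(1) k(1)])
  obtain b' where b': "fun_basis (fst \<sigma>) b' (left_ideal k ?e)"
    and M': "\<forall>g\<in>?S. snd \<sigma> g \<in> carrier_mat (fst \<sigma>) (fst \<sigma>) \<and>
      (\<forall>j<fst \<sigma>. \<forall>x. b' j (?s g x) = (\<Sum>i<fst \<sigma>. snd \<sigma> g $$ (i, j) * b' i x))"
    using aff(2) by (rule affordsD[OF s(2) k(2)])
  have act: "conv k a (bb j) x = (\<Sum>i<d. (\<Sum>g\<in>?S. a g * N g $$ (i, j)) * bb i x)"
    if "\<forall>g\<in>?S. N g \<in> carrier_mat d d \<and> (\<forall>j<d. \<forall>x. bb j (?s g x) = (\<Sum>i<d. N g $$ (i, j) * bb i x))" "j < d"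
    for a bb N d j x
  proof -
    have "conv k a (bb j) x = (\<Sum>g\<in>?S. \<Sum>i<d. a g * N g $$ (i, j) * bb i x)"
      unfolding conv_def
    proof (rule sum.cong[OF HOL.refl])
      fix g assume g: "g \<in> ?S"
      have "bb j (?s g x) = (\<Sum>i<d. N g $$ (i, j) * bb i x)" using that g by blast
      thus "a g * bb j (?s g x) = (\<Sum>i<d. a g * N g $$ (i, j) * bb i x)"
        by (simp add: sum_distrib_left mult.assoc)
    qed
    also have "\<dots> = (\<Sum>i<d. \<Sum>g\<in>?S. a g * N g $$ (i, j) * bb i x)" by (rule sum.swap)
    finally show ?thesis by (simp only: sum_distrib_right)
  qed
  have z: "(\<Sum>g\<in>?S. ?c g * snd \<sigma> g $$ (i, j)) = 0" if ij: "i < fst \<sigma>" "j < fst \<sigma>" for i j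
  proof -
    obtain a where a: "b' j = conv k a ?e"
      using fun_basis_in(2)[OF b' ij(2)] unfolding left_ideal_conv by blast
    have "conv k ?c (b' j) x = 0" for x
    proof (cases "x permutes {1..k}")
      case True
      show ?thesis unfolding a
      proof (rule biinvariant_zero[OF s(2) k _ _ True nd])
        show "conv k ?c (conv k a ?e) (p \<circ> x) = conv k ?c (conv k a ?e) x" if "p \<in> row_group \<kappa>" for p x
          by (rule conv_left[OF row_SC[OF s(1) k(1) that]]) (rule young_symmetrizer_left[OF that])
        show "conv k ?c (conv k a ?e) (x \<circ> q) = of_int (sign q) * conv k ?c (conv k a ?e) x"
          if "q \<in> col_group \<mu>" for q x
          by (intro conv_right young_symmetrizer_right that)
      qed
    next
      case False
      hence x: "x \<notin> ?S" by (simp add: sym_group_carrier)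
      show ?thesis unfolding a by (rule conv_support[OF conv_support[OF ys_support[OF s(2) k(2)]] x])
    qed
    hence "\<forall>x. (\<Sum>i<fst \<sigma>. (\<Sum>g\<in>?S. ?c g * snd \<sigma> g $$ (i, j)) * b' i x) = 0"
      unfolding act[OF M' ij(2), symmetric] by blast
    hence "\<And>x. (\<Sum>i<fst \<sigma>. (\<Sum>g\<in>?S. ?c g * snd \<sigma> g $$ (i, j)) * b' i x) = (\<Sum>i<fst \<sigma>. 0 * b' i x)" by simp
    from fun_basis_unique[OF b' this ij(1)] show ?thesis .
  qed
  have z': "(\<Sum>g\<in>?S. ?c g * snd \<pi> g $$ (i, j)) = 0" if "i < fst \<pi>" "j < fst \<pi>" for i j
    by (rule S.rep_iso_sum_zero[OF rp rs iso z that])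
  have "conv k ?c w = (\<lambda>x. 0)" if w: "w \<in> left_ideal k ?c" for w
  proof (rule ext)
    fix x
    obtain a where a: "w = (\<lambda>x. \<Sum>j<fst \<pi>. a j * b j x)" by (rule fun_basis_repr[OF b w])
    have "conv k ?c w x = (\<Sum>g\<in>?S. \<Sum>j<fst \<pi>. a j * (?c g * b j (?s g x)))"
      unfolding a conv_def by (simp add: sum_distrib_left mult_ac)
    also have "\<dots> = (\<Sum>j<fst \<pi>. \<Sum>g\<in>?S. a j * (?c g * b j (?s g x)))" by (rule sum.swap)
    also have "\<dots> = (\<Sum>j<fst \<pi>. a j * conv k ?c (b j) x)" by (simp add: conv_def sum_distrib_left)
    also have "\<dots> = (\<Sum>j<fst \<pi>. 0)"
      by (rule sum.cong[OF HOL.refl]) (simp add: act[OF M] z')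
    finally show "conv k ?c w x = 0" by simp
  qed
  from annihilated_left_ideal_zero[OF left_ideal_subspace subset_refl ys_support[OF s(1) k(1)] left_ideal_inv this
      ys_in_left_ideal[OF s(1) k(1)]]
  show False using ys_nonzero[OF s(1) k(1)] by simp
qed

text \<open>The padding condition is exactly what keeps the added first row longest. For
  \<open>k = 0\<close> the shape is \<open>[0]\<close>, with an empty first row.\<close>

lemma paddable_shape:
  assumes "paddable k \<nu>"
  shows "sorted_wrt (\<ge>) ((k - sum_list \<nu>) # \<nu>)" "sum_list ((k - sum_list \<nu>) # \<nu>) = k"
proof -
  have \<nu>: "sorted_wrt (\<ge>) \<nu>" "sum_list \<nu> + (if \<nu> = [] then 0 else hd \<nu>) \<le> k"
    using assms by (auto simp: paddable_def is_partition_def)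
  have "x \<le> k - sum_list \<nu>" if x: "x \<in> set \<nu>" for x
  proof -
    have "x \<le> hd \<nu>" using x \<nu>(1) by (cases \<nu>) auto
    thus ?thesis using \<nu>(2) x by (cases \<nu>) auto
  qed
  thus "sorted_wrt (\<ge>) ((k - sum_list \<nu>) # \<nu>)" using \<nu>(1) by simp
  show "sum_list ((k - sum_list \<nu>) # \<nu>) = k" using \<nu>(2) by simp
qed

lemma Sym_irrep_affords:
  assumes "paddable k \<nu>"
  shows "affords k (left_ideal k (young_symmetrizer ((k - sum_list \<nu>) # \<nu>))) (Sym_irrep k \<nu>)"
  unfolding Sym_irrep_def by (rule someI_ex[OF affords_exists[OF paddable_shape[OF assms]]])

lemma Sym_irrep_irrep: "paddable k \<nu> \<Longrightarrow> is_irrep (sym_group k) (Sym_irrep k \<nu>)"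
  by (rule affords_irrep[OF paddable_shape Sym_irrep_affords])

lemma partial_sums_eq:
  assumes pos: "\<forall>x\<in>set \<kappa>. 0 < x" "\<forall>x\<in>set \<mu>. (0::nat) < x"
    and eq: "\<And>r. sum_list (take r \<kappa>) = sum_list (take r \<mu>)"
  shows "\<kappa> = \<mu>"
  using assms
proof (induction \<kappa> arbitrary: \<mu>)
  case Nil
  show ?case
  proof (cases \<mu>)
    case (Cons y ys)
    thus ?thesis using Nil(3)[of 1] Nil(2) by simp
  qed simp
next
  case (Cons x xs)
  show ?case
  proof (cases \<mu>)
    case Nil
    thus ?thesis using Cons.prems(3)[of 1] Cons.prems(1) by simp
  next
    case (Cons y ys)
    have "x = y" using Cons.prems(3)[of 1] Cons by simp
    moreover have "sum_list (take r xs) = sum_list (take r ys)" for r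
      using Cons.prems(3)[of "Suc r"] Cons \<open>x = y\<close> by simp
    ultimately show ?thesis using Cons.IH[of ys] Cons.prems(1,2) Cons by simp
  qed
qed

text \<open>Isomorphism in both directions gives dominance in both directions, hence equal partial
  sums. The added first row may be zero, so the comparison of lists with positive entries is made on
  the tails.\<close>

lemma Sym_irrep_iso_eq:
  assumes p: "paddable k \<nu>" "paddable k \<nu>'" and iso: "rep_iso (sym_group k) (Sym_irrep k \<nu>) (Sym_irrep k \<nu>')"
  shows "\<nu> = \<nu>'"
proof -
  interpret S: group "sym_group k" by (rule sym_group_is_group)
  note sh = paddable_shape[OF p(1)] paddable_shape[OF p(2)]
  note aff = Sym_irrep_affords[OF p(1)] Sym_irrep_affords[OF p(2)]
  have "rep_iso (sym_group k) (Sym_irrep k \<nu>') (Sym_irrep k \<nu>)"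
    using S.rep_iso_sym[OF _ _ iso] Sym_irrep_irrep[OF p(1)] Sym_irrep_irrep[OF p(2)] by (simp add: is_irrep_def)
  hence "\<forall>r. sum_list (take r ((k - sum_list \<nu>) # \<nu>)) \<le> sum_list (take r ((k - sum_list \<nu>') # \<nu>'))"
    "\<forall>r. sum_list (take r ((k - sum_list \<nu>') # \<nu>')) \<le> sum_list (take r ((k - sum_list \<nu>) # \<nu>))"
    using not_dominated_not_iso[OF sh(1,3,2,4) aff] not_dominated_not_iso[OF sh(3,1,4,2) aff(2,1)] iso by blast+
  hence eq: "sum_list (take r ((k - sum_list \<nu>) # \<nu>)) = sum_list (take r ((k - sum_list \<nu>') # \<nu>'))" for r
    by (simp only: order_antisym)
  have "sum_list (take r \<nu>) = sum_list (take r \<nu>')" for r using eq[of "Suc r"] eq[of 1] by simp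
  thus ?thesis using p by (intro partial_sums_eq) (auto simp: paddable_def is_partition_def)
qed

subsection \<open>Conjugacy classes of permutations and completeness\<close>

definition orb :: "('a \<Rightarrow> 'a) \<Rightarrow> 'a \<Rightarrow> 'a set" where
  "orb g x = range (\<lambda>n. (g ^^ n) x)"

text \<open>Fixed points are counted as cycles of length 1, so that the lengths add up to the size
  of \<open>X\<close>.\<close>

definition cycle_mset :: "'a set \<Rightarrow> ('a \<Rightarrow> 'a) \<Rightarrow> nat multiset" where
  "cycle_mset X g = image_mset card (mset_set (orb g ` X))"

context
  fixes X :: "'a set" and g :: "'a \<Rightarrow> 'a"
  assumes fin: "finite X" and perm: "g permutes X"
begin

lemma perm_permutation: "permutation g"
  using fin perm permutation_permutes by blast

lemma funpow_permutes: "(g ^^ n) permutes X"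
  by (induction n) (simp_all only: funpow.simps permutes_id permutes_compose[OF _ perm])

lemma least_power_pos: "least_power g x > 0"
  using least_power_of_permutation(2)[OF perm_permutation] .

lemma funpow_eq_iff: "(g ^^ n) x = (g ^^ m) x \<longleftrightarrow> n mod least_power g x = m mod least_power g x"
proof -
  have le: "(g ^^ n) x = (g ^^ m) x \<longleftrightarrow> n mod least_power g x = m mod least_power g x" if nm: "n \<le> m" for n m
  proof -
    have "(g ^^ m) x = (g ^^ n) ((g ^^ (m - n)) x)"
      using nm funpow_add[of n "m - n" g] by simp
    hence "(g ^^ n) x = (g ^^ m) x \<longleftrightarrow> (g ^^ (m - n)) x = x"
      using permutes_inj[OF funpow_permutes[of n]] by (metis injD)
    also have "\<dots> \<longleftrightarrow> least_power g x dvd (m - n)"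
      using least_power_dvd[OF perm_permutation] by metis
    also have "\<dots> \<longleftrightarrow> m mod least_power g x = n mod least_power g x"
      using mod_eq_dvd_iff_nat[OF nm] by metis
    finally show ?thesis by metis
  qed
  show ?thesis using le[of n m] le[of m n] by (cases "n \<le> m") (auto simp: eq_commute)
qed

lemma card_orb: "card (orb g x) = least_power g x"
proof -
  let ?c = "least_power g x"
  have "orb g x = (\<lambda>n. (g ^^ n) x) ` {..<?c}"
  proof
    show "orb g x \<subseteq> (\<lambda>n. (g ^^ n) x) ` {..<?c}"
    proof
      fix y assume "y \<in> orb g x"
      then obtain n where "y = (g ^^ n) x" by (auto simp: orb_def)
      also have "\<dots> = (g ^^ (n mod ?c)) x" using funpow_eq_iff by simp
      finally show "y \<in> (\<lambda>n. (g ^^ n) x) ` {..<?c}" using least_power_pos by auto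
    qed
  qed (auto simp: orb_def)
  moreover have "inj_on (\<lambda>n. (g ^^ n) x) {..<?c}"
    by (rule inj_onI) (simp add: funpow_eq_iff)
  ultimately show ?thesis by (simp add: card_image)
qed

lemma orb_self: "x \<in> orb g x"
  unfolding orb_def by (rule range_eqI[of _ _ 0]) simp

lemma orb_funpow: "orb g ((g ^^ n) x) = orb g x"
proof -
  let ?c = "least_power g x"
  have "(g ^^ m) ((g ^^ n) x) = (g ^^ (m + n)) x" for m by (simp add: funpow_add)
  hence 1: "orb g ((g ^^ n) x) \<subseteq> orb g x" by (auto simp: orb_def)
  have "(g ^^ m) x \<in> orb g ((g ^^ n) x)" for m
  proof -
    \<comment> \<open>Going back \<open>n\<close> steps is going forward \<open>?c * n - n\<close>
      steps; the cycle length is multiplied by \<open>n\<close> to keep the difference a genuine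
      one.\<close>
    have "1 * n \<le> ?c * n" using least_power_pos[of x] by (intro mult_le_mono1) simp
    hence "(m + (?c * n - n)) + n = m + ?c * n" by linarith
    hence "(g ^^ ((m + (?c * n - n)) + n)) x = (g ^^ m) x" by (simp only: funpow_eq_iff) simp
    hence "(g ^^ m) x = (g ^^ (m + (?c * n - n))) ((g ^^ n) x)" by (simp add: funpow_add)
    thus ?thesis unfolding orb_def by blast
  qed
  thus ?thesis using 1 by (auto simp: orb_def)
qed

lemma orb_eq: "y \<in> orb g x \<Longrightarrow> orb g y = orb g x"
proof -
  assume "y \<in> orb g x"
  then obtain n where "y = (g ^^ n) x" by (auto simp: orb_def)
  thus "orb g y = orb g x" using orb_funpow by simp
qed

lemma orb_subset: "x \<in> X \<Longrightarrow> orb g x \<subseteq> X"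
  using permutes_in_image[OF funpow_permutes] by (fastforce simp: orb_def)

lemma orb_card_pos: "card (orb g x) > 0"
  using card_orb least_power_pos by simp

lemma sum_cycle_mset: "sum_mset (cycle_mset X g) = card X"
proof -
  have "sum_mset (cycle_mset X g) = (\<Sum>o'\<in>orb g ` X. card o')"
    by (simp add: cycle_mset_def sum_unfold_sum_mset)
  also have "\<dots> = card (\<Union> (orb g ` X))"
  proof (rule card_Union_disjoint[symmetric])
    show "pairwise disjnt (orb g ` X)"
    proof (rule pairwiseI)
      fix a b assume ab: "a \<in> orb g ` X" "b \<in> orb g ` X" "a \<noteq> b"
      have "False" if "y \<in> a" "y \<in> b" for y
        using ab that orb_eq by blast
      thus "disjnt a b" by (auto simp: disjnt_def)
    qed
    show "finite A" if "A \<in> orb g ` X" for A using that orb_subset fin by (auto intro: finite_subset)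
  qed
  also have "\<Union> (orb g ` X) = X" using orb_subset orb_self by blast
  finally show ?thesis .
qed

lemma cycle_mset_pos: "n \<in># cycle_mset X g \<Longrightarrow> n > 0"
  using orb_card_pos fin by (auto simp: cycle_mset_def)

end

text \<open>Match the cycles of \<open>g\<close> and \<open>h\<close> by length and send \<open>g\<^sup>n a\<^sub>i\<close> to \<open>h\<^sup>n b\<^sub>i\<close>.\<close>

lemma cycle_mset_conj:
  assumes fin: "finite X" and g: "g permutes X" and h: "h permutes X" and eq: "cycle_mset X g = cycle_mset X h"
  shows "\<exists>\<theta>. \<theta> permutes X \<and> \<theta> \<circ> g = h \<circ> \<theta>"
proof -
  obtain xs where xs: "set xs = orb g ` X" "distinct xs"
    using finite_distinct_list[OF finite_imageI[OF fin, of "orb g"]] by blast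
  obtain ys where ys: "set ys = orb h ` X" "distinct ys"
    using finite_distinct_list[OF finite_imageI[OF fin, of "orb h"]] by blast
  have "cycle_mset X g = mset (map card xs)" "cycle_mset X h = mset (map card ys)"
    unfolding cycle_mset_def xs(1)[symmetric] ys(1)[symmetric] mset_set_set[OF xs(2)] mset_set_set[OF ys(2)]
    by simp_all
  hence "mset (map card xs) = mset (map card ys)" using eq by simp
  \<comment> \<open>The second list of cycles is reordered so that cycles with the same index have
    the same length.\<close>
  then obtain p where p: "p permutes {..<length (map card ys)}" "permute_list p (map card ys) = map card xs"
    by (rule mset_eq_permutation)
  define zs where "zs = permute_list p ys"
  have p': "p permutes {..<length ys}" using p by simp
  have zs: "set zs = orb h ` X" "distinct zs" using ys p' by (simp_all add: zs_def)
  have "map card zs = map card xs" using p p' by (simp add: zs_def permute_list_map)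
  hence len: "length zs = length xs" and cards: "\<And>i. i < length xs \<Longrightarrow> card (zs ! i) = card (xs ! i)"
    by (metis length_map, metis length_map nth_map)
  let ?N = "length xs"
  have "\<forall>i<?N. \<exists>a. a \<in> X \<and> xs ! i = orb g a" using xs(1) nth_mem[of _ xs] by blast
  then obtain a where a: "\<And>i. i < ?N \<Longrightarrow> a i \<in> X" "\<And>i. i < ?N \<Longrightarrow> xs ! i = orb g (a i)" by metis
  have "\<forall>i<?N. \<exists>b. b \<in> X \<and> zs ! i = orb h b" 
    unfolding len[symmetric] using zs(1) nth_mem[of _ zs] by blast
  then obtain b where b: "\<And>i. i < ?N \<Longrightarrow> b i \<in> X" "\<And>i. i < ?N \<Longrightarrow> zs ! i = orb h (b i)" by metis
  have c: "least_power g (a i) = least_power h (b i)" if "i < ?N" for i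
    using cards[OF that] a(2)[OF that] b(2)[OF that] card_orb[OF fin g] card_orb[OF fin h] by simp
  have ex: "\<exists>i n. i < ?N \<and> y = (g ^^ n) (a i)" if y: "y \<in> X" for y
  proof -
    have "orb g y \<in> set xs" using y xs by blast
    then obtain i where i: "i < ?N" "xs ! i = orb g y" by (metis in_set_conv_nth)
    hence "y \<in> orb g (a i)" using a(2) orb_self[OF fin g] by metis
    thus ?thesis using i(1) unfolding orb_def by blast
  qed
  then obtain I E where IE: "\<And>y. y \<in> X \<Longrightarrow> I y < ?N" "\<And>y. y \<in> X \<Longrightarrow> y = (g ^^ E y) (a (I y))" by metis
  define \<theta> where "\<theta> y = (if y \<in> X then (h ^^ E y) (b (I y)) else y)" for y
  have inX: "(g ^^ n) (a i) \<in> X" "(h ^^ n) (b i) \<in> X" if "i < ?N" for i n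
    using permutes_in_image[OF funpow_permutes[OF fin g]] permutes_in_image[OF funpow_permutes[OF fin h]] a(1) b(1) that
    by blast+
  \<comment> \<open>The exponent \<open>E\<close> is determined only modulo the cycle length; equal
    lengths make the image independent of it.\<close>
  have key: "\<theta> ((g ^^ n) (a i)) = (h ^^ n) (b i)" if i: "i < ?N" for i n
  proof -
    let ?y = "(g ^^ n) (a i)"
    have y: "?y \<in> X" by (rule inX(1)[OF i])
    have "orb g ?y = xs ! I ?y" using IE[OF y] a(2) orb_funpow[OF fin g] by metis
    moreover have "orb g ?y = xs ! i" using a(2)[OF i] orb_funpow[OF fin g] by metis
    ultimately have Ii: "I ?y = i" using xs(2) IE(1)[OF y] i nth_eq_iff_index_eq by metis
    have "(g ^^ E ?y) (a i) = (g ^^ n) (a i)" using IE(2)[OF y] Ii by simp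
    hence "E ?y mod least_power g (a i) = n mod least_power g (a i)" using funpow_eq_iff[OF fin g] by blast
    hence "(h ^^ E ?y) (b i) = (h ^^ n) (b i)" unfolding c[OF i] using funpow_eq_iff[OF fin h] by blast
    thus ?thesis using y Ii by (simp add: \<theta>_def)
  qed
  have inj: "inj_on \<theta> X"
  proof (rule inj_onI)
    fix y y' assume yy: "y \<in> X" "y' \<in> X" "\<theta> y = \<theta> y'"
    obtain i n where y: "i < ?N" "y = (g ^^ n) (a i)" using ex[OF yy(1)] by blast
    obtain j m where y': "j < ?N" "y' = (g ^^ m) (a j)" using ex[OF yy(2)] by blast
    have e: "(h ^^ n) (b i) = (h ^^ m) (b j)" using yy(3) y y' key by simp
    hence "orb h (b i) = orb h (b j)" using orb_funpow[OF fin h] by metis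
    hence "zs ! i = zs ! j" using b(2) y(1) y'(1) by simp
    hence ij: "i = j" using zs(2) y(1) y'(1) len nth_eq_iff_index_eq by metis
    hence "n mod least_power h (b i) = m mod least_power h (b i)" using e funpow_eq_iff[OF fin h] by blast
    hence "(g ^^ n) (a i) = (g ^^ m) (a i)" unfolding c[OF y(1), symmetric] using funpow_eq_iff[OF fin g] by blast
    thus "y = y'" using y y' ij by simp
  qed
  have "\<theta> ` X \<subseteq> X" using inX IE(1) by (auto simp: \<theta>_def)
  hence "\<theta> ` X = X" using endo_inj_surj[OF fin _ inj] by blast
  hence "bij_betw \<theta> X X" using inj by (simp add: bij_betw_def)
  hence perm: "\<theta> permutes X" by (rule bij_imp_permutes) (simp add: \<theta>_def)
  have "\<theta> (g x) = h (\<theta> x)" for x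
  proof (cases "x \<in> X")
    case True
    obtain i n where x: "i < ?N" "x = (g ^^ n) (a i)" using ex[OF True] by blast
    have "\<theta> (g x) = (h ^^ Suc n) (b i)" using key[OF x(1), of "Suc n"] x(2) by simp
    thus ?thesis using key[OF x(1), of n] x(2) by simp
  next
    case False
    thus ?thesis using permutes_not_in[OF g False] permutes_not_in[OF h False] by (simp add: \<theta>_def)
  qed
  thus ?thesis using perm by (intro exI[of _ \<theta>]) (simp add: fun_eq_iff)
qed

text \<open>The largest cycle length is dropped, as the first row is in a padded partition; it is
  recovered from \<open>k\<close>. Thus cycle types are labels of the same kind as those of
  \<open>Sym_irrep\<close>.\<close>

definition cycle_type :: "nat \<Rightarrow> (nat \<Rightarrow> nat) \<Rightarrow> nat list" where
  "cycle_type k g = tl (rev (sorted_list_of_multiset (cycle_mset {1..k} g)))"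

lemma cycle_list:
  assumes "g permutes {1..k}"
  defines "T \<equiv> rev (sorted_list_of_multiset (cycle_mset {1..k} g))"
  shows "sum_list T = k" "\<forall>x\<in>set T. 0 < x" "sorted_wrt (\<ge>) T" "mset T = cycle_mset {1..k} g"
proof -
  have m: "mset T = cycle_mset {1..k} g" by (simp add: T_def)
  thus "mset T = cycle_mset {1..k} g" .
  show "sum_list T = k" using sum_cycle_mset[OF _ assms(1)] m by (metis card_atLeastAtMost diff_Suc_1 finite_atLeastAtMost sum_mset_sum_list)
  show "\<forall>x\<in>set T. 0 < x" using cycle_mset_pos[OF _ assms(1)] m by (metis finite_atLeastAtMost set_mset_mset)
  show "sorted_wrt (\<ge>) T" unfolding T_def by (simp add: sorted_wrt_rev)
qed

lemma cycle_type_paddable: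
  assumes "g permutes {1..k}"
  shows "paddable k (cycle_type k g)"
proof -
  define T where "T = rev (sorted_list_of_multiset (cycle_mset {1..k} g))"
  note T = cycle_list[OF assms, folded T_def]
  have ct: "cycle_type k g = tl T" by (simp add: cycle_type_def T_def)
  show ?thesis
  proof (cases T)
    case Nil
    hence "cycle_type k g = []" using ct by simp
    thus ?thesis by (simp add: paddable_def is_partition_def)
  next
    case (Cons a \<nu>)
    have "hd \<nu> \<le> a" if "\<nu> \<noteq> []" using T(3) Cons that by (cases \<nu>) auto
    thus ?thesis using T(1-3) Cons by (auto simp: ct paddable_def is_partition_def)
  qed
qed

lemma cycle_type_conj:
  assumes g: "g permutes {1..k}" and h: "h permutes {1..k}" and eq: "cycle_type k g = cycle_type k h"
  shows "\<exists>\<theta>. \<theta> permutes {1..k} \<and> \<theta> \<circ> g = h \<circ> \<theta>"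
proof -
  define T where "T = rev (sorted_list_of_multiset (cycle_mset {1..k} g))"
  define T' where "T' = rev (sorted_list_of_multiset (cycle_mset {1..k} h))"
  note T = cycle_list[OF g, folded T_def] and T' = cycle_list[OF h, folded T'_def]
  have tl: "tl T = tl T'" using eq by (simp add: cycle_type_def T_def T'_def)
  have "T = T'"
  proof (cases T)
    case Nil
    thus ?thesis using T(1) T'(1,2) by (cases T') auto
  next
    case (Cons a \<nu>)
    hence "T' \<noteq> []" using T(1,2) T'(1) by auto
    then obtain a' \<nu>' where "T' = a' # \<nu>'" by (cases T') auto
    thus ?thesis using Cons tl T(1) T'(1) by simp
  qed
  hence "cycle_mset {1..k} g = cycle_mset {1..k} h" using T(4) T'(4) by simp
  thus ?thesis using g h by (intro cycle_mset_conj) auto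
qed

lemma finite_paddable: "finite {\<nu>. paddable k \<nu>}"
proof (rule finite_subset)
  show "{\<nu>. paddable k \<nu>} \<subseteq> {\<nu>. set \<nu> \<subseteq> {..k} \<and> length \<nu> \<le> k}"
  proof
    fix \<nu> assume "\<nu> \<in> {\<nu>. paddable k \<nu>}"
    hence \<nu>: "sum_list \<nu> \<le> k" "\<forall>x\<in>set \<nu>. 0 < x" by (auto simp: paddable_def is_partition_def)
    have "length \<nu> \<le> sum_list \<nu>" using \<nu>(2) by (induction \<nu>) auto
    moreover have "x \<le> sum_list \<nu>" if "x \<in> set \<nu>" for x using that by (intro member_le_sum_list) auto
    ultimately show "\<nu> \<in> {\<nu>. set \<nu> \<subseteq> {..k} \<and> length \<nu> \<le> k}" using \<nu>(1) by fastforce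
  qed
  show "finite {\<nu>. set \<nu> \<subseteq> {..k} \<and> length \<nu> \<le> k}" by (rule finite_lists_length_le) simp
qed

section \<open>Characters and their orthogonality\<close>

definition character :: "'g rep \<Rightarrow> 'g \<Rightarrow> complex" where
  "character \<pi> g = (\<Sum>i<fst \<pi>. snd \<pi> g $$ (i, i))"

context group
begin

lemma character_cycle:
  assumes rep: "is_rep G \<pi>" and gh: "g \<in> carrier G" "h \<in> carrier G"
  shows "character \<pi> (g \<otimes> h) = character \<pi> (h \<otimes> g)"
proof -
  have "character \<pi> (g \<otimes> h) = (\<Sum>i<fst \<pi>. \<Sum>l<fst \<pi>. snd \<pi> g $$ (i, l) * snd \<pi> h $$ (l, i))"
    unfolding character_def using gh by (intro sum.cong) (auto simp: rep_mult_entry[OF rep])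
  also have "\<dots> = (\<Sum>l<fst \<pi>. \<Sum>i<fst \<pi>. snd \<pi> h $$ (l, i) * snd \<pi> g $$ (i, l))"
    by (subst sum.swap) (simp add: mult.commute)
  also have "\<dots> = character \<pi> (h \<otimes> g)"
    unfolding character_def using gh by (intro sum.cong) (auto simp: rep_mult_entry[OF rep])
  finally show ?thesis .
qed

text \<open>The value at the inverse is included because the orthogonality relations pair an element
  with its inverse.\<close>

lemma character_conj:
  assumes rep: "is_rep G \<pi>" and gh: "g \<in> carrier G" "h \<in> carrier G" "t \<in> carrier G" and eq: "t \<otimes> g = h \<otimes> t"
  shows "character \<pi> h = character \<pi> g" "character \<pi> (inv h) = character \<pi> (inv g)"
proof -
  have h: "h = t \<otimes> (g \<otimes> inv t)" using gh eq by (simp add: m_assoc[symmetric]) (simp add: m_assoc)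
  show "character \<pi> h = character \<pi> g"
    unfolding h using gh character_cycle[OF rep, of t "g \<otimes> inv t"] by (simp add: m_assoc)
  have ih: "inv h = t \<otimes> (inv g \<otimes> inv t)" unfolding h using gh by (simp add: inv_mult_group m_assoc)
  show "character \<pi> (inv h) = character \<pi> (inv g)"
    unfolding ih using gh character_cycle[OF rep, of t "inv g \<otimes> inv t"] by (simp add: m_assoc)
qed

lemma character_orth:
  assumes "coef_orth G \<sigma> \<pi>"
  shows "(\<Sum>g\<in>carrier G. character \<sigma> g * character \<pi> (inv g)) = 0"
proof -
  have "(\<Sum>g\<in>carrier G. character \<sigma> g * character \<pi> (inv g)) =
    (\<Sum>g\<in>carrier G. \<Sum>i<fst \<sigma>. \<Sum>k<fst \<pi>. snd \<sigma> g $$ (i, i) * snd \<pi> (inv g) $$ (k, k))"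
    by (simp add: character_def sum_product)
  also have "\<dots> = (\<Sum>i<fst \<sigma>. \<Sum>g\<in>carrier G. \<Sum>k<fst \<pi>. snd \<sigma> g $$ (i, i) * snd \<pi> (inv g) $$ (k, k))"
    by (rule sum.swap)
  also have "\<dots> = (\<Sum>i<fst \<sigma>. \<Sum>k<fst \<pi>. \<Sum>g\<in>carrier G. snd \<sigma> g $$ (i, i) * snd \<pi> (inv g) $$ (k, k))"
    by (intro sum.cong HOL.refl sum.swap)
  also have "\<dots> = (\<Sum>i<fst \<sigma>. \<Sum>k<fst \<pi>. 0)"
    by (intro sum.cong HOL.refl) (simp add: coef_orthD[OF assms])
  finally show ?thesis by simp
qed

lemma character_norm:
  assumes p: "is_irrep G \<pi>"
  shows "(\<Sum>g\<in>carrier G. character \<pi> g * character \<pi> (inv g)) = of_nat (card (carrier G))"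
proof -
  have n: "fst \<pi> > 0" using p by (simp add: is_irrep_def)
  have "(\<Sum>g\<in>carrier G. character \<pi> g * character \<pi> (inv g)) =
    (\<Sum>g\<in>carrier G. \<Sum>i<fst \<pi>. \<Sum>k<fst \<pi>. snd \<pi> g $$ (i, i) * snd \<pi> (inv g) $$ (k, k))"
    by (simp add: character_def sum_product)
  also have "\<dots> = (\<Sum>i<fst \<pi>. \<Sum>g\<in>carrier G. \<Sum>k<fst \<pi>. snd \<pi> g $$ (i, i) * snd \<pi> (inv g) $$ (k, k))"
    by (rule sum.swap)
  also have "\<dots> = (\<Sum>i<fst \<pi>. \<Sum>k<fst \<pi>. \<Sum>g\<in>carrier G. snd \<pi> g $$ (i, i) * snd \<pi> (inv g) $$ (k, k))"
    by (intro sum.cong HOL.refl sum.swap)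
  also have "\<dots> = (\<Sum>i<fst \<pi>. \<Sum>k<fst \<pi>. if i = k then of_nat (card (carrier G)) / of_nat (fst \<pi>) else 0)"
    by (intro sum.cong HOL.refl) (simp add: schur_relD[OF irrep_schur_rel[OF p]])
  also have "\<dots> = of_nat (card (carrier G))" using n by simp
  finally show ?thesis .
qed

end

text \<open>The characters of the \<open>V\<^sub>k(\<nu>)\<close> are orthogonal class functions, and there are as many of them as
  there are cycle types, so their table is an invertible matrix. A further irreducible character
  would be orthogonal to all of them.\<close>

lemma Sym_irrep_complete:
  assumes p: "is_irrep (sym_group k) \<pi>"
  shows "\<exists>\<nu>. paddable k \<nu> \<and> rep_iso (sym_group k) \<pi> (Sym_irrep k \<nu>)"
proof (rule ccontr)
  assume none: "\<nexists>\<nu>. paddable k \<nu> \<and> rep_iso (sym_group k) \<pi> (Sym_irrep k \<nu>)"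
  interpret S: group "sym_group k" by (rule sym_group_is_group)
  let ?S = "carrier (sym_group k)" and ?i = "m_inv (sym_group k)"
  have rp: "is_rep (sym_group k) \<pi>" and d: "0 < fst \<pi>" using p by (auto simp: is_irrep_def)
  obtain vs where vs: "set vs = {\<nu>. paddable k \<nu>}" "distinct vs"
    using finite_distinct_list[OF finite_paddable] by blast
  define n where "n = length vs"
  define \<sigma> where "\<sigma> a = Sym_irrep k (vs ! a)" for a
  have pad: "paddable k (vs ! a)" if "a < n" for a using vs that nth_mem unfolding n_def by blast
  have irr: "is_irrep (sym_group k) (\<sigma> a)" if "a < n" for a
    unfolding \<sigma>_def by (rule Sym_irrep_irrep[OF pad[OF that]])
  define cls where "cls b = {g \<in> ?S. cycle_type k g = vs ! b}" for b
  \<comment> \<open>For an empty class \<open>r b\<close> is arbitrary; the weight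
    \<open>card (cls b)\<close> removes its contribution.\<close>
  define r where "r b = (SOME g. g \<in> cls b)" for b
  have rcls: "r b \<in> cls b" if "g \<in> cls b" for g b unfolding r_def by (rule someI[where P = "\<lambda>g. g \<in> cls b", OF that])
  have char_r: "character \<tau> g = character \<tau> (r b)" "character \<tau> (?i g) = character \<tau> (?i (r b))"
    if t: "is_rep (sym_group k) \<tau>" and g: "g \<in> cls b" for \<tau> g b
  proof -
    have gr: "g permutes {1..k}" "r b permutes {1..k}" "cycle_type k (r b) = cycle_type k g"
      using rcls[OF g] g by (auto simp: cls_def sym_group_carrier)
    then obtain \<theta> where th: "\<theta> permutes {1..k}" "\<theta> \<circ> r b = g \<circ> \<theta>"
      using cycle_type_conj[OF gr(2,1,3)] by blast
    show "character \<tau> g = character \<tau> (r b)" "character \<tau> (?i g) = character \<tau> (?i (r b))"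
      using S.character_conj[OF t, of "r b" g \<theta>] gr th by (simp_all add: sym_group_carrier sym_simps)
  qed
  have classes: "(\<Sum>b<n. of_nat (card (cls b)) * (character \<tau> (r b) * character \<tau>' (?i (r b)))) =
      (\<Sum>g\<in>?S. character \<tau> g * character \<tau>' (?i g))"
    if t: "is_rep (sym_group k) \<tau>" "is_rep (sym_group k) \<tau>'" for \<tau> \<tau>'
  proof -
    have "(\<Sum>b<n. of_nat (card (cls b)) * (character \<tau> (r b) * character \<tau>' (?i (r b)))) =
      (\<Sum>b<n. \<Sum>g\<in>{g \<in> ?S. cycle_type k g = vs ! b}. character \<tau> g * character \<tau>' (?i g))"
    proof (rule sum.cong[OF HOL.refl])
      fix b
      have "(\<Sum>g\<in>cls b. character \<tau> g * character \<tau>' (?i g)) =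
        (\<Sum>g\<in>cls b. character \<tau> (r b) * character \<tau>' (?i (r b)))"
        by (rule sum.cong[OF HOL.refl]) (metis char_r(1)[OF t(1)] char_r(2)[OF t(2)])
      thus "of_nat (card (cls b)) * (character \<tau> (r b) * character \<tau>' (?i (r b))) =
        (\<Sum>g\<in>{g \<in> ?S. cycle_type k g = vs ! b}. character \<tau> g * character \<tau>' (?i g))"
        unfolding cls_def[symmetric] by simp
    qed
    also have "\<dots> = (\<Sum>\<nu>\<in>set vs. \<Sum>g\<in>{g \<in> ?S. cycle_type k g = \<nu>}. character \<tau> g * character \<tau>' (?i g))"
      by (rule sum.reindex_bij_betw) (simp add: bij_betw_nth[OF vs(2)] n_def)
    also have "\<dots> = (\<Sum>g\<in>?S. character \<tau> g * character \<tau>' (?i g))"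
      by (rule sum.group[OF finite_sym_group finite_set])
        (use vs(1) cycle_type_paddable in \<open>auto simp: sym_group_carrier\<close>)
    finally show ?thesis .
  qed
  define c where "c = (of_nat (card ?S) :: complex)"
  have c0: "c \<noteq> 0" using finite_sym_group SC_id by (auto simp: c_def card_eq_0_iff)
  \<comment> \<open>\<open>A\<close> is the character table divided by the group order,
    \<open>B\<close> the transposed table at inverses, weighted by class sizes. Their product in
    this order is the orthogonality of the characters.\<close>
  define A where "A = mat n n (\<lambda>(a, b). character (\<sigma> a) (r b) / c)"
  define B where "B = mat n n (\<lambda>(b, a). of_nat (card (cls b)) * character (\<sigma> a) (?i (r b)))"
  have AB: "A \<in> carrier_mat n n" "B \<in> carrier_mat n n" by (simp_all add: A_def B_def)
  have "A * B = 1\<^sub>m n"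
  proof (rule eq_matI)
    fix a a' assume "a < dim_row (1\<^sub>m n :: complex mat)" "a' < dim_col (1\<^sub>m n :: complex mat)"
    hence a: "a < n" "a' < n" by auto
    have "(A * B) $$ (a, a') = (\<Sum>b<n. character (\<sigma> a) (r b) / c * (of_nat (card (cls b)) * character (\<sigma> a') (?i (r b))))"
      unfolding mat_mult_entry[OF AB a] using a by (intro sum.cong) (auto simp: A_def B_def)
    also have "\<dots> = (\<Sum>b<n. of_nat (card (cls b)) * (character (\<sigma> a) (r b) * character (\<sigma> a') (?i (r b)))) / c"
      by (simp add: sum_divide_distrib mult_ac)
    also have "\<dots> = (\<Sum>g\<in>?S. character (\<sigma> a) g * character (\<sigma> a') (?i g)) / c"
      using classes[of "\<sigma> a" "\<sigma> a'"] irr a by (simp add: is_irrep_def)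
    also have "\<dots> = 1\<^sub>m n $$ (a, a')"
    proof (cases "a = a'")
      case True
      thus ?thesis using S.character_norm[OF irr[OF a(1)]] c0 a by (simp add: c_def)
    next
      case False
      hence "vs ! a' \<noteq> vs ! a" using vs(2) a nth_eq_iff_index_eq unfolding n_def by metis
      hence "\<not> rep_iso (sym_group k) (\<sigma> a') (\<sigma> a)"
        unfolding \<sigma>_def using Sym_irrep_iso_eq[OF pad pad] a by blast
      from S.character_orth[OF S.irrep_iso_or_orth[OF irr[OF a(2)] irr[OF a(1)] this]]
      show ?thesis using False a by simp
    qed
    finally show "(A * B) $$ (a, a') = 1\<^sub>m n $$ (a, a')" .
  qed (use AB in auto)
  \<comment> \<open>Rows and columns are both indexed by padded partitions, so the matrices are
    square and the inverse is two-sided.\<close>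
  hence BA: "B * A = 1\<^sub>m n" by (rule mat_mult_left_right_inverse[OF AB])
  define v where "v b = of_nat (card (cls b)) * character \<pi> (?i (r b))" for b
  have Av: "(\<Sum>b<n. A $$ (a, b) * v b) = 0" if a: "a < n" for a
  proof -
    have "(\<Sum>b<n. A $$ (a, b) * v b) = (\<Sum>b<n. of_nat (card (cls b)) * (character (\<sigma> a) (r b) * character \<pi> (?i (r b)))) / c"
      using a by (simp add: A_def v_def sum_divide_distrib mult_ac)
    also have "\<dots> = (\<Sum>g\<in>?S. character (\<sigma> a) g * character \<pi> (?i g)) / c"
      using classes[of "\<sigma> a" \<pi>] irr[OF a] rp by (simp add: is_irrep_def)
    also have "\<dots> = 0"
    proof -
      have "\<not> rep_iso (sym_group k) \<pi> (\<sigma> a)" unfolding \<sigma>_def using none pad[OF a] by blast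
      from S.character_orth[OF S.irrep_iso_or_orth[OF p irr[OF a] this]] show ?thesis by simp
    qed
    finally show ?thesis .
  qed
  have v0: "v b = 0" if b: "b < n" for b
  proof -
    have "v b = (\<Sum>b'<n. (B * A) $$ (b, b') * v b')"
    proof -
      have "(\<Sum>b'<n. 1\<^sub>m n $$ (b, b') * v b') = (\<Sum>b'<n. (if b = b' then 1 else 0) * v b')"
        using b by (intro sum.cong) auto
      thus ?thesis unfolding BA using b by (simp add: sum_single)
    qed
    also have "\<dots> = (\<Sum>b'<n. \<Sum>a<n. B $$ (b, a) * (A $$ (a, b') * v b'))"
      by (rule sum.cong[OF HOL.refl]) (simp add: mat_mult_entry[OF AB(2,1) b] sum_distrib_right mult.assoc)
    also have "\<dots> = (\<Sum>a<n. B $$ (b, a) * (\<Sum>b'<n. A $$ (a, b') * v b'))"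
      by (subst sum.swap) (simp add: sum_distrib_left)
    also have "\<dots> = 0" using Av by simp
    finally show ?thesis .
  qed
  \<comment> \<open>The vector \<open>v\<close> has been shown to vanish, but its entry at the class
    of the identity is the class size times the dimension.\<close>
  have "cycle_type k id \<in> set vs" using vs(1) cycle_type_paddable[OF permutes_id] by simp
  then obtain b where b: "b < n" "vs ! b = cycle_type k id" by (metis in_set_conv_nth n_def)
  have idc: "id \<in> cls b" using b SC_id by (simp add: cls_def)
  have "card (cls b) > 0" using idc finite_sym_group by (auto simp: cls_def card_gt_0_iff)
  moreover have "character \<pi> (?i (r b)) = of_nat (fst \<pi>)"
    using char_r(2)[OF rp idc] S.rep_one[OF rp] by (simp add: iv_id character_def sym_simps)
  ultimately show False using v0[OF b(1)] d by (simp add: v_def)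
qed

section \<open>The finite quotient in terms of crossings\<close>

lemma braid_words_simps [simp]:
  "[] \<in> braid_words n"
  "l # w \<in> braid_words n \<longleftrightarrow> fst l \<in> {1..<n} \<and> w \<in> braid_words n"
  "u @ v \<in> braid_words n \<longleftrightarrow> u \<in> braid_words n \<and> v \<in> braid_words n"
  by (cases l; auto simp: braid_words_def)+

lemma braid_eq_words: "braid_eq n u v \<Longrightarrow> u \<in> braid_words n \<and> v \<in> braid_words n"
  by (induction rule: braid_eq.induct) auto

lemma braid_class_eq_iff:
  assumes "u \<in> braid_words n"
  shows "braid_class n u = braid_class n v \<longleftrightarrow> braid_eq n u v"
proof
  assume eq: "braid_class n u = braid_class n v"
  have "u \<in> braid_class n u" using assms by (simp add: braid_class_def braid_eq.refl)
  hence "braid_eq n v u" unfolding eq by (simp add: braid_class_def)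
  thus "braid_eq n u v" by (rule braid_eq.sym)
next
  assume uv: "braid_eq n u v"
  show "braid_class n u = braid_class n v"
    unfolding braid_class_def using uv braid_eq.sym braid_eq.trans by blast
qed

lemma in_braid_class: "u \<in> braid_words n \<Longrightarrow> u \<in> braid_class n u"
  by (simp add: braid_class_def braid_eq.refl)

lemma braid_eq_append:
  assumes "braid_eq n u u'" "braid_eq n v v'"
  shows "braid_eq n (u @ v) (u' @ v')"
proof -
  have w: "u' \<in> braid_words n" "v \<in> braid_words n" using assms braid_eq_words by blast+
  have "braid_eq n ([] @ u @ v) ([] @ u' @ v)" by (intro braid_eq.cong assms) (use w in auto)
  moreover have "braid_eq n (u' @ v @ []) (u' @ v' @ [])" by (intro braid_eq.cong assms) (use w in auto)
  ultimately show ?thesis using braid_eq.trans by simp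
qed

text \<open>All classes in the union that defines \<open>mult\<close> coincide, and the union is
  over a nonempty family.\<close>

lemma braid_class_mult:
  assumes "u \<in> braid_words n" "v \<in> braid_words n"
  shows "braid_class n u \<otimes>\<^bsub>braid_group n\<^esub> braid_class n v = braid_class n (u @ v)"
proof -
  have eq: "braid_class n (u' @ v') = braid_class n (u @ v)" if "u' \<in> braid_class n u" "v' \<in> braid_class n v" for u' v'
  proof -
    have "braid_eq n (u @ v) (u' @ v')" using that by (intro braid_eq_append) (simp_all add: braid_class_def)
    hence "braid_class n (u @ v) = braid_class n (u' @ v')" using braid_class_eq_iff[of "u @ v" n] assms by simp
    thus ?thesis by (rule HOL.sym)
  qed
  have "(\<Union>u'\<in>braid_class n u. \<Union>v'\<in>braid_class n v. braid_class n (u' @ v')) =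
    (\<Union>u'\<in>braid_class n u. \<Union>v'\<in>braid_class n v. braid_class n (u @ v))"
    by (intro SUP_cong HOL.refl eq)
  also have "\<dots> = braid_class n (u @ v)"
    using in_braid_class[OF assms(1)] in_braid_class[OF assms(2)] by blast
  finally show ?thesis by (simp add: braid_group_def)
qed

definition word_inv :: "braid_word \<Rightarrow> braid_word" where
  "word_inv w = rev (map (\<lambda>(i, e). (i, \<not> e)) w)"

lemma word_inv_simps [simp]:
  "word_inv [] = []" "word_inv ((i, e) # w) = word_inv w @ [(i, \<not> e)]"
  "word_inv (u @ v) = word_inv v @ word_inv u" "word_inv (word_inv w) = w"
  by (simp_all add: word_inv_def rev_map comp_def case_prod_unfold)

lemma word_inv_words [simp]: "word_inv w \<in> braid_words n \<longleftrightarrow> w \<in> braid_words n"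
  by (induction w) auto

lemma braid_eq_inv: "w \<in> braid_words n \<Longrightarrow> braid_eq n (w @ word_inv w) []"
proof (induction w)
  case Nil
  thus ?case by (simp add: braid_eq.refl)
next
  case (Cons l w)
  obtain i e where l: "l = (i, e)" by (cases l)
  have "braid_eq n ([l] @ (w @ word_inv w) @ [(i, \<not> e)]) ([l] @ [] @ [(i, \<not> e)])"
    by (intro braid_eq.cong Cons.IH) (use Cons.prems l in auto)
  moreover have "braid_eq n ([l] @ [] @ [(i, \<not> e)]) []"
    using braid_eq.inverse[of i n e] Cons.prems l by simp
  ultimately show ?case using braid_eq.trans l by simp
qed

lemma braid_group_simps:
  "carrier (braid_group n) = braid_class n ` braid_words n" "\<one>\<^bsub>braid_group n\<^esub> = braid_class n []"
  by (simp_all add: braid_group_def)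

lemma braid_group_group: "group (braid_group n)"
proof (rule groupI)
  fix x assume "x \<in> carrier (braid_group n)"
  then obtain w where w: "w \<in> braid_words n" "x = braid_class n w" by (auto simp: braid_group_simps)
  have "braid_class n (word_inv w) \<otimes>\<^bsub>braid_group n\<^esub> x = \<one>\<^bsub>braid_group n\<^esub>"
    using w braid_eq_inv[of "word_inv w" n] by (simp add: braid_class_mult braid_group_simps braid_class_eq_iff)
  thus "\<exists>y\<in>carrier (braid_group n). y \<otimes>\<^bsub>braid_group n\<^esub> x = \<one>\<^bsub>braid_group n\<^esub>"
    using w by (intro bexI[of _ "braid_class n (word_inv w)"]) (auto simp: braid_group_simps)
qed (auto simp: braid_group_simps braid_class_mult)

lemma braid_class_inv:
  assumes "w \<in> braid_words n"
  shows "inv\<^bsub>braid_group n\<^esub> (braid_class n w) = braid_class n (word_inv w)"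
proof -
  interpret group "braid_group n" by (rule braid_group_group)
  have "braid_class n (word_inv w) \<otimes>\<^bsub>braid_group n\<^esub> braid_class n w = \<one>\<^bsub>braid_group n\<^esub>"
    using assms braid_eq_inv[of "word_inv w" n] by (simp add: braid_class_mult braid_group_simps braid_class_eq_iff)
  thus ?thesis using assms by (intro inv_equality) (simp_all add: braid_group_simps)
qed

lemma the_elem_class:
  assumes "\<And>u v. braid_eq n u v \<Longrightarrow> f u = f v" "w \<in> braid_words n"
  shows "the_elem (f ` braid_class n w) = f w"
proof -
  have "f ` braid_class n w = {f w}"
  proof (intro equalityI subsetI)
    fix y assume "y \<in> f ` braid_class n w"
    then obtain v where "braid_eq n w v" "y = f v" by (auto simp: braid_class_def)
    thus "y \<in> {f w}" using assms(1)[of w v] by simp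
  qed (use in_braid_class[OF assms(2)] in blast)
  thus ?thesis by simp
qed

lemma word_perm_simps [simp]:
  "word_perm [] = id" "word_perm ((i, e) # w) = Transposition.transpose i (Suc i) \<circ> word_perm w"
  by (simp_all add: word_perm_def)

lemma word_perm_append [simp]: "word_perm (u @ v) = word_perm u \<circ> word_perm v"
  by (induction u) (auto simp: comp_assoc)

lemma word_perm_permutes: "w \<in> braid_words n \<Longrightarrow> word_perm w permutes {1..n}"
proof (induction w)
  case Nil
  show ?case by (simp only: word_perm_simps permutes_id)
next
  case (Cons l w)
  obtain i e where l: "l = (i, e)" by (cases l)
  have "Transposition.transpose i (Suc i) permutes {1..n}"
    using Cons.prems l by (intro permutes_swap_id) auto
  moreover have "word_perm w permutes {1..n}" using Cons by simp
  ultimately show ?case unfolding l word_perm_simps by (rule permutes_compose[OF _ _, rotated])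
qed

lemma word_perm_inv: "word_perm (word_inv w) \<circ> word_perm w = id" "word_perm w \<circ> word_perm (word_inv w) = id"
proof -
  have 1: "word_perm w \<circ> word_perm (word_inv w) = id" for w
  proof (induction w)
    case (Cons l w)
    obtain i e where l: "l = (i, e)" by (cases l)
    have "word_perm (l # w) \<circ> word_perm (word_inv (l # w)) =
      Transposition.transpose i (Suc i) \<circ> (word_perm w \<circ> word_perm (word_inv w)) \<circ> Transposition.transpose i (Suc i)"
      by (simp add: l comp_assoc)
    thus ?case unfolding Cons.IH by simp
  qed simp
  show "word_perm w \<circ> word_perm (word_inv w) = id" by (rule 1)
  show "word_perm (word_inv w) \<circ> word_perm w = id" using 1[of "word_inv w"] by simp
qed

lemma word_perm_eq: "braid_eq n u v \<Longrightarrow> word_perm u = word_perm v"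
proof (induction rule: braid_eq.induct)
  case (far i j)
  thus ?case by (auto simp: fun_eq_iff Transposition.transpose_def)
next
  case (braid i)
  thus ?case by (auto simp: fun_eq_iff Transposition.transpose_def)
qed (auto simp: comp_assoc fun_eq_iff)

lemma braid_perm_class: "w \<in> braid_words n \<Longrightarrow> braid_perm (braid_class n w) = word_perm w"
  unfolding braid_perm_def by (rule the_elem_class) (rule word_perm_eq)

text \<open>Left multiplication by a Burau matrix acts on each column of a matrix, viewed as a function of
  the row index. The parameters stand for \<open>t\<close> and \<open>t\<^sup>-\<^sup>1\<close>.\<close>

definition burau_act :: "'a::comm_ring_1 \<Rightarrow> 'a \<Rightarrow> nat \<times> bool \<Rightarrow> (nat \<Rightarrow> 'a) \<Rightarrow> nat \<Rightarrow> 'a" where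
  "burau_act T U = (\<lambda>(i, e) f r.
     if Suc r = i then (if e then (1 - T) * f r + T * f i else f i)
     else if r = i then (if e then f (i - 1) else U * f (i - 1) + (1 - U) * f i)
     else f r)"

lemma burau_act_cases:
  assumes "1 \<le> i"
  shows "burau_act T U (i, e) f (i - 1) = (if e then (1 - T) * f (i - 1) + T * f i else f i)"
    "burau_act T U (i, e) f i = (if e then f (i - 1) else U * f (i - 1) + (1 - U) * f i)"
    "r \<noteq> i \<Longrightarrow> r \<noteq> i - 1 \<Longrightarrow> burau_act T U (i, e) f r = f r"
  using assms by (auto simp: burau_act_def)

text \<open>Rows are indexed by all natural numbers, so \<open>n\<close> does not enter and the
  relations become identities in \<open>T\<close> and \<open>U\<close> at no more than four
  rows.\<close>

lemma burau_act_eq: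
  fixes T U :: "'a::comm_ring_1"
  assumes TU: "T * U = 1"
  shows "braid_eq n u v \<Longrightarrow> foldr (burau_act T U) u f = foldr (burau_act T U) v f"
proof (induction arbitrary: f rule: braid_eq.induct)
  case (inverse i e)
  have UT: "U * T = 1" using TU by (simp add: mult.commute)
  have c: "T * (U * x) = x" for x
    using TU UT by (simp add: mult.assoc[symmetric])
  show ?case using inverse TU UT
    by (cases e) (auto simp: fun_eq_iff burau_act_def algebra_simps c)
next
  case (far i j)
  thus ?case by (auto simp: fun_eq_iff burau_act_def)
next
  case (braid i)
  then obtain k where k: "i = Suc k" by (cases i) auto
  show ?case unfolding k by (auto simp: fun_eq_iff burau_act_def algebra_simps)
qed auto

lemma burau_gen_carrier: "burau_gen n l \<in> carrier_mat n n"
  by (cases l) (simp add: burau_gen_def)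

lemma burau_word_simps [simp]:
  "burau_word n [] = 1\<^sub>m n" "burau_word n (l # w) = burau_gen n l * burau_word n w"
  by (simp_all add: burau_word_def)

lemma burau_word_carrier: "burau_word n w \<in> carrier_mat n n"
  by (induction w) (auto intro: mult_carrier_mat burau_gen_carrier)

lemma t_pow_inv: "t_pow 1 * t_pow (- 1) = 1"
  by (simp add: t_pow_def mult_single)

text \<open>The two nontrivial rows of a generator have their entries in the columns
  \<open>i - 1\<close> and \<open>i\<close>, counted from 0; all other rows are those of the
  identity.\<close>

lemma burau_gen_mult:
  assumes i: "1 \<le> i" "i < n" and M: "M \<in> carrier_mat n n" and rc: "r < n" "c < n"
  shows "(burau_gen n (i, e) * M) $$ (r, c) = burau_act (t_pow 1) (t_pow (- 1)) (i, e) (\<lambda>r. M $$ (r, c)) r"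
proof -
  have two: "(\<Sum>l<n. ((if l = i - 1 then x else 0) + (if l = i then y else 0)) * f l) = x * f (i - 1) + y * f i"
    for x y :: laurent and f
    using i by (simp add: distrib_right sum.distrib sum_single)
  have one: "(\<Sum>l<n. (if l = r then 1 else 0) * f l) = f r" for f :: "nat \<Rightarrow> laurent"
    using rc by (simp add: sum_single)
  have "(burau_gen n (i, e) * M) $$ (r, c) = (\<Sum>l<n. burau_gen n (i, e) $$ (r, l) * M $$ (l, c))"
    by (rule mat_mult_entry[OF burau_gen_carrier M rc])
  also have "\<dots> = (\<Sum>l<n. (if Suc r = i \<or> r = i then
      (if l = i - 1 then (if Suc r = i then (if e then 1 - t_pow 1 else 0) else (if e then 1 else t_pow (- 1))) else 0) +
      (if l = i then (if Suc r = i then (if e then t_pow 1 else 1) else (if e then 0 else 1 - t_pow (- 1))) else 0)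
      else (if l = r then 1 else 0)) * M $$ (l, c))"
    using i rc by (intro sum.cong HOL.refl arg_cong2[where f = "(*)"]) (auto simp: burau_gen_def)
  also have "\<dots> = burau_act (t_pow 1) (t_pow (- 1)) (i, e) (\<lambda>r. M $$ (r, c)) r"
  proof (cases "Suc r = i \<or> r = i")
    case True
    then consider "i = Suc r" | "r = i" "i \<noteq> Suc r" by auto
    thus ?thesis unfolding if_P[OF True] two by cases (simp_all add: burau_act_def)
  next
    case False
    thus ?thesis unfolding if_not_P[OF False] one by (simp add: burau_act_def)
  qed
  finally show ?thesis .
qed

lemma burau_act_cong:
  assumes "1 \<le> i" "i < n" "\<And>r. r < n \<Longrightarrow> f r = g r" "r < n"
  shows "burau_act T U (i, e) f r = burau_act T U (i, e) g r"
  using assms by (auto simp: burau_act_def)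

lemma burau_word_entry:
  assumes "w \<in> braid_words n" "r < n" "c < n"
  shows "burau_word n w $$ (r, c) = foldr (burau_act (t_pow 1) (t_pow (- 1))) w (\<lambda>r. if r = c then 1 else 0) r"
  using assms
proof (induction w arbitrary: r)
  case (Cons l w)
  obtain i e where l: "l = (i, e)" by (cases l)
  have i: "1 \<le> i" "i < n" using Cons.prems l by auto
  show ?case
    using Cons burau_gen_mult[OF i burau_word_carrier Cons.prems(2,3), of e w]
    by (simp add: l, intro burau_act_cong[OF i]) auto
qed simp

lemma burau_word_eq:
  assumes "braid_eq n u v"
  shows "burau_word n u = burau_word n v"
proof (rule eq_matI)
  fix r c assume "r < dim_row (burau_word n v)" "c < dim_col (burau_word n v)"
  hence rc: "r < n" "c < n" using burau_word_carrier[of n v] by auto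
  show "burau_word n u $$ (r, c) = burau_word n v $$ (r, c)"
    using burau_word_entry[OF _ rc] braid_eq_words[OF assms] burau_act_eq[OF t_pow_inv assms] by simp
qed (use burau_word_carrier[of n u] burau_word_carrier[of n v] in auto)

lemma burau_class: "w \<in> braid_words n \<Longrightarrow> burau n (braid_class n w) = burau_word n w"
  unfolding burau_def by (rule the_elem_class) (rule burau_word_eq)

section \<open>Evaluation of Laurent polynomials and the Burau matrices modulo 4\<close>

lemma eval_minus_one_add: "eval_minus_one (p + q) = eval_minus_one p + eval_minus_one q"
  unfolding eval_minus_one_def by (rule setsum_keys_plus_distrib) (simp_all add: distrib_right)

lemma eval_minus_one_zero: "eval_minus_one 0 = 0"
  by (simp add: eval_minus_one_def)

lemma eval_minus_one_sum: "eval_minus_one (\<Sum>x\<in>S. f x) = (\<Sum>x\<in>S. eval_minus_one (f x))"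
  by (induction S rule: infinite_finite_induct) (auto simp: eval_minus_one_add eval_minus_one_zero)

lemma eval_minus_one_single: "eval_minus_one (Poly_Mapping.single k v) = v * (- 1) ^ nat \<bar>k\<bar>"
  by (simp add: eval_minus_one_def)

lemma minus_one_power_abs: "(- 1 :: int) ^ nat \<bar>k\<bar> = (if even k then 1 else - 1)"
  by (simp add: minus_one_power_iff even_nat_iff)

text \<open>\<open>burau_act\<close> multiplies only by \<open>t\<close> and its inverse; a shift of
  exponents by an odd number flips the sign of every evaluated monomial.\<close>

lemma eval_minus_one_t_pow_mult:
  assumes "odd j"
  shows "eval_minus_one (t_pow j * p) = - eval_minus_one p"
proof -
  have p: "p = (\<Sum>k\<in>Poly_Mapping.keys p. Poly_Mapping.single k (Poly_Mapping.lookup p k))"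
    by (rule poly_mapping_eqI) (auto simp: lookup_sum lookup_single when_def in_keys_iff)
  have "eval_minus_one (t_pow j * p) =
    eval_minus_one (\<Sum>k\<in>Poly_Mapping.keys p. Poly_Mapping.single (j + k) (Poly_Mapping.lookup p k))"
    by (subst p) (simp add: t_pow_def sum_distrib_left mult_single)
  also have "\<dots> = - eval_minus_one p"
    unfolding eval_minus_one_sum eval_minus_one_single unfolding eval_minus_one_def[of p] sum_negf[symmetric]
    using assms by (intro sum.cong) (auto simp: minus_one_power_abs)
  finally show ?thesis .
qed

definition eval4 :: "laurent \<Rightarrow> 4" where
  "eval4 p = of_int (eval_minus_one p)"

lemma eval4_simps:
  "eval4 (p + q) = eval4 p + eval4 q" "eval4 0 = 0" "eval4 1 = 1" "eval4 (p - q) = eval4 p - eval4 q"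
  "eval4 (t_pow 1 * p) = - eval4 p" "eval4 (t_pow (- 1) * p) = - eval4 p"
proof -
  show a: "eval4 (p + q) = eval4 p + eval4 q" for p q by (simp add: eval4_def eval_minus_one_add)
  show "eval4 0 = 0" by (simp add: eval4_def eval_minus_one_zero)
  have "eval_minus_one (Poly_Mapping.single 0 1) = 1" by (simp only: eval_minus_one_single) simp
  thus "eval4 1 = 1" by (simp add: eval4_def)
  have "eval4 (p - q) + eval4 q = eval4 p" using a[of "p - q" q] by simp
  thus "eval4 (p - q) = eval4 p - eval4 q" by (simp add: eq_diff_eq)
qed (simp_all add: eval4_def eval_minus_one_t_pow_mult)

lemma eval4_burau_act:
  "eval4 (burau_act (t_pow 1) (t_pow (- 1)) l f r) = burau_act (- 1) (- 1) l (\<lambda>r. eval4 (f r)) r"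
  by (cases l) (auto simp: burau_act_def left_diff_distrib eval4_simps)

lemma eval4_burau_word:
  "eval4 (foldr (burau_act (t_pow 1) (t_pow (- 1))) w (\<lambda>r. if r = c then 1 else 0) r) =
    foldr (burau_act (- 1) (- 1)) w (\<lambda>r. if r = c then 1 else 0) r"
  by (induction w arbitrary: r) (auto simp: eval4_burau_act eval4_simps)

text \<open>\<open>crossing w a b\<close> is the parity of the number of crossings of the strands ending at positions
  \<open>a\<close> and \<open>b\<close> at which, reading from right to left, the strand of \<open>a\<close> comes from the right of a
  positive crossing or from the left of a negative one.\<close>

definition crosses :: "nat \<times> bool \<Rightarrow> nat \<Rightarrow> nat \<Rightarrow> bool" where
  "crosses l a b \<longleftrightarrow> (case l of (i, e) \<Rightarrow> if e then a = Suc i \<and> b = i else a = i \<and> b = Suc i)"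

fun crossing :: "braid_word \<Rightarrow> nat \<Rightarrow> nat \<Rightarrow> bool" where
  "crossing [] a b = False"
| "crossing (l # w) a b = (crosses l (word_perm w a) (word_perm w b) \<noteq> crossing w a b)"

lemma crossing_append: "crossing (u @ v) a b = (crossing u (word_perm v a) (word_perm v b) \<noteq> crossing v a b)"
  by (induction u) auto

lemma crossing_self: "\<not> crossing w a a"
  by (induction w) (auto simp: crosses_def split: prod.splits)

text \<open>Modulo 4 the Burau matrix at \<open>t = -1\<close> is \<open>P (1 + 2 Y)\<close> with \<open>P\<close> a permutation matrix, and this
  is the cocycle \<open>Y\<close>.\<close>

lemma burau_mod4:
  assumes "w \<in> braid_words n" "a \<in> {1..n}" "b \<in> {1..n}"
  shows "foldr (burau_act (- 1 :: 4) (- 1)) w (\<lambda>r. if r = b - 1 then 1 else 0) (word_perm w a - 1) =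
    (if a = b then 1 + (\<Sum>c\<in>{1..n}. 2 * of_bool (crossing w a c)) else 2 * of_bool (crossing w a b))"
  using assms
proof (induction w arbitrary: a)
  case Nil
  thus ?case by auto
next
  case (Cons l w)
  obtain i e where l: "l = (i, e)" by (cases l)
  have i: "1 \<le> i" "i < n" and w: "w \<in> braid_words n" using Cons.prems l by auto
  let ?p = "word_perm w"
  define f where "f = foldr (burau_act (- 1 :: 4) (- 1)) w (\<lambda>r. if r = b - 1 then 1 else 0)"
  have P: "?p permutes {1..n}" by (rule word_perm_permutes[OF w])
  have pX: "?p x \<in> {1..n}" if "x \<in> {1..n}" for x using permutes_in_image[OF P] that by blast
  have inj: "?p x = ?p y \<longleftrightarrow> x = y" for x y using permutes_inj[OF P] by (simp add: inj_eq)
  have surj: "\<exists>x\<in>{1..n}. ?p x = y" if "y \<in> {1..n}" for y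
    using permutes_image[OF P] that by (metis imageE)
  have four: "x + x + x + x = 0" for x :: 4
  proof -
    have "x + x + x + x = 4 * x" by simp
    also have "(4::4) = 0" by simp
    finally show ?thesis by simp
  qed
  have IH: "f (?p x - 1) = (if x = b then 1 + (\<Sum>c\<in>{1..n}. 2 * of_bool (crossing w x c)) else 2 * of_bool (crossing w x b))"
    if "x \<in> {1..n}" for x
    unfolding f_def by (rule Cons.IH[OF w that Cons.prems(3)])
  \<comment> \<open>Doubling kills the crossing terms modulo 4 and leaves twice a permutation
    matrix.\<close>
  have dbl: "f (?p x - 1) + f (?p x - 1) = 2 * of_bool (x = b)" if "x \<in> {1..n}" for x
  proof -
    have "(\<Sum>c\<in>{1..n}. 2 * of_bool (crossing w x c)) + (\<Sum>c\<in>{1..n}. 2 * of_bool (crossing w x c)) = (0 :: 4)"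
      unfolding sum.distrib[symmetric] by (rule sum.neutral, rule ballI) simp
    thus ?thesis using IH[OF that] by (auto simp: algebra_simps)
  qed
  define D where "D c = crosses l (?p a) (?p c)" for c
  have split: "2 * of_bool (crossing (l # w) a c) = 2 * of_bool (D c) + (2 * of_bool (crossing w a c) :: 4)" for c
    by (cases "crossing w a c"; cases "D c") (simp_all add: D_def)
  \<comment> \<open>The change of the right-hand side caused by the new letter
    \<open>l\<close>.\<close>
  define R :: 4 where "R = (if a = b then (\<Sum>c\<in>{1..n}. 2 * of_bool (D c)) else 2 * of_bool (D b))"
  have rhs: "(if a = b then 1 + (\<Sum>c\<in>{1..n}. 2 * of_bool (crossing (l # w) a c)) else 2 * of_bool (crossing (l # w) a b)) =
    f (?p a - 1) + R"
    unfolding IH[OF Cons.prems(2)] R_def split sum.distrib by simp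
  have lhs: "foldr (burau_act (- 1 :: 4) (- 1)) (l # w) (\<lambda>r. if r = b - 1 then 1 else 0) (word_perm (l # w) a - 1) =
    burau_act (- 1) (- 1) (i, e) f (Transposition.transpose i (Suc i) (?p a) - 1)"
    by (simp add: l f_def)
  have pa: "?p a \<in> {1..n}" by (rule pX[OF Cons.prems(2)])
  \<comment> \<open>A letter crosses the strand of \<open>a\<close> with at most one other strand,
    at a position \<open>y\<close>. On the diagonal the sum in \<open>R\<close> then has one term,
    and off the diagonal \<open>R\<close> tests whether that strand is the one of
    \<open>b\<close>.\<close>
  have exact: "R = 2 * of_bool (a = b) + 2 * of_bool (?p b = y)"
    if D: "\<And>c. D c \<longleftrightarrow> ?p c = y" and y: "y \<in> {1..n}" "y \<noteq> ?p a" for y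
  proof (cases "a = b")
    case True
    obtain x where x: "x \<in> {1..n}" "?p x = y" using surj[OF y(1)] by blast
    have "D c \<longleftrightarrow> c = x" for c using D x inj by metis
    hence "(\<Sum>c\<in>{1..n}. 2 * of_bool (D c)) = (\<Sum>c\<in>{1..n}. if c = x then 2 else (0::4))"
      by (intro sum.cong) auto
    hence "R = 2" using True x by (simp add: R_def)
    thus ?thesis using True y by simp
  next
    case False
    thus ?thesis by (simp add: R_def D)
  qed
  have none: "R = 0" if "\<And>c. \<not> D c" using that by (simp add: R_def)
  have dbl': "f (y - 1) + f (y - 1) = 2 * of_bool (?p b = y)" if y: "y \<in> {1..n}" for y
  proof -
    obtain x where x: "x \<in> {1..n}" "?p x = y" using surj[OF y] by blast
    show ?thesis using dbl[OF x(1)] x(2) inj[of b x] by (auto simp: eq_commute)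
  qed
  \<comment> \<open>In the rows where a sign appears, \<open>- x = x + 2 * x\<close> modulo 4. The
    difference to \<open>f (?p a - 1)\<close> is then a sum of doubled entries, which
    \<open>dbl\<close> and \<open>dbl'\<close> identify with \<open>R\<close>.\<close>
  have "burau_act (- 1) (- 1) (i, e) f (Transposition.transpose i (Suc i) (?p a) - 1) = f (?p a - 1) + R"
  proof -
    consider (lo) "?p a = i" | (hi) "?p a = Suc i" | (no) "?p a \<noteq> i" "?p a \<noteq> Suc i" by blast
    thus ?thesis
    proof cases
      case lo
      have L: "burau_act (- 1) (- 1) (i, e) f (Transposition.transpose i (Suc i) (?p a) - 1) =
        (if e then f (i - 1) else - f (i - 1) + (f i + f i))"
        using i lo burau_act_cases(2)[of i "- 1 :: 4" "- 1" e f] by simp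
      show ?thesis
      proof (cases e)
        case True
        have "R = 0" by (rule none) (use True lo l in \<open>simp add: D_def crosses_def\<close>)
        thus ?thesis using L True lo by simp
      next
        case False
        have "R = 2 * of_bool (a = b) + 2 * of_bool (?p b = Suc i)"
          by (rule exact) (use False lo l i in \<open>auto simp: D_def crosses_def\<close>)
        also have "\<dots> = (f (i - 1) + f (i - 1)) + (f i + f i)"
          using dbl[OF Cons.prems(2)] dbl'[of "Suc i"] i lo by simp
        finally have "f (?p a - 1) + R = (f (i - 1) + f (i - 1) + f (i - 1) + f (i - 1)) - f (i - 1) + (f i + f i)"
          using lo by simp
        thus ?thesis using L False unfolding four by simp
      qed
    next
      case hi
      have L: "burau_act (- 1) (- 1) (i, e) f (Transposition.transpose i (Suc i) (?p a) - 1) =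
        (if e then (f (i - 1) + f (i - 1)) - f i else f i)"
        using i hi burau_act_cases(1)[of i "- 1 :: 4" "- 1" e f] by simp
      show ?thesis
      proof (cases e)
        case False
        have "R = 0" by (rule none) (use False hi l in \<open>simp add: D_def crosses_def\<close>)
        thus ?thesis using L False hi by simp
      next
        case True
        have "R = 2 * of_bool (a = b) + 2 * of_bool (?p b = i)"
          by (rule exact) (use True hi l i in \<open>auto simp: D_def crosses_def\<close>)
        also have "\<dots> = (f i + f i) + (f (i - 1) + f (i - 1))"
          using dbl[OF Cons.prems(2)] dbl'[of i] i hi by simp
        finally have "f (?p a - 1) + R = (f i + f i + f i + f i) - f i + (f (i - 1) + f (i - 1))"
          using hi by simp
        thus ?thesis using L True unfolding four by simp
      qed
    next
      case no
      have "R = 0" by (rule none) (use no l in \<open>auto simp: D_def crosses_def\<close>)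
      moreover have "?p a - 1 \<noteq> i" "?p a - 1 \<noteq> i - 1" using no pa i by auto
      ultimately show ?thesis using no burau_act_cases(3)[OF i(1), of "?p a - 1"] by simp
    qed
  qed
  thus ?case unfolding lhs rhs .
qed

lemma crossing_range:
  assumes "w \<in> braid_words n" "crossing w a b"
  shows "a \<in> {1..n} \<and> b \<in> {1..n}"
  using assms
proof (induction w)
  case (Cons l w)
  obtain i e where l: "l = (i, e)" by (cases l)
  have w: "w \<in> braid_words n" and i: "1 \<le> i" "i < n" using Cons.prems l by auto
  show ?case
  proof (cases "crossing w a b")
    case False
    hence "crosses l (word_perm w a) (word_perm w b)" using Cons.prems by simp
    hence "word_perm w a \<in> {1..n} \<and> word_perm w b \<in> {1..n}"
      using i by (auto simp: l crosses_def split: if_splits)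
    thus ?thesis using permutes_in_image[OF word_perm_permutes[OF w]] by blast
  qed (use Cons.IH w in blast)
qed simp

lemma word_perm_inv_cancel [simp]:
  "word_perm (word_inv w) (word_perm w a) = a" "word_perm w (word_perm (word_inv w) a) = a"
  using word_perm_inv[of w] by (metis comp_apply id_apply)+

text \<open>Read backwards, a crossing changes sign and its strands exchange positions;
  \<open>crosses\<close> is invariant under both changes together.\<close>

lemma crossing_inv: "crossing (word_inv w) (word_perm w a) (word_perm w b) = crossing w a b"
proof (induction w)
  case (Cons l w)
  obtain i e where l: "l = (i, e)" by (cases l)
  let ?s = "Transposition.transpose i (Suc i)"
  have "crosses (i, \<not> e) (?s p) (?s q) = crosses (i, e) p q" for p q
    by (auto simp: crosses_def Transposition.transpose_def)
  thus ?case using Cons by (auto simp: l crossing_append)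
qed simp

text \<open>A complete invariant of elements of \<open>Zgrp\<close>: by \<open>Zc_eq_iff\<close> two
  words represent the same element exactly when their keys agree.\<close>

definition key :: "braid_word \<Rightarrow> (nat \<Rightarrow> nat) \<times> (nat \<Rightarrow> nat \<Rightarrow> bool)" where
  "key w = (word_perm w, crossing w)"

lemma key_eqI: "word_perm u = word_perm v \<Longrightarrow> (\<And>a b. crossing u a b = crossing v a b) \<Longrightarrow> key u = key v"
  by (auto simp: key_def fun_eq_iff)

lemma key_eqD: "key u = key v \<Longrightarrow> word_perm u = word_perm v" "key u = key v \<Longrightarrow> crossing u a b = crossing v a b"
  by (auto simp: key_def)

lemma key_append:
  assumes "key u = key u'" "key v = key v'"
  shows "key (u @ v) = key (u' @ v')"
  using key_eqD[OF assms(1)] key_eqD[OF assms(2)] by (intro key_eqI) (simp_all add: crossing_append)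

lemma key_word_inv: "key (w @ word_inv w) = key []"
proof (rule key_eqI)
  show "word_perm (w @ word_inv w) = word_perm []" by (simp only: word_perm_append word_perm_inv word_perm_simps)
  show "crossing (w @ word_inv w) a b = crossing [] a b" for a b
    using crossing_inv[of w "word_perm (word_inv w) a" "word_perm (word_inv w) b"] by (simp add: crossing_append)
qed

lemma key_word_inv': "key (word_inv w @ w) = key []"
  using key_word_inv[of "word_inv w"] by simp

lemma key_quotient: "key (u @ word_inv v) = key [] \<longleftrightarrow> key u = key v"
proof
  assume "key (u @ word_inv v) = key []"
  hence "key ((u @ word_inv v) @ v) = key ([] @ v)" by (rule key_append) simp
  moreover have "key (u @ (word_inv v @ v)) = key (u @ [])" by (rule key_append[OF HOL.refl key_word_inv'])
  ultimately show "key u = key v" by simp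
next
  assume "key u = key v"
  hence "key (u @ word_inv v) = key (v @ word_inv v)" by (rule key_append) simp
  thus "key (u @ word_inv v) = key []" by (simp add: key_word_inv)
qed

text \<open>In P (1 + 2 Y) the diagonal entries of the second factor have the form 1 + 2 s and never
  vanish modulo 4, so an identity matrix forces P to be trivial. After that, an off-diagonal entry 2
  would reveal any crossing.\<close>

lemma level4_iff:
  assumes w: "w \<in> braid_words n"
  shows "braid_class n w \<in> level4 n \<longleftrightarrow> key w = key []"
proof -
  let ?p = "word_perm w"
  define M :: "4 mat" where "M = map_mat of_int (map_mat eval_minus_one (burau n (braid_class n w)))"
  have M: "M \<in> carrier_mat n n" using burau_word_carrier[of n w] by (simp add: M_def burau_class[OF w])
  have P: "?p permutes {1..n}" by (rule word_perm_permutes[OF w])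
  have pX: "?p x \<in> {1..n}" if "x \<in> {1..n}" for x using permutes_in_image[OF P] that by blast
  have entry: "M $$ (?p a - 1, b - 1) =
      (if a = b then 1 + (\<Sum>c\<in>{1..n}. 2 * of_bool (crossing w a c)) else 2 * of_bool (crossing w a b))"
    if "a \<in> {1..n}" "b \<in> {1..n}" for a b
  proof -
    have lt: "?p a - 1 < n" "b - 1 < n" using pX[OF that(1)] that(2) by auto
    have "M $$ (?p a - 1, b - 1) = eval4 (burau_word n w $$ (?p a - 1, b - 1))"
      using lt burau_word_carrier[of n w] by (simp add: M_def burau_class[OF w] eval4_def)
    also have "\<dots> = foldr (burau_act (- 1 :: 4) (- 1)) w (\<lambda>r. if r = b - 1 then 1 else 0) (?p a - 1)"
      unfolding burau_word_entry[OF w lt] by (rule eval4_burau_word)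
    finally show ?thesis unfolding burau_mod4[OF w that] .
  qed
  have two: "(2 :: 4) \<noteq> 0" by simp
  have four: "2 * (\<Sum>c\<in>S. 2 * of_bool (P c)) = (0 :: 4)" for S :: "nat set" and P
    unfolding sum_distrib_left by (rule sum.neutral, rule ballI) simp
  \<comment> \<open>Twice this entry is 2, which is nonzero modulo 4.\<close>
  have odd: "1 + (\<Sum>c\<in>{1..n}. 2 * of_bool (Q c)) \<noteq> (0 :: 4)" for Q :: "nat \<Rightarrow> bool"
  proof
    assume "1 + (\<Sum>c\<in>{1..n}. 2 * of_bool (Q c)) = (0 :: 4)"
    hence "2 * (1 + (\<Sum>c\<in>{1..n}. 2 * of_bool (Q c))) = (0 :: 4)" by simp
    hence "2 + 2 * (\<Sum>c\<in>{1..n}. 2 * of_bool (Q c)) = (0 :: 4)" by (simp only: distrib_left mult_1_right)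
    thus False using two unfolding four by simp
  qed
  have "braid_class n w \<in> level4 n \<longleftrightarrow> M = 1\<^sub>m n"
    using w by (auto simp: level4_def kernel_def M_def GL_simps braid_group_simps)
  also have "\<dots> \<longleftrightarrow> key w = key []"
  proof
    assume one: "M = 1\<^sub>m n"
    have fixed: "?p a = a" if a: "a \<in> {1..n}" for a
    proof -
      have "M $$ (?p a - 1, a - 1) \<noteq> 0" using entry[OF a a] odd by simp
      moreover have lt: "?p a - 1 < n" "a - 1 < n" using pX[OF a] a by auto
      ultimately have "?p a - 1 = a - 1" unfolding one by (auto split: if_splits)
      thus ?thesis using pX[OF a] a unfolding atLeastAtMost_iff by linarith
    qed
    have cr: "\<not> crossing w a b" for a b
    proof
      assume c: "crossing w a b"
      hence ab: "a \<in> {1..n}" "b \<in> {1..n}" using crossing_range[OF w] by blast+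
      have ne: "a \<noteq> b" using c crossing_self by blast
      have "M $$ (a - 1, b - 1) = 2" using entry[OF ab] fixed[OF ab(1)] ne c by simp
      moreover have "a - 1 < n" "b - 1 < n" "a - 1 \<noteq> b - 1" using ab ne by auto
      ultimately show False unfolding one using two by simp
    qed
    show "key w = key []"
    proof (rule key_eqI)
      show "word_perm w = word_perm []"
      proof
        fix x show "word_perm w x = word_perm [] x"
          using fixed[of x] permutes_not_in[OF P, of x] by (cases "x \<in> {1..n}") auto
      qed
    qed (simp add: cr)
  next
    assume k: "key w = key []"
    show "M = 1\<^sub>m n"
    proof (rule eq_matI)
      fix r c assume "r < dim_row (1\<^sub>m n :: 4 mat)" "c < dim_col (1\<^sub>m n :: 4 mat)"
      hence rc: "r < n" "c < n" by auto
      have "M $$ (?p (Suc r) - 1, Suc c - 1) = (if r = c then 1 else 0)"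
        using rc key_eqD(2)[OF k] by (subst entry) auto
      thus "M $$ (r, c) = 1\<^sub>m n $$ (r, c)" using rc key_eqD(1)[OF k] by simp
    qed (use M in auto)
  qed
  finally show ?thesis .
qed

text \<open>Having the key of the empty word is stable under concatenation, inversion and
  conjugation of words, so subgroup and normality are both verified on keys.\<close>

lemma level4_normal: "level4 n \<lhd> braid_group n"
proof -
  interpret group "braid_group n" by (rule braid_group_group)
  have mem: "x \<in> level4 n \<longleftrightarrow> (\<exists>w\<in>braid_words n. x = braid_class n w \<and> key w = key [])" for x
  proof -
    have "x \<in> level4 n \<Longrightarrow> x \<in> carrier (braid_group n)" by (simp add: level4_def kernel_def)
    thus ?thesis using level4_iff by (auto simp: braid_group_simps)
  qed
  have "subgroup (level4 n) (braid_group n)"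
  proof (rule subgroupI)
    show "level4 n \<subseteq> carrier (braid_group n)" by (auto simp: level4_def kernel_def)
    have "braid_class n [] \<in> level4 n" by (simp add: level4_iff)
    thus "level4 n \<noteq> {}" by blast
  next
    fix x assume "x \<in> level4 n"
    then obtain w where w: "w \<in> braid_words n" "x = braid_class n w" "key w = key []" unfolding mem by blast
    have "key ([] @ word_inv w) = key (w @ word_inv w)" by (rule key_append) (simp_all add: w)
    hence "key (word_inv w) = key []" by (simp add: key_word_inv)
    thus "inv\<^bsub>braid_group n\<^esub> x \<in> level4 n" using w by (simp add: braid_class_inv level4_iff)
  next
    fix x y assume "x \<in> level4 n" "y \<in> level4 n"
    then obtain v w where w: "w \<in> braid_words n" "x = braid_class n w" "key w = key []"
      and v: "v \<in> braid_words n" "y = braid_class n v" "key v = key []" unfolding mem by blast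
    have "key (w @ v) = key ([] @ [])" by (intro key_append w v)
    thus "x \<otimes>\<^bsub>braid_group n\<^esub> y \<in> level4 n" using w v by (simp add: braid_class_mult level4_iff)
  qed
  moreover have "g \<otimes>\<^bsub>braid_group n\<^esub> x \<otimes>\<^bsub>braid_group n\<^esub> inv\<^bsub>braid_group n\<^esub> g \<in> level4 n"
    if g: "g \<in> carrier (braid_group n)" and x: "x \<in> level4 n" for g x
  proof -
    obtain w where w: "w \<in> braid_words n" "x = braid_class n w" "key w = key []" using x unfolding mem by blast
    obtain v where v: "v \<in> braid_words n" "g = braid_class n v" using g by (auto simp: braid_group_simps)
    have "key ((v @ w) @ word_inv v) = key ((v @ []) @ word_inv v)" by (intro key_append w HOL.refl)
    hence "key (v @ w @ word_inv v) = key []" by (simp add: key_word_inv)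
    thus ?thesis using v w by (simp add: braid_class_inv braid_class_mult level4_iff)
  qed
  ultimately show ?thesis unfolding normal_inv_iff by blast
qed

section \<open>The finite quotient described by words\<close>

definition Zc :: "nat \<Rightarrow> braid_word \<Rightarrow> zelem" where
  "Zc n w = to_Z n (braid_class n w)"

lemma Zgrp_group: "group (Zgrp n)"
  unfolding Zgrp_def by (rule normal.factorgroup_is_group[OF level4_normal])

lemma Zgrp_carrier: "carrier (Zgrp n) = Zc n ` braid_words n"
  by (simp add: Zgrp_def carrier_FactGroup Zc_def[abs_def] to_Z_def braid_group_simps image_image)

lemma Zc_mult:
  assumes "u \<in> braid_words n" "v \<in> braid_words n"
  shows "Zc n u \<otimes>\<^bsub>Zgrp n\<^esub> Zc n v = Zc n (u @ v)"
  unfolding Zgrp_def Zc_def to_Z_def using assms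
  by (simp add: normal.rcos_sum[OF level4_normal] braid_class_mult braid_group_simps)

lemma Zc_one: "\<one>\<^bsub>Zgrp n\<^esub> = Zc n []"
proof -
  interpret normal "level4 n" "braid_group n" by (rule level4_normal)
  have "level4 n #>\<^bsub>braid_group n\<^esub> \<one>\<^bsub>braid_group n\<^esub> = level4 n"
    by (rule coset_mult_one) (rule subset)
  thus ?thesis by (simp add: Zgrp_def Zc_def to_Z_def braid_group_simps)
qed

lemma Zc_eq_iff:
  assumes "u \<in> braid_words n" "v \<in> braid_words n"
  shows "Zc n u = Zc n v \<longleftrightarrow> key u = key v"
proof -
  interpret normal "level4 n" "braid_group n" by (rule level4_normal)
  let ?u = "braid_class n u" and ?v = "braid_class n v"
  have c: "?u \<in> carrier (braid_group n)" "?v \<in> carrier (braid_group n)"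
    using assms by (auto simp: braid_group_simps)
  have "Zc n u = Zc n v \<longleftrightarrow> ?u \<in> level4 n #>\<^bsub>braid_group n\<^esub> ?v"
    unfolding Zc_def to_Z_def using c is_subgroup
    by (metis rcos_self repr_independence)
  also have "\<dots> \<longleftrightarrow> ?u \<otimes>\<^bsub>braid_group n\<^esub> inv\<^bsub>braid_group n\<^esub> ?v \<in> level4 n"
    by (rule rcos_module[OF is_group c(2,1)])
  also have "\<dots> \<longleftrightarrow> key u = key v"
    using assms by (simp add: braid_class_inv braid_class_mult level4_iff key_quotient)
  finally show ?thesis .
qed

lemma Zc_inv:
  assumes "w \<in> braid_words n"
  shows "inv\<^bsub>Zgrp n\<^esub> (Zc n w) = Zc n (word_inv w)"
proof -
  interpret group "Zgrp n" by (rule Zgrp_group)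
  have "Zc n (word_inv w) \<otimes>\<^bsub>Zgrp n\<^esub> Zc n w = \<one>\<^bsub>Zgrp n\<^esub>"
    using assms by (simp add: Zc_mult Zc_one Zc_eq_iff key_word_inv')
  thus ?thesis using assms by (intro inv_equality) (auto simp: Zgrp_carrier)
qed

text \<open>A key consists of a permutation of \<open>{1..n}\<close> and a relation on
  \<open>{1..n}\<close>, and there are finitely many of these.\<close>

lemma Zgrp_finite: "finite (carrier (Zgrp n))"
proof -
  define K where "K = {p. p permutes {1..n}} \<times> (\<lambda>S a b. (a, b) \<in> S) ` Pow ({1..n} \<times> {1..n})"
  have fin: "finite K" unfolding K_def using finite_permutations[of "{1..n}"] by simp
  have "Zc n w \<in> (\<lambda>k. Zc n (SOME v. v \<in> braid_words n \<and> key v = k)) ` K" if w: "w \<in> braid_words n" for w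
  proof (rule image_eqI)
    define v where "v = (SOME v. v \<in> braid_words n \<and> key v = key w)"
    have "v \<in> braid_words n \<and> key v = key w" unfolding v_def by (rule someI[of _ w]) (simp add: w)
    thus "Zc n w = Zc n (SOME v. v \<in> braid_words n \<and> key v = key w)"
      unfolding v_def[symmetric] using w by (simp add: Zc_eq_iff)
    have "crossing w = (\<lambda>a b. (a, b) \<in> {(a, b). crossing w a b})" by simp
    moreover have "{(a, b). crossing w a b} \<in> Pow ({1..n} \<times> {1..n})" using crossing_range[OF w] by auto
    ultimately show "key w \<in> K"
      unfolding K_def key_def using word_perm_permutes[OF w] by (intro SigmaI CollectI image_eqI)
  qed
  hence "carrier (Zgrp n) \<subseteq> (\<lambda>k. Zc n (SOME v. v \<in> braid_words n \<and> key v = k)) ` K"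
    unfolding Zgrp_carrier by blast
  thus ?thesis using fin finite_surj by blast
qed

section \<open>Pure braids and their characters\<close>

definition pure_words :: "nat \<Rightarrow> braid_word set" where
  "pure_words n = {w \<in> braid_words n. word_perm w = id}"

lemma pure_words_words: "w \<in> pure_words n \<Longrightarrow> w \<in> braid_words n"
  by (simp add: pure_words_def)

lemma pure_words_append: "u \<in> pure_words n \<Longrightarrow> v \<in> pure_words n \<Longrightarrow> u @ v \<in> pure_words n"
  by (simp add: pure_words_def)

lemma pure_words_conj: "g \<in> braid_words n \<Longrightarrow> w \<in> pure_words n \<Longrightarrow> g @ w @ word_inv g \<in> pure_words n"
  by (simp add: pure_words_def word_perm_inv)

lemma PZ_carrier: "carrier (PZgrp n) = Zc n ` pure_words n"
proof -
  have "pure_braids n = braid_class n ` pure_words n"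
    by (auto simp: pure_braids_def kernel_def braid_group_simps pure_words_def braid_perm_class sym_simps)
  thus ?thesis by (simp add: PZgrp_def image_image Zc_def)
qed

lemma PZ_mult: "mult (PZgrp n) = mult (Zgrp n)" and PZ_one: "one (PZgrp n) = one (Zgrp n)"
  by (simp_all add: PZgrp_def)

lemma Zc_eq_perm: "Zc n u = Zc n v \<Longrightarrow> u \<in> braid_words n \<Longrightarrow> v \<in> braid_words n \<Longrightarrow> word_perm u = word_perm v"
  using Zc_eq_iff key_eqD(1) by blast

lemma Zc_in_PZ:
  assumes "w \<in> braid_words n"
  shows "Zc n w \<in> carrier (PZgrp n) \<longleftrightarrow> word_perm w = id"
proof
  assume "Zc n w \<in> carrier (PZgrp n)"
  then obtain v where "Zc n w = Zc n v" "v \<in> braid_words n" "word_perm v = id"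
    unfolding PZ_carrier pure_words_def by blast
  thus "word_perm w = id" using Zc_eq_perm[of n w v] assms by simp
qed (use assms in \<open>simp add: PZ_carrier pure_words_def\<close>)

lemma stab_carrier: "Z_stab n I = Zc n ` {w \<in> braid_words n. (`) (word_perm w) ` I = I}"
proof -
  have "braid_stab n I = braid_class n ` {w \<in> braid_words n. (`) (word_perm w) ` I = I}"
    by (auto simp: braid_stab_def stabilizer_def braid_group_simps braid_perm_class)
  thus ?thesis by (simp add: Z_stab_def image_image Zc_def)
qed

lemma Zc_in_stab:
  assumes "w \<in> braid_words n"
  shows "Zc n w \<in> Z_stab n I \<longleftrightarrow> (`) (word_perm w) ` I = I"
proof
  assume "Zc n w \<in> Z_stab n I"
  then obtain v where "Zc n w = Zc n v" "v \<in> braid_words n" and v: "(`) (word_perm v) ` I = I"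
    unfolding stab_carrier by blast
  hence "word_perm w = word_perm v" using Zc_eq_perm[of n w v] assms by simp
  thus "(`) (word_perm w) ` I = I" using v by simp
qed (use assms in \<open>simp add: stab_carrier\<close>)

lemma Zc_words: "w \<in> braid_words n \<Longrightarrow> Zc n w \<in> carrier (Zgrp n)"
  by (auto simp: Zgrp_carrier)

lemma PZ_subgroup: "subgroup (carrier (PZgrp n)) (Zgrp n)"
proof -
  interpret group "Zgrp n" by (rule Zgrp_group)
  show ?thesis
  proof (rule subgroupI)
    show "carrier (PZgrp n) \<subseteq> carrier (Zgrp n)" by (auto simp: PZ_carrier Zgrp_carrier pure_words_def)
    have "[] \<in> pure_words n" by (simp add: pure_words_def)
    thus "carrier (PZgrp n) \<noteq> {}" unfolding PZ_carrier by blast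
  next
    fix a assume "a \<in> carrier (PZgrp n)"
    then obtain w where w: "w \<in> braid_words n" "word_perm w = id" "a = Zc n w"
      by (auto simp: PZ_carrier pure_words_def)
    have "word_perm (word_inv w) = id" using word_perm_inv(1)[of w] unfolding w(2) comp_id .
    thus "inv\<^bsub>Zgrp n\<^esub> a \<in> carrier (PZgrp n)" using w by (simp add: Zc_inv Zc_in_PZ)
  next
    fix a b assume "a \<in> carrier (PZgrp n)" "b \<in> carrier (PZgrp n)"
    then obtain u v where "u \<in> pure_words n" "v \<in> pure_words n" "a = Zc n u" "b = Zc n v"
      by (auto simp: PZ_carrier)
    thus "a \<otimes>\<^bsub>Zgrp n\<^esub> b \<in> carrier (PZgrp n)"
      using pure_words_append[of u n v] by (simp add: PZ_carrier Zc_mult pure_words_words)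
  qed
qed

lemma stab_subgroup: "subgroup (Z_stab n I) (Zgrp n)"
proof -
  interpret group "Zgrp n" by (rule Zgrp_group)
  show ?thesis
  proof (rule subgroupI)
    show "Z_stab n I \<subseteq> carrier (Zgrp n)" by (auto simp: stab_carrier Zgrp_carrier)
    show "Z_stab n I \<noteq> {}" using Zc_in_stab[of "[]" n I] by auto
  next
    fix a assume "a \<in> Z_stab n I"
    then obtain w where w: "w \<in> braid_words n" "(`) (word_perm w) ` I = I" "a = Zc n w"
      by (auto simp: stab_carrier)
    have "(`) (word_perm (word_inv w)) ` I = (`) (word_perm (word_inv w)) ` (`) (word_perm w) ` I"
      using w(2) by simp
    also have "\<dots> = I" by (simp add: image_image)
    finally show "inv\<^bsub>Zgrp n\<^esub> a \<in> Z_stab n I" using w(1,3) by (simp add: Zc_inv Zc_in_stab)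
  next
    fix a b assume "a \<in> Z_stab n I" "b \<in> Z_stab n I"
    then obtain u v where uv: "u \<in> braid_words n" "v \<in> braid_words n" "a = Zc n u" "b = Zc n v"
      "(`) (word_perm u) ` I = I" "(`) (word_perm v) ` I = I"
      by (auto simp: stab_carrier)
    have "(`) (word_perm (u @ v)) ` I = (`) (word_perm u) ` (`) (word_perm v) ` I"
      by (simp add: image_image)
    also have "\<dots> = I" unfolding uv(6,5) ..
    finally show "a \<otimes>\<^bsub>Zgrp n\<^esub> b \<in> Z_stab n I" using uv by (simp add: Zc_mult Zc_in_stab)
  qed
qed

lemma PZ_in_stab: "carrier (PZgrp n) \<subseteq> Z_stab n I"
  by (auto simp: PZ_carrier pure_words_def Zc_in_stab)

lemma PZ_conj:
  assumes "g \<in> carrier (Zgrp n)" "a \<in> carrier (PZgrp n)"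
  shows "inv\<^bsub>Zgrp n\<^esub> g \<otimes>\<^bsub>Zgrp n\<^esub> a \<otimes>\<^bsub>Zgrp n\<^esub> g \<in> carrier (PZgrp n)"
proof -
  obtain w where w: "w \<in> braid_words n" "g = Zc n w" using assms(1) by (auto simp: Zgrp_carrier)
  obtain u where u: "u \<in> pure_words n" "a = Zc n u" using assms(2) by (auto simp: PZ_carrier)
  have "word_inv w @ u @ word_inv (word_inv w) \<in> pure_words n" using w(1) u(1) by (intro pure_words_conj) simp_all
  thus ?thesis using w u(2) pure_words_words[OF u(1)] by (auto simp: Zc_inv Zc_mult PZ_carrier)
qed

text \<open>The integral antisymmetric part of the cocycle only depends on the permutation, so a pure braid
  crosses \<open>a\<close> over \<open>b\<close> as often as \<open>b\<close> over \<open>a\<close>, up to parity.\<close>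

lemma crossing_commute:
  assumes "a \<noteq> b"
  shows "(crossing w a b \<noteq> crossing w b a) \<longleftrightarrow> ((a < b) \<noteq> (word_perm w a < word_perm w b))"
proof (induction w)
  case (Cons l w)
  obtain i e where l: "l = (i, e)" by (cases l)
  have "word_perm w a \<noteq> word_perm w b" using assms word_perm_inv_cancel(1)[of w] by metis
  moreover have "(crosses (i, e) p q \<noteq> crosses (i, e) q p) \<longleftrightarrow>
      ((p < q) \<noteq> (Transposition.transpose i (Suc i) p < Transposition.transpose i (Suc i) q))"
    if "p \<noteq> q" for p q
    using that by (auto simp: crosses_def Transposition.transpose_def)
  ultimately show ?case using Cons by (auto simp: l)
qed simp

lemma crossing_pure_sym:
  assumes "word_perm w = id"
  shows "crossing w a b = crossing w b a"
  using crossing_commute[of a b w] by (cases "a = b") (auto simp: assms)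

text \<open>For a pure braid this is the set of pairs of strands with odd linking number, i.e. the
  class in the mod 2 abelianization in the basis of the Artin generators.\<close>

definition link :: "braid_word \<Rightarrow> nat set set" where
  "link w = {{a, b} |a b. crossing w a b}"

lemma link_iff: "word_perm w = id \<Longrightarrow> {a, b} \<in> link w \<longleftrightarrow> crossing w a b"
  using crossing_pure_sym[of w] by (auto simp: link_def doubleton_eq_iff)

lemma link_key: "key u = key v \<Longrightarrow> link u = link v"
  by (simp add: link_def key_def)

lemma link_pairs: "w \<in> braid_words n \<Longrightarrow> link w \<subseteq> pairs n"
  using crossing_range[of w n] crossing_self[of w] by (auto simp: link_def pairs_def card_2_iff) metis

lemma link_append:
  assumes "word_perm u = id" "word_perm v = id"
  shows "A \<in> link (u @ v) \<longleftrightarrow> (A \<in> link u) \<noteq> (A \<in> link v)"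
proof (cases "\<exists>a b. A = {a, b}")
  case True
  then obtain a b where A: "A = {a, b}" by blast
  show ?thesis unfolding A using assms by (simp add: link_iff crossing_append)
qed (auto simp: link_def)

text \<open>Conjugation relabels strands by the permutation of \<open>g\<close>; the crossings
  contributed by \<open>g\<close> and by its inverse occur between the same strands and cancel
  modulo 2.\<close>

lemma link_conj:
  assumes x: "word_perm x = id"
  shows "A \<in> link (g @ x @ word_inv g) \<longleftrightarrow> word_perm (word_inv g) ` A \<in> link x"
proof -
  let ?p = "word_perm g" and ?q = "word_perm (word_inv g)"
  have pure: "word_perm (g @ x @ word_inv g) = id" using x by (simp only: word_perm_append id_comp word_perm_inv)
  have A: "?p ` ?q ` A = A" by (simp add: image_image)
  show ?thesis
  proof (cases "\<exists>a b. A = {a, b}")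
    case True
    then obtain a b where ab: "A = {a, b}" by blast
    show ?thesis unfolding ab link_iff[OF pure]
      using link_iff[OF x] x crossing_inv[of g "?q a" "?q b"] by (simp add: crossing_append) blast
  next
    case False
    hence "A \<notin> link (g @ x @ word_inv g)" by (auto simp: link_def)
    moreover have "?q ` A \<notin> link x"
    proof
      assume "?q ` A \<in> link x"
      then obtain a b where "?q ` A = {a, b}" by (auto simp: link_def)
      hence "A = {?p a, ?p b}" using A by simp
      thus False using False by blast
    qed
    ultimately show ?thesis by simp
  qed
qed

text \<open>For finite \<open>I\<close> the product is -1 to the power of the number of pairs common
  to \<open>I\<close> and \<open>link w\<close>. On pure words this is the character of V_I.\<close>

definition sgn_word :: "nat set set \<Rightarrow> braid_word \<Rightarrow> complex" where
  "sgn_word I w = (\<Prod>A\<in>I. if A \<in> link w then - 1 else 1)"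

lemma sgn_word_append:
  assumes "word_perm u = id" "word_perm v = id"
  shows "sgn_word I (u @ v) = sgn_word I u * sgn_word I v"
  unfolding sgn_word_def prod.distrib[symmetric]
  by (rule prod.cong[OF HOL.refl]) (simp add: link_append[OF assms])

lemma sgn_word_sq: "sgn_word I w * sgn_word I w = 1"
  unfolding sgn_word_def prod.distrib[symmetric] by (rule prod.neutral) simp

lemma sgn_word_conj:
  assumes "word_perm x = id"
  shows "sgn_word I (word_inv g @ x @ g) = sgn_word ((`) (word_perm g) ` I) x"
proof -
  have "inj (word_perm g)" using word_perm_inv_cancel(1)[of g] by (rule inj_on_inverseI)
  hence inj: "inj_on ((`) (word_perm g)) I" by (simp add: inj_on_def inj_image_eq_iff)
  have eq: "A \<in> link (word_inv g @ x @ g) \<longleftrightarrow> word_perm g ` A \<in> link x" for A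
    using link_conj[OF assms, of A "word_inv g"] by simp
  show ?thesis unfolding sgn_word_def prod.reindex[OF inj] by (simp add: eq)
qed

text \<open>The chosen word is immaterial because \<open>link\<close> depends only on the key. The
  function is multiplicative on the pure part, which is where it is used as a character.\<close>

definition chi :: "nat \<Rightarrow> nat set set \<Rightarrow> zelem \<Rightarrow> complex" where
  "chi n I z = sgn_word I (SOME w. w \<in> braid_words n \<and> Zc n w = z)"

lemma chi_Zc:
  assumes "w \<in> braid_words n"
  shows "chi n I (Zc n w) = sgn_word I w"
proof -
  define v where "v = (SOME v. v \<in> braid_words n \<and> Zc n v = Zc n w)"
  have "v \<in> braid_words n \<and> Zc n v = Zc n w" unfolding v_def by (rule someI[of _ w]) (simp add: assms)
  hence "key v = key w" using Zc_eq_iff assms by blast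
  show ?thesis unfolding chi_def v_def[symmetric] sgn_word_def link_key[OF \<open>key v = key w\<close>] by (rule HOL.refl)
qed

lemma chi_mult:
  assumes "a \<in> carrier (PZgrp n)" "b \<in> carrier (PZgrp n)"
  shows "chi n I (a \<otimes>\<^bsub>Zgrp n\<^esub> b) = chi n I a * chi n I b"
  using assms by (auto simp: PZ_carrier pure_words_def Zc_mult chi_Zc sgn_word_append)

lemma chi_sq: "a \<in> carrier (PZgrp n) \<Longrightarrow> chi n I a * chi n I a = 1"
  by (auto simp: PZ_carrier pure_words_def chi_Zc sgn_word_sq)

lemma chi_conj:
  assumes "w \<in> braid_words n" "a \<in> carrier (PZgrp n)"
  shows "chi n I (inv\<^bsub>Zgrp n\<^esub> (Zc n w) \<otimes>\<^bsub>Zgrp n\<^esub> a \<otimes>\<^bsub>Zgrp n\<^esub> Zc n w) = chi n ((`) (word_perm w) ` I) a"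
  using assms by (auto simp: PZ_carrier pure_words_def Zc_mult Zc_inv chi_Zc sgn_word_conj)

definition t_word :: "nat \<Rightarrow> nat \<Rightarrow> braid_word" where
  "t_word i j = map (\<lambda>l. (l, True)) (rev [i + 1..<j]) @ [(i, True), (i, True)] @ map (\<lambda>l. (l, False)) [i + 1..<j]"

lemma artin_gen_class: "artin_gen n i j = braid_class n (t_word i j)"
  by (simp add: artin_gen_def t_word_def)

lemma t_word_Suc: "i < j \<Longrightarrow> t_word i (Suc j) = [(j, True)] @ t_word i j @ word_inv [(j, True)]"
  by (simp add: t_word_def)

text \<open>Induction on \<open>j - i\<close>: the next generator is the conjugate of the previous
  one by a crossing of the strands \<open>j\<close> and \<open>Suc j\<close>, which moves the linked
  pair along.\<close>

lemma t_word_pure_link: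
  assumes "i < j"
  shows "word_perm (t_word i j) = id \<and> link (t_word i j) = {{i, j}}"
proof -
  have "word_perm (t_word i (Suc (i + d))) = id \<and> link (t_word i (Suc (i + d))) = {{i, Suc (i + d)}}" for d
  proof (induction d)
    case 0
    have t: "t_word i (Suc i) = [(i, True), (i, True)]" by (simp add: t_word_def)
    have c: "crossing (t_word i (Suc i)) a b \<longleftrightarrow> a = Suc i \<and> b = i \<or> a = i \<and> b = Suc i" for a b
      by (auto simp: t crosses_def Transposition.transpose_def)
    have "link (t_word i (Suc i)) = {{i, Suc i}}" by (auto simp: link_def c doubleton_eq_iff)
    moreover have "word_perm (t_word i (Suc i)) = id" by (simp add: t)
    ultimately show ?case by simp
  next
    case (Suc d)
    define j where "j = Suc (i + d)"
    let ?t = "t_word i j" and ?g = "[(j, True)]"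
    have IH: "word_perm ?t = id" "link ?t = {{i, j}}" using Suc unfolding j_def by blast+
    have t: "t_word i (Suc j) = ?g @ ?t @ word_inv ?g" by (rule t_word_Suc) (simp add: j_def)
    have "word_perm (t_word i (Suc j)) = id" unfolding t by (simp only: word_perm_append IH id_comp word_perm_inv)
    moreover have "A \<in> link (t_word i (Suc j)) \<longleftrightarrow> A = {i, Suc j}" for A
    proof -
      let ?s = "Transposition.transpose j (Suc j)"
      have s: "?s ` ?s ` B = B" for B by (simp add: image_image)
      have sij: "?s ` {i, j} = {i, Suc j}" by (simp add: j_def Transposition.transpose_def)
      have "A \<in> link (t_word i (Suc j)) \<longleftrightarrow> ?s ` A = {i, j}"
        unfolding t link_conj[OF IH(1)] IH(2) by simp
      also have "\<dots> \<longleftrightarrow> A = {i, Suc j}" using s[of A] s[of "{i, j}"] sij by metis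
      finally show ?thesis .
    qed
    ultimately show ?case by (auto simp: j_def)
  qed
  from this[of "j - Suc i"] show ?thesis using assms by simp
qed

lemma t_word_words: "1 \<le> i \<Longrightarrow> i < j \<Longrightarrow> j \<le> n \<Longrightarrow> t_word i j \<in> braid_words n"
  unfolding t_word_def braid_words_def by auto

lemma t_word_pure: "1 \<le> i \<Longrightarrow> i < j \<Longrightarrow> j \<le> n \<Longrightarrow> t_word i j \<in> pure_words n"
  by (simp add: pure_words_def t_word_words t_word_pure_link)

lemma pure_key_eqI:
  assumes "word_perm u = id" "word_perm v = id" "link u = link v"
  shows "key u = key v"
  using assms link_iff[of u] link_iff[of v] by (intro key_eqI) auto

lemma pairsE:
  assumes "A \<in> pairs n"
  obtains i j where "1 \<le> i" "i < j" "j \<le> n" "A = {i, j}"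
proof -
  obtain a b where ab: "A = {a, b}" "a \<noteq> b" using assms by (auto simp: pairs_def card_2_iff)
  have "a \<in> {1..n}" "b \<in> {1..n}" using assms ab by (auto simp: pairs_def)
  thus thesis using that[of a b] that[of b a] ab by (cases "a < b") (auto simp: insert_commute)
qed

lemma finite_pairs: "finite (pairs n)"
  by (rule finite_subset[of _ "Pow {1..n}"]) (auto simp: pairs_def)

text \<open>The Artin generators generate the pure part. Multiplying by the generator of a linked
  pair removes that pair from \<open>link w\<close>, so the number of linked pairs decreases to
  zero.\<close>

lemma pure_induct:
  assumes "w \<in> pure_words n" "P (Zc n [])"
    and step: "\<And>i j v. 1 \<le> i \<Longrightarrow> i < j \<Longrightarrow> j \<le> n \<Longrightarrow> v \<in> pure_words n \<Longrightarrow> P (Zc n v) \<Longrightarrow>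
      P (Zc n (t_word i j) \<otimes>\<^bsub>Zgrp n\<^esub> Zc n v)"
  shows "P (Zc n w)"
  using assms(1)
proof (induction "card (link w)" arbitrary: w rule: less_induct)
  case less
  have w: "w \<in> braid_words n" "word_perm w = id" using less.prems by (auto simp: pure_words_def)
  have fin: "finite (link w)" using link_pairs[OF w(1)] finite_pairs finite_subset by blast
  show ?case
  proof (cases "link w = {}")
    case True
    hence "key w = key []" by (intro pure_key_eqI) (auto simp: w link_def)
    hence "Zc n w = Zc n []" using w by (simp add: Zc_eq_iff)
    thus ?thesis using assms(2) by simp
  next
    case False
    then obtain A where A: "A \<in> link w" by blast
    then obtain i j where ij: "1 \<le> i" "i < j" "j \<le> n" "A = {i, j}" using link_pairs[OF w(1)] by (blast elim: pairsE)
    let ?t = "t_word i j"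
    have t: "?t \<in> pure_words n" "word_perm ?t = id" "link ?t = {A}"
      using t_word_pure[OF ij(1-3)] t_word_pure_link[OF ij(2)] ij(4) by auto
    have v: "?t @ w \<in> pure_words n" by (rule pure_words_append[OF t(1) less.prems])
    have lv: "link (?t @ w) = link w - {A}" using link_append[OF t(2) w(2)] A t(3) by auto
    have "card (link (?t @ w)) < card (link w)" unfolding lv by (rule card_Diff1_less[OF fin A])
    hence "P (Zc n (?t @ w))" using v by (rule less.hyps)
    hence P: "P (Zc n ?t \<otimes>\<^bsub>Zgrp n\<^esub> Zc n (?t @ w))" by (intro step ij(1-3) v)
    \<comment> \<open>Multiplying by the same generator again restores \<open>w\<close>, since its
      square is trivial in the quotient.\<close>
    have k: "key (?t @ ?t @ w) = key w"
    proof (rule pure_key_eqI)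
      have tw: "word_perm (?t @ w) = id" using v by (simp add: pure_words_def)
      show "word_perm (?t @ ?t @ w) = id" by (simp only: word_perm_append t(2) w(2) comp_id)
      show "link (?t @ ?t @ w) = link w" using link_append[OF t(2) tw] lv A t(3) by auto
    qed (rule w(2))
    have "Zc n (?t @ ?t @ w) = Zc n w"
      using w(1) pure_words_words[OF t(1)] Zc_eq_iff[of "?t @ ?t @ w" n w] k by simp
    thus ?thesis using P pure_words_words[OF t(1)] pure_words_words[OF v] by (simp add: Zc_mult)
  qed
qed

lemma chi_t_word:
  assumes "1 \<le> i" "i < j" "j \<le> n" "I \<subseteq> pairs n"
  shows "chi n I (Zc n (t_word i j)) = (if {i, j} \<in> I then - 1 else 1)"
proof -
  have fin: "finite I" using assms(4) finite_pairs finite_subset by blast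
  have "chi n I (Zc n (t_word i j)) = (\<Prod>A\<in>I. if A = {i, j} then - 1 else 1)"
    using t_word_pure_link[OF assms(2)] by (simp add: chi_Zc[OF t_word_words[OF assms(1-3)]] sgn_word_def)
  thus ?thesis using fin by simp
qed

lemma chi_separates:
  assumes "I \<subseteq> pairs n" "J \<subseteq> pairs n" "I \<noteq> J"
  shows "\<exists>a\<in>carrier (PZgrp n). chi n I a \<noteq> chi n J a"
proof -
  obtain A where A: "A \<in> I \<longleftrightarrow> A \<notin> J" "A \<in> pairs n" using assms by blast
  obtain i j where ij: "1 \<le> i" "i < j" "j \<le> n" "A = {i, j}" using pairsE[OF A(2)] by blast
  have "chi n I (Zc n (t_word i j)) \<noteq> chi n J (Zc n (t_word i j))"
    using A(1) by (simp add: chi_t_word[OF ij(1-3)] assms(1,2) ij(4)[symmetric])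
  moreover have "Zc n (t_word i j) \<in> carrier (PZgrp n)" using t_word_pure[OF ij(1-3)] by (simp add: PZ_carrier)
  ultimately show ?thesis by blast
qed

text \<open>Expanding the product over all pairs of 1 plus the sign of the pair gives the sum over
  all \<open>J\<close>. A linked pair contributes the factor 0.\<close>

lemma sum_chi:
  assumes "a \<in> carrier (PZgrp n)"
  shows "(\<Sum>J\<in>Pow (pairs n). chi n J a) = (if a = \<one>\<^bsub>Zgrp n\<^esub> then 2 ^ card (pairs n) else 0)"
proof -
  obtain w where w: "w \<in> braid_words n" "word_perm w = id" "a = Zc n w"
    using assms by (auto simp: PZ_carrier pure_words_def)
  have "(\<Sum>J\<in>Pow (pairs n). chi n J a) = (\<Prod>A\<in>pairs n. (if A \<in> link w then - 1 else 1) + 1)"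
    by (simp add: prod_add[OF finite_pairs] w chi_Zc sgn_word_def)
  also have "\<dots> = (if link w = {} then 2 ^ card (pairs n) else 0)"
  proof (cases "link w = {}")
    case False
    then obtain A where "A \<in> link w" "A \<in> pairs n" using link_pairs[OF w(1)] by blast
    thus ?thesis using finite_pairs by (auto simp: prod_zero_iff intro!: bexI[of _ A])
  qed simp
  also have "link w = {} \<longleftrightarrow> a = \<one>\<^bsub>Zgrp n\<^esub>"
  proof -
    have "link w = {} \<longleftrightarrow> link w = link []" by (simp add: link_def)
    also have "\<dots> \<longleftrightarrow> key w = key []"
      using pure_key_eqI[OF w(2), of "[]"] link_key[of w "[]"] word_perm_simps(1) by blast
    also have "\<dots> \<longleftrightarrow> a = \<one>\<^bsub>Zgrp n\<^esub>" unfolding Zc_one w(3) by (rule Zc_eq_iff[symmetric]) (simp_all add: w(1))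
    finally show ?thesis .
  qed
  finally show ?thesis .
qed

section \<open>Stabilizers of characters and isotypic representations\<close>

lemma one_smult_mat [simp]: "(1 :: complex) \<cdot>\<^sub>m A = A"
  by (rule eq_matI) simp_all

lemma scalar_mat_mult: "x \<cdot>\<^sub>m 1\<^sub>m d * (y \<cdot>\<^sub>m 1\<^sub>m d) = (x * y :: complex) \<cdot>\<^sub>m 1\<^sub>m d"
proof -
  have "x \<cdot>\<^sub>m 1\<^sub>m d * (y \<cdot>\<^sub>m 1\<^sub>m d) = x \<cdot>\<^sub>m (1\<^sub>m d * (y \<cdot>\<^sub>m 1\<^sub>m d))"
    by (rule mult_smult_assoc_mat) auto
  also have "\<dots> = (x * y) \<cdot>\<^sub>m 1\<^sub>m d" by (rule eq_matI) auto
  finally show ?thesis .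
qed

lemma PZ_group: "group (PZgrp n)"
  using subgroup.subgroup_is_group[OF PZ_subgroup Zgrp_group, of n] by (simp add: PZgrp_def)

lemma ZIgrp_group: "group (ZIgrp n I)"
  unfolding ZIgrp_def by (rule subgroup.subgroup_is_group[OF stab_subgroup Zgrp_group])

lemma ZIgrp_simps:
  "carrier (ZIgrp n I) = Z_stab n I" "mult (ZIgrp n I) = mult (Zgrp n)" "one (ZIgrp n I) = one (Zgrp n)"
  by (simp_all add: ZIgrp_def)

lemma ZIgrp_finite: "finite (carrier (ZIgrp n I))"
  unfolding ZIgrp_simps by (rule finite_subset[OF subgroup.subset[OF stab_subgroup] Zgrp_finite])

lemma word_perm_pairs:
  assumes "w \<in> braid_words n" "A \<in> pairs n"
  shows "word_perm w ` A \<in> pairs n"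
proof -
  note P = word_perm_permutes[OF assms(1)]
  have A: "A \<subseteq> {1..n}" "card A = 2" using assms(2) by (auto simp: pairs_def)
  have "word_perm w ` A \<subseteq> {1..n}" using A(1) permutes_image[OF P] by blast
  moreover have "card (word_perm w ` A) = card A" by (rule card_image) (use permutes_inj_on[OF P] in blast)
  ultimately show ?thesis using A(2) by (simp add: pairs_def)
qed

text \<open>Conjugation carries the character of \<open>I\<close> to that of its image under the
  permutation, and distinct sets have distinct characters. This supplies \<open>\<chi>_H\<close> and
  \<open>stab\<close> of the locale \<open>clifford\<close>.\<close>

lemma Z_stab_char:
  assumes I: "I \<subseteq> pairs n" and g: "g \<in> carrier (Zgrp n)"
  shows "g \<in> Z_stab n I \<longleftrightarrow>
    (\<forall>a\<in>carrier (PZgrp n). chi n I (inv\<^bsub>Zgrp n\<^esub> g \<otimes>\<^bsub>Zgrp n\<^esub> a \<otimes>\<^bsub>Zgrp n\<^esub> g) = chi n I a)"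
proof -
  obtain w where w: "w \<in> braid_words n" "g = Zc n w" using g by (auto simp: Zgrp_carrier)
  have "(`) (word_perm w) ` I \<subseteq> pairs n" using word_perm_pairs[OF w(1)] I by blast
  hence "(`) (word_perm w) ` I = I \<longleftrightarrow> (\<forall>a\<in>carrier (PZgrp n). chi n ((`) (word_perm w) ` I) a = chi n I a)"
    using chi_separates[of "(`) (word_perm w) ` I" n I] I by metis
  thus ?thesis using chi_conj[OF w(1)] by (simp add: w Zc_in_stab)
qed

text \<open>\<open>is_V\<close> prescribes values only at the Artin generators;
  \<open>pure_induct\<close> extends the agreement to all pure elements.\<close>

lemma is_V_chi:
  assumes V: "is_V n I \<chi>" and I: "I \<subseteq> pairs n" and z: "z \<in> carrier (PZgrp n)"
  shows "snd \<chi> z = chi n I z \<cdot>\<^sub>m 1\<^sub>m 1"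
proof -
  interpret P: group "PZgrp n" by (rule PZ_group)
  have V': "fst \<chi> = 1" "is_rep (PZgrp n) \<chi>" using V by (auto simp: is_V_def)
  obtain w where w: "w \<in> pure_words n" "z = Zc n w" using z by (auto simp: PZ_carrier)
  have "snd \<chi> (Zc n w) = chi n I (Zc n w) \<cdot>\<^sub>m 1\<^sub>m 1"
  proof (rule pure_induct[OF w(1)])
    have "chi n I (Zc n []) = 1" by (simp add: chi_Zc sgn_word_def link_def)
    thus "snd \<chi> (Zc n []) = chi n I (Zc n []) \<cdot>\<^sub>m 1\<^sub>m 1"
      using P.rep_one[OF V'(2)] V'(1) by (simp add: PZ_one Zc_one)
  next
    fix i j v assume ij: "1 \<le> i" "i < j" "j \<le> n" and v: "v \<in> pure_words n"
      and IH: "snd \<chi> (Zc n v) = chi n I (Zc n v) \<cdot>\<^sub>m 1\<^sub>m 1"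
    have c: "Zc n (t_word i j) \<in> carrier (PZgrp n)" "Zc n v \<in> carrier (PZgrp n)"
      using t_word_pure[OF ij] v by (auto simp: PZ_carrier)
    have "to_Z n (artin_gen n i j) = Zc n (t_word i j)" by (simp add: artin_gen_class Zc_def)
    hence "snd \<chi> (Zc n (t_word i j)) = chi n I (Zc n (t_word i j)) \<cdot>\<^sub>m 1\<^sub>m 1"
      using V ij unfolding is_V_def chi_t_word[OF ij I] by metis
    thus "snd \<chi> (Zc n (t_word i j) \<otimes>\<^bsub>Zgrp n\<^esub> Zc n v) = chi n I (Zc n (t_word i j) \<otimes>\<^bsub>Zgrp n\<^esub> Zc n v) \<cdot>\<^sub>m 1\<^sub>m 1"
      using P.rep_mult[OF V'(2) c] unfolding PZ_mult chi_mult[OF c] IH by (simp only: scalar_mat_mult)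
  qed
  thus ?thesis using w by simp
qed

lemma is_V_exists:
  assumes I: "I \<subseteq> pairs n"
  shows "is_V n I (1, \<lambda>z. chi n I z \<cdot>\<^sub>m 1\<^sub>m 1)"
proof -
  interpret P: group "PZgrp n" by (rule PZ_group)
  have "is_rep (PZgrp n) (1, \<lambda>z. chi n I z \<cdot>\<^sub>m 1\<^sub>m 1)"
  proof (rule P.is_repI)
    show "chi n I \<one>\<^bsub>PZgrp n\<^esub> \<cdot>\<^sub>m 1\<^sub>m 1 = 1\<^sub>m 1" by (simp add: PZ_one Zc_one chi_Zc sgn_word_def link_def)
    show "chi n I (g \<otimes>\<^bsub>PZgrp n\<^esub> h) \<cdot>\<^sub>m 1\<^sub>m 1 = chi n I g \<cdot>\<^sub>m 1\<^sub>m 1 * (chi n I h \<cdot>\<^sub>m 1\<^sub>m 1)"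
      if "g \<in> carrier (PZgrp n)" "h \<in> carrier (PZgrp n)" for g h
      unfolding PZ_mult chi_mult[OF that] scalar_mat_mult ..
  qed simp
  moreover have "to_Z n (artin_gen n i j) = Zc n (t_word i j)" for i j by (simp add: artin_gen_class Zc_def)
  ultimately show ?thesis using I by (simp add: is_V_def chi_t_word)
qed

lemma diag_block_scalar: "diag_block_mat (replicate k (c \<cdot>\<^sub>m 1\<^sub>m (Suc 0))) = (c :: complex) \<cdot>\<^sub>m 1\<^sub>m k"
proof (induction k)
  case (Suc k)
  have "four_block_mat (c \<cdot>\<^sub>m 1\<^sub>m (Suc 0)) (0\<^sub>m (Suc 0) k) (0\<^sub>m k (Suc 0)) (c \<cdot>\<^sub>m 1\<^sub>m k) = c \<cdot>\<^sub>m 1\<^sub>m (Suc k)"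
    by (rule eq_matI) auto
  thus ?case by (simp add: Suc Let_def)
qed auto

text \<open>Copies of a one-dimensional representation act by scalar matrices, and conjugation does
  not change a scalar matrix. Later arguments use this form in place of
  \<open>copies\<close>.\<close>

lemma isotypic_iff:
  assumes I: "I \<subseteq> pairs n" and \<pi>: "is_rep (ZIgrp n J) \<pi>"
  shows "isotypic n I \<pi> \<longleftrightarrow> (\<forall>a\<in>carrier (PZgrp n). snd \<pi> a = chi n I a \<cdot>\<^sub>m 1\<^sub>m (fst \<pi>))"
proof
  assume "isotypic n I \<pi>"
  then obtain \<chi> k where \<chi>: "is_V n I \<chi>" and iso: "rep_iso (PZgrp n) \<pi> (copies k \<chi>)"
    by (auto simp: isotypic_def)
  have d: "fst \<pi> = k" using iso \<chi> by (simp add: rep_iso_def copies_def is_V_def)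
  obtain P where P: "P \<in> carrier (GL TYPE(complex) k)"
    "\<And>g. g \<in> carrier (PZgrp n) \<Longrightarrow> P * snd \<pi> g = snd (copies k \<chi>) g * P"
    using iso d by (auto simp: rep_iso_def)
  have Pc: "P \<in> carrier_mat k k" using P(1) by (simp add: GL_carrier)
  obtain Q where Q: "Q \<in> carrier_mat k k" "Q * P = 1\<^sub>m k" using P(1) by (auto simp: GL_carrier)
  show "\<forall>a\<in>carrier (PZgrp n). snd \<pi> a = chi n I a \<cdot>\<^sub>m 1\<^sub>m (fst \<pi>)"
  proof
    fix a assume a: "a \<in> carrier (PZgrp n)"
    have "snd (copies k \<chi>) a = chi n I a \<cdot>\<^sub>m 1\<^sub>m k"
      by (simp add: copies_def is_V_chi[OF \<chi> I a] diag_block_scalar)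
    hence e: "P * snd \<pi> a = chi n I a \<cdot>\<^sub>m P"
      using P(2)[OF a] mult_smult_assoc_mat[OF one_carrier_mat Pc, of "chi n I a"] left_mult_one_mat[OF Pc] by simp
    have ac: "a \<in> carrier (ZIgrp n J)" using a PZ_in_stab by (auto simp: ZIgrp_simps)
    have \<pi>c: "snd \<pi> a \<in> carrier_mat k k" using group.rep_carrier[OF ZIgrp_group \<pi> ac] d by simp
    have "snd \<pi> a = (Q * P) * snd \<pi> a" using \<pi>c by (simp add: Q)
    also have "\<dots> = Q * (P * snd \<pi> a)" by (rule assoc_mult_mat[OF Q(1) Pc \<pi>c])
    also have "\<dots> = chi n I a \<cdot>\<^sub>m 1\<^sub>m k" unfolding e mult_smult_distrib[OF Q(1) Pc] Q(2) ..
    finally show "snd \<pi> a = chi n I a \<cdot>\<^sub>m 1\<^sub>m (fst \<pi>)" by (simp add: d)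
  qed
next
  assume *: "\<forall>a\<in>carrier (PZgrp n). snd \<pi> a = chi n I a \<cdot>\<^sub>m 1\<^sub>m (fst \<pi>)"
  let ?\<chi> = "(1, \<lambda>z. chi n I z \<cdot>\<^sub>m 1\<^sub>m 1) :: zelem rep"
  have "rep_iso (PZgrp n) \<pi> (copies (fst \<pi>) ?\<chi>)"
    unfolding rep_iso_def using *
    by (intro conjI bexI[of _ "1\<^sub>m (fst \<pi>)"]) (auto simp: copies_def diag_block_scalar GL_carrier)
  thus "isotypic n I \<pi>" unfolding isotypic_def using is_V_exists[OF I] by blast
qed

lemma transposition_word:
  assumes "i < j"
  shows "\<exists>w. set w \<subseteq> {i..<j} \<times> UNIV \<and> word_perm w = Transposition.transpose i j"
proof -
  have "\<exists>w. set w \<subseteq> {i..<Suc (i + d)} \<times> UNIV \<and> word_perm w = Transposition.transpose i (Suc (i + d))" for d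
  proof (induction d)
    case 0
    show ?case by (rule exI[of _ "[(i, True)]"]) simp
  next
    case (Suc d)
    then obtain w where w: "set w \<subseteq> {i..<Suc (i + d)} \<times> UNIV"
      "word_perm w = Transposition.transpose i (Suc (i + d))" by blast
    let ?j = "Suc (i + d)"
    have "word_perm ([(?j, True)] @ w @ [(?j, True)]) = Transposition.transpose i (Suc ?j)"
      unfolding word_perm_append w(2) by (auto simp: fun_eq_iff Transposition.transpose_def)
    moreover have "set ([(?j, True)] @ w @ [(?j, True)]) \<subseteq> {i..<Suc (i + Suc d)} \<times> UNIV"
      using w(1) by auto
    ultimately show ?case by (intro exI[of _ "[(?j, True)] @ w @ [(?j, True)]"]) simp
  qed
  from this[of "j - Suc i"] show ?thesis using assms by simp
qed

text \<open>The letters are confined to an interval so that a permutation of the last strands can be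
  realised without touching the first ones, as in \<open>Z_split_surj\<close>.\<close>

lemma permutation_word:
  assumes "p permutes {a..b}"
  shows "\<exists>w. set w \<subseteq> {a..<b} \<times> UNIV \<and> word_perm w = p"
  using assms finite_atLeastAtMost
proof (induction rule: permutes_induct)
  case id
  show ?case by (rule exI[of _ "[]"]) simp
next
  case (swap i j p)
  have "\<exists>u. set u \<subseteq> {a..<b} \<times> UNIV \<and> word_perm u = Transposition.transpose i j"
  proof (cases "i < j")
    case True
    have "{i..<j} \<subseteq> {a..<b}" using swap by auto
    thus ?thesis using transposition_word[OF True] by (meson Sigma_mono order_refl order_trans)
  next
    case False
    hence ji: "j < i" using swap by simp
    have "{j..<i} \<subseteq> {a..<b}" using swap by auto
    thus ?thesis using transposition_word[OF ji] unfolding transpose_commute[of i j]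
      by (meson Sigma_mono order_refl order_trans)
  qed
  then obtain u w where "set u \<subseteq> {a..<b} \<times> UNIV" "word_perm u = Transposition.transpose i j"
    "set w \<subseteq> {a..<b} \<times> UNIV" "word_perm w = p" using swap.IH by blast
  thus ?case by (intro exI[of _ "u @ w"]) simp
qed

lemma chi_orbit:
  assumes "p permutes {1..n}"
  shows "\<exists>g\<in>carrier (Zgrp n). \<forall>I. \<forall>a\<in>carrier (PZgrp n).
    chi n I (inv\<^bsub>Zgrp n\<^esub> g \<otimes>\<^bsub>Zgrp n\<^esub> a \<otimes>\<^bsub>Zgrp n\<^esub> g) = chi n ((`) p ` I) a"
proof -
  obtain w where w: "set w \<subseteq> {1..<n} \<times> UNIV" "word_perm w = p" using permutation_word[OF assms] by blast
  hence "w \<in> braid_words n" by (auto simp: braid_words_def)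
  thus ?thesis using chi_conj[of w n] w(2) Zc_words by blast
qed

section \<open>Forgetting strands\<close>

text \<open>The new number of a kept position. On a finite \<open>K\<close> it is the increasing
  bijection onto \<open>{1..card K}\<close>.\<close>

definition rk :: "nat set \<Rightarrow> nat \<Rightarrow> nat" where
  "rk K x = card (K \<inter> {..x})"

abbreviation adj :: "nat \<Rightarrow> nat \<Rightarrow> nat" where
  "adj i \<equiv> Transposition.transpose i (Suc i)"

lemma adj_image_iff: "x \<in> adj i ` K \<longleftrightarrow> adj i x \<in> K"
  by (metis imageE imageI transpose_involutory)

lemma adj_vimage: "adj i ` K = adj i -` K"
  by (auto simp: adj_image_iff)

lemma card_adj: "card (adj i ` K) = card K"
  by (rule card_image) (metis inj_on_inverseI transpose_involutory)

lemma adj_image_self: "i \<in> K \<Longrightarrow> Suc i \<in> K \<Longrightarrow> adj i ` K = K"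
  by (auto simp: adj_image_iff Transposition.transpose_def split: if_splits)

lemma keep_word_Cons [simp]: 
  "keep_word K ((i, e) # w) = (if i \<in> K \<and> Suc i \<in> K then [(rk K i, e)] else []) @ keep_word (adj i ` K) w"
  by (simp add: rk_def Let_def)

declare keep_word.simps(2) [simp del]

lemma word_perm_Cons_vimage: "word_perm ((i, e) # w) -` K = word_perm w -` (adj i ` K)"
  unfolding word_perm_simps adj_vimage by (rule vimage_comp[symmetric])

text \<open>Each letter moves the set of kept positions by an involution, so after reading
  \<open>u\<close> the kept strands stand at the preimage of \<open>K\<close> under
  \<open>word_perm u\<close>.\<close>

lemma keep_word_append: "keep_word K (u @ v) = keep_word K u @ keep_word (word_perm u -` K) v"
proof (induction u arbitrary: K)
  case (Cons l u)
  obtain i e where l: "l = (i, e)" by (cases l)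
  show ?case unfolding l word_perm_Cons_vimage by (simp add: Cons.IH)
qed simp

lemma rk_Suc: "rk K (Suc i) = rk K i + of_bool (Suc i \<in> K)"
proof -
  have "K \<inter> {..Suc i} = (if Suc i \<in> K then insert (Suc i) (K \<inter> {..i}) else K \<inter> {..i})"
    by (auto simp: atMost_Suc)
  thus ?thesis by (simp add: rk_def)
qed

lemma rk_less:
  assumes "x < y" "y \<in> K"
  shows "rk K x < rk K y"
proof -
  have "K \<inter> {..x} \<subseteq> K \<inter> {..y}" "y \<in> K \<inter> {..y}" "y \<notin> K \<inter> {..x}" using assms by auto
  hence "K \<inter> {..x} \<subset> K \<inter> {..y}" by blast
  thus ?thesis unfolding rk_def by (intro psubset_card_mono) simp_all
qed

lemma rk_inj: "x \<in> K \<Longrightarrow> y \<in> K \<Longrightarrow> rk K x = rk K y \<longleftrightarrow> x = y"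
  using rk_less[of x y K] rk_less[of y x K] by (cases x y rule: linorder_cases) auto

lemma rk_pos: "x \<in> K \<Longrightarrow> 1 \<le> rk K x"
  unfolding rk_def using card_gt_0_iff[of "K \<inter> {..x}"] by (auto simp: Suc_le_eq)

lemma rk_le: "finite K \<Longrightarrow> rk K x \<le> card K"
  unfolding rk_def by (rule card_mono) auto

text \<open>When at most one strand of the crossing is kept, it passes a discarded one and keeps its
  rank among the kept strands.\<close>

lemma rk_adj:
  assumes y: "y \<in> adj i ` K" and K: "\<not> (i \<in> K \<and> Suc i \<in> K)"
  shows "rk (adj i ` K) y = rk K (adj i y)"
proof -
  have y': "adj i y \<in> K" using y by (simp add: adj_image_iff)
  have "z \<in> adj i ` K \<inter> {..y} \<longleftrightarrow> z \<in> adj i ` (K \<inter> {..adj i y})" for z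
    using y' K by (auto simp: adj_image_iff Transposition.transpose_def split: if_splits)
  hence "adj i ` K \<inter> {..y} = adj i ` (K \<inter> {..adj i y})" by blast
  thus ?thesis unfolding rk_def by (simp only: card_adj)
qed

lemma rk_adj_above:
  assumes "i < j"
  shows "rk (adj i ` K) j = rk K j"
proof -
  have "z \<in> adj i ` K \<inter> {..j} \<longleftrightarrow> z \<in> adj i ` (K \<inter> {..j})" for z
    using assms by (auto simp: adj_image_iff Transposition.transpose_def)
  hence "adj i ` K \<inter> {..j} = adj i ` (K \<inter> {..j})" by blast
  thus ?thesis unfolding rk_def by (simp only: card_adj)
qed

lemma rk_adj_below:
  assumes "j < i"
  shows "rk (adj i ` K) j = rk K j"
proof -
  have "adj i ` K \<inter> {..j} = K \<inter> {..j}"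
    using assms by (auto simp: adj_image_iff Transposition.transpose_def split: if_splits)
  thus ?thesis by (simp add: rk_def)
qed

lemma keep_word_words:
  assumes "w \<in> braid_words n" "K \<subseteq> {1..n}" "card K = m"
  shows "keep_word K w \<in> braid_words m"
  using assms
proof (induction w arbitrary: K)
  case (Cons l w)
  obtain i e where l: "l = (i, e)" by (cases l)
  have i: "1 \<le> i" "i < n" and w: "w \<in> braid_words n" using Cons.prems l by auto
  have fin: "finite K" using Cons.prems(2) finite_subset by blast
  have "adj i ` K \<subseteq> {1..n}" using Cons.prems(2) i by (auto simp: Transposition.transpose_def)
  hence IH: "keep_word (adj i ` K) w \<in> braid_words m" using w Cons.prems(3) by (intro Cons.IH) (simp_all add: card_adj)
  show ?case
  proof (cases "i \<in> K \<and> Suc i \<in> K")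
    case True
    hence "1 \<le> rk K i" "rk K i < m"
      using rk_pos[of i K] rk_less[of i "Suc i" K] rk_le[OF fin, of "Suc i"] Cons.prems(3) by auto
    thus ?thesis using IH True by (simp add: l)
  qed (use IH in \<open>auto simp: l\<close>)
qed simp

text \<open>Renumbering intertwines a word with its reduced word. The claims are proved together
  because a crossing of the reduced word is located by its permutation at both strands.\<close>

lemma keep_word_cocycle:
  assumes "x \<in> word_perm w -` K" "y \<in> word_perm w -` K"
  shows "word_perm (keep_word K w) (rk (word_perm w -` K) x) = rk K (word_perm w x)"
    and "crossing (keep_word K w) (rk (word_perm w -` K) x) (rk (word_perm w -` K) y) = crossing w x y"
proof -
  have "word_perm (keep_word K w) (rk (word_perm w -` K) x) = rk K (word_perm w x) \<and>
      word_perm (keep_word K w) (rk (word_perm w -` K) y) = rk K (word_perm w y) \<and>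
      crossing (keep_word K w) (rk (word_perm w -` K) x) (rk (word_perm w -` K) y) = crossing w x y"
    using assms
  proof (induction w arbitrary: K)
    case (Cons l w)
    obtain i e where l: "l = (i, e)" by (cases l)
    let ?K = "adj i ` K"
    have K': "word_perm (l # w) -` K = word_perm w -` ?K" unfolding l by (rule word_perm_Cons_vimage)
    define u v where "u = word_perm w x" and "v = word_perm w y"
    have uv: "u \<in> ?K" "v \<in> ?K" using Cons.prems unfolding K' by (auto simp: u_def v_def)
    have IH: "word_perm (keep_word ?K w) (rk (word_perm w -` ?K) x) = rk ?K u"
      "word_perm (keep_word ?K w) (rk (word_perm w -` ?K) y) = rk ?K v"
      "crossing (keep_word ?K w) (rk (word_perm w -` ?K) x) (rk (word_perm w -` ?K) y) = crossing w x y"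
      using Cons.IH[of ?K] uv by (simp_all add: u_def v_def)
    show ?case
    proof (cases "i \<in> K \<and> Suc i \<in> K")
      case True
      have KK: "?K = K" using True adj_image_self by blast
      have S: "Suc (rk K i) = rk K (Suc i)" using True by (simp add: rk_Suc)
      have tr: "adj (rk K i) (rk K z) = rk K (adj i z)" if z: "z \<in> K" for z
        unfolding S using rk_inj[OF z, of i] rk_inj[OF z, of "Suc i"] True
        by (auto simp: Transposition.transpose_def)
      have cr: "crosses (rk K i, e) (rk K u) (rk K v) = crosses (i, e) u v"
        unfolding crosses_def S using rk_inj[of u K] rk_inj[of v K] uv True by (simp add: KK S)
      show ?thesis unfolding K' using True IH uv tr[of u] tr[of v] cr
        by (simp add: l KK u_def[symmetric] v_def[symmetric])
    next
      case False
      have "\<not> crosses (i, e) u v"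
        using uv False unfolding adj_image_iff by (auto simp: crosses_def split: if_splits)
      moreover have "keep_word K (l # w) = keep_word ?K w" using False by (auto simp: l)
      ultimately show ?thesis unfolding K' using IH rk_adj[OF uv(1) False] rk_adj[OF uv(2) False]
        by (simp add: l u_def[symmetric] v_def[symmetric] del: keep_word_Cons)
    qed
  qed simp
  thus "word_perm (keep_word K w) (rk (word_perm w -` K) x) = rk K (word_perm w x)"
    "crossing (keep_word K w) (rk (word_perm w -` K) x) (rk (word_perm w -` K) y) = crossing w x y" by blast+
qed

lemma word_perm_vimage_card:
  assumes w: "w \<in> braid_words n" and K: "K \<subseteq> {1..n}"
  shows "word_perm w -` K \<subseteq> {1..n} \<and> card (word_perm w -` K) = card K"
proof -
  have P: "word_perm w permutes {1..n}" by (rule word_perm_permutes[OF w])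
  have "word_perm w -` K \<subseteq> {1..n}" using permutes_in_image[OF P] K by blast
  moreover have "card (word_perm w -` K) = card K"
    by (rule card_vimage_inj) (use permutes_inj[OF P] permutes_surj[OF P] in auto)
  ultimately show ?thesis by blast
qed

text \<open>Forgetting strands respects the defining relations. \<open>K\<close> has to be
  arbitrary, since in the congruence case the set of kept positions seen by the inner word has been
  moved by the outer one.\<close>

lemma keep_word_eq:
  assumes "braid_eq n u v" "K \<subseteq> {1..n}" "card K = m"
  shows "braid_eq m (keep_word K u) (keep_word K v)"
  using assms
proof (induction arbitrary: K rule: braid_eq.induct)
  case (refl w)
  thus ?case by (intro braid_eq.refl keep_word_words)
next
  case (sym u v)
  show ?case by (rule braid_eq.sym[OF sym.IH[OF sym.prems]])
next
  case (trans u v w)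
  show ?case by (rule braid_eq.trans[OF trans.IH(1)[OF trans.prems] trans.IH(2)[OF trans.prems]])
next
  case (cong x y u v)
  let ?X = "word_perm x -` K"
  have X: "?X \<subseteq> {1..n}" "card ?X = m" using word_perm_vimage_card[OF cong.hyps(1) cong.prems(1)] cong.prems(2) by auto
  have u: "u \<in> braid_words n" using braid_eq_words cong.hyps(3) by blast
  let ?Y = "word_perm u -` ?X"
  have Y: "?Y \<subseteq> {1..n}" "card ?Y = m" using word_perm_vimage_card[OF u X(1)] X(2) by auto
  have "word_perm u = word_perm v" by (rule word_perm_eq[OF cong.hyps(3)])
  thus ?case unfolding keep_word_append
    using braid_eq.cong[OF keep_word_words[OF cong.hyps(1) cong.prems] keep_word_words[OF cong.hyps(2) Y]
      cong.IH[OF X]] by simp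
next
  case (inverse i e)
  show ?case
  proof (cases "i \<in> K \<and> Suc i \<in> K")
    case True
    have fin: "finite K" using inverse.prems(1) finite_subset by blast
    have "1 \<le> rk K i" "rk K i < m"
      using True rk_pos[of i K] rk_less[of i "Suc i" K] rk_le[OF fin, of "Suc i"] inverse.prems(2) by auto
    thus ?thesis using True adj_image_self[of i K] braid_eq.inverse[of "rk K i" m e] by simp
  next
    case False
    hence "\<not> (i \<in> adj i ` K \<and> Suc i \<in> adj i ` K)" by (auto simp: adj_image_iff)
    thus ?thesis using False by (auto intro: braid_eq.refl)
  qed
next
  case (far i j)
  have fin: "finite K" using far.prems(1) finite_subset by blast
  have mem: "j \<in> adj i ` K \<longleftrightarrow> j \<in> K" "Suc j \<in> adj i ` K \<longleftrightarrow> Suc j \<in> K"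
    "i \<in> adj j ` K \<longleftrightarrow> i \<in> K" "Suc i \<in> adj j ` K \<longleftrightarrow> Suc i \<in> K"
    unfolding adj_image_iff using far.hyps by (simp_all add: Transposition.transpose_def)
  have rk: "rk (adj i ` K) j = rk K j" "rk (adj j ` K) i = rk K i"
    using far.hyps rk_adj_above[of i j K] rk_adj_below[of i j K] by simp_all
  have iK: "1 \<le> rk K i \<and> rk K i < m" if "i \<in> K" "Suc i \<in> K" for i
    using that rk_pos[of i K] rk_less[of i "Suc i" K] rk_le[OF fin, of "Suc i"] far.prems(2) by auto
  \<comment> \<open>Distant crossings stay distant after renumbering because the intervening
    positions \<open>Suc i\<close> and \<open>j\<close> are themselves kept.\<close>
  have both: "rk K i + 1 < rk K j" if "Suc i \<in> K" "j \<in> K"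
    using that rk_less[of "Suc i" j K] far.hyps by (simp add: rk_Suc)
  have "braid_eq m [(rk K i, True), (rk K j, True)] [(rk K j, True), (rk K i, True)]"
    if "i \<in> K" "Suc i \<in> K" "j \<in> K" "Suc j \<in> K"
    using that by (intro braid_eq.far) (use both iK in auto)
  thus ?case using iK[of i] iK[of j] by (auto simp: mem rk intro: braid_eq.refl)
next
  case (braid i)
  have fin: "finite K" using braid.prems(1) finite_subset by blast
  \<comment> \<open>\<open>rk K k\<close> counts the kept positions to the left of the three
    strands; all other ranks are expressed through it.\<close>
  obtain k where k: "i = Suc k" using braid.hyps(1) by (cases i) auto
  have le: "rk K (Suc (Suc i)) \<le> m" using rk_le[OF fin] braid.prems(2) by blast
  have rk1: "rk L (Suc (Suc k)) = rk L k + of_bool (Suc k \<in> L) + of_bool (Suc (Suc k) \<in> L)"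
    "rk L (Suc k) = rk L k + of_bool (Suc k \<in> L)" for L
    by (simp_all add: rk_Suc)
  have rk0: "rk (adj i ` L) k = rk L k" "rk (adj (Suc i) ` L) k = rk L k" for L
    by (rule rk_adj_below, simp add: k)+
  have mem: "i \<in> adj i ` L \<longleftrightarrow> Suc i \<in> L" "Suc i \<in> adj i ` L \<longleftrightarrow> i \<in> L"
    "Suc (Suc i) \<in> adj i ` L \<longleftrightarrow> Suc (Suc i) \<in> L"
    "i \<in> adj (Suc i) ` L \<longleftrightarrow> i \<in> L" "Suc i \<in> adj (Suc i) ` L \<longleftrightarrow> Suc (Suc i) \<in> L"
    "Suc (Suc i) \<in> adj (Suc i) ` L \<longleftrightarrow> Suc i \<in> L" for L
    unfolding adj_image_iff by (simp_all add: Transposition.transpose_def)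
  let ?a = "rk K k"
  have rk2: "rk L i = rk L k + of_bool (i \<in> L)" "rk L (Suc i) = rk L k + of_bool (i \<in> L) + of_bool (Suc i \<in> L)" for L
    using rk1[of L] by (simp_all add: k)
  have le': "?a + of_bool (i \<in> K) + of_bool (Suc i \<in> K) + of_bool (Suc (Suc i) \<in> K) \<le> m"
    using le by (simp add: rk_Suc rk2)
  have three: "braid_eq m [(Suc ?a, True), (Suc (Suc ?a), True), (Suc ?a, True)]
      [(Suc (Suc ?a), True), (Suc ?a, True), (Suc (Suc ?a), True)]" if "Suc (Suc ?a) < m"
    using braid_eq.braid[of "Suc ?a" m] that by simp
  have one: "braid_eq m [(Suc ?a, True)] [(Suc ?a, True)]" if "Suc ?a < m"
    by (rule braid_eq.refl) (use that in simp)
  have none: "braid_eq m [] []" by (rule braid_eq.refl) simp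
  \<comment> \<open>With all three strands kept the relation survives. With two kept strands each
    side has exactly one crossing, with the same number. With fewer, both sides are empty.\<close>
  show ?case using le' three one none
    by (cases "i \<in> K"; cases "Suc i \<in> K"; cases "Suc (Suc i) \<in> K") (simp_all add: mem rk0 rk2)
qed

lemma rk_interval:
  assumes "x \<le> m"
  shows "rk {Suc 0..m} x = x"
proof -
  have "{Suc 0..m} \<inter> {..x} = {Suc 0..x}" using assms by auto
  thus ?thesis unfolding rk_def by (simp only: card_atLeastAtMost diff_Suc_1)
qed

lemma permutes_vimage:
  assumes "p permutes S" "p ` T = T"
  shows "p -` T = T"
proof -
  have "p -` p ` T = T" by (rule inj_vimage_image_eq[OF permutes_inj[OF assms(1)]])
  thus ?thesis unfolding assms(2) .
qed

text \<open>If \<open>{1..m}\<close> is preserved, the kept strands occupy it at both ends, where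
  \<open>rk\<close> is the identity, so no renumbering remains in the cocycle formulas.\<close>

lemma keep_word_fixed:
  assumes w: "w \<in> braid_words n" and fx: "word_perm w ` {1..m} = {1..m}" and mn: "m \<le> n"
  shows "keep_word {1..m} w \<in> braid_words m"
    and "x \<in> {1..m} \<Longrightarrow> word_perm (keep_word {1..m} w) x = word_perm w x"
    and "x \<in> {1..m} \<Longrightarrow> y \<in> {1..m} \<Longrightarrow> crossing (keep_word {1..m} w) x y = crossing w x y"
proof -
  have v: "word_perm w -` {1..m} = {1..m}" by (rule permutes_vimage[OF word_perm_permutes[OF w] fx])
  show "keep_word {1..m} w \<in> braid_words m" by (rule keep_word_words[OF w]) (use mn in auto)
  have le: "word_perm w x \<le> m" if "x \<in> {1..m}" for x using fx that by (metis atLeastAtMost_iff imageI)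
  show "word_perm (keep_word {1..m} w) x = word_perm w x" if "x \<in> {1..m}"
    using keep_word_cocycle(1)[of x w "{1..m}" x] that le[OF that] unfolding v by (simp add: rk_interval)
  show "crossing (keep_word {1..m} w) x y = crossing w x y" if "x \<in> {1..m}" "y \<in> {1..m}"
    using keep_word_cocycle(2)[of x w "{1..m}" y] that unfolding v by (simp add: rk_interval)
qed

lemma word_perm_outside: "w \<in> braid_words m \<Longrightarrow> x \<notin> {1..m} \<Longrightarrow> word_perm w x = x"
  using permutes_not_in[OF word_perm_permutes] by blast

text \<open>A class in \<open>Zgrp\<close> contains words that may represent different braids, so
  beyond \<open>keep_word_eq\<close> invariance under equal keys is required for the first component
  of \<open>Z_split\<close> to be well defined.\<close>

lemma keep_word_key:
  assumes u: "u \<in> braid_words n" and v: "v \<in> braid_words n" and fx: "word_perm u ` {1..m} = {1..m}"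
    and mn: "m \<le> n" and k: "key u = key v"
  shows "key (keep_word {1..m} u) = key (keep_word {1..m} v)"
proof (rule key_eqI)
  have fv: "word_perm v ` {1..m} = {1..m}" using fx key_eqD(1)[OF k] by simp
  note ku = keep_word_fixed[OF u fx mn] and kv = keep_word_fixed[OF v fv mn]
  show "word_perm (keep_word {1..m} u) = word_perm (keep_word {1..m} v)"
  proof
    fix x
    show "word_perm (keep_word {1..m} u) x = word_perm (keep_word {1..m} v) x"
      using ku(2)[of x] kv(2)[of x] word_perm_outside[OF ku(1), of x] word_perm_outside[OF kv(1), of x]
        key_eqD(1)[OF k] by (cases "x \<in> {1..m}") simp_all
  qed
  show "crossing (keep_word {1..m} u) a b = crossing (keep_word {1..m} v) a b" for a b
    using ku(3)[of a b] kv(3)[of a b] crossing_range[OF ku(1), of a b] crossing_range[OF kv(1), of a b]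
      key_eqD(2)[OF k, of a b] by (cases "a \<in> {1..m} \<and> b \<in> {1..m}") blast+
qed

section \<open>The surjection from the stabilizer to the product\<close>

definition shift_perm :: "nat \<Rightarrow> nat \<Rightarrow> (nat \<Rightarrow> nat) \<Rightarrow> nat \<Rightarrow> nat" where
  "shift_perm n m p = (\<lambda>j. if j \<in> {1..n - m} then p (j + m) - m else j)"

lemma forget_strands_class:
  assumes "w \<in> braid_words n" "m \<le> n"
  shows "forget_strands m (braid_class n w) = braid_class m (keep_word {1..m} w)"
  unfolding forget_strands_def
proof (rule the_elem_class[OF _ assms(1)])
  fix u v assume uv: "braid_eq n u v"
  have u: "u \<in> braid_words n" using braid_eq_words[OF uv] by blast
  have "braid_eq m (keep_word {1..m} u) (keep_word {1..m} v)"
    by (rule keep_word_eq[OF uv]) (use assms(2) in auto)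
  moreover have "keep_word {1..m} u \<in> braid_words m" by (rule keep_word_words[OF u]) (use assms(2) in auto)
  ultimately show "braid_class m (keep_word {1..m} u) = braid_class m (keep_word {1..m} v)"
    by (simp add: braid_class_eq_iff)
qed

lemma in_Zc:
  assumes "w \<in> braid_words n"
  shows "b \<in> Zc n w \<longleftrightarrow> (\<exists>v\<in>braid_words n. b = braid_class n v \<and> key v = key w)"
proof -
  interpret normal "level4 n" "braid_group n" by (rule level4_normal)
  have w: "braid_class n w \<in> carrier (braid_group n)" using assms by (simp add: braid_group_simps)
  have mem: "braid_class n v \<in> Zc n w \<longleftrightarrow> key v = key w" if v: "v \<in> braid_words n" for v
  proof -
    have vc: "braid_class n v \<in> carrier (braid_group n)" using v by (simp add: braid_group_simps)
    show ?thesis unfolding Zc_def to_Z_def rcos_module[OF is_group w vc]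
      using v assms by (simp add: braid_class_inv braid_class_mult level4_iff key_quotient)
  qed
  have sub: "Zc n w \<subseteq> carrier (braid_group n)"
    unfolding Zc_def to_Z_def by (rule r_coset_subset_G[OF subset w])
  show ?thesis using mem sub unfolding braid_group_simps by blast
qed

lemma Z_split_Zc:
  assumes w: "w \<in> braid_words n" and fx: "word_perm w ` {1..m} = {1..m}" and mn: "m \<le> n"
  shows "Z_split n m (Zc n w) = (Zc m (keep_word {1..m} w), shift_perm n m (word_perm w))"
proof -
  have val: "(to_Z m (forget_strands m b), last_perm n m b) = (Zc m (keep_word {1..m} w), shift_perm n m (word_perm w))"
    if b: "b \<in> Zc n w" for b
  proof -
    obtain v where v: "v \<in> braid_words n" "b = braid_class n v" "key v = key w"
      using b unfolding in_Zc[OF w] by blast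
    have fv: "word_perm v ` {1..m} = {1..m}" using fx key_eqD(1)[OF v(3)] by simp
    have "key (keep_word {1..m} v) = key (keep_word {1..m} w)" by (rule keep_word_key[OF v(1) w fv mn v(3)])
    hence "Zc m (keep_word {1..m} v) = Zc m (keep_word {1..m} w)"
      using keep_word_fixed(1)[OF v(1) fv mn] keep_word_fixed(1)[OF w fx mn] by (simp add: Zc_eq_iff)
    moreover have "last_perm n m b = shift_perm n m (word_perm w)"
      unfolding last_perm_def shift_perm_def v(2) braid_perm_class[OF v(1)] key_eqD(1)[OF v(3)] ..
    ultimately show ?thesis by (simp add: v(2) forget_strands_class[OF v(1) mn] Zc_def)
  qed
  have "braid_class n w \<in> Zc n w" unfolding in_Zc[OF w] using w by blast
  hence "(\<lambda>b. (to_Z m (forget_strands m b), last_perm n m b)) ` Zc n w =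
      {(Zc m (keep_word {1..m} w), shift_perm n m (word_perm w))}"
    using val by (intro equalityI subsetI) (blast, force)
  thus ?thesis unfolding Z_split_def by simp
qed

lemma keep_word_id: "w \<in> braid_words m \<Longrightarrow> keep_word {1..m} w = w"
proof (induction w)
  case (Cons l w)
  obtain i e where l: "l = (i, e)" by (cases l)
  have "i \<in> {1..m} \<and> Suc i \<in> {1..m}" using Cons.prems by (auto simp: l)
  thus ?case using Cons adj_image_self[of i "{1..m}"] by (simp add: l rk_interval)
qed simp

lemma keep_word_far: "set w \<subseteq> {Suc m..<n} \<times> UNIV \<Longrightarrow> keep_word {1..m} w = []"
proof (induction w)
  case (Cons l w)
  obtain i e where l: "l = (i, e)" by (cases l)
  have i: "m < i" using Cons.prems by (auto simp: l)
  hence "adj i ` {1..m} = {1..m}" by (auto simp: adj_image_iff Transposition.transpose_def split: if_splits)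
  moreover have "keep_word {1..m} w = []" using Cons by simp
  ultimately show ?case using i by (simp add: l)
qed simp

lemma shift_perm_permutes:
  assumes p: "p permutes {1..n}" and fx: "p ` {1..m} = {1..m}" and mn: "m \<le> n"
  shows "shift_perm n m p permutes {1..n - m}"
    and "j \<in> {1..n - m} \<Longrightarrow> p (j + m) = shift_perm n m p j + m"
    and "j \<in> {1..n - m} \<Longrightarrow> p (j + m) \<in> {Suc m..n}"
proof -
  have v: "p -` {1..m} = {1..m}" by (rule permutes_vimage[OF p fx])
  show in': "p (j + m) \<in> {Suc m..n}" if "j \<in> {1..n - m}" for j
  proof -
    have "p (j + m) \<in> {1..n}" using permutes_in_image[OF p, of "j + m"] that mn by auto
    moreover have "p (j + m) \<notin> {1..m}" 
    proof
      assume "p (j + m) \<in> {1..m}"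
      hence "j + m \<in> {1..m}" using v by blast
      thus False using that by simp
    qed
    ultimately show ?thesis by auto
  qed
  show eq: "p (j + m) = shift_perm n m p j + m" if "j \<in> {1..n - m}" for j
    using in'[OF that] that by (simp add: shift_perm_def)
  have mem: "shift_perm n m p j \<in> {1..n - m}" if "j \<in> {1..n - m}" for j
    using in'[OF that] that by (auto simp: shift_perm_def)
  have inj: "inj_on (shift_perm n m p) {1..n - m}"
  proof (rule inj_onI)
    fix x y assume xy: "x \<in> {1..n - m}" "y \<in> {1..n - m}" "shift_perm n m p x = shift_perm n m p y"
    hence "p (x + m) = p (y + m)" using eq by simp
    thus "x = y" using permutes_inj[OF p] by (simp add: inj_eq)
  qed
  have "shift_perm n m p ` {1..n - m} = {1..n - m}"
    by (rule endo_inj_surj[OF _ _ inj]) (use mem in auto)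
  thus "shift_perm n m p permutes {1..n - m}"
    using inj by (intro bij_imp_permutes) (auto simp: bij_betw_def shift_perm_def)
qed

lemma shift_perm_comp:
  assumes p: "p permutes {1..n}" "p ` {1..m} = {1..m}" and q: "q permutes {1..n}" "q ` {1..m} = {1..m}" and mn: "m \<le> n"
  shows "shift_perm n m (p \<circ> q) = shift_perm n m p \<circ> shift_perm n m q"
proof
  fix j
  show "shift_perm n m (p \<circ> q) j = (shift_perm n m p \<circ> shift_perm n m q) j"
  proof (cases "j \<in> {1..n - m}")
    case True
    have "shift_perm n m q j \<in> {1..n - m}"
      using permutes_in_image[OF shift_perm_permutes(1)[OF q mn]] True by blast
    hence "p (q (j + m)) = shift_perm n m p (shift_perm n m q j) + m"
      using shift_perm_permutes(2)[OF q mn True] shift_perm_permutes(2)[OF p mn] by simp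
    thus ?thesis using True by (simp add: shift_perm_def)
  next
    case False
    thus ?thesis by (auto simp: shift_perm_def)
  qed
qed

text \<open>Fullness enters here: the union of the members of \<open>I\<close> is
  \<open>{1..m}\<close>, so a permutation preserving \<open>I\<close> preserves the first
  \<open>m\<close> strands.\<close>

lemma full_stab_fixes:
  assumes "full m I" "(`) p ` I = I"
  shows "p ` {1..m} = {1..m}"
proof -
  have "p ` \<Union>I = \<Union>((`) p ` I)" by blast
  thus ?thesis using assms by (simp add: full_def)
qed

lemma full_pairs: "full m I \<Longrightarrow> m \<le> n \<Longrightarrow> I \<subseteq> pairs n"
  unfolding full_def pairs_def by fastforce

lemma image_image_cong:
  assumes "I \<subseteq> pairs m" "\<And>x. x \<in> {1..m} \<Longrightarrow> p x = q x"
  shows "(`) p ` I = (`) q ` I"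
proof (rule image_cong[OF HOL.refl])
  fix A assume "A \<in> I"
  hence "A \<subseteq> {1..m}" using assms(1) by (auto simp: pairs_def)
  thus "p ` A = q ` A" using assms(2) by (intro image_cong) auto
qed

context
  fixes n m :: nat and I :: "nat set set"
  assumes mn: "m \<le> n" and full: "full m I"
begin

lemma stab_wordE:
  assumes "z \<in> Z_stab n I"
  obtains w where "w \<in> braid_words n" "z = Zc n w" "(`) (word_perm w) ` I = I" "word_perm w ` {1..m} = {1..m}"
proof -
  obtain w where w: "w \<in> braid_words n" "z = Zc n w" "(`) (word_perm w) ` I = I"
    using assms unfolding stab_carrier by blast
  show thesis by (rule that[OF w full_stab_fixes[OF full w(3)]])
qed

lemma I_pairs: "I \<subseteq> pairs m" "I \<subseteq> pairs n"
  using full full_pairs mn by auto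

lemma Z_split_hom: "Z_split n m \<in> hom (ZIgrp n I) (ZIgrp m I \<times>\<times> sym_group (n - m))"
proof (rule homI)
  fix z assume "z \<in> carrier (ZIgrp n I)"
  then obtain w where w: "w \<in> braid_words n" "z = Zc n w" "(`) (word_perm w) ` I = I" "word_perm w ` {1..m} = {1..m}"
    unfolding ZIgrp_simps by (rule stab_wordE)
  note k = keep_word_fixed[OF w(1,4) mn]
  have "(`) (word_perm (keep_word {1..m} w)) ` I = (`) (word_perm w) ` I"
    by (rule image_image_cong[OF I_pairs(1)]) (rule k(2))
  hence "Zc m (keep_word {1..m} w) \<in> Z_stab m I" using k(1) w(3) by (simp add: Zc_in_stab)
  moreover have "shift_perm n m (word_perm w) permutes {1..n - m}"
    by (rule shift_perm_permutes(1)[OF word_perm_permutes[OF w(1)] w(4) mn])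
  ultimately show "Z_split n m z \<in> carrier (ZIgrp m I \<times>\<times> sym_group (n - m))"
    unfolding w(2) Z_split_Zc[OF w(1,4) mn] by (simp add: ZIgrp_simps sym_group_def)
next
  fix y z assume "y \<in> carrier (ZIgrp n I)" "z \<in> carrier (ZIgrp n I)"
  then obtain u w where u: "u \<in> braid_words n" "y = Zc n u" "word_perm u ` {1..m} = {1..m}"
    and w: "w \<in> braid_words n" "z = Zc n w" "word_perm w ` {1..m} = {1..m}"
    unfolding ZIgrp_simps by (auto elim!: stab_wordE)
  have uw: "u @ w \<in> braid_words n" "word_perm (u @ w) ` {1..m} = {1..m}"
    using u w by (simp_all only: braid_words_simps word_perm_append image_comp[symmetric])
  have "keep_word {1..m} (u @ w) = keep_word {1..m} u @ keep_word {1..m} w"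
    unfolding keep_word_append permutes_vimage[OF word_perm_permutes[OF u(1)] u(3)] ..
  moreover have "shift_perm n m (word_perm (u @ w)) = shift_perm n m (word_perm u) \<circ> shift_perm n m (word_perm w)"
    unfolding word_perm_append by (intro shift_perm_comp word_perm_permutes u w mn)
  moreover have "y \<otimes>\<^bsub>ZIgrp n I\<^esub> z = Zc n (u @ w)" using u w by (simp add: ZIgrp_simps Zc_mult)
  ultimately show "Z_split n m (y \<otimes>\<^bsub>ZIgrp n I\<^esub> z) = Z_split n m y \<otimes>\<^bsub>ZIgrp m I \<times>\<times> sym_group (n - m)\<^esub> Z_split n m z"
    using Z_split_Zc[OF uw mn] Z_split_Zc[OF u(1,3) mn] Z_split_Zc[OF w(1,3) mn]
      keep_word_fixed(1)[OF u(1,3) mn] keep_word_fixed(1)[OF w(1,3) mn]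
    by (simp add: u(2) w(2) ZIgrp_simps Zc_mult sym_simps)
qed

lemma Z_split_surj: "Z_split n m ` carrier (ZIgrp n I) = carrier (ZIgrp m I \<times>\<times> sym_group (n - m))"
proof (intro equalityI subsetI)
  fix x assume "x \<in> Z_split n m ` carrier (ZIgrp n I)"
  thus "x \<in> carrier (ZIgrp m I \<times>\<times> sym_group (n - m))" using Z_split_hom unfolding hom_def by blast
next
  fix x assume "x \<in> carrier (ZIgrp m I \<times>\<times> sym_group (n - m))"
  then obtain v s where x: "x = (Zc m v, s)" and v: "v \<in> braid_words m" "(`) (word_perm v) ` I = I"
    and s: "s permutes {1..n - m}"
    by (auto simp: ZIgrp_simps stab_carrier sym_group_def)
  \<comment> \<open>The second component is moved to the last strands. A word for it uses only
    generators beyond \<open>m\<close>, so forgetting those strands leaves \<open>v\<close>, and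
    \<open>v\<close> itself does not permute them.\<close>
  define p where "p = (\<lambda>x. if x \<in> {Suc m..n} then s (x - m) + m else x)"
  have p: "p permutes {Suc m..n}"
  proof (rule bij_imp_permutes)
    have sm: "s (x - m) \<in> {1..n - m}" if "x \<in> {Suc m..n}" for x
      using permutes_in_image[OF s, of "x - m"] that by auto
    have inj: "inj_on p {Suc m..n}"
    proof (rule inj_onI)
      fix x y assume xy: "x \<in> {Suc m..n}" "y \<in> {Suc m..n}" "p x = p y"
      hence "s (x - m) = s (y - m)" by (simp add: p_def)
      hence "x - m = y - m" using permutes_inj[OF s] by (simp add: inj_eq)
      thus "x = y" using xy by auto
    qed
    have "p x \<in> {Suc m..n}" if "x \<in> {Suc m..n}" for x using sm[OF that] that mn by (auto simp: p_def)
    hence "p ` {Suc m..n} = {Suc m..n}" by (intro endo_inj_surj[OF _ _ inj]) auto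
    thus "bij_betw p {Suc m..n} {Suc m..n}" using inj by (simp add: bij_betw_def)
  qed (auto simp: p_def)
  obtain u where u: "set u \<subseteq> {Suc m..<n} \<times> UNIV" "word_perm u = p" using permutation_word[OF p] by blast
  have uw: "u \<in> braid_words n" using u(1) by (auto simp: braid_words_def)
  have vw: "v \<in> braid_words n" using v(1) mn by (auto simp: braid_words_def)
  have w: "v @ u \<in> braid_words n" using uw vw by simp
  have pv: "word_perm v ` {1..m} = {1..m}" by (rule full_stab_fixes[OF full v(2)])
  have pu: "word_perm u x = x" if "x \<in> {1..m}" for x using that by (simp add: u(2) p_def)
  have pvu: "word_perm (v @ u) x = word_perm v x" if "x \<in> {1..m}" for x using pu[OF that] by simp
  have "(`) (word_perm (v @ u)) ` I = (`) (word_perm v) ` I" by (rule image_image_cong[OF I_pairs(1) pvu])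
  hence st: "(`) (word_perm (v @ u)) ` I = I" using v(2) by simp
  hence fx: "word_perm (v @ u) ` {1..m} = {1..m}" by (rule full_stab_fixes[OF full])
  have "keep_word {1..m} (v @ u) = v"
    unfolding keep_word_append permutes_vimage[OF word_perm_permutes[OF vw] pv]
    by (simp only: keep_word_id[OF v(1)] keep_word_far[OF u(1)] append_Nil2)
  moreover have "shift_perm n m (word_perm (v @ u)) = s"
  proof
    fix j
    show "shift_perm n m (word_perm (v @ u)) j = s j"
    proof (cases "j \<in> {1..n - m}")
      case True
      have "s j \<in> {1..n - m}" using permutes_in_image[OF s] True by blast
      hence "word_perm v (s j + m) = s j + m" by (intro word_perm_outside[OF v(1)]) auto
      thus ?thesis using True mn by (auto simp: shift_perm_def u(2) p_def)
    next
      case False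
      show ?thesis using permutes_not_in[OF s False] unfolding shift_perm_def if_not_P[OF False] ..
    qed
  qed
  ultimately have "Z_split n m (Zc n (v @ u)) = x" using Z_split_Zc[OF w fx mn] x by simp
  moreover have "Zc n (v @ u) \<in> carrier (ZIgrp n I)" using w st by (simp only: ZIgrp_simps Zc_in_stab)
  ultimately show "x \<in> Z_split n m ` carrier (ZIgrp n I)" by blast
qed

text \<open>The pairs in \<open>I\<close> consist of kept strands, whose crossings survive
  unchanged.\<close>

lemma sgn_word_keep:
  assumes w: "w \<in> braid_words n" and p: "word_perm w = id"
  shows "sgn_word I (keep_word {1..m} w) = sgn_word I w" "word_perm (keep_word {1..m} w) = id"
proof -
  have fx: "word_perm w ` {1..m} = {1..m}" using p by simp
  note k = keep_word_fixed[OF w fx mn]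
  show kp: "word_perm (keep_word {1..m} w) = id"
  proof
    fix x show "word_perm (keep_word {1..m} w) x = id x"
      using k(2)[of x] word_perm_outside[OF k(1), of x] p by (cases "x \<in> {1..m}") simp_all
  qed
  have "A \<in> link (keep_word {1..m} w) \<longleftrightarrow> A \<in> link w" if A: "A \<in> I" for A
  proof -
    obtain i j where ij: "1 \<le> i" "i < j" "j \<le> m" "A = {i, j}" using pairsE I_pairs(1) A by blast
    show ?thesis unfolding ij(4) link_iff[OF kp] link_iff[OF p] by (rule k(3)) (use ij in auto)
  qed
  thus "sgn_word I (keep_word {1..m} w) = sgn_word I w" unfolding sgn_word_def by (intro prod.cong) auto
qed

lemma Z_split_PZ:
  assumes "a \<in> carrier (PZgrp n)"
  shows "fst (Z_split n m a) \<in> carrier (PZgrp m)" "chi m I (fst (Z_split n m a)) = chi n I a"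
    "snd (Z_split n m a) = id"
proof -
  obtain w where w: "w \<in> braid_words n" "word_perm w = id" "a = Zc n w"
    using assms by (auto simp: PZ_carrier pure_words_def)
  have fx: "word_perm w ` {1..m} = {1..m}" using w by simp
  have k: "keep_word {1..m} w \<in> braid_words m" by (rule keep_word_fixed(1)[OF w(1) fx mn])
  note s = sgn_word_keep[OF w(1,2)]
  show "fst (Z_split n m a) \<in> carrier (PZgrp m)" "chi m I (fst (Z_split n m a)) = chi n I a"
    unfolding w(3) Z_split_Zc[OF w(1) fx mn] using k s w(1) by (simp_all add: Zc_in_PZ chi_Zc)
  show "snd (Z_split n m a) = id"
    unfolding w(3) Z_split_Zc[OF w(1) fx mn] using w(2) by (auto simp: shift_perm_def)
qed

lemma Z_split_PZ_surj: "\<exists>a\<in>carrier (PZgrp n). fst (Z_split n m a) = b" if b: "b \<in> carrier (PZgrp m)"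
proof -
  obtain v where v: "v \<in> braid_words m" "word_perm v = id" "b = Zc m v"
    using b by (auto simp: PZ_carrier pure_words_def)
  have vn: "v \<in> braid_words n" using v(1) mn by (auto simp: braid_words_def)
  have "fst (Z_split n m (Zc n v)) = b"
    using Z_split_Zc[OF vn _ mn] keep_word_id[OF v(1)] v(2,3) by simp
  thus ?thesis using vn v(2) by (intro bexI[of _ "Zc n v"]) (simp_all add: Zc_in_PZ)
qed

text \<open>The first component controls the permutation on the first \<open>m\<close> strands and
  the second on the rest, so kernel elements are pure. The character of \<open>I\<close> sees only
  crossings among the first \<open>m\<close> strands, and these are trivial.\<close>

lemma Z_split_kernel:
  assumes z: "z \<in> Z_stab n I" and one: "Z_split n m z = (\<one>\<^bsub>ZIgrp m I\<^esub>, \<one>\<^bsub>sym_group (n - m)\<^esub>)"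
  shows "z \<in> carrier (PZgrp n)" "chi n I z = 1"
proof -
  obtain w where w: "w \<in> braid_words n" "z = Zc n w" "(`) (word_perm w) ` I = I" "word_perm w ` {1..m} = {1..m}"
    using z by (rule stab_wordE)
  note k = keep_word_fixed[OF w(1,4) mn]
  have "Zc m (keep_word {1..m} w) = Zc m []" and sh: "shift_perm n m (word_perm w) = id"
    using one unfolding w(2) Z_split_Zc[OF w(1,4) mn] by (simp_all add: ZIgrp_simps Zc_one sym_simps)
  hence key: "key (keep_word {1..m} w) = key []" using Zc_eq_iff[OF k(1), of "[]"] by simp
  have p: "word_perm w = id"
  proof
    fix x
    consider "x \<in> {1..m}" | "x \<in> {Suc m..n}" | "x \<notin> {1..n}" by fastforce
    thus "word_perm w x = id x"
    proof cases
      case 1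
      thus ?thesis using k(2)[OF 1] key_eqD(1)[OF key] by simp
    next
      case 2
      hence x: "x - m \<in> {1..n - m}" by auto
      show ?thesis
        using shift_perm_permutes(2)[OF word_perm_permutes[OF w(1)] w(4) mn x] 2 unfolding sh by simp
    next
      case 3
      thus ?thesis using word_perm_outside[OF w(1)] by simp
    qed
  qed
  show "z \<in> carrier (PZgrp n)" using w p by (simp add: Zc_in_PZ)
  have "chi n I z = sgn_word I (keep_word {1..m} w)"
    unfolding w(2) chi_Zc[OF w(1)] sgn_word_keep(1)[OF w(1) p] ..
  also have "\<dots> = 1" unfolding sgn_word_def link_key[OF key] by (simp add: link_def)
  finally show "chi n I z = 1" .
qed

end

section \<open>The irreducible representations of the finite quotient\<close>

lemma rep_iso_refl:
  assumes "group G" "is_rep G \<pi>"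
  shows "rep_iso G \<pi> \<pi>"
  unfolding rep_iso_def
proof (intro conjI bexI[of _ "1\<^sub>m (fst \<pi>)"] ballI)
  fix g assume "g \<in> carrier G"
  hence "snd \<pi> g \<in> carrier_mat (fst \<pi>) (fst \<pi>)" by (rule group.rep_carrier[OF assms])
  thus "1\<^sub>m (fst \<pi>) * snd \<pi> g = snd \<pi> g * 1\<^sub>m (fst \<pi>)" by simp
qed (auto simp: GL_carrier)

lemma pullback_rep_iso:
  assumes "rep_iso Q \<pi> \<sigma>" "\<And>g. g \<in> carrier G \<Longrightarrow> f g \<in> carrier Q"
  shows "rep_iso G (pullback f \<pi>) (pullback f \<sigma>)"
  using assms unfolding rep_iso_def pullback_def fst_conv snd_conv comp_apply by blast

lemma kronecker_scalar: "kronecker (c \<cdot>\<^sub>m 1\<^sub>m d) (1\<^sub>m e) = c \<cdot>\<^sub>m 1\<^sub>m (d * e)"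
proof (rule eq_matI)
  fix i j assume "i < dim_row (c \<cdot>\<^sub>m 1\<^sub>m (d * e))" "j < dim_col (c \<cdot>\<^sub>m 1\<^sub>m (d * e))"
  hence ij: "i < d * e" "j < d * e" by auto
  show "kronecker (c \<cdot>\<^sub>m 1\<^sub>m d) (1\<^sub>m e) $$ (i, j) = (c \<cdot>\<^sub>m 1\<^sub>m (d * e)) $$ (i, j)"
    using ij div_mod_less[OF ij(1)] div_mod_less[OF ij(2)] div_mod_eq_iff[of i j e]
    by (auto simp: kronecker_def)
qed (simp_all add: kronecker_def)

lemma mult_add_less:
  assumes "a < d" "c < e"
  shows "a * e + c < d * (e :: nat)"
proof -
  have "a * e + c < Suc a * e" using assms(2) by simp
  also have "\<dots> \<le> d * e" using assms(1) by (intro mult_le_mono1) simp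
  finally show ?thesis .
qed

context
  fixes n m :: nat and I :: "nat set set"
  assumes mn: "m \<le> n" and full: "full m I"
begin

abbreviation (input) big :: "zelem rep \<Rightarrow> (nat \<Rightarrow> nat) rep \<Rightarrow> zelem rep" where
  "big \<rho> \<sigma> \<equiv> pullback (Z_split n m) (ext_tensor \<rho> \<sigma>)"

lemma clifford_stab: "clifford (Zgrp n) (Z_stab n I) (carrier (PZgrp n)) (chi n I)"
proof -
  note I = I_pairs(2)[OF mn full]
  have sub: "finite_subgroup (Zgrp n) (Z_stab n I)"
    by (intro finite_subgroup.intro finite_subgroup_axioms.intro Zgrp_group Zgrp_finite stab_subgroup)
  have "chi n I (inv\<^bsub>Zgrp n\<^esub> h \<otimes>\<^bsub>Zgrp n\<^esub> a \<otimes>\<^bsub>Zgrp n\<^esub> h) = chi n I a"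
    if "h \<in> Z_stab n I" "a \<in> carrier (PZgrp n)" for h a
    using Z_stab_char[OF I] subgroup.mem_carrier[OF stab_subgroup] that by blast
  moreover have "g \<in> Z_stab n I"
    if "g \<in> carrier (Zgrp n)"
      "\<And>a. a \<in> carrier (PZgrp n) \<Longrightarrow> chi n I (inv\<^bsub>Zgrp n\<^esub> g \<otimes>\<^bsub>Zgrp n\<^esub> a \<otimes>\<^bsub>Zgrp n\<^esub> g) = chi n I a" for g
    using Z_stab_char[OF I that(1)] that(2) by blast
  ultimately show ?thesis
    by (intro clifford.intro[OF sub] clifford_axioms.intro PZ_subgroup PZ_in_stab PZ_conj chi_mult chi_sq) blast+
qed

lemma clifford_split: "clifford_product (Zgrp n) (Z_stab n I) (carrier (PZgrp n)) (chi n I)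
    (ZIgrp m I) (sym_group (n - m)) (Z_split n m)"
proof -
  interpret C: clifford "Zgrp n" "Z_stab n I" "carrier (PZgrp n)" "chi n I" by (rule clifford_stab)
  interpret Q: group_pair "ZIgrp m I" "sym_group (n - m)"
    by (simp add: group_pair_def ZIgrp_group sym_group_is_group)
  interpret H: group "ZIgrp n I" by (rule ZIgrp_group)
  have "group_hom (ZIgrp n I) (ZIgrp m I \<times>\<times> sym_group (n - m)) (Z_split n m)"
    using Z_split_hom[OF mn full] Q.group_prod H.group_axioms by (simp add: group_hom_def group_hom_axioms_def)
  hence f: "finite_group_surj (ZIgrp n I) (ZIgrp m I \<times>\<times> sym_group (n - m)) (Z_split n m)"
    by (simp add: finite_group_surj_def finite_group_surj_axioms_def ZIgrp_finite Z_split_surj[OF mn full])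
  show ?thesis
  proof (rule clifford_product.intro)
    show "finite_group_surj (Zgrp n\<lparr>carrier := Z_stab n I\<rparr>) (ZIgrp m I \<times>\<times> sym_group (n - m)) (Z_split n m)"
      using f unfolding ZIgrp_def .
    show "clifford_product_axioms (Z_stab n I) (carrier (PZgrp n)) (chi n I)
        (ZIgrp m I) (sym_group (n - m)) (Z_split n m)"
      by (rule clifford_product_axioms.intro)
        (use Z_split_kernel[OF mn full] Z_split_PZ(3)[OF mn full] in \<open>simp_all add: sym_simps(2)\<close>)
  qed (rule clifford_stab, rule Q.group_pair_axioms)
qed

interpretation C: clifford_product "Zgrp n" "Z_stab n I" "carrier (PZgrp n)" "chi n I"
  "ZIgrp m I" "sym_group (n - m)" "Z_split n m"
  by (rule clifford_split)

text \<open>Pure elements on \<open>m\<close> strands lift to pure elements on \<open>n\<close>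
  strands with the same value of the character, so the isotypic condition can be tested on
  \<open>n\<close> strands, where the Clifford setting lives.\<close>

lemma isotypic_split:
  assumes "is_rep (ZIgrp m I) \<rho>"
  shows "isotypic m I \<rho> \<longleftrightarrow>
    (\<forall>a\<in>carrier (PZgrp n). snd \<rho> (fst (Z_split n m a)) = chi n I a \<cdot>\<^sub>m 1\<^sub>m (fst \<rho>))"
  unfolding isotypic_iff[OF I_pairs(1)[OF mn full] assms]
proof
  assume *: "\<forall>a\<in>carrier (PZgrp m). snd \<rho> a = chi m I a \<cdot>\<^sub>m 1\<^sub>m (fst \<rho>)"
  show "\<forall>a\<in>carrier (PZgrp n). snd \<rho> (fst (Z_split n m a)) = chi n I a \<cdot>\<^sub>m 1\<^sub>m (fst \<rho>)"
  proof
    fix a assume a: "a \<in> carrier (PZgrp n)"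
    show "snd \<rho> (fst (Z_split n m a)) = chi n I a \<cdot>\<^sub>m 1\<^sub>m (fst \<rho>)"
      using bspec[OF * Z_split_PZ(1)[OF mn full a]] unfolding Z_split_PZ(2)[OF mn full a] .
  qed
next
  assume *: "\<forall>a\<in>carrier (PZgrp n). snd \<rho> (fst (Z_split n m a)) = chi n I a \<cdot>\<^sub>m 1\<^sub>m (fst \<rho>)"
  show "\<forall>b\<in>carrier (PZgrp m). snd \<rho> b = chi m I b \<cdot>\<^sub>m 1\<^sub>m (fst \<rho>)"
  proof
    fix b assume "b \<in> carrier (PZgrp m)"
    then obtain a where a: "a \<in> carrier (PZgrp n)" "fst (Z_split n m a) = b"
      using Z_split_PZ_surj[OF mn full] by blast
    show "snd \<rho> b = chi m I b \<cdot>\<^sub>m 1\<^sub>m (fst \<rho>)"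
      using bspec[OF * a(1)] unfolding a(2)[symmetric] Z_split_PZ(2)[OF mn full a(1)] .
  qed
qed

lemma big_iso_rep:
  assumes \<rho>: "is_rep (ZIgrp m I) \<rho>" "isotypic m I \<rho>" and \<sigma>: "is_rep (sym_group (n - m)) \<sigma>"
  shows "C.iso_rep (big \<rho> \<sigma>)"
  unfolding C.iso_rep_def
proof (intro conjI ballI)
  show "is_rep (Zgrp n\<lparr>carrier := Z_stab n I\<rparr>) (big \<rho> \<sigma>)"
    by (intro C.f.pullback_rep C.Q.tensor_rep \<rho> \<sigma>)
  fix a assume a: "a \<in> carrier (PZgrp n)"
  have "snd \<rho> (fst (Z_split n m a)) = chi n I a \<cdot>\<^sub>m 1\<^sub>m (fst \<rho>)"
    using \<rho> a isotypic_split by blast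
  moreover have "snd \<sigma> (snd (Z_split n m a)) = 1\<^sub>m (fst \<sigma>)"
    using C.Q.B.rep_one[OF \<sigma>] unfolding C.A_snd[OF a] .
  ultimately show "snd (big \<rho> \<sigma>) a = chi n I a \<cdot>\<^sub>m 1\<^sub>m (fst (big \<rho> \<sigma>))"
    by (simp add: pullback_def ext_tensor_def kronecker_scalar case_prod_unfold)
qed

text \<open>Schur relations of the two factors pass through tensor product, pullback and induction;
  \<open>schur_rel_irrep\<close> turns them back into irreducibility.\<close>

lemma big_irrep:
  assumes \<rho>: "is_irrep (ZIgrp m I) \<rho>" "isotypic m I \<rho>" and \<sigma>: "is_irrep (sym_group (n - m)) \<sigma>"
  shows "is_irrep (Zgrp n) (induced (Zgrp n) (Z_stab n I) (big \<rho> \<sigma>))"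
proof -
  have r: "is_rep (ZIgrp m I) \<rho>" "is_rep (sym_group (n - m)) \<sigma>" "0 < fst \<rho>" "0 < fst \<sigma>"
    using \<rho> \<sigma> by (auto simp: is_irrep_def)
  have iso: "C.iso_rep (big \<rho> \<sigma>)" by (rule big_iso_rep[OF r(1) \<rho>(2) r(2)])
  show ?thesis
  proof (rule C.schur_rel_irrep)
    show "is_rep (Zgrp n) (induced (Zgrp n) (Z_stab n I) (big \<rho> \<sigma>))"
      using iso unfolding C.iso_rep_def by (intro C.induced_rep) blast
    have "0 < fst (big \<rho> \<sigma>)" using r by (simp add: pullback_def ext_tensor_def)
    thus "0 < fst (induced (Zgrp n) (Z_stab n I) (big \<rho> \<sigma>))" using C.N_pos by (simp add: fst_induced)
    show "schur_rel (Zgrp n) (induced (Zgrp n) (Z_stab n I) (big \<rho> \<sigma>))"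
      by (intro C.induced_schur_rel iso C.f.pullback_schur_rel C.Q.tensor_schur_rel r
        C.Q.A.irrep_schur_rel C.Q.B.irrep_schur_rel \<rho> \<sigma>)
  qed (rule Zgrp_finite)
qed

lemma big_orth:
  assumes \<rho>: "is_irrep (ZIgrp m I) \<rho>" "isotypic m I \<rho>" and \<sigma>: "is_irrep (sym_group (n - m)) \<sigma>"
    and \<rho>': "is_irrep (ZIgrp m I) \<rho>'" "isotypic m I \<rho>'" and \<sigma>': "is_irrep (sym_group (n - m)) \<sigma>'"
    and ni: "\<not> rep_iso (ZIgrp m I) \<rho>' \<rho> \<or> \<not> rep_iso (sym_group (n - m)) \<sigma>' \<sigma>"
  shows "coef_orth (Zgrp n) (induced (Zgrp n) (Z_stab n I) (big \<rho> \<sigma>)) (induced (Zgrp n) (Z_stab n I) (big \<rho>' \<sigma>'))"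
proof -
  have r: "is_rep (ZIgrp m I) \<rho>" "is_rep (sym_group (n - m)) \<sigma>"
    "is_rep (ZIgrp m I) \<rho>'" "is_rep (sym_group (n - m)) \<sigma>'"
    using \<rho> \<sigma> \<rho>' \<sigma>' by (auto simp: is_irrep_def)
  have "coef_orth (ZIgrp m I) \<rho> \<rho>' \<or> coef_orth (sym_group (n - m)) \<sigma> \<sigma>'"
    using ni C.Q.A.irrep_iso_or_orth[OF \<rho>'(1) \<rho>(1)] C.Q.B.irrep_iso_or_orth[OF \<sigma>' \<sigma>] by blast
  thus ?thesis
    by (intro C.induced_coef_orth_same C.f.pullback_coef_orth C.Q.tensor_coef_orth big_iso_rep r \<rho> \<rho>')
qed

text \<open>Orthogonality is given only for the fixed representatives in \<open>R\<close> and the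
  \<open>Sym_irrep\<close>. It extends to all isotypic \<rho> and all \<sigma> because the vanishing
  of sums is invariant under isomorphism.\<close>

lemma isotypic_sum_zero:
  assumes \<pi>: "is_rep (Zgrp n) \<pi>"
    and R: "isotypic_irrep_reps m I R"
    and orth: "\<And>\<rho> \<nu>. \<rho> \<in> R \<Longrightarrow> paddable (n - m) \<nu> \<Longrightarrow> coef_orth (Zgrp n) (V_rep n m I \<rho> \<nu>) \<pi>"
    and kl: "k < fst \<pi>" "l < fst \<pi>"
  shows "(\<Sum>a\<in>carrier (PZgrp n). chi n I a * snd \<pi> (inv\<^bsub>Zgrp n\<^esub> a) $$ (k, l)) = 0"
proof (rule C.isotypic_part_zero)
  fix \<rho> \<sigma> i j p q
  assume \<rho>: "is_irrep (ZIgrp m I) \<rho>"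
    and iso: "\<forall>a\<in>carrier (PZgrp n). snd \<rho> (fst (Z_split n m a)) = chi n I a \<cdot>\<^sub>m 1\<^sub>m (fst \<rho>)"
    and \<sigma>: "is_irrep (sym_group (n - m)) \<sigma>" and ij: "i < fst \<rho>" "j < fst \<rho>" and pq: "p < fst \<sigma>" "q < fst \<sigma>"
  let ?H = "Zgrp n\<lparr>carrier := Z_stab n I\<rparr>" and ?u = "\<lambda>h. snd \<pi> (inv\<^bsub>Zgrp n\<^esub> h) $$ (k, l)"
  let ?f\<^sub>1 = "\<lambda>h. fst (Z_split n m h)" and ?f\<^sub>2 = "\<lambda>h. snd (Z_split n m h)"
  have r: "is_rep (ZIgrp m I) \<rho>" "is_rep (sym_group (n - m)) \<sigma>" using \<rho> \<sigma> by (auto simp: is_irrep_def)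
  have "isotypic m I \<rho>" using isotypic_split[OF r(1)] iso by blast
  then obtain \<rho>\<^sub>0 where \<rho>\<^sub>0: "\<rho>\<^sub>0 \<in> R" "rep_iso (ZIgrp m I) \<rho> \<rho>\<^sub>0" "is_irrep (ZIgrp m I) \<rho>\<^sub>0"
    using R \<rho> unfolding isotypic_irrep_reps_def by blast
  obtain \<nu> where \<nu>: "paddable (n - m) \<nu>" "rep_iso (sym_group (n - m)) \<sigma> (Sym_irrep (n - m) \<nu>)"
    using Sym_irrep_complete[OF \<sigma>] by blast
  let ?s = "Sym_irrep (n - m) \<nu>"
  have r0: "is_rep (ZIgrp m I) \<rho>\<^sub>0" "is_rep (sym_group (n - m)) ?s"
    using \<rho>\<^sub>0(3) Sym_irrep_irrep[OF \<nu>(1)] by (auto simp: is_irrep_def)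
  have f1: "is_rep ?H (pullback ?f\<^sub>1 \<tau>)" if "is_rep (ZIgrp m I) \<tau>" for \<tau>
    using that C.f_carrier(1) C.f_mult(1) by (auto simp: is_rep_def pullback_def hom_def Pi_iff)
  have f2: "is_rep ?H (pullback ?f\<^sub>2 \<tau>)" if "is_rep (sym_group (n - m)) \<tau>" for \<tau>
    using that C.f_carrier(2) C.f_mult(2) by (auto simp: is_rep_def pullback_def hom_def Pi_iff)
  have i1: "rep_iso ?H (pullback ?f\<^sub>1 \<rho>) (pullback ?f\<^sub>1 \<rho>\<^sub>0)"
    by (rule pullback_rep_iso[OF \<rho>\<^sub>0(2)]) (simp add: C.f_carrier(1))
  have i2: "rep_iso ?H (pullback ?f\<^sub>2 \<sigma>) (pullback ?f\<^sub>2 ?s)"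
    by (rule pullback_rep_iso[OF \<nu>(2)]) (simp add: C.f_carrier(2))
  \<comment> \<open>\<open>a * ?e + c\<close> is the Kronecker index of the pair of \<open>a\<close>
    and \<open>c\<close>; the sum over the stabilizer comes from
    \<open>induced_orth_restrict\<close>.\<close>
  have base: "(\<Sum>h\<in>Z_stab n I. ?u h * snd \<rho>\<^sub>0 (?f\<^sub>1 h) $$ (a, b) * snd ?s (?f\<^sub>2 h) $$ (c, d)) = 0"
    if ab: "a < fst \<rho>\<^sub>0" "b < fst \<rho>\<^sub>0" and cd: "c < fst ?s" "d < fst ?s" for a b c d
  proof -
    let ?e = "fst ?s"
    have lt: "a * ?e + c < fst (big \<rho>\<^sub>0 ?s)" "b * ?e + d < fst (big \<rho>\<^sub>0 ?s)"
      using ab cd by (auto simp: pullback_def ext_tensor_def intro: mult_add_less)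
    have "(\<Sum>h\<in>Z_stab n I. snd (big \<rho>\<^sub>0 ?s) h $$ (a * ?e + c, b * ?e + d) * ?u h) = 0"
      using orth[OF \<rho>\<^sub>0(1) \<nu>(1)] unfolding V_rep_def by (rule C.induced_orth_restrict[OF \<pi> _ lt kl])
    moreover have "snd (big \<rho>\<^sub>0 ?s) h $$ (a * ?e + c, b * ?e + d) = snd \<rho>\<^sub>0 (?f\<^sub>1 h) $$ (a, b) * snd ?s (?f\<^sub>2 h) $$ (c, d)"
      if h: "h \<in> Z_stab n I" for h
      using lt cd C.Q.A.rep_carrier[OF r0(1) C.f_carrier(1)[OF h]] C.Q.B.rep_carrier[OF r0(2) C.f_carrier(2)[OF h]]
      by (simp add: pullback_def ext_tensor_def kronecker_def case_prod_unfold)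
    ultimately show ?thesis by (simp add: mult_ac)
  qed
  \<comment> \<open>The fixed representatives are exchanged one tensor factor at a time, the
    coefficient of the other factor being treated as part of the weight.\<close>
  have step1: "(\<Sum>h\<in>Z_stab n I. ?u h * snd \<rho>\<^sub>0 (?f\<^sub>1 h) $$ (a, b) * snd \<sigma> (?f\<^sub>2 h) $$ (p, q)) = 0"
    if ab: "a < fst \<rho>\<^sub>0" "b < fst \<rho>\<^sub>0" for a b
    using group.rep_iso_sum_zero[OF C.H_group f2[OF r(2)] f2[OF r0(2)] i2, of "\<lambda>h. ?u h * snd \<rho>\<^sub>0 (?f\<^sub>1 h) $$ (a, b)" p q] base[OF ab] pq
    by (simp add: pullback_def)
  have "(\<Sum>h\<in>Z_stab n I. ?u h * snd \<sigma> (?f\<^sub>2 h) $$ (p, q) * snd \<rho> (?f\<^sub>1 h) $$ (i, j)) = 0"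
    using group.rep_iso_sum_zero[OF C.H_group f1[OF r(1)] f1[OF r0(1)] i1, of "\<lambda>h. ?u h * snd \<sigma> (?f\<^sub>2 h) $$ (p, q)" i j] step1 ij
    by (simp add: pullback_def mult_ac)
  thus "(\<Sum>h\<in>Z_stab n I. ?u h * (snd \<rho> (?f\<^sub>1 h) $$ (i, j) * snd \<sigma> (?f\<^sub>2 h) $$ (p, q))) = 0"
    by (simp add: mult_ac)
qed

end

text \<open>Summing over all \<open>J\<close> collapses the sum over the pure part to the identity
  by \<open>sum_chi\<close>, leaving a power of 2 times a diagonal entry of the identity
  matrix.\<close>

lemma coefs_nonzero:
  assumes \<pi>: "is_rep (Zgrp n) \<pi>" and pos: "0 < fst \<pi>"
  shows "\<exists>J\<subseteq>pairs n. \<exists>k<fst \<pi>. \<exists>l<fst \<pi>.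
    (\<Sum>a\<in>carrier (PZgrp n). chi n J a * snd \<pi> (inv\<^bsub>Zgrp n\<^esub> a) $$ (k, l)) \<noteq> 0"
proof (rule ccontr)
  interpret group "Zgrp n" by (rule Zgrp_group)
  let ?u = "\<lambda>a. snd \<pi> (inv\<^bsub>Zgrp n\<^esub> a) $$ (0, 0)"
  have fin: "finite (carrier (PZgrp n))" using finite_subset[OF subgroup.subset[OF PZ_subgroup] Zgrp_finite] .
  have one: "\<one>\<^bsub>Zgrp n\<^esub> \<in> carrier (PZgrp n)" by (rule subgroup.one_closed[OF PZ_subgroup])
  assume "\<not> ?thesis"
  hence "0 = (\<Sum>J\<in>Pow (pairs n). \<Sum>a\<in>carrier (PZgrp n). chi n J a * ?u a)"
    using pos by (intro sum.neutral[symmetric] ballI) blast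
  also have "\<dots> = (\<Sum>a\<in>carrier (PZgrp n). (\<Sum>J\<in>Pow (pairs n). chi n J a) * ?u a)"
    by (subst sum.swap) (simp add: sum_distrib_right)
  also have "\<dots> = (\<Sum>a\<in>carrier (PZgrp n). if a = \<one>\<^bsub>Zgrp n\<^esub> then 2 ^ card (pairs n) * ?u a else 0)"
    by (rule sum.cong[OF HOL.refl]) (simp add: sum_chi)
  also have "\<dots> = 2 ^ card (pairs n) * ?u \<one>\<^bsub>Zgrp n\<^esub>"
    using fin one by simp
  also have "?u \<one>\<^bsub>Zgrp n\<^esub> = 1" using rep_one[OF \<pi>] pos by simp
  finally show False by simp
qed

text \<open>Lift \<open>p\<close> to an element \<open>g\<close> of the quotient and conjugate the
  summation variable. The representation at the conjugate expands into its entries at the original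
  elements, all of whose sums vanish.\<close>

lemma chi_sum_conj:
  assumes \<pi>: "is_rep (Zgrp n) \<pi>" and p: "p permutes {1..n}"
    and z: "\<And>k l. k < fst \<pi> \<Longrightarrow> l < fst \<pi> \<Longrightarrow>
      (\<Sum>a\<in>carrier (PZgrp n). chi n I a * snd \<pi> (inv\<^bsub>Zgrp n\<^esub> a) $$ (k, l)) = 0"
    and kl: "k < fst \<pi>" "l < fst \<pi>"
  shows "(\<Sum>a\<in>carrier (PZgrp n). chi n ((`) p ` I) a * snd \<pi> (inv\<^bsub>Zgrp n\<^esub> a) $$ (k, l)) = 0"
proof -
  interpret group "Zgrp n" by (rule Zgrp_group)
  let ?i = "m_inv (Zgrp n)" and ?P = "carrier (PZgrp n)"
  obtain g where g: "g \<in> carrier (Zgrp n)"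
    and chi: "\<And>a. a \<in> ?P \<Longrightarrow> chi n I (?i g \<otimes>\<^bsub>Zgrp n\<^esub> a \<otimes>\<^bsub>Zgrp n\<^esub> g) = chi n ((`) p ` I) a"
    using chi_orbit[OF p] by blast
  have cl: "a \<in> ?P \<Longrightarrow> a \<in> carrier (Zgrp n)" for a using subgroup.mem_carrier[OF PZ_subgroup] .
  have c': "g \<otimes>\<^bsub>Zgrp n\<^esub> a \<otimes>\<^bsub>Zgrp n\<^esub> ?i g \<in> ?P" if "a \<in> ?P" for a
    using PZ_conj[of "?i g" n a] g that by simp
  have conj1: "?i g \<otimes>\<^bsub>Zgrp n\<^esub> (g \<otimes>\<^bsub>Zgrp n\<^esub> a \<otimes>\<^bsub>Zgrp n\<^esub> ?i g) \<otimes>\<^bsub>Zgrp n\<^esub> g = a"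
    if "a \<in> carrier (Zgrp n)" for a
    using g that by (simp add: m_assoc inv_cancel)
  have conj2: "g \<otimes>\<^bsub>Zgrp n\<^esub> (?i g \<otimes>\<^bsub>Zgrp n\<^esub> a \<otimes>\<^bsub>Zgrp n\<^esub> g) \<otimes>\<^bsub>Zgrp n\<^esub> ?i g = a"
    if "a \<in> carrier (Zgrp n)" for a
    using g that by (simp add: m_assoc inv_cancel)
  have inv: "?i (g \<otimes>\<^bsub>Zgrp n\<^esub> a \<otimes>\<^bsub>Zgrp n\<^esub> ?i g) = g \<otimes>\<^bsub>Zgrp n\<^esub> (?i a \<otimes>\<^bsub>Zgrp n\<^esub> ?i g)"
    if "a \<in> carrier (Zgrp n)" for a
    using g that by (simp add: inv_mult_group)
  have "(\<Sum>a\<in>?P. chi n ((`) p ` I) a * snd \<pi> (?i a) $$ (k, l)) =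
      (\<Sum>a\<in>?P. chi n I a * snd \<pi> (g \<otimes>\<^bsub>Zgrp n\<^esub> (?i a \<otimes>\<^bsub>Zgrp n\<^esub> ?i g)) $$ (k, l))"
    by (rule sum.reindex_bij_witness[where j = "\<lambda>a. ?i g \<otimes>\<^bsub>Zgrp n\<^esub> a \<otimes>\<^bsub>Zgrp n\<^esub> g"
        and i = "\<lambda>a. g \<otimes>\<^bsub>Zgrp n\<^esub> a \<otimes>\<^bsub>Zgrp n\<^esub> ?i g"])
      (use g cl c' PZ_conj[OF g] chi conj1 conj2 inv[symmetric] in \<open>simp_all\<close>)
  also have "\<dots> = (\<Sum>a\<in>?P. \<Sum>x<fst \<pi>. \<Sum>y<fst \<pi>.
      (snd \<pi> g $$ (k, x) * snd \<pi> (?i g) $$ (y, l)) * (chi n I a * snd \<pi> (?i a) $$ (x, y)))"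
    using g cl kl by (intro sum.cong HOL.refl) (simp add: rep_mult_entry[OF \<pi>] sum_distrib_left mult_ac)
  also have "\<dots> = (\<Sum>x<fst \<pi>. \<Sum>y<fst \<pi>. \<Sum>a\<in>?P.
      (snd \<pi> g $$ (k, x) * snd \<pi> (?i g) $$ (y, l)) * (chi n I a * snd \<pi> (?i a) $$ (x, y)))"
    by (subst sum.swap, rule sum.cong[OF HOL.refl], rule sum.swap)
  also have "\<dots> = 0"
    unfolding sum_distrib_left[symmetric] using z by (intro sum.neutral) simp
  finally show ?thesis .
qed

section \<open>Orbits of sets of pairs\<close>

lemma full_orbit_repsD:
  assumes "full_orbit_reps m F" "full m J"
  shows "\<exists>!I. I \<in> F \<and> (\<exists>p. p permutes {1..m} \<and> J = (`) p ` I)"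
  by (rule assms(1)[unfolded full_orbit_reps_def, THEN conjunct2, THEN spec, THEN mp, OF assms(2)])

text \<open>The number \<open>m\<close> counts the strands that occur in \<open>J\<close>. Moving
  these to the first \<open>m\<close> positions makes \<open>J\<close> full there, and a chosen
  representative is reached by a further permutation of these positions.\<close>

lemma full_orbit_cover:
  assumes FF: "\<And>m. full_orbit_reps m (FF m)" and J: "J \<subseteq> pairs n"
  shows "\<exists>m\<le>n. \<exists>I\<in>FF m. \<exists>p. p permutes {1..n} \<and> J = (`) p ` I"
proof -
  define m where "m = card (\<Union>J)"
  have U: "\<Union>J \<subseteq> {1..n}" using J by (auto simp: pairs_def)
  have mn: "m \<le> n" using card_mono[OF _ U] by (simp add: m_def)
  \<comment> \<open>A bijection from \<open>{1..m}\<close> onto the union of \<open>J\<close> is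
    completed by any bijection between the complements in \<open>{1..n}\<close>.\<close>
  obtain q where q: "q permutes {1..n}" "q ` {1..m} = \<Union>J"
  proof -
    have fU: "finite (\<Union>J)" using U finite_subset by blast
    obtain f where f: "bij_betw f {1..m} (\<Union>J)"
      using finite_same_card_bij[of "{1..m}" "\<Union>J"] fU by (auto simp: m_def)
    have "card ({1..n} - {1..m}) = card ({1..n} - \<Union>J)"
      using U mn by (simp add: card_Diff_subset fU m_def[symmetric])
    then obtain g where g: "bij_betw g ({1..n} - {1..m}) ({1..n} - \<Union>J)"
      using finite_same_card_bij[of "{1..n} - {1..m}" "{1..n} - \<Union>J"] by auto
    define q where "q x = (if x \<in> {1..m} then f x else if x \<in> {1..n} then g x else x)" for x
    have "bij_betw q {1..m} (\<Union>J)"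
      by (rule bij_betw_cong[THEN iffD1, OF _ f]) (simp add: q_def)
    moreover have "bij_betw q ({1..n} - {1..m}) ({1..n} - \<Union>J)"
      by (rule bij_betw_cong[THEN iffD1, OF _ g]) (auto simp: q_def)
    ultimately have "bij_betw q ({1..m} \<union> ({1..n} - {1..m})) (\<Union>J \<union> ({1..n} - \<Union>J))"
      by (rule bij_betw_combine) blast
    moreover have "{1..m} \<union> ({1..n} - {1..m}) = {1..n}" "\<Union>J \<union> ({1..n} - \<Union>J) = {1..n}"
      using mn U by auto
    ultimately have "bij_betw q {1..n} {1..n}" by simp
    hence "q permutes {1..n}" by (rule bij_imp_permutes) (use mn in \<open>auto simp: q_def\<close>)
    moreover have "q ` {1..m} = \<Union>J" using \<open>bij_betw q {1..m} (\<Union>J)\<close> by (rule bij_betw_imp_surj_on)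
    ultimately show thesis by (rule that)
  qed
  have inv: "q (inv_into UNIV q x) = x" "inv_into UNIV q (q x) = x" for x
    using permutes_inverses[OF q(1)] by auto
  define I0 where "I0 = (`) (inv_into UNIV q) ` J"
  have JI: "J = (`) q ` I0" by (simp add: I0_def image_image inv)
  have "\<Union>I0 = inv_into UNIV q ` \<Union>J" unfolding I0_def by blast
  also have "\<dots> = {1..m}" unfolding q(2)[symmetric] by (simp add: image_image inv)
  finally have U0: "\<Union>I0 = {1..m}" .
  have "card A = 2" if A: "A \<in> I0" for A
  proof -
    obtain B where B: "B \<in> J" "A = inv_into UNIV q ` B" using A by (auto simp: I0_def)
    have "card A = card B" unfolding B(2)
      by (rule card_image) (use permutes_inj[OF permutes_inv[OF q(1)]] inj_on_subset in blast)
    thus ?thesis using B(1) J by (auto simp: pairs_def)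
  qed
  hence "full m I0" using U0 by (auto simp: full_def pairs_def)
  from full_orbit_repsD[OF FF this] obtain I p where I: "I \<in> FF m" "p permutes {1..m}" "I0 = (`) p ` I"
    by (elim ex1E conjE exE)
  have "p permutes {1..n}" by (rule permutes_subset[OF I(2)]) (use mn in auto)
  hence "q \<circ> p permutes {1..n}" by (rule permutes_compose[OF _ q(1)])
  moreover have "J = (`) (q \<circ> p) ` I" unfolding JI I(3) by (simp add: image_image)
  ultimately show ?thesis using mn I(1) by blast
qed

text \<open>The map \<open>p\<close> may move strands beyond the first \<open>m\<close>. It carries
  the union of \<open>I'\<close> onto that of \<open>I\<close>, hence \<open>m = m'\<close>; its
  restriction to \<open>{1..m}\<close> is a permutation, to which uniqueness of representatives
  applies.\<close>

lemma orbit_reps_unique: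
  assumes FF: "\<And>m. full_orbit_reps m (FF m)" and I: "I \<in> FF m" "I' \<in> FF m'"
    and p: "inj p" and eq: "I = (`) p ` I'"
  shows "m = m' \<and> I = I'"
proof -
  have f: "full m I" "full m' I'" using FF I by (auto simp: full_orbit_reps_def)
  have U: "p ` {1..m'} = {1..m}" using f unfolding full_def eq by (metis image_Union)
  have "card (p ` {1..m'}) = card {1..m'}" by (rule card_image) (use p inj_on_subset in blast)
  hence m: "m = m'" unfolding U by simp
  define p' where "p' x = (if x \<in> {1..m} then p x else x)" for x
  have "bij_betw p' {1..m} {1..m}"
    by (rule bij_betw_cong[THEN iffD1, of _ p]) (use U m inj_on_subset[OF p subset_UNIV] in \<open>auto simp: p'_def bij_betw_def\<close>)
  hence p': "p' permutes {1..m}" by (rule bij_imp_permutes) (auto simp: p'_def)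
  have "(`) p' ` I' = (`) p ` I'"
    by (rule image_image_cong[of _ m]) (use f(2) m in \<open>auto simp: full_def p'_def\<close>)
  hence I': "I = (`) p' ` I'" using eq by simp
  have id: "I = (`) id ` I" by simp
  have m1: "I \<in> FF m \<and> (\<exists>p. p permutes {1..m} \<and> I = (`) p ` I)"
    by (rule conjI[OF I(1)], rule exI[of _ id], rule conjI[OF permutes_id id])
  have m2: "I' \<in> FF m \<and> (\<exists>p. p permutes {1..m} \<and> I = (`) p ` I')"
    using I(2) unfolding m[symmetric] by (intro conjI exI[of _ p'] p' I')
  note U = full_orbit_repsD[OF FF f(1)]
  have "I = I'" by (rule HOL.trans[OF the1_equality[OF U m1, symmetric] the1_equality[OF U m2]])
  thus ?thesis using m by blast
qed

theorem theorem1p4: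
  fixes FF :: "nat \<Rightarrow> nat set set set"
    and R :: "nat \<Rightarrow> nat set set \<Rightarrow> zelem rep set"
  assumes FF: "\<And>m. full_orbit_reps m (FF m)"
    and R: "\<And>m I. I \<in> FF m \<Longrightarrow> isotypic_irrep_reps m I (R m I)"
  shows "(\<forall>n m I \<rho> \<nu>. m \<le> n \<and> I \<in> FF m \<and> \<rho> \<in> R m I \<and> paddable (n - m) \<nu> \<longrightarrow>
            is_irrep (Zgrp n) (V_rep n m I \<rho> \<nu>)) \<and>
         (\<forall>n \<pi>. is_irrep (Zgrp n) \<pi> \<longrightarrow>
            (\<exists>!(m, I, \<rho>, \<nu>). m \<le> n \<and> I \<in> FF m \<and> \<rho> \<in> R m I \<and> paddable (n - m) \<nu> \<and>
               rep_iso (Zgrp n) \<pi> (V_rep n m I \<rho> \<nu>)))"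
proof -
  have full: "full m I" if "I \<in> FF m" for m I using FF that by (auto simp: full_orbit_reps_def)
  have RD: "is_irrep (ZIgrp m I) \<rho>" "isotypic m I \<rho>" if "I \<in> FF m" "\<rho> \<in> R m I" for m I \<rho>
    using R[OF that(1)] that(2) by (auto simp: isotypic_irrep_reps_def)
  have irr: "is_irrep (Zgrp n) (V_rep n m I \<rho> \<nu>)"
    if "m \<le> n" "I \<in> FF m" "\<rho> \<in> R m I" "paddable (n - m) \<nu>" for n m I \<rho> \<nu>
    unfolding V_rep_def by (intro big_irrep that full RD Sym_irrep_irrep)
  have exist: "\<exists>m I \<rho> \<nu>. m \<le> n \<and> I \<in> FF m \<and> \<rho> \<in> R m I \<and> paddable (n - m) \<nu> \<and>
      rep_iso (Zgrp n) \<pi> (V_rep n m I \<rho> \<nu>)" if \<pi>: "is_irrep (Zgrp n) \<pi>" for n \<pi>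
  proof (rule ccontr)
    interpret group "Zgrp n" by (rule Zgrp_group)
    have rep: "is_rep (Zgrp n) \<pi>" "0 < fst \<pi>" using \<pi> by (auto simp: is_irrep_def)
    assume none: "\<not> ?thesis"
    \<comment> \<open>Orthogonality handles the representative \<open>I\<close> of the orbit;
      conjugation spreads the vanishing to every \<open>J\<close> in it.\<close>
    have zero: "(\<Sum>a\<in>carrier (PZgrp n). chi n J a * snd \<pi> (inv\<^bsub>Zgrp n\<^esub> a) $$ (k, l)) = 0"
      if J: "J \<subseteq> pairs n" and kl: "k < fst \<pi>" "l < fst \<pi>" for J k l
    proof -
      obtain m I p where mI: "m \<le> n" "I \<in> FF m" and p: "p permutes {1..n}" "J = (`) p ` I"
        using full_orbit_cover[of FF, OF FF J] by blast
      have "coef_orth (Zgrp n) (V_rep n m I \<rho> \<nu>) \<pi>" if "\<rho> \<in> R m I" "paddable (n - m) \<nu>" for \<rho> \<nu>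
        by (rule irrep_iso_or_orth[OF \<pi> irr[OF mI that]]) (use none mI that in blast)
      hence "(\<Sum>a\<in>carrier (PZgrp n). chi n I a * snd \<pi> (inv\<^bsub>Zgrp n\<^esub> a) $$ (k, l)) = 0"
        if "k < fst \<pi>" "l < fst \<pi>" for k l
        by (intro isotypic_sum_zero[OF mI(1) full[OF mI(2)] rep(1) R[OF mI(2)] _ that])
      thus ?thesis unfolding p(2) by (intro chi_sum_conj[OF rep(1) p(1) _ kl])
    qed
    show False using coefs_nonzero[OF rep] zero by blast
  qed
  have unique: "(m, I, \<rho>, \<nu>) = (m', I', \<rho>', \<nu>')"
    if \<pi>: "is_irrep (Zgrp n) \<pi>"
      and V: "m \<le> n" "I \<in> FF m" "\<rho> \<in> R m I" "paddable (n - m) \<nu>"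
      and V': "m' \<le> n" "I' \<in> FF m'" "\<rho>' \<in> R m' I'" "paddable (n - m') \<nu>'"
      and iso: "rep_iso (Zgrp n) \<pi> (V_rep n m I \<rho> \<nu>)" "rep_iso (Zgrp n) \<pi> (V_rep n m' I' \<rho>' \<nu>')"
    for n \<pi> m I \<rho> \<nu> m' I' \<rho>' \<nu>'
  proof -
    interpret group "Zgrp n" by (rule Zgrp_group)
    have rep: "is_rep G \<tau>" if "is_irrep G \<tau>" for G :: "('z, 'x) monoid_scheme" and \<tau>
      using that by (simp add: is_irrep_def)
    note reps = rep[OF \<pi>] rep[OF irr[OF V]] rep[OF irr[OF V']]
    have "rep_iso (Zgrp n) (V_rep n m I \<rho> \<nu>) (V_rep n m' I' \<rho>' \<nu>')"
      by (rule rep_iso_trans[OF reps(2,1,3) rep_iso_sym[OF reps(1,2) iso(1)] iso(2)])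
    hence no: "\<not> coef_orth (Zgrp n) (V_rep n m' I' \<rho>' \<nu>') (V_rep n m I \<rho> \<nu>)"
      using irrep_iso_not_orth[OF irr[OF V] irr[OF V'] Zgrp_finite] by blast
    \<comment> \<open>For different pairs of \<open>m\<close> and \<open>I\<close> no permutation
      carries one set to the other, so any two conjugates of the characters differ at some pure
      element and the induced representations are orthogonal.\<close>
    have same: "m = m' \<and> I = I'"
    proof (rule ccontr)
      assume ne: "\<not> (m = m' \<and> I = I')"
      have "coef_orth (Zgrp n) (V_rep n m' I' \<rho>' \<nu>') (V_rep n m I \<rho> \<nu>)"
        unfolding V_rep_def
      proof (rule induced_coef_orth_diff[OF clifford_stab[OF V'(1) full[OF V'(2)]] clifford_stab[OF V(1) full[OF V(2)]]])
        show "clifford.iso_rep (Zgrp n) (Z_stab n I') (carrier (PZgrp n)) (chi n I')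
            (pullback (Z_split n m') (ext_tensor \<rho>' (Sym_irrep (n - m') \<nu>')))"
          by (intro big_iso_rep V' full RD rep Sym_irrep_irrep)
        show "clifford.iso_rep (Zgrp n) (Z_stab n I) (carrier (PZgrp n)) (chi n I)
            (pullback (Z_split n m) (ext_tensor \<rho> (Sym_irrep (n - m) \<nu>)))"
          by (intro big_iso_rep V full RD rep Sym_irrep_irrep)
        fix t t' assume "t \<in> carrier (Zgrp n)" "t' \<in> carrier (Zgrp n)"
        then obtain u v where u: "u \<in> braid_words n" "t = Zc n u" and v: "v \<in> braid_words n" "t' = Zc n v"
          by (auto simp: Zgrp_carrier)
        note pu = word_perm_permutes[OF u(1)] and pv = word_perm_permutes[OF v(1)]
        have "(`) (word_perm u) ` I' \<noteq> (`) (word_perm v) ` I"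
        proof
          assume eq: "(`) (word_perm u) ` I' = (`) (word_perm v) ` I"
          have "I = (`) (word_perm (word_inv v)) ` (`) (word_perm v) ` I" by (simp add: image_image)
          also have "\<dots> = (`) (word_perm (word_inv v) \<circ> word_perm u) ` I'"
            unfolding eq[symmetric] by (simp add: image_image)
          finally have "I = (`) (word_perm (word_inv v) \<circ> word_perm u) ` I'" .
          moreover have "inj (word_perm (word_inv v) \<circ> word_perm u)"
            using v(1) by (intro inj_compose permutes_inj[OF pu] permutes_inj[OF word_perm_permutes[of _ n]]) simp
          ultimately show False using orbit_reps_unique[of FF, OF FF V(2) V'(2)] ne by blast
        qed
        moreover have "(`) (word_perm w) ` K \<subseteq> pairs n" if "w \<in> braid_words n" "K \<subseteq> pairs n" for w K
          using word_perm_pairs[OF that(1)] that(2) by blast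
        ultimately have "\<exists>a\<in>carrier (PZgrp n). chi n ((`) (word_perm u) ` I') a \<noteq> chi n ((`) (word_perm v) ` I) a"
          using full_pairs[OF full[OF V'(2)] V'(1)] full_pairs[OF full[OF V(2)] V(1)] u(1) v(1)
          by (intro chi_separates) auto
        thus "\<exists>a\<in>carrier (PZgrp n). chi n I' (inv\<^bsub>Zgrp n\<^esub> t \<otimes>\<^bsub>Zgrp n\<^esub> a \<otimes>\<^bsub>Zgrp n\<^esub> t) \<noteq>
            chi n I (inv\<^bsub>Zgrp n\<^esub> t' \<otimes>\<^bsub>Zgrp n\<^esub> a \<otimes>\<^bsub>Zgrp n\<^esub> t')"
          using chi_conj[OF u(1)] chi_conj[OF v(1)] unfolding u(2) v(2) by metis
      qed
      thus False using no by blast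
    qed
    hence V'': "m' = m" "I' = I" by auto
    note V' = V'[unfolded V''] and no = no[unfolded V'']
    \<comment> \<open>A failure of isomorphism in either factor already gives orthogonality, so both
      factors must be isomorphic.\<close>
    have "rep_iso (ZIgrp m I) \<rho> \<rho>' \<and> rep_iso (sym_group (n - m)) (Sym_irrep (n - m) \<nu>) (Sym_irrep (n - m) \<nu>')"
    proof (rule ccontr)
      assume "\<not> ?thesis"
      hence "coef_orth (Zgrp n) (V_rep n m I \<rho>' \<nu>') (V_rep n m I \<rho> \<nu>)"
        unfolding V_rep_def
        by (intro big_orth V V' full RD Sym_irrep_irrep) blast
      thus False using no by blast
    qed
    moreover have "rep_iso (ZIgrp m I) \<rho> \<rho>" by (rule rep_iso_refl[OF ZIgrp_group rep[OF RD(1)[OF V(2,3)]]])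
    \<comment> \<open>Both \<rho> and \<rho>' are representatives isomorphic to \<rho>, so they
      coincide.\<close>
    moreover have "\<exists>!r. r \<in> R m I \<and> rep_iso (ZIgrp m I) \<rho> r"
      using R[OF V(2)] RD[OF V(2,3)] unfolding isotypic_irrep_reps_def by blast
    ultimately have "\<rho> = \<rho>'" "\<nu> = \<nu>'" using V(3) V'(3) Sym_irrep_iso_eq[OF V(4) V'(4)] by blast+
    thus ?thesis using V'' by simp
  qed
  show ?thesis
  proof (intro conjI allI impI)
    fix n m I \<rho> \<nu>
    assume "m \<le> n \<and> I \<in> FF m \<and> \<rho> \<in> R m I \<and> paddable (n - m) \<nu>"
    thus "is_irrep (Zgrp n) (V_rep n m I \<rho> \<nu>)" using irr by blast
  next
    fix n \<pi> assume \<pi>: "is_irrep (Zgrp n) \<pi>"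
    obtain m I \<rho> \<nu> where V: "m \<le> n" "I \<in> FF m" "\<rho> \<in> R m I" "paddable (n - m) \<nu>"
      "rep_iso (Zgrp n) \<pi> (V_rep n m I \<rho> \<nu>)" using exist[OF \<pi>] by blast
    show "\<exists>!(m, I, \<rho>, \<nu>). m \<le> n \<and> I \<in> FF m \<and> \<rho> \<in> R m I \<and> paddable (n - m) \<nu> \<and>
        rep_iso (Zgrp n) \<pi> (V_rep n m I \<rho> \<nu>)"
    proof (rule ex1I[of _ "(m, I, \<rho>, \<nu>)"])
      show "case (m, I, \<rho>, \<nu>) of (m, I, \<rho>, \<nu>) \<Rightarrow> m \<le> n \<and> I \<in> FF m \<and> \<rho> \<in> R m I \<and> paddable (n - m) \<nu> \<and>
          rep_iso (Zgrp n) \<pi> (V_rep n m I \<rho> \<nu>)" using V by simp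
      fix x assume x: "case x of (m, I, \<rho>, \<nu>) \<Rightarrow> m \<le> n \<and> I \<in> FF m \<and> \<rho> \<in> R m I \<and> paddable (n - m) \<nu> \<and>
          rep_iso (Zgrp n) \<pi> (V_rep n m I \<rho> \<nu>)"
      obtain m' I' \<rho>' \<nu>' where x': "x = (m', I', \<rho>', \<nu>')" by (rule prod_cases4)
      show "x = (m, I, \<rho>, \<nu>)"
        unfolding x' by (rule unique[OF \<pi> _ _ _ _ V(1-4) _ V(5)]) (use x in \<open>simp_all add: x'\<close>)
    qed
  qed
qed

end
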